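(* Let $\psi:J^1(\mathbb G_m)\to\widehat{\mathbb G_a}$ be the canonical $\delta$-character and $P^\infty(\psi):P^\infty(\mathbb G_m)\to P^\infty(\mathbb G_a)$ the induced morphism. There is a unique cocharacter $\sigma:P^\infty(\mathbb G_a)\to P^\infty(\mathbb G_m)$ such that $\sigma$ is a right inverse of $P^\infty(\psi)$, i.e. $P^\infty(\psi)\circ\sigma=\mathrm{id}$. It is the cocharacter given by the sequence $a_n=p^n$ for $n\ge1$ and $a_n=0$ for $n\le0$.
   Context: $p$ odd prime; $R$ a complete discrete valuation ring with maximal ideal $pR$, algebraically closed residue field, unique Frobenius lift $\phi$ (bijective). $\widehat{\ }$ is $p$-adic completion. $\mathbb K^\circ$ is the $p$-adic completion of $\bigcup_mR[p^{1/p^m}]$, $\mathbb K=\mathbb K^\circ[1/p]$, $\Phi$ on $\mathbb K^\circ$ the automorphism extending $\phi$ and fixing the $p^{1/p^m}$. For a $p$-torsion free $p$-adically complete $R$-algebra $A$ with $A/pA$ reduced and Frobenius lift $\phi$: $\mathcal A=A\otimes_R\mathbb K^\circ$ with $\Phi=\phi\otimes\Phi$ extended to $\widehat{\mathcal A}$, $P^\circ(A,\phi)=(\varinjlim_\Phi\widehat{\mathcal A})\widehat{\ }$, $P(A,\phi)=P^\circ(A,\phi)[1/p]$. For an affine smooth $X=\operatorname{Spec}B$, $P^\infty(X)=\operatorname{Spa}(P(J^\infty(B),\phi),P^\circ(J^\infty(B),\phi))$, where $J^\infty(R[x_1,\dots])=R[x,x',x'',\dots]\widehat{\ }$ with $\phi(x^{(i)})=(x^{(i)})^p+px^{(i+1)}$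 and $p$-derivation $\delta F=(\phi(F)-F^p)/p$ (similarly with $x^{-1}$ adjoined). $\mathbb G_m=\operatorname{Spec}R[x,x^{-1}]$, $\mathbb G_a=\operatorname{Spec}R[z]$. The canonical $\delta$-character is given by $z\mapsto\Psi=\sum_{n\ge1}(-1)^{n-1}\frac{p^{n-1}}{n}(x'/x^p)^n\in R[x,x^{-1},x']\widehat{\ }$; $P^\infty(\psi)$ is induced by the unique $\delta$-compatible homomorphism $J^\infty(R[z])\to J^\infty(R[x,x^{-1}])$ with $z\mapsto\Psi$ (tensoring with $\mathbb K^\circ$ and passing to the limit along $\Phi$). Cocharacters: let $C=\varinjlim_\phi J^\infty(R[z])$ and $\phi^{-i}(z)$ the class $[z,i]$, so $\phi(\phi^{-i}(z))=\phi^{-i+1}(z)$. For a sequence $(a_n)_{n\in\mathbb Z}$ of elements of $pR$ with $a_n\to0$ as $n\to\pm\infty$, let $\Sigma=\exp(\sum_{n}a_n\phi^{-n}(z))\in\widehat C$. The unique $R$-algebra homomorphism $J^\infty(R[x,x^{-1}])\to\widehat C$ commuting with the $p$-derivations and sending $x\mapsto\Sigma$ induces, after tensoring with $\mathbb K^\circ$ and passing to limits along the relative Frobenius lifts, a homomorphism $P^\circ(J^\infty(R[x,x^{-1}]),\phi)\to P^\circ(J^\infty(R[z]),\phi)$ and hence a morphism $\sigma:P^\infty(\mathbb G_a)\to P^\infty(\mathbb G_m)$; such a $\sigma$ is called a cocharacter of $\mathbb G_m$. *)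

theory Defs
  imports "HOL-Algebra.Algebra" "HOL-Algebra.Algebraic_Closure_Type"
    "HOL-Library.Poly_Mapping" "HOL-Analysis.Abstract_Topology"
begin

text \<open>
  The base ring is a type of class \<open>idom\<close>, seen as a HOL-Algebra record through the library's
  \<open>ring_of_type_algebra\<close>.  All rings derived from it are HOL-Algebra records.
\<close>


section \<open>Completion at p\<close>

definition pideal :: "nat \<Rightarrow> ('a, 'm) ring_scheme \<Rightarrow> nat \<Rightarrow> 'a set" where
  "pideal p A n = PIdl\<^bsub>A\<^esub> ([(p ^ n)] \<cdot>\<^bsub>A\<^esub> \<one>\<^bsub>A\<^esub>)"

text \<open>
  The completion is the inverse limit of the rings \<open>A / p^n A\<close>.  The transition map sends a coset
  of \<open>p^(n+1) A\<close> to the coset of \<open>p^n A\<close> containing it, so that compatibility is inclusion.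
\<close>

definition pcompl :: "nat \<Rightarrow> ('a, 'm) ring_scheme \<Rightarrow> (nat \<Rightarrow> 'a set) ring" where
  "pcompl p A =
    \<lparr>carrier = {s. (\<forall>n. s n \<in> carrier (A Quot pideal p A n)) \<and> (\<forall>n. s (Suc n) \<subseteq> s n)},
     monoid.mult = (\<lambda>s t n. s n \<otimes>\<^bsub>A Quot pideal p A n\<^esub> t n),
     monoid.one = (\<lambda>n. \<one>\<^bsub>A Quot pideal p A n\<^esub>),
     ring.zero = (\<lambda>n. \<zero>\<^bsub>A Quot pideal p A n\<^esub>),
     ring.add = (\<lambda>s t n. s n \<oplus>\<^bsub>A Quot pideal p A n\<^esub> t n)\<rparr>"

definition pcompl_inj :: "nat \<Rightarrow> ('a, 'm) ring_scheme \<Rightarrow> 'a \<Rightarrow> nat \<Rightarrow> 'a set" where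
  "pcompl_inj p A a = (\<lambda>n. pideal p A n +>\<^bsub>A\<^esub> a)"

text \<open>
  The map of completions induced by a ring homomorphism \<open>f\<close> into \<open>B\<close>.  Here and below, a map
  on classes is written as the union of the classes of the images of all representatives; these
  coincide whenever the map is well defined.
\<close>

definition pcompl_map ::
    "nat \<Rightarrow> ('b, 'm) ring_scheme \<Rightarrow> ('a \<Rightarrow> 'b) \<Rightarrow> (nat \<Rightarrow> 'a set) \<Rightarrow> nat \<Rightarrow> 'b set" where
  "pcompl_map p B f s = (\<lambda>n. \<Union>x\<in>s n. pideal p B n +>\<^bsub>B\<^esub> f x)"

definition p_complete :: "nat \<Rightarrow> ('a, 'm) ring_scheme \<Rightarrow> bool" where
  "p_complete p A \<longleftrightarrow> bij_betw (pcompl_inj p A) (carrier A) (carrier (pcompl p A))"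


section \<open>The base ring\<close>

definition discrete_valuation_ring :: "('a, 'm) ring_scheme \<Rightarrow> bool" where
  "discrete_valuation_ring R \<longleftrightarrow>
     principal_domain R \<and> \<not> field R \<and> (\<exists>!M. maximalideal M R)"

definition frobenius_lift :: "nat \<Rightarrow> ('a, 'm) ring_scheme \<Rightarrow> ('a \<Rightarrow> 'a) \<Rightarrow> bool" where
  "frobenius_lift p A f \<longleftrightarrow>
     f \<in> ring_hom A A \<and> (\<forall>a\<in>carrier A. f a \<ominus>\<^bsub>A\<^esub> a [^]\<^bsub>A\<^esub> p \<in> pideal p A 1)"


section \<open>Algebras with a Frobenius lift\<close>

text \<open>
  An algebra over the type \<open>'r\<close>, given by its structure map \<open>emb\<close>, with an endomorphism \<open>frob\<close>.
\<close>

record ('r, 'a) frob_alg = "'a ring" +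
  emb :: "'r \<Rightarrow> 'a"
  frob :: "'a \<Rightarrow> 'a"

definition pcompl_alg ::
    "nat \<Rightarrow> ('r, 'a, 'm) frob_alg_scheme \<Rightarrow> ('r, nat \<Rightarrow> 'a set) frob_alg" where
  "pcompl_alg p A = ring.extend (pcompl p A)
     (frob_alg.fields (\<lambda>r. pcompl_inj p A (emb A r)) (pcompl_map p A (frob A)))"

text \<open>
  The direct limit of \<open>A \<rightarrow> A \<rightarrow> A \<rightarrow> \<dots>\<close> along \<open>frob\<close>; \<open>dlim_cls A a i\<close> is the class of \<open>a\<close> in the
  \<open>i\<close>-th copy of \<open>A\<close>.
\<close>

definition dlim_cls :: "('r, 'a, 'm) frob_alg_scheme \<Rightarrow> 'a \<Rightarrow> nat \<Rightarrow> ('a \<times> nat) set" where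
  "dlim_cls A a i =
     {(b, j). b \<in> carrier A \<and> (\<exists>k. (frob A ^^ (j + k)) a = (frob A ^^ (i + k)) b)}"

definition dlim :: "('r, 'a, 'm) frob_alg_scheme \<Rightarrow> ('r, ('a \<times> nat) set) frob_alg" where
  "dlim A =
    \<lparr>carrier = {dlim_cls A a i | a i. a \<in> carrier A},
     monoid.mult = (\<lambda>u v. \<Union>(a, i)\<in>u. \<Union>(b, j)\<in>v.
               dlim_cls A ((frob A ^^ j) a \<otimes>\<^bsub>A\<^esub> (frob A ^^ i) b) (i + j)),
     monoid.one = dlim_cls A \<one>\<^bsub>A\<^esub> 0,
     ring.zero = dlim_cls A \<zero>\<^bsub>A\<^esub> 0,
     ring.add = (\<lambda>u v. \<Union>(a, i)\<in>u. \<Union>(b, j)\<in>v.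
               dlim_cls A ((frob A ^^ j) a \<oplus>\<^bsub>A\<^esub> (frob A ^^ i) b) (i + j)),
     emb = (\<lambda>r. dlim_cls A (emb A r) 0),
     frob = (\<lambda>u. \<Union>(a, i)\<in>u. dlim_cls A (frob A a) i)\<rparr>"

definition dlim_map ::
    "('r, 'b, 'm) frob_alg_scheme \<Rightarrow> ('a \<Rightarrow> 'b) \<Rightarrow> ('a \<times> nat) set \<Rightarrow> ('b \<times> nat) set" where
  "dlim_map B f u = (\<Union>(a, i)\<in>u. dlim_cls B (f a) i)"

text \<open>
  The tensor product over \<open>'r\<close>: the free abelian group on \<open>A \<times> B\<close>, with the product extending
  that of \<open>A \<times> B\<close> bilinearly, modulo the bilinearity relations.
\<close>

definition tensor_free ::
    "('a, 'm) ring_scheme \<Rightarrow> ('b, 'n) ring_scheme \<Rightarrow> ('a \<times> 'b \<Rightarrow>\<^sub>0 int) ring" where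
  "tensor_free A B =
    \<lparr>carrier = {c. Poly_Mapping.keys c \<subseteq> carrier A \<times> carrier B},
     monoid.mult = (\<lambda>c d. frag_extend (\<lambda>(a, b).
               frag_extend (\<lambda>(a', b'). frag_of (a \<otimes>\<^bsub>A\<^esub> a', b \<otimes>\<^bsub>B\<^esub> b')) d) c),
     monoid.one = frag_of (\<one>\<^bsub>A\<^esub>, \<one>\<^bsub>B\<^esub>),
     ring.zero = 0,
     ring.add = (+)\<rparr>"

definition tensor_ideal ::
    "('r, 'a, 'm) frob_alg_scheme \<Rightarrow> ('r, 'b, 'n) frob_alg_scheme \<Rightarrow> ('a \<times> 'b \<Rightarrow>\<^sub>0 int) set" where
  "tensor_ideal A B = Idl\<^bsub>tensor_free A B\<^esub>
     ({frag_of (a \<oplus>\<^bsub>A\<^esub> a', b) - frag_of (a, b) - frag_of (a', b) | a a' b.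
         a \<in> carrier A \<and> a' \<in> carrier A \<and> b \<in> carrier B} \<union>
      {frag_of (a, b \<oplus>\<^bsub>B\<^esub> b') - frag_of (a, b) - frag_of (a, b') | a b b'.
         a \<in> carrier A \<and> b \<in> carrier B \<and> b' \<in> carrier B} \<union>
      {frag_of (emb A r \<otimes>\<^bsub>A\<^esub> a, b) - frag_of (a, emb B r \<otimes>\<^bsub>B\<^esub> b) | r a b.
         a \<in> carrier A \<and> b \<in> carrier B})"

definition tensor_map ::
    "('r, 'c, 'm) frob_alg_scheme \<Rightarrow> ('r, 'd, 'n) frob_alg_scheme \<Rightarrow> ('a \<Rightarrow> 'c) \<Rightarrow> ('b \<Rightarrow> 'd)
      \<Rightarrow> ('a \<times> 'b \<Rightarrow>\<^sub>0 int) set \<Rightarrow> ('c \<times> 'd \<Rightarrow>\<^sub>0 int) set" where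
  "tensor_map C D f g u =
     (\<Union>c\<in>u. tensor_ideal C D +>\<^bsub>tensor_free C D\<^esub>
        frag_extend (\<lambda>(a, b). frag_of (f a, g b)) c)"

definition tensor ::
    "('r, 'a, 'm) frob_alg_scheme \<Rightarrow> ('r, 'b, 'n) frob_alg_scheme
      \<Rightarrow> ('r, ('a \<times> 'b \<Rightarrow>\<^sub>0 int) set) frob_alg" where
  "tensor A B = ring.extend (tensor_free A B Quot tensor_ideal A B)
     (frob_alg.fields
       (\<lambda>r. tensor_ideal A B +>\<^bsub>tensor_free A B\<^esub> frag_of (emb A r, \<one>\<^bsub>B\<^esub>))
       (tensor_map A B (frob A) (frob B)))"


section \<open>Polynomial rings and jet algebras\<close>

text \<open>
  Laurent monomials in variables indexed by \<open>nat\<close> are exponent vectors; \<open>poly_alg M\<close> is the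
  subring of the monoid algebra spanned by the monomials with exponents in the submonoid \<open>M\<close>.
  The variable of index \<open>i\<close> stands for the \<open>i\<close>-th \<open>\<delta>\<close>-coordinate: with \<open>Ga_exps\<close> one gets
  \<open>R[z, z', z'', \<dots>]\<close>, with \<open>Gm_exps\<close> one gets \<open>R[x, 1/x, x', x'', \<dots>]\<close>.
\<close>

type_synonym expo = "nat \<Rightarrow>\<^sub>0 int"

definition Ga_exps :: "expo set" where
  "Ga_exps = {m. \<forall>i. 0 \<le> Poly_Mapping.lookup m i}"

definition Gm_exps :: "expo set" where
  "Gm_exps = {m. \<forall>i\<ge>1. 0 \<le> Poly_Mapping.lookup m i}"

definition poly_alg :: "expo set \<Rightarrow> (expo \<Rightarrow>\<^sub>0 'r::comm_ring_1) ring" where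
  "poly_alg M = ring_of_type_algebra\<lparr>carrier := {f. Poly_Mapping.keys f \<subseteq> M}\<rparr>"

definition poly_const :: "'r \<Rightarrow> (expo \<Rightarrow>\<^sub>0 'r::comm_ring_1)" where
  "poly_const r = Poly_Mapping.single 0 r"

definition poly_var :: "nat \<Rightarrow> (expo \<Rightarrow>\<^sub>0 'r::comm_ring_1)" where
  "poly_var i = Poly_Mapping.single (Poly_Mapping.single i 1) 1"

type_synonym 'r jet = "nat \<Rightarrow> (expo \<Rightarrow>\<^sub>0 'r) set"

definition jet_ring :: "nat \<Rightarrow> expo set \<Rightarrow> 'r::comm_ring_1 jet ring" where
  "jet_ring p M = pcompl p (poly_alg M)"

definition jet_const :: "nat \<Rightarrow> expo set \<Rightarrow> 'r::comm_ring_1 \<Rightarrow> 'r jet" where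
  "jet_const p M r = pcompl_inj p (poly_alg M) (poly_const r)"

definition jet_var :: "nat \<Rightarrow> expo set \<Rightarrow> nat \<Rightarrow> 'r::comm_ring_1 jet" where
  "jet_var p M i = pcompl_inj p (poly_alg M) (poly_var i)"

definition jet_frob :: "nat \<Rightarrow> ('r \<Rightarrow> 'r) \<Rightarrow> expo set \<Rightarrow> 'r::comm_ring_1 jet \<Rightarrow> 'r jet" where
  "jet_frob p \<phi> M = (THE f. f \<in> ring_hom (jet_ring p M) (jet_ring p M) \<and>
     f \<in> extensional (carrier (jet_ring p M)) \<and>
     (\<forall>r. f (jet_const p M r) = jet_const p M (\<phi> r)) \<and>
     (\<forall>i. f (jet_var p M i) =
        jet_var p M i [^]\<^bsub>jet_ring p M\<^esub> p \<oplus>\<^bsub>jet_ring p M\<^esub>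
        [p] \<cdot>\<^bsub>jet_ring p M\<^esub> jet_var p M (Suc i)))"

definition jet_alg :: "nat \<Rightarrow> ('r \<Rightarrow> 'r) \<Rightarrow> expo set \<Rightarrow> ('r::comm_ring_1, 'r jet) frob_alg" where
  "jet_alg p \<phi> M =
     ring.extend (jet_ring p M) (frob_alg.fields (jet_const p M) (jet_frob p \<phi> M))"


section \<open>The perfectoid base\<close>

text \<open>
  The union of the rings \<open>R[p^(1/p^m)]\<close>, for compatible roots, is \<open>R[t\<^sub>0, t\<^sub>1, \<dots>]\<close> modulo \<open>t\<^sub>0 = p\<close>
  and \<open>t\<^sub>m\<^sub>+\<^sub>1^p = t\<^sub>m\<close>, where \<open>t\<^sub>m\<close> stands for \<open>p^(1/p^m)\<close>: the polynomials \<open>T^(p^m) - p\<close> are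
  irreducible (Eisenstein), so \<open>R[p^(1/p^m)]\<close> is \<open>R[T] / (T^(p^m) - p)\<close>.
\<close>

definition root_ideal :: "nat \<Rightarrow> (expo \<Rightarrow>\<^sub>0 'r::comm_ring_1) set" where
  "root_ideal p = Idl\<^bsub>poly_alg Ga_exps\<^esub>
     (insert (poly_var 0 - of_nat p) {poly_var (Suc m) ^ p - poly_var m | m. True})"

definition root_ring :: "nat \<Rightarrow> (expo \<Rightarrow>\<^sub>0 'r::comm_ring_1) set ring" where
  "root_ring p = poly_alg Ga_exps Quot root_ideal p"

definition root_class :: "nat \<Rightarrow> (expo \<Rightarrow>\<^sub>0 'r::comm_ring_1) \<Rightarrow> (expo \<Rightarrow>\<^sub>0 'r) set" where
  "root_class p f = root_ideal p +>\<^bsub>poly_alg Ga_exps\<^esub> f"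

type_synonym 'r perf = "nat \<Rightarrow> (expo \<Rightarrow>\<^sub>0 'r) set set"

definition K_const :: "nat \<Rightarrow> 'r::comm_ring_1 \<Rightarrow> 'r perf" where
  "K_const p r = pcompl_inj p (root_ring p) (root_class p (poly_const r))"

definition K_root :: "nat \<Rightarrow> nat \<Rightarrow> 'r::comm_ring_1 perf" where
  "K_root p m = pcompl_inj p (root_ring p) (root_class p (poly_var m))"

definition K_frob :: "nat \<Rightarrow> ('r \<Rightarrow> 'r) \<Rightarrow> 'r::comm_ring_1 perf \<Rightarrow> 'r perf" where
  "K_frob p \<phi> = (THE f. f \<in> ring_iso (pcompl p (root_ring p)) (pcompl p (root_ring p)) \<and>
     f \<in> extensional (carrier (pcompl p (root_ring p))) \<and>
     (\<forall>r. f (K_const p r) = K_const p (\<phi> r)) \<and> (\<forall>m. f (K_root p m) = K_root p m))"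

definition K_circ :: "nat \<Rightarrow> ('r \<Rightarrow> 'r) \<Rightarrow> ('r::comm_ring_1, 'r perf) frob_alg" where
  "K_circ p \<phi> = ring.extend (pcompl p (root_ring p)) (frob_alg.fields (K_const p) (K_frob p \<phi>))"


section \<open>The rings \<open>P\<^sup>\<circ>(A,\<phi>)\<close> and \<open>P(A,\<phi>)\<close>\<close>

type_synonym ('r, 'a) ext = "nat \<Rightarrow> ('a \<times> 'r perf \<Rightarrow>\<^sub>0 int) set set"
type_synonym ('r, 'a) Pcirc = "nat \<Rightarrow> (('r, 'a) ext \<times> nat) set set"

definition K_ext :: "nat \<Rightarrow> ('r \<Rightarrow> 'r) \<Rightarrow> ('r::comm_ring_1, 'a) frob_alg
    \<Rightarrow> ('r, ('r, 'a) ext) frob_alg" where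
  "K_ext p \<phi> A = pcompl_alg p (tensor A (K_circ p \<phi>))"

definition P_circ :: "nat \<Rightarrow> ('r \<Rightarrow> 'r) \<Rightarrow> ('r::comm_ring_1, 'a) frob_alg
    \<Rightarrow> ('r, ('r, 'a) Pcirc) frob_alg" where
  "P_circ p \<phi> A = pcompl_alg p (dlim (K_ext p \<phi> A))"

definition P_circ_map :: "nat \<Rightarrow> ('r \<Rightarrow> 'r) \<Rightarrow> ('r::comm_ring_1, 'b) frob_alg \<Rightarrow> ('a \<Rightarrow> 'b)
    \<Rightarrow> ('r, 'a) Pcirc \<Rightarrow> ('r, 'b) Pcirc" where
  "P_circ_map p \<phi> B f =
     pcompl_map p (dlim (K_ext p \<phi> B))
       (dlim_map (K_ext p \<phi> B)
         (pcompl_map p (tensor B (K_circ p \<phi>)) (tensor_map B (K_circ p \<phi>) f id)))"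

text \<open>\<open>A[1/p]\<close>; here \<open>loc_cls p A a n\<close> is the fraction \<open>a / p^n\<close>.\<close>

definition loc_cls :: "nat \<Rightarrow> ('a, 'm) ring_scheme \<Rightarrow> 'a \<Rightarrow> nat \<Rightarrow> ('a \<times> nat) set" where
  "loc_cls p A a n =
     {(b, m). b \<in> carrier A \<and> (\<exists>k. [(p ^ (m + k))] \<cdot>\<^bsub>A\<^esub> a = [(p ^ (n + k))] \<cdot>\<^bsub>A\<^esub> b)}"

definition loc :: "nat \<Rightarrow> ('a, 'm) ring_scheme \<Rightarrow> ('a \<times> nat) set ring" where
  "loc p A =
    \<lparr>carrier = {loc_cls p A a n | a n. a \<in> carrier A},
     monoid.mult = (\<lambda>u v. \<Union>(a, n)\<in>u. \<Union>(b, m)\<in>v. loc_cls p A (a \<otimes>\<^bsub>A\<^esub> b) (n + m)),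
     monoid.one = loc_cls p A \<one>\<^bsub>A\<^esub> 0,
     ring.zero = loc_cls p A \<zero>\<^bsub>A\<^esub> 0,
     ring.add = (\<lambda>u v. \<Union>(a, n)\<in>u. \<Union>(b, m)\<in>v.
              loc_cls p A ([(p ^ m)] \<cdot>\<^bsub>A\<^esub> a \<oplus>\<^bsub>A\<^esub> [(p ^ n)] \<cdot>\<^bsub>A\<^esub> b) (n + m))\<rparr>"

definition loc_map ::
    "nat \<Rightarrow> ('b, 'm) ring_scheme \<Rightarrow> ('a \<Rightarrow> 'b) \<Rightarrow> ('a \<times> nat) set \<Rightarrow> ('b \<times> nat) set" where
  "loc_map p B f u = (\<Union>(a, n)\<in>u. loc_cls p B (f a) n)"


section \<open>Adic spectra\<close>

record 'a huber_pair = "'a ring" +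
  plus_part :: "'a set"
  ring_topology :: "'a topology"

text \<open>
  An equivalence class of valuations on \<open>A\<close> is encoded by the relation \<open>v\<close> with \<open>(f, g) \<in> v\<close> iff
  \<open>|f| \<le> |g|\<close>, on which it depends only and which determines it.  The conditions below are those
  making \<open>v\<close> the relation of a valuation: the elements with \<open>|f| \<le> |0|\<close> form a prime ideal, and
  the fractions of elements outside of it form the ordered value group.
\<close>

definition valuation_rel :: "('a, 'm) ring_scheme \<Rightarrow> ('a \<times> 'a) set \<Rightarrow> bool" where
  "valuation_rel A v \<longleftrightarrow>
     v \<subseteq> carrier A \<times> carrier A \<and> total_on (carrier A) v \<and> refl_on (carrier A) v \<and> trans v \<and>
     (\<one>\<^bsub>A\<^esub>, \<zero>\<^bsub>A\<^esub>) \<notin> v \<and>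
     (\<forall>f\<in>carrier A. \<forall>g\<in>carrier A. \<forall>h\<in>carrier A.
        ((f, h) \<in> v \<and> (g, h) \<in> v \<longrightarrow> (f \<oplus>\<^bsub>A\<^esub> g, h) \<in> v) \<and>
        ((f, g) \<in> v \<longrightarrow> (f \<otimes>\<^bsub>A\<^esub> h, g \<otimes>\<^bsub>A\<^esub> h) \<in> v) \<and>
        ((f \<otimes>\<^bsub>A\<^esub> h, g \<otimes>\<^bsub>A\<^esub> h) \<in> v \<and> (h, \<zero>\<^bsub>A\<^esub>) \<notin> v \<longrightarrow> (f, g) \<in> v))"

text \<open>
  Continuity of a valuation: the sets of all \<open>a\<close> with \<open>|a| < \<gamma>\<close> are open, for \<open>\<gamma> = |g| / |f|\<close>
  running through the value group.
\<close>

definition spa :: "('a, 'm) huber_pair_scheme \<Rightarrow> ('a \<times> 'a) set set" where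
  "spa A = {v. valuation_rel A v \<and>
     (\<forall>f\<in>carrier A. \<forall>g\<in>carrier A. (f, \<zero>\<^bsub>A\<^esub>) \<notin> v \<longrightarrow> (g, \<zero>\<^bsub>A\<^esub>) \<notin> v \<longrightarrow>
        openin (ring_topology A) {a \<in> carrier A. (g, a \<otimes>\<^bsub>A\<^esub> f) \<notin> v}) \<and>
     (\<forall>a\<in>plus_part A. (a, \<one>\<^bsub>A\<^esub>) \<in> v)}"

definition spa_topology :: "('a, 'm) huber_pair_scheme \<Rightarrow> ('a \<times> 'a) set topology" where
  "spa_topology A = topology_generated_by
     {{v \<in> spa A. (f, g) \<in> v \<and> (g, \<zero>\<^bsub>A\<^esub>) \<notin> v} | f g. f \<in> carrier A \<and> g \<in> carrier A}"

text \<open>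
  A morphism from \<open>Spa S\<close> to \<open>Spa T\<close> consists of its map on points and of its homomorphism on
  global sections, which goes from \<open>T\<close> to \<open>S\<close> and determines the morphism.
\<close>

type_synonym ('a, 'b) adic_mor = "(('a \<times> 'a) set \<Rightarrow> ('b \<times> 'b) set) \<times> ('b \<Rightarrow> 'a)"

definition pull_valuation ::
    "('b, 'm) huber_pair_scheme \<Rightarrow> ('b \<Rightarrow> 'a) \<Rightarrow> ('a \<times> 'a) set \<Rightarrow> ('b \<times> 'b) set" where
  "pull_valuation T h v = {(f, g). f \<in> carrier T \<and> g \<in> carrier T \<and> (h f, h g) \<in> v}"

definition adic_hom ::
    "('a, 'm) huber_pair_scheme \<Rightarrow> ('b, 'n) huber_pair_scheme \<Rightarrow> ('a, 'b) adic_mor set" where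
  "adic_hom S T = {(f, h).
     h \<in> ring_hom T S \<and> h \<in> extensional (carrier T) \<and>
     continuous_map (ring_topology T) (ring_topology S) h \<and> h ` plus_part T \<subseteq> plus_part S \<and>
     f \<in> extensional (spa S) \<and> continuous_map (spa_topology S) (spa_topology T) f \<and>
     (\<forall>v\<in>spa S. f v = pull_valuation T h v)}"

definition adic_induced ::
    "('a, 'm) huber_pair_scheme \<Rightarrow> ('b, 'n) huber_pair_scheme \<Rightarrow> ('b \<Rightarrow> 'a)
      \<Rightarrow> ('a, 'b) adic_mor" where
  "adic_induced S T h = (restrict (pull_valuation T h) (spa S), restrict h (carrier T))"

definition adic_id :: "('a, 'm) huber_pair_scheme \<Rightarrow> ('a, 'a) adic_mor" where
  "adic_id S = (restrict id (spa S), restrict id (carrier S))"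

text \<open>\<open>adic_comp S U \<tau> \<sigma>\<close> is the composite of \<open>\<sigma>\<close> from \<open>S\<close> to \<open>T\<close> and \<open>\<tau>\<close> from \<open>T\<close> to \<open>U\<close>.\<close>

definition adic_comp ::
    "('a, 'm) huber_pair_scheme \<Rightarrow> ('c, 'n) huber_pair_scheme
      \<Rightarrow> ('b, 'c) adic_mor \<Rightarrow> ('a, 'b) adic_mor \<Rightarrow> ('a, 'c) adic_mor" where
  "adic_comp S U \<tau> \<sigma> =
     (compose (spa S) (fst \<tau>) (fst \<sigma>), compose (carrier U) (snd \<sigma>) (snd \<tau>))"

type_synonym ('r, 'a) P = "(('r, 'a) Pcirc \<times> nat) set"

text \<open>
  The pair \<open>(P, P\<^sup>\<circ>)\<close>, with the topology in which the \<open>p^n P\<^sup>\<circ>\<close> are a basis of neighbourhoods of 0.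
\<close>

definition P_pair :: "nat \<Rightarrow> ('r \<Rightarrow> 'r) \<Rightarrow> ('r::comm_ring_1, 'a) frob_alg
    \<Rightarrow> ('r, 'a) P huber_pair" where
  "P_pair p \<phi> A =
    (let P = loc p (P_circ p \<phi> A);
         B = {loc_cls p (P_circ p \<phi> A) a 0 | a. a \<in> carrier (P_circ p \<phi> A)}
     in ring.extend P (huber_pair.fields B
          (topology (\<lambda>U. U \<subseteq> carrier P \<and>
             (\<forall>x\<in>U. \<exists>n. \<forall>y\<in>B. x \<oplus>\<^bsub>P\<^esub> [(p ^ n)] \<cdot>\<^bsub>P\<^esub> y \<in> U)))))"

text \<open>\<open>P_inf p \<phi> Ga_exps\<close> and \<open>P_inf p \<phi> Gm_exps\<close> are \<open>P\<^sup>\<infinity>\<close> of the additive and multiplicative group.\<close>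

definition P_inf :: "nat \<Rightarrow> ('r \<Rightarrow> 'r) \<Rightarrow> expo set \<Rightarrow> ('r::comm_ring_1, 'r jet) P huber_pair" where
  "P_inf p \<phi> M = P_pair p \<phi> (jet_alg p \<phi> M)"


section \<open>\<open>\<delta>\<close>-homomorphisms and p-adic series\<close>

definition nat_div :: "('a, 'm) ring_scheme \<Rightarrow> nat \<Rightarrow> 'a \<Rightarrow> 'a" where
  "nat_div A n x = (THE y. y \<in> carrier A \<and> [n] \<cdot>\<^bsub>A\<^esub> y = x)"

definition p_deriv :: "nat \<Rightarrow> ('r, 'a, 'm) frob_alg_scheme \<Rightarrow> 'a \<Rightarrow> 'a" where
  "p_deriv p A a = nat_div A p (frob A a \<ominus>\<^bsub>A\<^esub> a [^]\<^bsub>A\<^esub> p)"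

definition delta_hom :: "nat \<Rightarrow> ('r, 'a, 'm) frob_alg_scheme \<Rightarrow> ('r, 'b, 'n) frob_alg_scheme
    \<Rightarrow> ('a \<Rightarrow> 'b) set" where
  "delta_hom p A B = {g. g \<in> ring_hom A B \<and> g \<in> extensional (carrier A) \<and>
     (\<forall>r. g (emb A r) = emb B r) \<and> (\<forall>a\<in>carrier A. g (p_deriv p A a) = p_deriv p B (g a))}"

definition has_psum :: "nat \<Rightarrow> ('a, 'm) ring_scheme \<Rightarrow> ('i \<Rightarrow> 'a) \<Rightarrow> 'i set \<Rightarrow> 'a \<Rightarrow> bool" where
  "has_psum p A f I s \<longleftrightarrow> s \<in> carrier A \<and>
     (\<forall>k. \<exists>F. finite F \<and> F \<subseteq> I \<and>
        (\<forall>G. finite G \<and> F \<subseteq> G \<and> G \<subseteq> I \<longrightarrow> (\<Oplus>\<^bsub>A\<^esub>i\<in>G. f i) \<ominus>\<^bsub>A\<^esub> s \<in> pideal p A k))"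

definition psum :: "nat \<Rightarrow> ('a, 'm) ring_scheme \<Rightarrow> ('i \<Rightarrow> 'a) \<Rightarrow> 'i set \<Rightarrow> 'a" where
  "psum p A f I = (THE s. has_psum p A f I s)"

definition pexp :: "nat \<Rightarrow> ('a, 'm) ring_scheme \<Rightarrow> 'a \<Rightarrow> 'a" where
  "pexp p A y = psum p A (\<lambda>n. nat_div A (fact n) (y [^]\<^bsub>A\<^esub> n)) (UNIV :: nat set)"


section \<open>The canonical \<open>\<delta>\<close>-character\<close>

text \<open>
  The series \<open>\<Psi>\<close>, whose terms lie in \<open>R[x, 1/x, x']\<close>, computed in the jet algebra of the
  multiplicative group.
\<close>

definition Psi :: "nat \<Rightarrow> ('r \<Rightarrow> 'r) \<Rightarrow> 'r::comm_ring_1 jet" where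
  "Psi p \<phi> = (let J = jet_alg p \<phi> Gm_exps; x = jet_var p Gm_exps 0; x' = jet_var p Gm_exps 1 in
     psum p J (\<lambda>n::nat. [((- 1 :: int) ^ (n - 1))] \<cdot>\<^bsub>J\<^esub>
        (nat_div J n ([(p ^ (n - 1))] \<cdot>\<^bsub>J\<^esub> \<one>\<^bsub>J\<^esub>) \<otimes>\<^bsub>J\<^esub>
         (x' \<otimes>\<^bsub>J\<^esub> inv\<^bsub>J\<^esub> (x [^]\<^bsub>J\<^esub> p)) [^]\<^bsub>J\<^esub> n)) {1..})"

definition psi_hom :: "nat \<Rightarrow> ('r \<Rightarrow> 'r) \<Rightarrow> 'r::comm_ring_1 jet \<Rightarrow> 'r jet" where
  "psi_hom p \<phi> = (THE g. g \<in> delta_hom p (jet_alg p \<phi> Ga_exps) (jet_alg p \<phi> Gm_exps) \<and>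
     g (jet_var p Ga_exps 0) = Psi p \<phi>)"

definition P_inf_psi ::
    "nat \<Rightarrow> ('r \<Rightarrow> 'r) \<Rightarrow> (('r::comm_ring_1, 'r jet) P, ('r, 'r jet) P) adic_mor" where
  "P_inf_psi p \<phi> = adic_induced (P_inf p \<phi> Gm_exps) (P_inf p \<phi> Ga_exps)
     (loc_map p (P_circ p \<phi> (jet_alg p \<phi> Gm_exps))
       (P_circ_map p \<phi> (jet_alg p \<phi> Gm_exps) (psi_hom p \<phi>)))"


section \<open>Cocharacters\<close>

type_synonym 'r Calg = "nat \<Rightarrow> ('r jet \<times> nat) set set"

definition C_alg :: "nat \<Rightarrow> ('r \<Rightarrow> 'r) \<Rightarrow> ('r::comm_ring_1, ('r jet \<times> nat) set) frob_alg" where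
  "C_alg p \<phi> = dlim (jet_alg p \<phi> Ga_exps)"

definition C_hat :: "nat \<Rightarrow> ('r \<Rightarrow> 'r) \<Rightarrow> ('r::comm_ring_1, 'r Calg) frob_alg" where
  "C_hat p \<phi> = pcompl_alg p (C_alg p \<phi>)"

definition C_can :: "nat \<Rightarrow> ('r \<Rightarrow> 'r) \<Rightarrow> 'r::comm_ring_1 jet \<Rightarrow> 'r Calg" where
  "C_can p \<phi> y = pcompl_inj p (C_alg p \<phi>) (dlim_cls (jet_alg p \<phi> Ga_exps) y 0)"

text \<open>\<open>C_shift p \<phi> n\<close> is \<open>\<phi>^(-n) (z)\<close>, for positive and negative \<open>n\<close>.\<close>

definition C_shift :: "nat \<Rightarrow> ('r \<Rightarrow> 'r) \<Rightarrow> int \<Rightarrow> 'r::comm_ring_1 Calg" where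
  "C_shift p \<phi> n = (let J = jet_alg p \<phi> Ga_exps; z = jet_var p Ga_exps 0 in
     pcompl_inj p (C_alg p \<phi>)
       (if 0 \<le> n then dlim_cls J z (nat n) else dlim_cls J ((frob J ^^ nat (- n)) z) 0))"

definition admissible :: "nat \<Rightarrow> (int \<Rightarrow> 'r::comm_ring_1) \<Rightarrow> bool" where
  "admissible p a \<longleftrightarrow> (\<forall>n. of_nat p dvd a n) \<and>
     (\<forall>k. \<exists>N. \<forall>n. N \<le> \<bar>n\<bar> \<longrightarrow> of_nat p ^ k dvd a n)"

definition Sigma_ser :: "nat \<Rightarrow> ('r \<Rightarrow> 'r) \<Rightarrow> (int \<Rightarrow> 'r) \<Rightarrow> 'r::comm_ring_1 Calg" where
  "Sigma_ser p \<phi> a = pexp p (C_hat p \<phi>)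
     (psum p (C_hat p \<phi>) (\<lambda>n. emb (C_hat p \<phi>) (a n) \<otimes>\<^bsub>C_hat p \<phi>\<^esub> C_shift p \<phi> n) UNIV)"

definition cochar_delta_hom ::
    "nat \<Rightarrow> ('r \<Rightarrow> 'r) \<Rightarrow> (int \<Rightarrow> 'r) \<Rightarrow> 'r::comm_ring_1 jet \<Rightarrow> 'r Calg" where
  "cochar_delta_hom p \<phi> a = (THE g. g \<in> delta_hom p (jet_alg p \<phi> Gm_exps) (C_hat p \<phi>) \<and>
     g (jet_var p Gm_exps 0) = Sigma_ser p \<phi> a)"

text \<open>
  Functoriality sends the homomorphism from the jet algebra of the multiplicative group to the
  completion of \<open>C\<close> to a homomorphism into \<open>P\<^sup>\<circ>\<close> of the completion of \<open>C\<close>.  The latter is identified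
  with \<open>P\<^sup>\<circ>\<close> of the jet algebra of the additive group through the isomorphism induced by \<open>C_can\<close>.
\<close>

definition cochar_P_circ :: "nat \<Rightarrow> ('r \<Rightarrow> 'r) \<Rightarrow> (int \<Rightarrow> 'r)
    \<Rightarrow> ('r::comm_ring_1, 'r jet) Pcirc \<Rightarrow> ('r, 'r jet) Pcirc" where
  "cochar_P_circ p \<phi> a y =
     inv_into (carrier (P_circ p \<phi> (jet_alg p \<phi> Ga_exps)))
       (P_circ_map p \<phi> (C_hat p \<phi>) (C_can p \<phi>))
       (P_circ_map p \<phi> (C_hat p \<phi>) (cochar_delta_hom p \<phi> a) y)"

definition cochar :: "nat \<Rightarrow> ('r \<Rightarrow> 'r) \<Rightarrow> (int \<Rightarrow> 'r)
    \<Rightarrow> (('r::comm_ring_1, 'r jet) P, ('r, 'r jet) P) adic_mor" where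
  "cochar p \<phi> a = adic_induced (P_inf p \<phi> Ga_exps) (P_inf p \<phi> Gm_exps)
     (loc_map p (P_circ p \<phi> (jet_alg p \<phi> Ga_exps)) (cochar_P_circ p \<phi> a))"

definition cocharacters ::
    "nat \<Rightarrow> ('r \<Rightarrow> 'r) \<Rightarrow> (('r::comm_ring_1, 'r jet) P, ('r, 'r jet) P) adic_mor set" where
  "cocharacters p \<phi> = {cochar p \<phi> a | a. admissible p a}"

end

theory Submission
  imports Defs
begin

text \<open>
  Let \<open>g\<close> be the \<open>\<delta>\<close>-homomorphism with \<open>x \<mapsto> exp Y\<close>, where \<open>Y = \<Sum> a\<^sub>n \<phi>^(-n)(z)\<close>.  Since
  \<open>p \<Psi> = log (1 + p x'/x^p) = log (\<phi>(x)/x^p)\<close>, one gets \<open>p g(\<Psi>) = \<phi>(Y) - p Y\<close>, in which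
  \<open>\<phi>^(-n)(z)\<close> has the coefficient \<open>\<phi>(a\<^sub>n\<^sub>+\<^sub>1) - p a\<^sub>n\<close>.  For \<open>a\<^sub>n = p^n\<close> with \<open>n \<ge> 1\<close> and \<open>a\<^sub>n = 0\<close> otherwise only
  the term \<open>p z\<close> remains, so \<open>g\<close> after \<open>\<psi>\<close> is the canonical map to the completed direct limit,
  which becomes invertible under \<open>P\<^sup>\<circ>\<close>.

  Conversely, suppose that \<open>g(\<Psi>)\<close> and \<open>z\<close> have the same image in \<open>P\<close>.  Evaluation at \<open>z = r\<close>,
  together with the \<open>R\<close>-linear projection of \<open>R[p^(1/p^m)]\<close> onto \<open>R\<close> that kills the non-integral
  powers of \<open>p\<close>, yields additive maps from \<open>P\<^sup>\<circ>\<close> to \<open>R\<close>.  Hence a series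
  \<open>\<Sum> c\<^sub>n \<phi>^(-n)(r)\<close> vanishes for all \<open>r\<close> in \<open>R\<close>.  Modulo \<open>p\<close> this is a polynomial identity on the
  infinite residue field, so all \<open>c\<^sub>n\<close> are divisible by \<open>p\<close>, and inductively by all powers of \<open>p\<close>.
  The remaining recursion \<open>\<phi>(a\<^sub>n\<^sub>+\<^sub>1) = p a\<^sub>n\<close> for \<open>n \<noteq> 0\<close>, \<open>\<phi>(a\<^sub>1) = p a\<^sub>0 + p\<close> has only one
  solution tending to 0.
\<close>

text \<open>A ring \<open>P_circ p \<phi> A\<close> arises by a tensor product, a completion, a
  direct limit and a second completion. From this description it is not evident whether it has
  p-torsion, or whether \<open>A\<close> embeds into it. The proof settles neither question.
  Uniqueness is tested by functionals with values in R, which is torsion-free and separated, so that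
  the power of p left over by an equality in P is cancelled in R. The functionals cannot be
  multiplicative, but additivity is enough: an additive map respects congruences modulo p^n and is
  therefore determined on a completion by its values on the image of the ring. Each of the four
  layers thus has a mapping property for additive maps.

  The relation between exp and log is obtained without composing series: with N = p^k, both u^N and
  exp(N y) are compared with their linear parts modulo p^(2k), and N is cancelled. Convergence of
  exp rests on v_p(n!) < n/2, which is where p odd enters. Evaluating \<open>\<phi>^(-n)(z)\<close>
  in R uses that \<open>\<phi>\<close> is bijective on R.\<close>

no_notation ideal_prod (infixl "\<cdot>\<index>" 80)

section \<open>Congruences and additive maps\<close>

text \<open>Additivity is the common denominator of ring homomorphisms and of the functionals used
  for uniqueness, which are not multiplicative.\<close>

definition add_hom :: "('a, 'm) ring_scheme \<Rightarrow> ('b, 'n) ring_scheme \<Rightarrow> ('a \<Rightarrow> 'b) set" where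
  "add_hom A B = {f. f \<in> carrier A \<rightarrow> carrier B \<and>
     (\<forall>x\<in>carrier A. \<forall>y\<in>carrier A. f (x \<oplus>\<^bsub>A\<^esub> y) = f x \<oplus>\<^bsub>B\<^esub> f y)}"

text \<open>Congruence modulo p^n with an explicit witness \<open>t\<close>, a form that every
  additive map preserves. Membership of \<open>x\<close> in the carrier follows from that of
  \<open>y\<close>, which the lemmas assume.\<close>

definition pcong :: "nat \<Rightarrow> ('a, 'm) ring_scheme \<Rightarrow> nat \<Rightarrow> 'a \<Rightarrow> 'a \<Rightarrow> bool" where
  "pcong p A n x y \<longleftrightarrow> (\<exists>t\<in>carrier A. x = y \<oplus>\<^bsub>A\<^esub> [(p ^ n)] \<cdot>\<^bsub>A\<^esub> t)"

lemma add_homI: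
  assumes "\<And>x. x \<in> carrier A \<Longrightarrow> f x \<in> carrier B"
    and "\<And>x y. x \<in> carrier A \<Longrightarrow> y \<in> carrier A \<Longrightarrow> f (x \<oplus>\<^bsub>A\<^esub> y) = f x \<oplus>\<^bsub>B\<^esub> f y"
  shows "f \<in> add_hom A B"
  using assms by (auto simp: add_hom_def)

lemma add_hom_closed: "f \<in> add_hom A B \<Longrightarrow> x \<in> carrier A \<Longrightarrow> f x \<in> carrier B"
  by (auto simp: add_hom_def)

lemma add_hom_add: "f \<in> add_hom A B \<Longrightarrow> x \<in> carrier A \<Longrightarrow> y \<in> carrier A
    \<Longrightarrow> f (x \<oplus>\<^bsub>A\<^esub> y) = f x \<oplus>\<^bsub>B\<^esub> f y"
  by (auto simp: add_hom_def)

lemma ring_hom_add_hom: "f \<in> ring_hom A B \<Longrightarrow> f \<in> add_hom A B"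
  by (auto simp: add_hom_def ring_hom_def)

lemma add_hom_comp: "f \<in> add_hom A B \<Longrightarrow> g \<in> add_hom B C \<Longrightarrow> (\<lambda>x. g (f x)) \<in> add_hom A C"
  by (auto simp: add_hom_def Pi_def)

lemma add_hom_zero:
  assumes "abelian_group A" "abelian_group B" "f \<in> add_hom A B"
  shows "f \<zero>\<^bsub>A\<^esub> = \<zero>\<^bsub>B\<^esub>"
proof -
  interpret A: abelian_group A by fact
  interpret B: abelian_group B by fact
  have "f \<zero>\<^bsub>A\<^esub> \<oplus>\<^bsub>B\<^esub> f \<zero>\<^bsub>A\<^esub> = f \<zero>\<^bsub>A\<^esub>"
    using add_hom_add[OF assms(3), of "\<zero>\<^bsub>A\<^esub>" "\<zero>\<^bsub>A\<^esub>"] by simp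
  then show ?thesis
    using add_hom_closed[OF assms(3), of "\<zero>\<^bsub>A\<^esub>"] by (metis A.zero_closed B.add.r_cancel_one)
qed

lemma add_hom_minus:
  assumes "abelian_group A" "abelian_group B" "f \<in> add_hom A B" "x \<in> carrier A"
  shows "f (\<ominus>\<^bsub>A\<^esub> x) = \<ominus>\<^bsub>B\<^esub> f x"
proof -
  interpret A: abelian_group A by fact
  interpret B: abelian_group B by fact
  have "f (\<ominus>\<^bsub>A\<^esub> x) \<oplus>\<^bsub>B\<^esub> f x = \<zero>\<^bsub>B\<^esub>"
    using add_hom_add[OF assms(3), of "\<ominus>\<^bsub>A\<^esub> x" x] add_hom_zero[OF assms(1-3)] assms(4)
    by (simp add: A.l_neg)
  then show ?thesis
    using add_hom_closed[OF assms(3)] assms(4) by (metis A.a_inv_closed B.minus_equality)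
qed

lemma add_hom_diff:
  assumes "abelian_group A" "abelian_group B" "f \<in> add_hom A B" "x \<in> carrier A" "y \<in> carrier A"
  shows "f (x \<ominus>\<^bsub>A\<^esub> y) = f x \<ominus>\<^bsub>B\<^esub> f y"
proof -
  interpret A: abelian_group A by fact
  show ?thesis
    using add_hom_add[OF assms(3,4), of "\<ominus>\<^bsub>A\<^esub> y"] assms(5) add_hom_minus[OF assms(1-3,5)]
    by (simp add: a_minus_def)
qed

lemma add_hom_smult:
  assumes "abelian_group A" "abelian_group B" "f \<in> add_hom A B" "x \<in> carrier A"
  shows "f ([(n::nat)] \<cdot>\<^bsub>A\<^esub> x) = [n] \<cdot>\<^bsub>B\<^esub> f x"
proof -
  interpret A: abelian_group A by fact
  interpret B: abelian_group B by fact
  show ?thesis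
    by (induction n) (simp_all add: add_hom_zero[OF assms(1-3)] add_hom_add[OF assms(3)] assms(4))
qed

lemma add_hom_finsum:
  assumes "abelian_group A" "abelian_group B" "f \<in> add_hom A B" "g \<in> I \<rightarrow> carrier A"
  shows "f (\<Oplus>\<^bsub>A\<^esub>i\<in>I. g i) = (\<Oplus>\<^bsub>B\<^esub>i\<in>I. f (g i))"
proof -
  interpret A: abelian_group A by fact
  interpret B: abelian_group B by fact
  have c: "x \<in> carrier A \<Longrightarrow> f x \<in> carrier B" for x using add_hom_closed[OF assms(3)] by blast
  from assms(4) show ?thesis
    by (induction I rule: infinite_finite_induct)
      (auto simp: add_hom_zero[OF assms(1-3)] add_hom_add[OF assms(3)] c Pi_def)
qed

section \<open>Congruences modulo p^n in a ring\<close>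

context ring begin

lemma smult_l: "a \<in> carrier R \<Longrightarrow> b \<in> carrier R \<Longrightarrow> ([(k::nat)] \<cdot> a) \<otimes> b = [k] \<cdot> (a \<otimes> b)"
  by (rule semiring.add_pow_ldistr[OF semiring_axioms])

lemma smult_r: "a \<in> carrier R \<Longrightarrow> b \<in> carrier R \<Longrightarrow> a \<otimes> ([(k::nat)] \<cdot> b) = [k] \<cdot> (a \<otimes> b)"
  by (rule semiring.add_pow_rdistr[OF semiring_axioms])

lemma smult_add: "a \<in> carrier R \<Longrightarrow> b \<in> carrier R \<Longrightarrow> [(k::nat)] \<cdot> (a \<oplus> b) = [k] \<cdot> a \<oplus> [k] \<cdot> b"
  by (rule add.nat_pow_distrib)

lemma smult_smult: "a \<in> carrier R \<Longrightarrow> [(k::nat)] \<cdot> ([(l::nat)] \<cdot> a) = [(k * l)] \<cdot> a"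
  by (metis add.nat_pow_pow mult.commute)

lemma smult_minus: "a \<in> carrier R \<Longrightarrow> [(k::nat)] \<cdot> (\<ominus> a) = \<ominus> ([k] \<cdot> a)"
  by (simp add: add.nat_pow_inv)

lemma smult_diff: "a \<in> carrier R \<Longrightarrow> b \<in> carrier R \<Longrightarrow> [(k::nat)] \<cdot> (a \<ominus> b) = [k] \<cdot> a \<ominus> [k] \<cdot> b"
  by (simp add: a_minus_def smult_add smult_minus)

lemma minus_eq_iff: "x \<in> carrier R \<Longrightarrow> y \<in> carrier R \<Longrightarrow> z \<in> carrier R \<Longrightarrow> x \<ominus> y = z \<longleftrightarrow> x = y \<oplus> z"
  by (metis a_minus_def a_comm add.inv_solve_right)

lemma pcong_refl [simp]: "x \<in> carrier R \<Longrightarrow> pcong p R n x x"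
  unfolding pcong_def by (rule bexI[of _ \<zero>]) auto

lemma pcong_closed: "pcong p R n x y \<Longrightarrow> y \<in> carrier R \<Longrightarrow> x \<in> carrier R"
  by (auto simp: pcong_def)

lemma pcong_sym: "pcong p R n x y \<Longrightarrow> y \<in> carrier R \<Longrightarrow> pcong p R n y x"
  unfolding pcong_def
proof (elim bexE)
  fix t assume "t \<in> carrier R" "x = y \<oplus> [(p ^ n)] \<cdot> t" "y \<in> carrier R"
  then show "\<exists>t\<in>carrier R. y = x \<oplus> [(p ^ n)] \<cdot> t"
    by (intro bexI[of _ "\<ominus> t"]) (auto simp: smult_minus a_assoc r_neg)
qed

lemma pcong_trans: "pcong p R n x y \<Longrightarrow> pcong p R n y z \<Longrightarrow> z \<in> carrier R \<Longrightarrow> pcong p R n x z"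
  unfolding pcong_def
proof (elim bexE)
  fix t s assume "t \<in> carrier R" "x = y \<oplus> [(p ^ n)] \<cdot> t" "z \<in> carrier R"
    "s \<in> carrier R" "y = z \<oplus> [(p ^ n)] \<cdot> s"
  then show "\<exists>t\<in>carrier R. x = z \<oplus> [(p ^ n)] \<cdot> t"
    by (intro bexI[of _ "s \<oplus> t"]) (auto simp: smult_add a_assoc)
qed

lemma pcong_mono: "pcong p R n x y \<Longrightarrow> m \<le> n \<Longrightarrow> pcong p R m x y"
  unfolding pcong_def
proof (elim bexE)
  fix t assume "t \<in> carrier R" "x = y \<oplus> [(p ^ n)] \<cdot> t" "m \<le> n"
  then show "\<exists>t\<in>carrier R. x = y \<oplus> [(p ^ m)] \<cdot> t"
    by (intro bexI[of _ "[(p ^ (n - m))] \<cdot> t"]) (auto simp: smult_smult power_add[symmetric])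
qed

lemma pcong_add:
  assumes "pcong p R n x y" "pcong p R n x' y'" "y \<in> carrier R" "y' \<in> carrier R"
  shows "pcong p R n (x \<oplus> x') (y \<oplus> y')"
proof -
  obtain t t' where "t \<in> carrier R" "x = y \<oplus> [(p ^ n)] \<cdot> t" "t' \<in> carrier R" "x' = y' \<oplus> [(p ^ n)] \<cdot> t'"
    using assms by (auto simp: pcong_def)
  then show ?thesis unfolding pcong_def using assms(3,4)
    by (intro bexI[of _ "t \<oplus> t'"]) (auto simp: smult_add a_ac)
qed

lemma pcong_minus:
  assumes "pcong p R n x y" "y \<in> carrier R"
  shows "pcong p R n (\<ominus> x) (\<ominus> y)"
proof -
  obtain t where "t \<in> carrier R" "x = y \<oplus> [(p ^ n)] \<cdot> t"
    using assms by (auto simp: pcong_def)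
  then show ?thesis unfolding pcong_def using assms(2)
    by (intro bexI[of _ "\<ominus> t"]) (auto simp: smult_minus minus_add)
qed

lemma pcong_diff:
  assumes "pcong p R n x y" "pcong p R n x' y'" "y \<in> carrier R" "y' \<in> carrier R"
  shows "pcong p R n (x \<ominus> x') (y \<ominus> y')"
  unfolding a_minus_def using assms by (intro pcong_add pcong_minus) auto

lemma pcong_smult:
  assumes "pcong p R n x y" "y \<in> carrier R"
  shows "pcong p R (m + n) ([(p ^ m)] \<cdot> x) ([(p ^ m)] \<cdot> y)"
proof -
  obtain t where "t \<in> carrier R" "x = y \<oplus> [(p ^ n)] \<cdot> t"
    using assms by (auto simp: pcong_def)
  then show ?thesis unfolding pcong_def using assms(2)
    by (intro bexI[of _ t]) (auto simp: smult_add smult_smult power_add)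
qed

lemma pcong_mult_l:
  assumes "pcong p R n x y" "y \<in> carrier R" "a \<in> carrier R"
  shows "pcong p R n (a \<otimes> x) (a \<otimes> y)"
proof -
  obtain t where "t \<in> carrier R" "x = y \<oplus> [(p ^ n)] \<cdot> t"
    using assms by (auto simp: pcong_def)
  then show ?thesis unfolding pcong_def using assms(2,3)
    by (intro bexI[of _ "a \<otimes> t"]) (auto simp: smult_r r_distr)
qed

lemma pcong_mult_r:
  assumes "pcong p R n x y" "y \<in> carrier R" "a \<in> carrier R"
  shows "pcong p R n (x \<otimes> a) (y \<otimes> a)"
proof -
  obtain t where "t \<in> carrier R" "x = y \<oplus> [(p ^ n)] \<cdot> t"
    using assms by (auto simp: pcong_def)
  then show ?thesis unfolding pcong_def using assms(2,3)
    by (intro bexI[of _ "t \<otimes> a"]) (auto simp: smult_l l_distr)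
qed

lemma pcong_mult:
  assumes "pcong p R n x y" "pcong p R n x' y'" "y \<in> carrier R" "y' \<in> carrier R"
  shows "pcong p R n (x \<otimes> x') (y \<otimes> y')"
proof -
  have "x' \<in> carrier R" using assms pcong_closed by blast
  then show ?thesis
    using pcong_mult_r[OF assms(1,3)] pcong_mult_l[OF assms(2,4)] assms(3,4)
    by (meson m_closed pcong_trans)
qed

lemma pcong_pow:
  assumes "pcong p R n x y" "y \<in> carrier R"
  shows "pcong p R n (x [^] (k::nat)) (y [^] k)"
  using assms by (induction k) (auto intro: pcong_mult)

lemma pcong_zero_iff: "pcong p R n x \<zero> \<longleftrightarrow> (\<exists>t\<in>carrier R. x = [(p ^ n)] \<cdot> t)"
  unfolding pcong_def by auto

lemma pcong_finsum:
  assumes "\<And>i. i \<in> I \<Longrightarrow> pcong p R n (f i) (g i)" "g \<in> I \<rightarrow> carrier R"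
  shows "pcong p R n (\<Oplus>i\<in>I. f i) (\<Oplus>i\<in>I. g i)"
  using assms
proof (induction I rule: infinite_finite_induct)
  case (insert x F)
  then have "f \<in> insert x F \<rightarrow> carrier R" using pcong_closed by blast
  with insert show ?case by (auto simp: Pi_def intro!: pcong_add)
qed auto

lemma pcong_iff_minus: "x \<in> carrier R \<Longrightarrow> y \<in> carrier R \<Longrightarrow> pcong p R n x y \<longleftrightarrow> pcong p R n (x \<ominus> y) \<zero>"
  by (auto simp: pcong_def minus_eq_iff)

end

lemma add_hom_pcong:
  assumes "ring A" "ring B" "f \<in> add_hom A B" "pcong p A n x y" "y \<in> carrier A"
  shows "pcong p B n (f x) (f y)"
proof -
  interpret A: ring A by fact
  interpret B: ring B by fact
  obtain t where t: "t \<in> carrier A" "x = y \<oplus>\<^bsub>A\<^esub> [(p ^ n)] \<cdot>\<^bsub>A\<^esub> t" using assms(4) by (auto simp: pcong_def)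
  then have "f x = f y \<oplus>\<^bsub>B\<^esub> [(p ^ n)] \<cdot>\<^bsub>B\<^esub> f t"
    using assms by (simp add: add_hom_add add_hom_smult[OF A.is_abelian_group B.is_abelian_group])
  then show ?thesis using add_hom_closed[OF assms(3) t(1)] by (auto simp: pcong_def)
qed

section \<open>Cosets of p^n A\<close>

context cring begin

lemma pideal_iff: "x \<in> pideal p R n \<longleftrightarrow> pcong p R n x \<zero>"
  unfolding pideal_def cgenideal_def pcong_zero_iff
  by (auto simp: smult_r) (metis one_closed r_one smult_r)

lemma pideal_ideal: "ideal (pideal p R n) R"
  unfolding pideal_def by (rule cgenideal_ideal) simp

lemma minus_in_pideal: "x \<in> carrier R \<Longrightarrow> y \<in> carrier R \<Longrightarrow> x \<ominus> y \<in> pideal p R n \<longleftrightarrow> pcong p R n x y"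
  by (simp add: pideal_iff pcong_iff_minus[of x y])

lemma pcoset_eq: "x \<in> carrier R \<Longrightarrow> y \<in> carrier R \<Longrightarrow>
    pideal p R n +> x = pideal p R n +> y \<longleftrightarrow> pcong p R n x y"
  using quotient_eq_iff_same_a_r_cos[OF pideal_ideal] minus_in_pideal by blast

lemma pcoset_iff: "y \<in> carrier R \<Longrightarrow> x \<in> pideal p R n +> y \<longleftrightarrow> pcong p R n x y"
proof -
  assume y: "y \<in> carrier R"
  have "x \<in> pideal p R n +> y \<longleftrightarrow> (\<exists>h. (\<exists>t\<in>carrier R. h = [(p ^ n)] \<cdot> t) \<and> x = h \<oplus> y)"
    by (simp add: a_r_coset_def' Bex_def pideal_iff pcong_zero_iff)
  also have "\<dots> \<longleftrightarrow> pcong p R n x y"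
    unfolding pcong_def using y by (metis a_comm add.nat_pow_closed)
  finally show ?thesis .
qed

lemma pcoset_subset: "x \<in> carrier R \<Longrightarrow> y \<in> carrier R \<Longrightarrow> m \<le> n \<Longrightarrow>
    pideal p R n +> x \<subseteq> pideal p R m +> y \<longleftrightarrow> pcong p R m x y"
proof
  assume "x \<in> carrier R" "y \<in> carrier R" "m \<le> n" "pideal p R n +> x \<subseteq> pideal p R m +> y"
  then show "pcong p R m x y" by (auto simp: subset_iff pcoset_iff)
next
  assume "x \<in> carrier R" "y \<in> carrier R" "m \<le> n" "pcong p R m x y"
  then show "pideal p R n +> x \<subseteq> pideal p R m +> y"
    using pcong_mono[of p n _ x m] pcong_trans[of p m _ x y] by (auto simp: pcoset_iff)
qed

end

section \<open>Completion\<close>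

text \<open>A system of representatives for an element of the inverse limit: only the class of
  \<open>x n\<close> modulo p^n matters. Arguments about completions are carried out on such systems
  instead of on cosets.\<close>

definition coherent :: "nat \<Rightarrow> ('a, 'm) ring_scheme \<Rightarrow> (nat \<Rightarrow> 'a) \<Rightarrow> bool" where
  "coherent p A x \<longleftrightarrow> (\<forall>n. x n \<in> carrier A \<and> pcong p A n (x (Suc n)) (x n))"

definition clim :: "nat \<Rightarrow> ('a, 'm) ring_scheme \<Rightarrow> (nat \<Rightarrow> 'a) \<Rightarrow> nat \<Rightarrow> 'a set" where
  "clim p A x = (\<lambda>n. pideal p A n +>\<^bsub>A\<^esub> x n)"

lemma pcompl_inj_clim: "pcompl_inj p A a = clim p A (\<lambda>_. a)"
  by (simp add: pcompl_inj_def clim_def)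

lemma coherent_closed: "coherent p A x \<Longrightarrow> x n \<in> carrier A"
  by (simp add: coherent_def)

context cring begin

lemma coherent_const: "a \<in> carrier R \<Longrightarrow> coherent p R (\<lambda>_. a)"
  by (simp add: coherent_def)

lemma coherent_le:
  assumes "coherent p R x" "m \<le> n"
  shows "pcong p R m (x n) (x m)"
  using assms(2)
proof (induction n rule: dec_induct)
  case base show ?case using assms(1) by (simp add: coherent_def)
next
  case (step n)
  have "pcong p R m (x (Suc n)) (x n)"
    using assms(1) step(1) unfolding coherent_def using pcong_mono by blast
  then show ?case using step(3) assms(1) pcong_trans by (auto simp: coherent_def)
qed

lemma coherent_add: "coherent p R x \<Longrightarrow> coherent p R y \<Longrightarrow> coherent p R (\<lambda>n. x n \<oplus> y n)"
  by (auto simp: coherent_def intro: pcong_add)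
lemma coherent_mult: "coherent p R x \<Longrightarrow> coherent p R y \<Longrightarrow> coherent p R (\<lambda>n. x n \<otimes> y n)"
  by (auto simp: coherent_def intro: pcong_mult)
lemma coherent_minus: "coherent p R x \<Longrightarrow> coherent p R (\<lambda>n. \<ominus> x n)"
  by (auto simp: coherent_def intro: pcong_minus)

lemma carrier_pcompl: "carrier (pcompl p R) = clim p R ` {x. coherent p R x}"
proof
  show "clim p R ` {x. coherent p R x} \<subseteq> carrier (pcompl p R)"
  proof clarify
    fix x assume x: "coherent p R x"
    have "pideal p R (Suc n) +> x (Suc n) \<subseteq> pideal p R n +> x n" for n
      using x by (subst pcoset_subset) (auto simp: coherent_def)
    then show "clim p R x \<in> carrier (pcompl p R)"
      using x by (auto simp: pcompl_def clim_def coherent_def FactRing_def A_RCOSETS_def')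
  qed
  show "carrier (pcompl p R) \<subseteq> clim p R ` {x. coherent p R x}"
  proof
    fix s assume s: "s \<in> carrier (pcompl p R)"
    then have "\<forall>n. \<exists>x\<in>carrier R. s n = pideal p R n +> x"
      by (auto simp: pcompl_def FactRing_def A_RCOSETS_def')
    then obtain x where x: "\<And>n. x n \<in> carrier R" "\<And>n. s n = pideal p R n +> x n" by metis
    have "pcong p R n (x (Suc n)) (x n)" for n
      using s x pcoset_subset[of "x (Suc n)" "x n" n "Suc n" p] by (simp add: pcompl_def)
    then have "coherent p R x" using x by (simp add: coherent_def)
    moreover have "s = clim p R x" using x by (auto simp: clim_def)
    ultimately show "s \<in> clim p R ` {x. coherent p R x}" by blast
  qed
qed

lemma clim_closed: "coherent p R x \<Longrightarrow> clim p R x \<in> carrier (pcompl p R)"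
  by (auto simp: carrier_pcompl)

lemma clim_eq_iff: "coherent p R x \<Longrightarrow> coherent p R y \<Longrightarrow>
    clim p R x = clim p R y \<longleftrightarrow> (\<forall>n. pcong p R n (x n) (y n))"
  by (simp add: clim_def fun_eq_iff pcoset_eq coherent_closed)

lemma clim_mult:
  assumes "coherent p R x" "coherent p R y"
  shows "clim p R x \<otimes>\<^bsub>pcompl p R\<^esub> clim p R y = clim p R (\<lambda>n. x n \<otimes> y n)"
  using assms ring_hom_mult[OF ideal.rcos_ring_hom[OF pideal_ideal], of _ _ p]
  by (simp add: pcompl_def clim_def coherent_closed)

lemma clim_add:
  assumes "coherent p R x" "coherent p R y"
  shows "clim p R x \<oplus>\<^bsub>pcompl p R\<^esub> clim p R y = clim p R (\<lambda>n. x n \<oplus> y n)"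
  using assms ring_hom_add[OF ideal.rcos_ring_hom[OF pideal_ideal], of _ _ p]
  by (simp add: pcompl_def clim_def coherent_closed)

lemma clim_one: "\<one>\<^bsub>pcompl p R\<^esub> = clim p R (\<lambda>_. \<one>)"
  using ring_hom_one[OF ideal.rcos_ring_hom[OF pideal_ideal], of p]
  by (simp add: pcompl_def clim_def)

lemma clim_zero: "\<zero>\<^bsub>pcompl p R\<^esub> = clim p R (\<lambda>_. \<zero>)"
  using a_rcos_zero[OF pideal_ideal] by (simp add: pcompl_def clim_def FactRing_def pideal_iff)

lemma pcompl_cring: "cring (pcompl p R)"
proof -
  note simps = clim_add clim_mult clim_one clim_zero coherent_add coherent_mult coherent_const
    coherent_closed clim_eq_iff
  show ?thesis
  proof (rule cringI)
    show "abelian_group (pcompl p R)"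
    proof (rule abelian_groupI)
      fix s assume "s \<in> carrier (pcompl p R)"
      then obtain x where x: "s = clim p R x" "coherent p R x" by (auto simp: carrier_pcompl)
      then show "\<exists>y\<in>carrier (pcompl p R). y \<oplus>\<^bsub>pcompl p R\<^esub> s = \<zero>\<^bsub>pcompl p R\<^esub>"
        by (intro bexI[of _ "clim p R (\<lambda>n. \<ominus> x n)"])
          (auto simp: simps coherent_minus l_neg clim_closed)
    qed (auto simp: carrier_pcompl simps a_ac)
    show "Group.comm_monoid (pcompl p R)"
      by (rule comm_monoidI) (auto simp: carrier_pcompl simps m_ac)
  qed (auto simp: carrier_pcompl simps l_distr)
qed

lemma clim_smult:
  assumes "coherent p R x"
  shows "[(k::nat)] \<cdot>\<^bsub>pcompl p R\<^esub> clim p R x = clim p R (\<lambda>n. [k] \<cdot> x n)" and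
    "coherent p R (\<lambda>n. [k] \<cdot> x n)"
proof -
  interpret C: cring "pcompl p R" by (rule pcompl_cring)
  have "[k] \<cdot>\<^bsub>pcompl p R\<^esub> clim p R x = clim p R (\<lambda>n. [k] \<cdot> x n) \<and> coherent p R (\<lambda>n. [k] \<cdot> x n)"
    by (induction k) (use assms in \<open>auto simp: clim_zero clim_add coherent_add coherent_const\<close>)
  then show "[k] \<cdot>\<^bsub>pcompl p R\<^esub> clim p R x = clim p R (\<lambda>n. [k] \<cdot> x n)"
    "coherent p R (\<lambda>n. [k] \<cdot> x n)" by auto
qed

lemma pcompl_inj_hom: "pcompl_inj p R \<in> ring_hom R (pcompl p R)"
  by (rule ring_hom_memI)
    (auto simp: pcompl_inj_clim clim_closed coherent_const clim_mult clim_add clim_one)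

text \<open>The kernel of the projection onto A / p^n A is p^n times the completion. Torsion is
  allowed, so the quotient by p^n cannot be found by cancellation and has to be constructed.\<close>

lemma clim_pcongI:
  assumes x: "coherent p R x" and y: "coherent p R y" and n: "pcong p R n (x n) (y n)"
  shows "pcong p (pcompl p R) n (clim p R x) (clim p R y)"
proof -
  define d where "d = (\<lambda>m. x m \<ominus> y m)"
  have d: "coherent p R d"
    unfolding d_def a_minus_def by (intro coherent_add coherent_minus x y)
  note [simp] = coherent_closed[OF x] coherent_closed[OF y] coherent_closed[OF d]
  have "pcong p R n (d n) \<zero>" using n pcong_iff_minus[of "x n" "y n" p n] by (simp add: d_def)
  then obtain b' where b': "b' \<in> carrier R" "d n = [(p ^ n)] \<cdot> b'" by (auto simp: pcong_zero_iff)
  have "\<forall>m. \<exists>t\<in>carrier R. d (Suc m) = d m \<oplus> [(p ^ m)] \<cdot> t"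
    using d by (auto simp: coherent_def pcong_def)
  then obtain b where b: "\<And>m. b m \<in> carrier R" "\<And>m. d (Suc m) = d m \<oplus> [(p ^ m)] \<cdot> b m" by metis
  \<comment> \<open>Dividing the increments p^(n+m) \<open>b (n + m)\<close> of \<open>d\<close> by
    p^n gives the increments p^m \<open>b (n + m)\<close> of the quotient; its initial value
    \<open>b'\<close> comes from the hypothesis at level n.\<close>
  define t where "t = rec_nat b' (\<lambda>m u. u \<oplus> [(p ^ m)] \<cdot> b (n + m))"
  have t0: "t 0 = b'" and tS: "t (Suc m) = t m \<oplus> [(p ^ m)] \<cdot> b (n + m)" for m by (auto simp: t_def)
  have tc: "t m \<in> carrier R" for m by (induction m) (auto simp: t0 tS b b')
  have tcoh: "coherent p R t" using tc b by (auto simp: coherent_def pcong_def tS)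
  have eq: "d (n + m) = [(p ^ n)] \<cdot> t m" for m
    by (induction m) (auto simp: t0 tS b b' tc smult_add smult_smult power_add)
  have "pcong p R m (x m) (y m \<oplus> [(p ^ n)] \<cdot> t m)" for m
  proof -
    have "pcong p R m (d m) ([(p ^ n)] \<cdot> t m)"
      using coherent_le[OF d, of m "n + m"] eq[of m] by (auto intro: pcong_sym)
    then have "pcong p R m (y m \<oplus> d m) (y m \<oplus> [(p ^ n)] \<cdot> t m)"
      by (intro pcong_add) (auto simp: tc)
    moreover have "y m \<oplus> d m = x m" unfolding d_def
      using minus_eq_iff[of "x m" "y m" "x m \<ominus> y m"] by simp
    ultimately show ?thesis by simp
  qed
  then have "clim p R x = clim p R y \<oplus>\<^bsub>pcompl p R\<^esub> [(p ^ n)] \<cdot>\<^bsub>pcompl p R\<^esub> clim p R t"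
    by (simp add: clim_smult[OF tcoh] clim_add[OF y clim_smult(2)[OF tcoh]] clim_eq_iff x
        coherent_add[OF y clim_smult(2)[OF tcoh]])
  then show ?thesis unfolding pcong_def using clim_closed[OF tcoh] by blast
qed

lemma clim_pcongD:
  assumes x: "coherent p R x" and y: "coherent p R y" and n: "pcong p (pcompl p R) n (clim p R x) (clim p R y)"
  shows "pcong p R n (x n) (y n)"
proof -
  obtain t where t: "coherent p R t" "clim p R x = clim p R y \<oplus>\<^bsub>pcompl p R\<^esub> [(p ^ n)] \<cdot>\<^bsub>pcompl p R\<^esub> clim p R t"
    using n by (auto simp: pcong_def carrier_pcompl)
  then have "pcong p R n (x n) (y n \<oplus> [(p ^ n)] \<cdot> t n)"
    by (simp add: clim_smult[OF t(1)] clim_add[OF y clim_smult(2)[OF t(1)]] clim_eq_iff x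
        coherent_add[OF y clim_smult(2)[OF t(1)]])
  moreover have "pcong p R n (y n \<oplus> [(p ^ n)] \<cdot> t n) (y n)"
    using coherent_closed[OF t(1)] by (auto simp: pcong_def)
  ultimately show ?thesis using coherent_closed[OF y] pcong_trans by blast
qed

lemma pcompl_inj_pcong: "a \<in> carrier R \<Longrightarrow> b \<in> carrier R \<Longrightarrow>
    pcong p (pcompl p R) n (pcompl_inj p R a) (pcompl_inj p R b) \<longleftrightarrow> pcong p R n a b"
  using clim_pcongI[of p "\<lambda>_. a" "\<lambda>_. b" n] clim_pcongD[of p "\<lambda>_. a" "\<lambda>_. b" n]
  by (auto simp: pcompl_inj_clim coherent_const)

lemma clim_approx: "coherent p R x \<Longrightarrow> pcong p (pcompl p R) n (clim p R x) (pcompl_inj p R (x n))"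
  unfolding pcompl_inj_clim
  by (rule clim_pcongI) (auto intro: coherent_const coherent_closed simp: coherent_closed)

lemma pcompl_dense:
  assumes "s \<in> carrier (pcompl p R)"
  obtains a where "a \<in> carrier R" "pcong p (pcompl p R) n s (pcompl_inj p R a)"
proof -
  obtain x where x: "s = clim p R x" "coherent p R x" using assms by (auto simp: carrier_pcompl)
  show ?thesis
    by (rule that[of "x n"]) (auto simp: x(1) clim_approx[OF x(2)] coherent_closed[OF x(2)])
qed

text \<open>Injectivity of \<open>pcompl_inj\<close> is separatedness, and its surjectivity is
  convergence of coherent sequences.\<close>

lemma p_complete_iff:
  "p_complete p R \<longleftrightarrow>
     (\<forall>x\<in>carrier R. \<forall>y\<in>carrier R. (\<forall>n. pcong p R n x y) \<longrightarrow> x = y) \<and>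
     (\<forall>x. coherent p R x \<longrightarrow> (\<exists>l\<in>carrier R. \<forall>n. pcong p R n l (x n)))"
proof -
  have 1: "inj_on (pcompl_inj p R) (carrier R) \<longleftrightarrow>
      (\<forall>x\<in>carrier R. \<forall>y\<in>carrier R. (\<forall>n. pcong p R n x y) \<longrightarrow> x = y)"
    unfolding inj_on_def by (auto simp: pcompl_inj_clim clim_eq_iff coherent_const)
  have 2: "pcompl_inj p R ` carrier R = carrier (pcompl p R) \<longleftrightarrow>
      (\<forall>x. coherent p R x \<longrightarrow> (\<exists>l\<in>carrier R. \<forall>n. pcong p R n l (x n)))"
  proof -
    have "clim p R x = pcompl_inj p R l \<longleftrightarrow> (\<forall>n. pcong p R n l (x n))"
      if "coherent p R x" "l \<in> carrier R" for x l
      using that clim_eq_iff[of p "\<lambda>_. l" x] by (auto simp: pcompl_inj_clim coherent_const)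
    moreover have "pcompl_inj p R ` carrier R \<subseteq> carrier (pcompl p R)"
      using ring_hom_closed[OF pcompl_inj_hom] by blast
    ultimately show ?thesis by (auto simp: carrier_pcompl image_def set_eq_iff subset_iff) metis+
  qed
  show ?thesis unfolding p_complete_def bij_betw_def 1 2 ..
qed

lemma p_complete_sep: "p_complete p R \<Longrightarrow> x \<in> carrier R \<Longrightarrow> y \<in> carrier R \<Longrightarrow>
    (\<And>n. pcong p R n x y) \<Longrightarrow> x = y"
  by (auto simp: p_complete_iff)

lemma p_complete_lim:
  assumes "p_complete p R" "coherent p R x"
  obtains l where "l \<in> carrier R" "\<And>n. pcong p R n l (x n)"
  using assms by (auto simp: p_complete_iff)

text \<open>By \<open>clim_pcongI\<close> and \<open>clim_pcongD\<close> the p-adic congruences of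
  the completion are those of the components, so a coherent sequence of coherent sequences converges
  to its diagonal.\<close>

lemma p_complete_pcompl: "p_complete p (pcompl p R)"
proof -
  interpret C: cring "pcompl p R" by (rule pcompl_cring)
  show ?thesis unfolding C.p_complete_iff
  proof (intro conjI ballI allI impI)
    fix s t assume "s \<in> carrier (pcompl p R)" "t \<in> carrier (pcompl p R)"
      "\<forall>n. pcong p (pcompl p R) n s t"
    then show "s = t" using clim_pcongD by (auto simp: carrier_pcompl clim_eq_iff)
  next
    fix s assume s: "coherent p (pcompl p R) s"
    then have "\<forall>k. \<exists>x. coherent p R x \<and> s k = clim p R x"
      by (auto simp: coherent_def carrier_pcompl)
    then obtain x where x: "\<And>k. coherent p R (x k)" "\<And>k. s k = clim p R (x k)" by metis
    \<comment> \<open>The n-th component of the n-th term is the only entry that the congruences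
      modulo p^n determine.\<close>
    define l where "l = (\<lambda>n. x n n)"
    have l: "coherent p R l" unfolding coherent_def
    proof (intro allI conjI)
      fix n
      have "pcong p (pcompl p R) n (clim p R (x (Suc n))) (clim p R (x n))"
        using s x by (simp add: coherent_def)
      then have "pcong p R n (x (Suc n) n) (x n n)" using x clim_pcongD by blast
      moreover have "pcong p R n (x (Suc n) (Suc n)) (x (Suc n) n)" using x by (simp add: coherent_def)
      ultimately show "pcong p R n (l (Suc n)) (l n)" unfolding l_def
        using x by (meson coherent_closed pcong_trans)
      show "l n \<in> carrier R" unfolding l_def using x(1) by (rule coherent_closed)
    qed
    have "pcong p (pcompl p R) n (clim p R l) (s n)" for n
      unfolding x(2) by (rule clim_pcongI[OF l x(1)]) (simp add: l_def coherent_closed[OF x(1)])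
    then show "\<exists>l\<in>carrier (pcompl p R). \<forall>n. pcong p (pcompl p R) n l (s n)"
      using clim_closed[OF l] by blast
  qed
qed

end

section \<open>Inverse homomorphisms, and the ring operations of extended records\<close>

lemma inv_into_add_hom:
  assumes "abelian_group A" "f \<in> add_hom A B" "bij_betw f (carrier A) (carrier B)"
  shows "inv_into (carrier A) f \<in> add_hom B A"
proof -
  interpret A: abelian_group A by fact
  have c: "y \<in> carrier B \<Longrightarrow> inv_into (carrier A) f y \<in> carrier A" for y
    using assms(3) by (metis bij_betw_imp_surj_on inv_into_into)
  have r: "y \<in> carrier B \<Longrightarrow> f (inv_into (carrier A) f y) = y" for y
    using assms(3) by (simp add: bij_betw_inv_into_right)
  show ?thesis
  proof (rule add_homI)
    fix x y assume xy: "x \<in> carrier B" "y \<in> carrier B"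
    have "f (inv_into (carrier A) f x \<oplus>\<^bsub>A\<^esub> inv_into (carrier A) f y) = x \<oplus>\<^bsub>B\<^esub> y"
      by (simp add: add_hom_add[OF assms(2)] c r xy)
    then show "inv_into (carrier A) f (x \<oplus>\<^bsub>B\<^esub> y) =
        inv_into (carrier A) f x \<oplus>\<^bsub>A\<^esub> inv_into (carrier A) f y"
      by (metis A.a_closed assms(3) bij_betw_inv_into_left c xy)
  qed (rule c)
qed

lemma inv_into_ring_hom:
  assumes "ring A" "f \<in> ring_hom A B" "bij_betw f (carrier A) (carrier B)"
  shows "inv_into (carrier A) f \<in> ring_hom B A"
  using ring_iso_set_sym[of A f B] assms by (auto simp: ring_iso_def)

lemma ring_extend_simps [simp]:
  "carrier (ring.extend R m) = carrier R"
  "monoid.mult (ring.extend R m) = monoid.mult R"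
  "monoid.one (ring.extend R m) = monoid.one R"
  "ring.zero (ring.extend R m) = ring.zero R"
  "ring.add (ring.extend R m) = ring.add R"
  by (auto simp: ring.extend_def)

lemma ring_extend_pow [simp]: "x [^]\<^bsub>ring.extend R m\<^esub> (n::nat) = x [^]\<^bsub>R\<^esub> n"
  by (simp add: nat_pow_def)

lemma ring_extend_smult [simp]: "[(n::nat)] \<cdot>\<^bsub>ring.extend R m\<^esub> x = [n] \<cdot>\<^bsub>R\<^esub> x"
  by (simp add: add_pow_def nat_pow_def)

lemma ring_extend_a_inv [simp]: "\<ominus>\<^bsub>ring.extend R m\<^esub> x = \<ominus>\<^bsub>R\<^esub> x"
  by (simp add: a_inv_def m_inv_def)

lemma ring_extend_smult_int [simp]: "[(n::int)] \<cdot>\<^bsub>ring.extend R m\<^esub> x = [n] \<cdot>\<^bsub>R\<^esub> x"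
  by (simp add: add_pow_def int_pow_def nat_pow_def m_inv_def Let_def)

lemma ring_extend_inv [simp]: "inv\<^bsub>ring.extend R m\<^esub> x = inv\<^bsub>R\<^esub> x"
  by (simp add: m_inv_def)

lemma ring_extend_minus [simp]: "x \<ominus>\<^bsub>ring.extend R m\<^esub> y = x \<ominus>\<^bsub>R\<^esub> y"
  by (simp add: a_minus_def)

lemma ring_extend_Units [simp]: "Units (ring.extend R m) = Units R"
  by (simp add: Units_def)

lemma ring_extend_hom [simp]:
  "ring_hom (ring.extend R m) S = ring_hom R S" "ring_hom T (ring.extend R m) = ring_hom T R"
  "add_hom (ring.extend R m) S = add_hom R S" "add_hom T (ring.extend R m) = add_hom T R"
  by (simp_all add: ring_hom_def add_hom_def)

lemma ring_extend_pcong [simp]: "pcong p (ring.extend R m) = pcong p R"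
  by (simp add: pcong_def fun_eq_iff)

lemma ring_extend_pideal [simp]: "pideal p (ring.extend R m) n = pideal p R n"
  by (simp add: pideal_def cgenideal_def)

lemma ring_extend_pcompl [simp]: "pcompl p (ring.extend R m) = pcompl p R"
  by (simp add: pcompl_def FactRing_def A_RCOSETS_def' a_r_coset_def' rcoset_mult_def set_add_def')

lemma ring_extend_pcompl_inj [simp]: "pcompl_inj p (ring.extend R m) = pcompl_inj p R"
  by (simp add: pcompl_inj_def a_r_coset_def' fun_eq_iff)

lemma ring_extend_p_complete [simp]: "p_complete p (ring.extend R m) = p_complete p R"
  by (simp add: p_complete_def)

lemma cring_cong:
  assumes "cring A" and [simp]: "carrier B = carrier A" "monoid.mult B = monoid.mult A"
    "monoid.one B = monoid.one A" "ring.zero B = ring.zero A" "ring.add B = ring.add A"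
  shows "cring B"
proof -
  interpret A: cring A by fact
  show ?thesis
    by (intro cringI abelian_groupI comm_monoidI)
      (auto simp: A.a_ac A.m_ac A.l_distr A.r_distr intro: A.l_neg bexI[of _ "\<ominus>\<^bsub>A\<^esub> _"])
qed

lemma cring_extend [simp]: "cring (ring.extend R m) = cring R"
  by (auto intro: cring_cong)

section \<open>Extension of additive maps to completions\<close>

text \<open>An additive map sends congruent representatives to congruent values, so the union in
  \<open>pcompl_map\<close> is taken over one and the same coset.\<close>

lemma pcompl_map_clim:
  assumes "cring A" "cring B" "f \<in> add_hom A B" "coherent p A x"
  shows "pcompl_map p B f (clim p A x) = clim p B (\<lambda>n. f (x n))" "coherent p B (\<lambda>n. f (x n))"
proof -
  interpret A: cring A by fact
  interpret B: cring B by fact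
  note c = coherent_closed[OF assms(4)]
  show co: "coherent p B (\<lambda>n. f (x n))"
    unfolding coherent_def
    using assms(4) add_hom_pcong[OF A.ring_axioms B.ring_axioms assms(3)] add_hom_closed[OF assms(3)]
    by (simp add: coherent_def)
  have "(\<Union>y\<in>pideal p A n +>\<^bsub>A\<^esub> x n. pideal p B n +>\<^bsub>B\<^esub> f y) = pideal p B n +>\<^bsub>B\<^esub> f (x n)" for n
  proof -
    have "pideal p B n +>\<^bsub>B\<^esub> f y = pideal p B n +>\<^bsub>B\<^esub> f (x n)" if "y \<in> pideal p A n +>\<^bsub>A\<^esub> x n" for y
    proof -
      have "pcong p A n y (x n)" using that A.pcoset_iff[OF c] by simp
      moreover from this have "y \<in> carrier A" using A.pcong_closed c by blast
      ultimately show ?thesis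
        using add_hom_pcong[OF A.ring_axioms B.ring_axioms assms(3)] add_hom_closed[OF assms(3)] c
        by (subst B.pcoset_eq) auto
    qed
    moreover have "x n \<in> pideal p A n +>\<^bsub>A\<^esub> x n" using A.pcoset_iff[OF c] c by simp
    ultimately show ?thesis by blast
  qed
  then show "pcompl_map p B f (clim p A x) = clim p B (\<lambda>n. f (x n))"
    by (simp add: pcompl_map_def clim_def)
qed

lemma pcompl_map_add_hom:
  assumes "cring A" "cring B" "f \<in> add_hom A B"
  shows "pcompl_map p B f \<in> add_hom (pcompl p A) (pcompl p B)"
proof -
  interpret A: cring A by fact
  interpret B: cring B by fact
  note m = pcompl_map_clim[OF assms, of p]
  show ?thesis
  proof (rule add_homI)
    fix s t assume "s \<in> carrier (pcompl p A)" "t \<in> carrier (pcompl p A)"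
    then obtain x y where x: "s = clim p A x" "coherent p A x" and y: "t = clim p A y" "coherent p A y"
      by (auto simp: A.carrier_pcompl)
    show "pcompl_map p B f (s \<oplus>\<^bsub>pcompl p A\<^esub> t) =
        pcompl_map p B f s \<oplus>\<^bsub>pcompl p B\<^esub> pcompl_map p B f t"
      using x y by (simp add: A.clim_add A.coherent_add m B.clim_add add_hom_add[OF assms(3)]
          coherent_closed)
  qed (auto simp: A.carrier_pcompl m B.clim_closed)
qed

lemma pcompl_map_ring_hom:
  assumes "cring A" "cring B" "f \<in> ring_hom A B"
  shows "pcompl_map p B f \<in> ring_hom (pcompl p A) (pcompl p B)"
proof -
  interpret A: cring A by fact
  interpret B: cring B by fact
  note m = pcompl_map_clim[OF assms(1,2) ring_hom_add_hom[OF assms(3)], of p]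
  note a = pcompl_map_add_hom[OF assms(1,2) ring_hom_add_hom[OF assms(3)], of p]
  show ?thesis
  proof (rule ring_hom_memI)
    fix s t assume "s \<in> carrier (pcompl p A)" "t \<in> carrier (pcompl p A)"
    then obtain x y where x: "s = clim p A x" "coherent p A x" and y: "t = clim p A y" "coherent p A y"
      by (auto simp: A.carrier_pcompl)
    show "pcompl_map p B f (s \<otimes>\<^bsub>pcompl p A\<^esub> t) =
        pcompl_map p B f s \<otimes>\<^bsub>pcompl p B\<^esub> pcompl_map p B f t"
      using x y by (simp add: A.clim_mult A.coherent_mult m B.clim_mult ring_hom_mult[OF assms(3)]
          coherent_closed)
  qed (auto simp: A.clim_one B.clim_one m A.coherent_const ring_hom_one[OF assms(3)]
      add_hom_add[OF a] intro: add_hom_closed[OF a])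
qed

lemma pcompl_map_inj:
  assumes "cring A" "cring B" "f \<in> add_hom A B" "a \<in> carrier A"
  shows "pcompl_map p B f (pcompl_inj p A a) = pcompl_inj p B (f a)"
  using pcompl_map_clim(1)[OF assms(1-3), of p "\<lambda>_. a"] cring.coherent_const[OF assms(1,4)]
  by (simp add: pcompl_inj_clim)

text \<open>Additive maps are automatically p-adically continuous.\<close>

lemma pcompl_hom_unique:
  assumes A: "cring A" and T: "cring T"
    and sep: "\<And>x y. x \<in> carrier T \<Longrightarrow> y \<in> carrier T \<Longrightarrow> (\<And>n. pcong p T n x y) \<Longrightarrow> x = y"
    and F: "F \<in> add_hom (pcompl p A) T" and G: "G \<in> add_hom (pcompl p A) T"
    and eq: "\<And>a. a \<in> carrier A \<Longrightarrow> F (pcompl_inj p A a) = G (pcompl_inj p A a)"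
    and s: "s \<in> carrier (pcompl p A)"
  shows "F s = G s"
proof (rule sep)
  interpret A: cring A by fact
  interpret T: cring T by fact
  interpret C: cring "pcompl p A" by (rule A.pcompl_cring)
  show "F s \<in> carrier T" "G s \<in> carrier T" using add_hom_closed[OF F s] add_hom_closed[OF G s] .
  fix n
  obtain a where a: "a \<in> carrier A" "pcong p (pcompl p A) n s (pcompl_inj p A a)"
    using A.pcompl_dense[OF s] .
  have i: "pcompl_inj p A a \<in> carrier (pcompl p A)" using ring_hom_closed[OF A.pcompl_inj_hom a(1)] .
  have "pcong p T n (F s) (F (pcompl_inj p A a))" "pcong p T n (G s) (G (pcompl_inj p A a))"
    using add_hom_pcong[OF C.ring_axioms T.ring_axioms F a(2) i]
      add_hom_pcong[OF C.ring_axioms T.ring_axioms G a(2) i] .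
  then show "pcong p T n (F s) (G s)" using eq[OF a(1)] add_hom_closed[OF G i] add_hom_closed[OF G s]
    by (metis T.pcong_sym T.pcong_trans)
qed

lemma p_complete_hom_unique:
  assumes "cring A" "cring T" "p_complete p T"
    and "F \<in> add_hom (pcompl p A) T" "G \<in> add_hom (pcompl p A) T"
    and "\<And>a. a \<in> carrier A \<Longrightarrow> F (pcompl_inj p A a) = G (pcompl_inj p A a)"
    and "s \<in> carrier (pcompl p A)"
  shows "F s = G s"
  by (rule pcompl_hom_unique[OF assms(1,2) _ assms(4-7)])
    (use cring.p_complete_sep[OF assms(2,3)] in blast)

text \<open>A composite of \<open>pcompl_map\<close> with the inverse of the isomorphism of
  \<open>T\<close> with its completion, so that additivity and multiplicativity are inherited from
  the two factors.\<close>

definition pext :: "nat \<Rightarrow> ('b, 'm) ring_scheme \<Rightarrow> ('a \<Rightarrow> 'b) \<Rightarrow> (nat \<Rightarrow> 'a set) \<Rightarrow> 'b" where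
  "pext p T f s = inv_into (carrier T) (pcompl_inj p T) (pcompl_map p T f s)"

lemma pext_add_hom:
  assumes "cring A" "cring T" "p_complete p T" "f \<in> add_hom A T"
  shows "pext p T f \<in> add_hom (pcompl p A) T"
proof -
  interpret T: cring T by fact
  show ?thesis unfolding pext_def
    using add_hom_comp[OF pcompl_map_add_hom[OF assms(1,2,4)] inv_into_add_hom[OF T.is_abelian_group
      ring_hom_add_hom[OF T.pcompl_inj_hom] assms(3)[unfolded p_complete_def]]] .
qed

lemma pext_ring_hom:
  assumes "cring A" "cring T" "p_complete p T" "f \<in> ring_hom A T"
  shows "pext p T f \<in> ring_hom (pcompl p A) T"
proof -
  interpret T: cring T by fact
  show ?thesis unfolding pext_def
    using ring_hom_trans[OF pcompl_map_ring_hom[OF assms(1,2,4)] inv_into_ring_hom[OF T.ring_axioms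
      T.pcompl_inj_hom assms(3)[unfolded p_complete_def]]] by (simp add: comp_def)
qed

lemma pext_inj:
  assumes "cring A" "cring T" "p_complete p T" "f \<in> add_hom A T" "a \<in> carrier A"
  shows "pext p T f (pcompl_inj p A a) = f a"
  using assms(3) add_hom_closed[OF assms(4,5)] unfolding pext_def pcompl_map_inj[OF assms(1,2,4,5)]
  by (simp add: p_complete_def bij_betw_inv_into_left)

section \<open>Algebras with a Frobenius endomorphism\<close>

text \<open>The congruence of \<open>frob A a\<close> with a^p modulo p is kept apart, in
  \<open>frob_lift\<close>: it fails for \<open>K_circ\<close>, whose Frobenius fixes the roots
  p^(1/p^m).\<close>

definition falg :: "('r::comm_ring_1 \<Rightarrow> 'r) \<Rightarrow> ('r, 'a, 'm) frob_alg_scheme \<Rightarrow> bool" where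
  "falg \<phi> A \<longleftrightarrow> cring A \<and> emb A \<in> ring_hom ring_of_type_algebra A \<and> frob A \<in> ring_hom A A \<and>
     (\<forall>r. frob A (emb A r) = emb A (\<phi> r))"

definition falg_hom :: "('r, 'a, 'm) frob_alg_scheme \<Rightarrow> ('r, 'b, 'n) frob_alg_scheme
    \<Rightarrow> ('a \<Rightarrow> 'b) set" where
  "falg_hom A B = {f. f \<in> ring_hom A B \<and> (\<forall>r. f (emb A r) = emb B r) \<and>
     (\<forall>a\<in>carrier A. f (frob A a) = frob B (f a))}"

lemma carrier_type_algebra [simp]: "carrier ring_of_type_algebra = UNIV"
  by (simp add: ring_of_type_algebra_def)

lemma falgD:
  assumes "falg \<phi> A"
  shows "cring A" "emb A \<in> ring_hom ring_of_type_algebra A" "frob A \<in> ring_hom A A"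
    "frob A (emb A r) = emb A (\<phi> r)" "emb A r \<in> carrier A" "a \<in> carrier A \<Longrightarrow> frob A a \<in> carrier A"
  using assms ring_hom_closed[of "emb A" ring_of_type_algebra A r]
    ring_hom_closed[of "frob A" A A a] by (auto simp: falg_def)

lemma falg_homD:
  assumes "f \<in> falg_hom A B"
  shows "f \<in> ring_hom A B" "f \<in> add_hom A B" "f (emb A r) = emb B r"
    "a \<in> carrier A \<Longrightarrow> f (frob A a) = frob B (f a)" "a \<in> carrier A \<Longrightarrow> f a \<in> carrier B"
  using assms ring_hom_closed[of f A B a] ring_hom_add_hom[of f A B] by (auto simp: falg_hom_def)

lemma pcompl_alg_simps [simp]:
  "emb (pcompl_alg p A) = (\<lambda>r. pcompl_inj p A (emb A r))"
  "frob (pcompl_alg p A) = pcompl_map p A (frob A)"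
  by (simp_all add: pcompl_alg_def frob_alg.defs ring.defs)

lemma pcompl_alg_ops [simp]:
  "carrier (pcompl_alg p A) = carrier (pcompl p A)"
  "cring (pcompl_alg p A) = cring (pcompl p A)"
  "p_complete q (pcompl_alg p A) = p_complete q (pcompl p A)"
  "pcong q (pcompl_alg p A) = pcong q (pcompl p A)"
  "ring_hom (pcompl_alg p A) S = ring_hom (pcompl p A) S"
  "ring_hom T (pcompl_alg p A) = ring_hom T (pcompl p A)"
  "add_hom (pcompl_alg p A) S = add_hom (pcompl p A) S"
  "add_hom T (pcompl_alg p A) = add_hom T (pcompl p A)"
  "pcompl q (pcompl_alg p A) = pcompl q (pcompl p A)"
  "pcompl_inj q (pcompl_alg p A) = pcompl_inj q (pcompl p A)"
  by (simp_all add: pcompl_alg_def)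

lemma pcompl_falg:
  assumes "falg \<phi> A"
  shows "falg \<phi> (pcompl_alg p A)"
proof -
  interpret A: cring A using falgD(1)[OF assms] .
  show ?thesis
    using ring_hom_trans[OF falgD(2)[OF assms] A.pcompl_inj_hom, of p]
    by (simp add: falg_def A.pcompl_cring pcompl_map_ring_hom[OF A.is_cring A.is_cring] falgD[OF assms]
       comp_def pcompl_map_inj[OF A.is_cring A.is_cring ring_hom_add_hom])
qed

lemma pcompl_inj_falg_hom:
  assumes "falg \<phi> A"
  shows "pcompl_inj p A \<in> falg_hom A (pcompl_alg p A)"
proof -
  interpret A: cring A using falgD(1)[OF assms] .
  show ?thesis
    by (simp add: falg_hom_def A.pcompl_inj_hom falgD[OF assms]
       pcompl_map_inj[OF A.is_cring A.is_cring ring_hom_add_hom])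
qed

lemma pcompl_map_falg_hom:
  assumes A: "falg \<phi> A" and B: "falg \<phi> B" and f: "f \<in> falg_hom A B"
  shows "pcompl_map p B f \<in> falg_hom (pcompl_alg p A) (pcompl_alg p B)"
proof -
  interpret A: cring A using falgD(1)[OF A] .
  interpret B: cring B using falgD(1)[OF B] .
  interpret CB: cring "pcompl p B" by (rule B.pcompl_cring)
  have eq: "pcompl_map p B f (pcompl_map p A (frob A) a) = pcompl_map p B (frob B) (pcompl_map p B f a)"
    if "a \<in> carrier (pcompl p A)" for a
  proof (rule p_complete_hom_unique[OF A.is_cring CB.is_cring B.p_complete_pcompl _ _ _ that])
    show "(\<lambda>a. pcompl_map p B f (pcompl_map p A (frob A) a)) \<in> add_hom (pcompl p A) (pcompl p B)"
      by (intro add_hom_comp[OF pcompl_map_add_hom pcompl_map_add_hom] A.is_cring B.is_cring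
        ring_hom_add_hom falgD[OF A] falg_homD[OF f])
    show "(\<lambda>a. pcompl_map p B (frob B) (pcompl_map p B f a)) \<in> add_hom (pcompl p A) (pcompl p B)"
      by (intro add_hom_comp[OF pcompl_map_add_hom pcompl_map_add_hom] A.is_cring B.is_cring
        ring_hom_add_hom falgD[OF B] falg_homD[OF f])
  qed (simp add: pcompl_map_inj[OF A.is_cring A.is_cring ring_hom_add_hom[OF falgD(3)[OF A]]]
      pcompl_map_inj[OF B.is_cring B.is_cring ring_hom_add_hom[OF falgD(3)[OF B]]]
      pcompl_map_inj[OF A.is_cring B.is_cring falg_homD(2)[OF f]] falgD[OF A] falg_homD[OF f])
  show ?thesis
    by (simp add: falg_hom_def pcompl_map_ring_hom[OF A.is_cring B.is_cring] falg_homD[OF f]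
      pcompl_map_inj[OF A.is_cring B.is_cring falg_homD(2)[OF f]] falgD[OF A] eq)
qed

section \<open>Perfect algebras\<close>

definition perfect :: "('r, 'a, 'm) frob_alg_scheme \<Rightarrow> bool" where
  "perfect A \<longleftrightarrow> bij_betw (frob A) (carrier A) (carrier A)"

text \<open>The inverse of the Frobenius is additive and so extends to the completion; both
  composites are the identity on the image of \<open>A\<close>, hence everywhere.\<close>

lemma pcompl_perfect:
  assumes A: "falg \<phi> A" and "perfect A"
  shows "perfect (pcompl_alg p A)"
proof -
  interpret A: cring A using falgD(1)[OF A] .
  interpret C: cring "pcompl p A" by (rule A.pcompl_cring)
  let ?F = "frob A" and ?G = "inv_into (carrier A) (frob A)"
  have b: "bij_betw ?F (carrier A) (carrier A)" using assms(2) by (simp add: perfect_def)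
  have F: "?F \<in> add_hom A A" and G: "?G \<in> add_hom A A"
    using ring_hom_add_hom[OF falgD(3)[OF A]] inv_into_add_hom[OF A.is_abelian_group _ b] by auto
  note m = pcompl_map_inj[OF A.is_cring A.is_cring]
  have id: "(\<lambda>s. s) \<in> add_hom (pcompl p A) (pcompl p A)" by (auto simp: add_hom_def)
  note hF = pcompl_map_add_hom[OF A.is_cring A.is_cring F, of p]
  note hG = pcompl_map_add_hom[OF A.is_cring A.is_cring G, of p]
  note u = p_complete_hom_unique[OF A.is_cring C.is_cring A.p_complete_pcompl _ id]
  have 1: "pcompl_map p A ?G (pcompl_map p A ?F s) = s" if "s \<in> carrier (pcompl p A)" for s
    by (rule u[OF add_hom_comp[OF hF hG] _ that])
      (simp add: m[OF F] m[OF G] add_hom_closed[OF F] bij_betw_inv_into_left[OF b])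
  have 2: "pcompl_map p A ?F (pcompl_map p A ?G s) = s" if "s \<in> carrier (pcompl p A)" for s
    by (rule u[OF add_hom_comp[OF hG hF] _ that])
      (simp add: m[OF F] m[OF G] add_hom_closed[OF G] bij_betw_inv_into_right[OF b])
  show ?thesis unfolding perfect_def
    by (rule bij_betw_byWitness[of _ "pcompl_map p A ?G"])
      (auto simp: 1 2 intro: add_hom_closed[OF pcompl_map_add_hom[OF A.is_cring A.is_cring F]]
        add_hom_closed[OF pcompl_map_add_hom[OF A.is_cring A.is_cring G]])
qed

section \<open>Direct limits along the Frobenius endomorphism\<close>

lemma funpow_ring_hom: "f \<in> ring_hom A A \<Longrightarrow> f ^^ n \<in> ring_hom A A"
  by (induction n) (use id_ring_hom in \<open>auto intro: ring_hom_trans simp: id_def\<close>)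

context
  fixes \<phi> :: "'r::comm_ring_1 \<Rightarrow> 'r" and A :: "('r, 'a, 'm) frob_alg_scheme"
  assumes A: "falg \<phi> A"
begin

interpretation A: cring A using falgD(1)[OF A] .

private abbreviation "F \<equiv> frob A"

private lemma Fc [simp]: "a \<in> carrier A \<Longrightarrow> (F ^^ n) a \<in> carrier A"
  using ring_hom_closed[OF funpow_ring_hom[OF falgD(3)[OF A]]] .

private lemma Fs: "(F ^^ m) ((F ^^ n) a) = (F ^^ (m + n)) a"
  by (simp add: funpow_add)

lemma dlim_cls_eq:
  assumes "a \<in> carrier A" "b \<in> carrier A"
  shows "dlim_cls A a i = dlim_cls A b j \<longleftrightarrow> (\<exists>k. (F ^^ (j + k)) a = (F ^^ (i + k)) b)"
proof
  assume "dlim_cls A a i = dlim_cls A b j"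
  moreover have "(b, j) \<in> dlim_cls A b j" using assms by (simp add: dlim_cls_def)
  ultimately have "(b, j) \<in> dlim_cls A a i" by simp
  then show "\<exists>k. (F ^^ (j + k)) a = (F ^^ (i + k)) b" by (auto simp: dlim_cls_def)
next
  have tr: "dlim_cls A b j \<subseteq> dlim_cls A a i"
    if ex: "\<exists>k. (F ^^ (j + k)) a = (F ^^ (i + k)) b" for a b i j
  proof
    fix x assume "x \<in> dlim_cls A b j"
    then obtain c l m where x: "x = (c, l)" "c \<in> carrier A" "(F ^^ (l + m)) b = (F ^^ (j + m)) c"
      by (auto simp: dlim_cls_def)
    obtain k where k: "(F ^^ (j + k)) a = (F ^^ (i + k)) b" using ex by blast
    have "(F ^^ (l + (j + k + m))) a = (F ^^ (l + m)) ((F ^^ (j + k)) a)" by (simp add: Fs ac_simps)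
    also have "\<dots> = (F ^^ (i + k)) ((F ^^ (l + m)) b)" by (simp add: k Fs ac_simps)
    also have "\<dots> = (F ^^ (i + (j + k + m))) c" by (simp add: x Fs ac_simps)
    finally show "x \<in> dlim_cls A a i" using x by (auto simp: dlim_cls_def)
  qed
  assume *: "\<exists>k. (F ^^ (j + k)) a = (F ^^ (i + k)) b"
  then have "\<exists>k. (F ^^ (i + k)) b = (F ^^ (j + k)) a" by metis
  with * show "dlim_cls A a i = dlim_cls A b j" using tr by (meson subset_antisym)
qed

lemma dlim_cls_shift: "a \<in> carrier A \<Longrightarrow> dlim_cls A ((F ^^ k) a) (i + k) = dlim_cls A a i"
  by (subst dlim_cls_eq) (auto simp: Fs ac_simps)

lemma dlim_cls_self: "a \<in> carrier A \<Longrightarrow> (a, i) \<in> dlim_cls A a i"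
  by (simp add: dlim_cls_def)

lemma carrier_dlim: "carrier (dlim A) = {dlim_cls A a i | a i. a \<in> carrier A}"
  by (simp add: dlim_def)

lemma dlim_cls_closed [simp]: "a \<in> carrier A \<Longrightarrow> dlim_cls A a i \<in> carrier (dlim A)"
  by (auto simp: carrier_dlim)

text \<open>Common argument for sum and product: for an operation that commutes with the Frobenius,
  all pairs of representatives give the same class, so the double union in \<open>dlim\<close> is a
  single class.\<close>

private lemma cls_op:
  assumes opc: "\<And>x y. x \<in> carrier A \<Longrightarrow> y \<in> carrier A \<Longrightarrow> f x y \<in> carrier A"
    and opF: "\<And>x y k. x \<in> carrier A \<Longrightarrow> y \<in> carrier A \<Longrightarrow> (F ^^ k) (f x y) = f ((F ^^ k) x) ((F ^^ k) y)"
    and ab: "a \<in> carrier A" "b \<in> carrier A"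
  shows "(\<Union>(a, l)\<in>dlim_cls A a i. \<Union>(b, j)\<in>dlim_cls A b i.
      dlim_cls A (f ((F ^^ j) a) ((F ^^ l) b)) (l + j)) = dlim_cls A (f a b) i"
proof -
  have *: "dlim_cls A (f ((F ^^ j') a') ((F ^^ i') b')) (i' + j') = dlim_cls A (f a b) i"
    if a': "(a', i') \<in> dlim_cls A a i" and b': "(b', j') \<in> dlim_cls A b i" for a' i' b' j'
  proof -
    obtain m where m: "a' \<in> carrier A" "(F ^^ (i' + m)) a = (F ^^ (i + m)) a'" using a' by (auto simp: dlim_cls_def)
    obtain n where n: "b' \<in> carrier A" "(F ^^ (j' + n)) b = (F ^^ (i + n)) b'" using b' by (auto simp: dlim_cls_def)
    have "(F ^^ (i + (m + n))) ((F ^^ j') a') = (F ^^ (n + j')) ((F ^^ (i + m)) a')"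
      by (simp add: Fs ac_simps)
    also have "\<dots> = (F ^^ (i' + j' + (m + n))) a" by (simp add: m(2)[symmetric] Fs ac_simps)
    finally have 1: "(F ^^ (i + (m + n))) ((F ^^ j') a') = (F ^^ (i' + j' + (m + n))) a" .
    have "(F ^^ (i + (m + n))) ((F ^^ i') b') = (F ^^ (m + i')) ((F ^^ (i + n)) b')"
      by (simp add: Fs ac_simps)
    also have "\<dots> = (F ^^ (i' + j' + (m + n))) b" by (simp add: n(2)[symmetric] Fs ac_simps)
    finally have 2: "(F ^^ (i + (m + n))) ((F ^^ i') b') = (F ^^ (i' + j' + (m + n))) b" .
    show ?thesis
      by (subst dlim_cls_eq) (auto simp: m n ab opc opF 1 2 intro!: exI[of _ "m + n"])
  qed
  show ?thesis
    apply (rule SUP_eq_const)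
    subgoal using dlim_cls_self[OF ab(1)] by blast
    apply clarsimp
    apply (rule SUP_eq_const)
    subgoal using dlim_cls_self[OF ab(2)] by blast
    by (clarsimp simp: *)
qed

lemma dlim_add [simp]: "a \<in> carrier A \<Longrightarrow> b \<in> carrier A \<Longrightarrow>
    dlim_cls A a i \<oplus>\<^bsub>dlim A\<^esub> dlim_cls A b i = dlim_cls A (a \<oplus>\<^bsub>A\<^esub> b) i"
  unfolding dlim_def using cls_op[of "ring.add A" a b i] ring_hom_add[OF funpow_ring_hom[OF falgD(3)[OF A]]]
  by simp

lemma dlim_mult [simp]: "a \<in> carrier A \<Longrightarrow> b \<in> carrier A \<Longrightarrow>
    dlim_cls A a i \<otimes>\<^bsub>dlim A\<^esub> dlim_cls A b i = dlim_cls A (a \<otimes>\<^bsub>A\<^esub> b) i"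
  unfolding dlim_def using cls_op[of "monoid.mult A" a b i] ring_hom_mult[OF funpow_ring_hom[OF falgD(3)[OF A]]]
  by simp

lemma dlim_one: "\<one>\<^bsub>dlim A\<^esub> = dlim_cls A \<one>\<^bsub>A\<^esub> i"
  using ring_hom_one[OF funpow_ring_hom[OF falgD(3)[OF A]]] dlim_cls_shift[of "\<one>\<^bsub>A\<^esub>" i 0]
  by (simp add: dlim_def)

lemma dlim_zero: "\<zero>\<^bsub>dlim A\<^esub> = dlim_cls A \<zero>\<^bsub>A\<^esub> i"
  using ring_hom_zero[OF funpow_ring_hom[OF falgD(3)[OF A]] A.ring_axioms A.ring_axioms] dlim_cls_shift[of "\<zero>\<^bsub>A\<^esub>" i 0]
  by (simp add: dlim_def)

lemma dlim_frob [simp]: "a \<in> carrier A \<Longrightarrow> frob (dlim A) (dlim_cls A a i) = dlim_cls A (F a) i"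
proof -
  assume a: "a \<in> carrier A"
  have "dlim_cls A (F b) j = dlim_cls A (F a) i" if bj: "(b, j) \<in> dlim_cls A a i" for b j
  proof -
    obtain k where k: "b \<in> carrier A" "(F ^^ (j + k)) a = (F ^^ (i + k)) b" using bj by (auto simp: dlim_cls_def)
    have "(F ^^ (i + k)) (F b) = (F ^^ (j + k)) (F a)"
      using k(2) by (metis funpow_swap1)
    then show ?thesis using k(1) a falgD(6)[OF A] dlim_cls_eq[of "F b" "F a" j i] by blast
  qed
  note eq = this
  have "(\<Union>(b, j)\<in>dlim_cls A a i. dlim_cls A (F b) j) = dlim_cls A (F a) i"
  proof (rule SUP_eq_const)
    show "dlim_cls A a i \<noteq> {}" using dlim_cls_self[OF a] by blast
    show "(case x of (b, j) \<Rightarrow> dlim_cls A (F b) j) = dlim_cls A (F a) i" if "x \<in> dlim_cls A a i" for x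
      using eq[of "fst x" "snd x"] that by (simp add: case_prod_beta)
  qed
  then show ?thesis by (simp add: dlim_def)
qed

text \<open>The Frobenius undoes a shift of the stage. Surjectivity of the Frobenius on the limit
  and the inductions on the stage come from this.\<close>

lemma dlim_frob_Suc: "a \<in> carrier A \<Longrightarrow> frob (dlim A) (dlim_cls A a (Suc i)) = dlim_cls A a i"
  using dlim_cls_shift[of a 1 i] by simp

lemma dlim_emb [simp]: "emb (dlim A) = (\<lambda>r. dlim_cls A (emb A r) 0)"
  by (simp add: dlim_def)

text \<open>Any two elements can be moved to a common stage, where \<open>dlim_add\<close> and
  \<open>dlim_mult\<close> apply.\<close>

lemma dlim_common2:
  assumes "u \<in> carrier (dlim A)" "v \<in> carrier (dlim A)"
  obtains a b i where "a \<in> carrier A" "b \<in> carrier A" "u = dlim_cls A a i" "v = dlim_cls A b i"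
proof -
  obtain a i b j where ab: "a \<in> carrier A" "b \<in> carrier A" "u = dlim_cls A a i" "v = dlim_cls A b j"
    using assms by (auto simp: carrier_dlim)
  show ?thesis
    by (rule that[of "(F ^^ j) a" "(F ^^ i) b" "i + j"])
      (use ab dlim_cls_shift[of a j i] dlim_cls_shift[of b i j] in \<open>auto simp: add.commute\<close>)
qed

lemma dlim_common3:
  assumes "u \<in> carrier (dlim A)" "v \<in> carrier (dlim A)" "w \<in> carrier (dlim A)"
  obtains a b c i where "a \<in> carrier A" "b \<in> carrier A" "c \<in> carrier A"
    "u = dlim_cls A a i" "v = dlim_cls A b i" "w = dlim_cls A c i"
proof -
  obtain a b i where ab: "a \<in> carrier A" "b \<in> carrier A" "u = dlim_cls A a i" "v = dlim_cls A b i"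
    using dlim_common2[OF assms(1,2)] .
  obtain c j where c: "c \<in> carrier A" "w = dlim_cls A c j"
    using assms by (auto simp: carrier_dlim)
  show ?thesis
    by (rule that[of "(F ^^ j) a" "(F ^^ j) b" "(F ^^ i) c" "i + j"])
      (use ab c dlim_cls_shift[of a j i] dlim_cls_shift[of b j i] dlim_cls_shift[of c i j]
        in \<open>auto simp: add.commute\<close>)
qed

lemma dlim_cring: "cring (dlim A)"
proof (intro cringI abelian_groupI comm_monoidI)
  fix u v w assume uvw: "u \<in> carrier (dlim A)" "v \<in> carrier (dlim A)" "w \<in> carrier (dlim A)"
  obtain a b c i where *: "a \<in> carrier A" "b \<in> carrier A" "c \<in> carrier A"
    "u = dlim_cls A a i" "v = dlim_cls A b i" "w = dlim_cls A c i"
    using dlim_common3[OF uvw] .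
  show "(u \<oplus>\<^bsub>dlim A\<^esub> v) \<oplus>\<^bsub>dlim A\<^esub> w = u \<oplus>\<^bsub>dlim A\<^esub> (v \<oplus>\<^bsub>dlim A\<^esub> w)"
    "(u \<otimes>\<^bsub>dlim A\<^esub> v) \<otimes>\<^bsub>dlim A\<^esub> w = u \<otimes>\<^bsub>dlim A\<^esub> (v \<otimes>\<^bsub>dlim A\<^esub> w)"
    "(u \<oplus>\<^bsub>dlim A\<^esub> v) \<otimes>\<^bsub>dlim A\<^esub> w = u \<otimes>\<^bsub>dlim A\<^esub> w \<oplus>\<^bsub>dlim A\<^esub> v \<otimes>\<^bsub>dlim A\<^esub> w"
    using * by (simp_all add: A.a_assoc A.m_assoc A.l_distr)
next
  fix u v assume uv: "u \<in> carrier (dlim A)" "v \<in> carrier (dlim A)"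
  obtain a b i where *: "a \<in> carrier A" "b \<in> carrier A" "u = dlim_cls A a i" "v = dlim_cls A b i"
    using dlim_common2[OF uv] .
  show "u \<oplus>\<^bsub>dlim A\<^esub> v \<in> carrier (dlim A)" "u \<otimes>\<^bsub>dlim A\<^esub> v \<in> carrier (dlim A)"
    "u \<oplus>\<^bsub>dlim A\<^esub> v = v \<oplus>\<^bsub>dlim A\<^esub> u" "u \<otimes>\<^bsub>dlim A\<^esub> v = v \<otimes>\<^bsub>dlim A\<^esub> u"
    using * by (simp_all add: A.a_comm A.m_comm)
next
  show "\<zero>\<^bsub>dlim A\<^esub> \<in> carrier (dlim A)" "\<one>\<^bsub>dlim A\<^esub> \<in> carrier (dlim A)"
    by (simp_all add: dlim_zero[of 0] dlim_one[of 0])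
next
  fix u assume "u \<in> carrier (dlim A)"
  then obtain a i where a: "a \<in> carrier A" "u = dlim_cls A a i" by (auto simp: carrier_dlim)
  then show "\<zero>\<^bsub>dlim A\<^esub> \<oplus>\<^bsub>dlim A\<^esub> u = u" "\<one>\<^bsub>dlim A\<^esub> \<otimes>\<^bsub>dlim A\<^esub> u = u"
    by (simp_all add: dlim_zero[of i] dlim_one[of i])
  show "\<exists>y\<in>carrier (dlim A). y \<oplus>\<^bsub>dlim A\<^esub> u = \<zero>\<^bsub>dlim A\<^esub>"
    using a by (intro bexI[of _ "dlim_cls A (\<ominus>\<^bsub>A\<^esub> a) i"]) (auto simp: dlim_zero[of i] A.l_neg)
qed

lemma dlim_cls_hom: "(\<lambda>a. dlim_cls A a i) \<in> ring_hom A (dlim A)"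
  by (rule ring_hom_memI) (simp_all add: dlim_one[of i])

lemma dlim_falg: "falg \<phi> (dlim A)"
proof -
  have "frob (dlim A) \<in> ring_hom (dlim A) (dlim A)"
  proof (rule ring_hom_memI)
    fix u v assume uv: "u \<in> carrier (dlim A)" "v \<in> carrier (dlim A)"
    obtain a b i where *: "a \<in> carrier A" "b \<in> carrier A" "u = dlim_cls A a i" "v = dlim_cls A b i"
      using dlim_common2[OF uv] .
    then show "frob (dlim A) (u \<otimes>\<^bsub>dlim A\<^esub> v) = frob (dlim A) u \<otimes>\<^bsub>dlim A\<^esub> frob (dlim A) v"
      "frob (dlim A) (u \<oplus>\<^bsub>dlim A\<^esub> v) = frob (dlim A) u \<oplus>\<^bsub>dlim A\<^esub> frob (dlim A) v"
      by (simp_all add: ring_hom_mult[OF falgD(3)[OF A]] ring_hom_add[OF falgD(3)[OF A]] falgD(6)[OF A])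
  next
    fix u assume "u \<in> carrier (dlim A)"
    then obtain a i where "a \<in> carrier A" "u = dlim_cls A a i" by (auto simp: carrier_dlim)
    then show "frob (dlim A) u \<in> carrier (dlim A)" by (simp add: falgD(6)[OF A])
  qed (simp add: dlim_one[of 0] ring_hom_one[OF falgD(3)[OF A]])
  moreover have "(\<lambda>r. emb (dlim A) r) \<in> ring_hom ring_of_type_algebra (dlim A)"
    using ring_hom_trans[OF falgD(2)[OF A] dlim_cls_hom[of 0]] by (simp add: comp_def)
  ultimately show ?thesis by (simp add: falg_def dlim_cring falgD[OF A])
qed

lemma dlim_perfect: "perfect (dlim A)"
  unfolding perfect_def bij_betw_def
proof
  show "inj_on (frob (dlim A)) (carrier (dlim A))"
  proof
    fix u v assume uv: "u \<in> carrier (dlim A)" "v \<in> carrier (dlim A)" "frob (dlim A) u = frob (dlim A) v"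
    obtain a b i where *: "a \<in> carrier A" "b \<in> carrier A" "u = dlim_cls A a i" "v = dlim_cls A b i"
      using dlim_common2[OF uv(1,2)] .
    obtain k where "(F ^^ (i + k)) (F a) = (F ^^ (i + k)) (F b)"
      using uv(3) * falgD(6)[OF A] by (auto simp: dlim_cls_eq)
    then have "(F ^^ (i + Suc k)) a = (F ^^ (i + Suc k)) b"
      by (metis add_Suc_right funpow_Suc_right o_apply)
    then show "u = v" using dlim_cls_eq[OF *(1,2), of i i] *(3,4) by blast
  qed
  show "frob (dlim A) ` carrier (dlim A) = carrier (dlim A)"
  proof
    show "frob (dlim A) ` carrier (dlim A) \<subseteq> carrier (dlim A)"
      using falgD(6)[OF dlim_falg] by blast
    show "carrier (dlim A) \<subseteq> frob (dlim A) ` carrier (dlim A)"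
    proof
      fix u assume "u \<in> carrier (dlim A)"
      then obtain a i where a: "a \<in> carrier A" "u = dlim_cls A a i" by (auto simp: carrier_dlim)
      then show "u \<in> frob (dlim A) ` carrier (dlim A)"
        by (intro image_eqI[where x = "dlim_cls A a (Suc i)"]) (simp_all add: dlim_frob_Suc del: dlim_frob)
    qed
  qed
qed

lemma dlim_pcong: "pcong p A n a b \<Longrightarrow> b \<in> carrier A \<Longrightarrow> pcong p (dlim A) n (dlim_cls A a i) (dlim_cls A b i)"
  by (rule add_hom_pcong[OF A.ring_axioms cring.axioms(1)[OF dlim_cring] ring_hom_add_hom[OF dlim_cls_hom]])

text \<open>Agreement at stage i passes to stage i+1, because the Frobenius of the limit leads from
  stage i+1 back to stage i and that of the target is injective.\<close>

lemma dlim_hom_unique: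
  fixes T :: "('s, 't, 'n) frob_alg_scheme"
  assumes T: "inj_on (frob T) (carrier T)"
    and G: "G \<in> carrier (dlim A) \<rightarrow> carrier T" "\<And>u. u \<in> carrier (dlim A) \<Longrightarrow> G (frob (dlim A) u) = frob T (G u)"
    and H: "H \<in> carrier (dlim A) \<rightarrow> carrier T" "\<And>u. u \<in> carrier (dlim A) \<Longrightarrow> H (frob (dlim A) u) = frob T (H u)"
    and eq: "\<And>a. a \<in> carrier A \<Longrightarrow> G (dlim_cls A a 0) = H (dlim_cls A a 0)"
    and u: "u \<in> carrier (dlim A)"
  shows "G u = H u"
proof -
  obtain a i where a: "a \<in> carrier A" "u = dlim_cls A a i" using u by (auto simp: carrier_dlim)
  have "G (dlim_cls A a i) = H (dlim_cls A a i)"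
  proof (induction i)
    case (Suc i)
    have "frob T (G (dlim_cls A a (Suc i))) = frob T (H (dlim_cls A a (Suc i)))"
      using Suc a by (simp add: G(2)[symmetric] H(2)[symmetric] dlim_frob_Suc del: dlim_frob)
    moreover have "G (dlim_cls A a (Suc i)) \<in> carrier T" "H (dlim_cls A a (Suc i)) \<in> carrier T"
      using G(1) H(1) dlim_cls_closed[OF a(1)] by blast+
    ultimately show ?case using T by (simp add: inj_on_def)
  qed (use a eq in auto)
  then show ?thesis using a by simp
qed

end

text \<open>The extension of \<open>h\<close> to the limit: the class of \<open>a\<close> at stage i
  goes to the element whose i-th Frobenius iterate is \<open>h a\<close>. The description covers all
  representatives at once; they give the same element when \<open>T\<close> is perfect.\<close>

definition dext :: "('s, 't, 'n) frob_alg_scheme \<Rightarrow> ('a \<Rightarrow> 't) \<Rightarrow> ('a \<times> nat) set \<Rightarrow> 't" where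
  "dext T h u = (THE y. y \<in> carrier T \<and> (\<exists>(a, i)\<in>u. (frob T ^^ i) y = h a))"

lemma dext:
  fixes A :: "('r::comm_ring_1, 'a, 'm) frob_alg_scheme"
  assumes A: "falg \<phi> A" and T: "cring T" "frob T \<in> ring_hom T T" "perfect T"
    and h: "h \<in> add_hom A T" "\<And>a. a \<in> carrier A \<Longrightarrow> h (frob A a) = frob T (h a)"
  shows "dext T h \<in> add_hom (dlim A) T"
    and "\<And>a i. a \<in> carrier A \<Longrightarrow> (frob T ^^ i) (dext T h (dlim_cls A a i)) = h a"
    and "\<And>u. u \<in> carrier (dlim A) \<Longrightarrow> dext T h (frob (dlim A) u) = frob T (dext T h u)"
    and "h \<in> ring_hom A T \<Longrightarrow> dext T h \<in> ring_hom (dlim A) T"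
proof -
  interpret A: cring A using falgD(1)[OF A] .
  interpret T: cring T by fact
  let ?G = "frob T" and ?F = "frob A"
  have bij: "bij_betw (?G ^^ i) (carrier T) (carrier T)" for i
    using T(3) by (auto simp: perfect_def intro: bij_betw_funpow)
  have hF: "h ((?F ^^ k) a) = (?G ^^ k) (h a)" if "a \<in> carrier A" for k a
    by (induction k) (use that h ring_hom_closed[OF funpow_ring_hom[OF falgD(3)[OF A]]] in auto)
  note hc = add_hom_closed[OF h(1)]
  have GG: "(?G ^^ m) ((?G ^^ n) x) = (?G ^^ (m + n)) x" for m n x by (simp add: funpow_add)
  have key: "dext T h (dlim_cls A a i) \<in> carrier T \<and> (?G ^^ i) (dext T h (dlim_cls A a i)) = h a"
    and uni: "\<And>y. y \<in> carrier T \<Longrightarrow> (?G ^^ i) y = h a \<Longrightarrow> dext T h (dlim_cls A a i) = y"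
    if a: "a \<in> carrier A" for a i
  proof -
    obtain y where y: "y \<in> carrier T" "(?G ^^ i) y = h a"
      using bij[of i] hc[OF a] by (metis (no_types, lifting) bij_betw_iff_bijections)
    have *: "z = y" if z: "z \<in> carrier T" "(b, j) \<in> dlim_cls A a i" "(?G ^^ j) z = h b" for z b j
    proof -
      obtain k where k: "b \<in> carrier A" "(?F ^^ (j + k)) a = (?F ^^ (i + k)) b"
        using z(2) by (auto simp: dlim_cls_def)
      have "(?G ^^ (i + j + k)) z = (?G ^^ (i + k)) (h b)"
        by (simp add: z(3)[symmetric] GG ac_simps)
      also have "\<dots> = (?G ^^ (j + k)) (h a)" using k a by (simp flip: hF)
      also have "\<dots> = (?G ^^ (i + j + k)) y"
        by (simp add: y(2)[symmetric] GG ac_simps)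
      finally show "z = y" using bij[of "i + j + k"] y(1) z by (auto simp: bij_betw_def inj_on_def)
    qed
    have **: "dext T h (dlim_cls A a i) = y"
      unfolding dext_def using y dlim_cls_self[OF A a, of i] *
      by (intro the_equality) blast+
    then show "dext T h (dlim_cls A a i) \<in> carrier T \<and> (?G ^^ i) (dext T h (dlim_cls A a i)) = h a"
      using y by simp
    fix z assume "z \<in> carrier T" "(?G ^^ i) z = h a"
    then show "dext T h (dlim_cls A a i) = z" using * ** dlim_cls_self[OF A a, of i] by blast
  qed
  show "(frob T ^^ i) (dext T h (dlim_cls A a i)) = h a" if "a \<in> carrier A" for a i
    using key[OF that] by blast
  have Gi: "?G ^^ i \<in> ring_hom T T" for i by (rule funpow_ring_hom[OF T(2)])
  show ah: "dext T h \<in> add_hom (dlim A) T"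
  proof (rule add_homI)
    fix u v assume uv: "u \<in> carrier (dlim A)" "v \<in> carrier (dlim A)"
    obtain a b i where *: "a \<in> carrier A" "b \<in> carrier A" "u = dlim_cls A a i" "v = dlim_cls A b i"
      using dlim_common2[OF A uv] .
    have "dext T h (dlim_cls A (a \<oplus>\<^bsub>A\<^esub> b) i) = dext T h u \<oplus>\<^bsub>T\<^esub> dext T h v"
      by (rule uni) (use * key in \<open>auto simp: ring_hom_add[OF Gi] add_hom_add[OF h(1)]\<close>)
    then show "dext T h (u \<oplus>\<^bsub>dlim A\<^esub> v) = dext T h u \<oplus>\<^bsub>T\<^esub> dext T h v"
      using * by (simp add: dlim_add[OF A])
  qed (use key in \<open>auto simp: carrier_dlim[OF A]\<close>)
  show "dext T h (frob (dlim A) u) = frob T (dext T h u)" if u: "u \<in> carrier (dlim A)" for u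
  proof -
    obtain a i where a: "a \<in> carrier A" "u = dlim_cls A a i" using u by (auto simp: carrier_dlim[OF A])
    have "dext T h (dlim_cls A (frob A a) i) = frob T (dext T h u)"
      by (rule uni) (use a key h falgD(6)[OF A] ring_hom_closed[OF T(2)] in \<open>auto simp: funpow_swap1[symmetric]\<close>)
    then show ?thesis using a by (simp add: dlim_frob[OF A])
  qed
  show "dext T h \<in> ring_hom (dlim A) T" if r: "h \<in> ring_hom A T"
  proof (rule ring_hom_memI)
    fix u v assume uv: "u \<in> carrier (dlim A)" "v \<in> carrier (dlim A)"
    obtain a b i where *: "a \<in> carrier A" "b \<in> carrier A" "u = dlim_cls A a i" "v = dlim_cls A b i"
      using dlim_common2[OF A uv] .
    have "dext T h (dlim_cls A (a \<otimes>\<^bsub>A\<^esub> b) i) = dext T h u \<otimes>\<^bsub>T\<^esub> dext T h v"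
      by (rule uni) (use * key in \<open>auto simp: ring_hom_mult[OF Gi] ring_hom_mult[OF r]\<close>)
    then show "dext T h (u \<otimes>\<^bsub>dlim A\<^esub> v) = dext T h u \<otimes>\<^bsub>T\<^esub> dext T h v"
      using * by (simp add: dlim_mult[OF A])
    show "dext T h (u \<oplus>\<^bsub>dlim A\<^esub> v) = dext T h u \<oplus>\<^bsub>T\<^esub> dext T h v" using add_hom_add[OF ah uv] .
  next
    show "dext T h \<one>\<^bsub>dlim A\<^esub> = \<one>\<^bsub>T\<^esub>"
      unfolding dlim_one[OF A, of 0] by (rule uni) (auto simp: ring_hom_one[OF r])
  qed (use add_hom_closed[OF ah] in auto)
qed

text \<open>Commutation of \<open>f\<close> with the Frobenius carries the relation between two
  representatives over to \<open>B\<close>, so the union in \<open>dlim_map\<close> is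
  constant.\<close>

lemma dlim_map_cls:
  fixes A :: "('r::comm_ring_1, 'a, 'm) frob_alg_scheme" and B :: "('r, 'b, 'n) frob_alg_scheme"
  assumes A: "falg \<phi> A" and B: "falg \<phi> B" and f: "f \<in> falg_hom A B" and a: "a \<in> carrier A"
  shows "dlim_map B f (dlim_cls A a i) = dlim_cls B (f a) i"
proof -
  have fF: "f ((frob A ^^ k) a) = (frob B ^^ k) (f a)" if "a \<in> carrier A" for k a
    by (induction k) (use that falg_homD[OF f] ring_hom_closed[OF funpow_ring_hom[OF falgD(3)[OF A]]] in auto)
  have "dlim_cls B (f b) j = dlim_cls B (f a) i" if bj: "(b, j) \<in> dlim_cls A a i" for b j
  proof -
    obtain k where k: "b \<in> carrier A" "(frob A ^^ (j + k)) a = (frob A ^^ (i + k)) b"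
      using bj by (auto simp: dlim_cls_def)
    then have "(frob B ^^ (j + k)) (f a) = (frob B ^^ (i + k)) (f b)"
      using a by (metis fF)
    then show ?thesis using k(1) a dlim_cls_eq[OF B, of "f b" "f a" j i] falg_homD(5)[OF f] by metis
  qed
  note eq = this
  have "(\<Union>(b, j)\<in>dlim_cls A a i. dlim_cls B (f b) j) = dlim_cls B (f a) i"
  proof (rule SUP_eq_const)
    show "dlim_cls A a i \<noteq> {}" using dlim_cls_self[OF A a] by blast
    show "(case x of (b, j) \<Rightarrow> dlim_cls B (f b) j) = dlim_cls B (f a) i" if "x \<in> dlim_cls A a i" for x
      using eq[of "fst x" "snd x"] that by (simp add: case_prod_beta)
  qed
  then show ?thesis by (simp add: dlim_map_def)
qed

lemma dlim_map_falg_hom: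
  fixes A :: "('r::comm_ring_1, 'a, 'm) frob_alg_scheme" and B :: "('r, 'b, 'n) frob_alg_scheme"
  assumes A: "falg \<phi> A" and B: "falg \<phi> B" and f: "f \<in> falg_hom A B"
  shows "dlim_map B f \<in> falg_hom (dlim A) (dlim B)"
proof -
  note m = dlim_map_cls[OF A B f]
  note fc = falg_homD(5)[OF f]
  interpret A: cring A using falgD(1)[OF A] .
  have "dlim_map B f \<in> ring_hom (dlim A) (dlim B)"
  proof (rule ring_hom_memI)
    fix u v assume uv: "u \<in> carrier (dlim A)" "v \<in> carrier (dlim A)"
    obtain a b i where *: "a \<in> carrier A" "b \<in> carrier A" "u = dlim_cls A a i" "v = dlim_cls A b i"
      using dlim_common2[OF A uv] .
    then show "dlim_map B f (u \<otimes>\<^bsub>dlim A\<^esub> v) = dlim_map B f u \<otimes>\<^bsub>dlim B\<^esub> dlim_map B f v"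
      "dlim_map B f (u \<oplus>\<^bsub>dlim A\<^esub> v) = dlim_map B f u \<oplus>\<^bsub>dlim B\<^esub> dlim_map B f v"
      by (simp_all add: dlim_mult[OF A] dlim_mult[OF B] dlim_add[OF A] dlim_add[OF B] m fc
        ring_hom_mult[OF falg_homD(1)[OF f]] ring_hom_add[OF falg_homD(1)[OF f]])
  next
    fix u assume "u \<in> carrier (dlim A)"
    then obtain a i where "a \<in> carrier A" "u = dlim_cls A a i" by (auto simp: carrier_dlim[OF A])
    then show "dlim_map B f u \<in> carrier (dlim B)" by (simp add: m fc dlim_cls_closed[OF B])
  qed (simp add: m dlim_one[OF A, of 0] dlim_one[OF B, of 0] ring_hom_one[OF falg_homD(1)[OF f]])
  note 1 = this
  have 2: "dlim_map B f (frob (dlim A) u) = frob (dlim B) (dlim_map B f u)"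
    if u: "u \<in> carrier (dlim A)" for u
  proof -
    obtain a i where a: "a \<in> carrier A" "u = dlim_cls A a i" using u by (auto simp: carrier_dlim[OF A])
    have "dlim_map B f (frob (dlim A) u) = dlim_cls B (f (frob A a)) i"
      using a(1) unfolding a(2) by (simp only: dlim_frob[OF A] m falgD(6)[OF A])
    also have "\<dots> = frob (dlim B) (dlim_map B f u)"
      using a(1) unfolding a(2) by (simp only: dlim_frob[OF B] m fc falg_homD(4)[OF f])
    finally show ?thesis .
  qed
  have 3: "dlim_map B f (emb (dlim A) r) = emb (dlim B) r" for r
    by (simp only: dlim_emb[OF A] dlim_emb[OF B] m[OF falgD(5)[OF A]] falg_homD(3)[OF f])
  show ?thesis unfolding falg_hom_def using 1 2 3 by blast
qed

section \<open>Maps between quotients\<close>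

lemma quot_carrier: "carrier (R Quot I) = {I +>\<^bsub>R\<^esub> x | x. x \<in> carrier R}"
  by (auto simp: FactRing_def A_RCOSETS_def')

lemma (in ring) coset_eq_iff:
  "ideal I R \<Longrightarrow> a \<in> carrier R \<Longrightarrow> b \<in> carrier R \<Longrightarrow> I +> a = I +> b \<longleftrightarrow> a \<ominus> b \<in> I"
  using quotient_eq_iff_same_a_r_cos by blast

lemma (in ring) coset_memD:
  assumes "ideal I R" "x \<in> I +> a" "a \<in> carrier R"
  shows "x \<in> carrier R" "I +> x = I +> a"
proof -
  obtain h where h: "h \<in> I" "x = h \<oplus> a" using assms(2) by (auto simp: a_r_coset_def')
  have hc: "h \<in> carrier R" using h(1) assms(1) by (rule ideal.Icarr[rotated])
  show x: "x \<in> carrier R" using h hc assms(3) by simp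
  have "x \<ominus> a = h" using h hc assms(3) by (subst minus_eq_iff) (auto simp: a_comm)
  then show "I +> x = I +> a" using coset_eq_iff[OF assms(1) x assms(3)] h(1) by simp
qed

lemma (in ring) coset_self: "ideal I R \<Longrightarrow> a \<in> carrier R \<Longrightarrow> a \<in> I +> a"
  using additive_subgroup.zero_closed[OF ideal.axioms(1), of I R] by (force simp: a_r_coset_def')

text \<open>Shows that the maps on quotients that are written as unions over representatives are
  well defined.\<close>

lemma quot_map:
  assumes "ring V" "ring W" "ideal I V" "ideal J W" "e \<in> add_hom V W" "e ` I \<subseteq> J" "c \<in> carrier V"
  shows "(\<Union>d\<in>a_r_coset V I c. a_r_coset W J (e d)) = a_r_coset W J (e c)"
proof (rule SUP_eq_const)
  interpret V: ring V by fact
  interpret W: ring W by fact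
  show "I +>\<^bsub>V\<^esub> c \<noteq> {}" using V.coset_self[OF assms(3,7)] by blast
  fix d assume d: "d \<in> I +>\<^bsub>V\<^esub> c"
  note d' = V.coset_memD[OF assms(3) d assms(7)]
  have "e (d \<ominus>\<^bsub>V\<^esub> c) \<in> J" using d'(2) V.coset_eq_iff[OF assms(3) d'(1) assms(7)] assms(6) by blast
  then show "J +>\<^bsub>W\<^esub> e d = J +>\<^bsub>W\<^esub> e c"
    using add_hom_diff[OF V.is_abelian_group W.is_abelian_group assms(5) d'(1) assms(7)]
      W.coset_eq_iff[OF assms(4)] add_hom_closed[OF assms(5)] d'(1) assms(7) by simp
qed

section \<open>Tensor products\<close>

lemma frag_extend_add2: "frag_extend (\<lambda>x. f x + g x) c = frag_extend f c + frag_extend g c"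
  by (simp add: frag_extend_def frag_cmul_distrib2 sum.distrib)

lemma frag_extend_diff2: "frag_extend (\<lambda>x. f x - g x) c = frag_extend f c - frag_extend g c"
proof -
  have "frag_extend (\<lambda>x. (f x - g x) + g x) c = frag_extend (\<lambda>x. f x - g x) c + frag_extend g c"
    by (rule frag_extend_add2)
  then show ?thesis by simp
qed

lemma frag_extend_zero2: "frag_extend (\<lambda>x. 0) c = 0"
  by (simp add: frag_extend_def)

lemma tensor_free_simps [simp]:
  "c \<in> carrier (tensor_free A B) \<longleftrightarrow> Poly_Mapping.keys c \<subseteq> carrier A \<times> carrier B"
  "c \<oplus>\<^bsub>tensor_free A B\<^esub> d = c + d" "\<zero>\<^bsub>tensor_free A B\<^esub> = 0"
  "\<one>\<^bsub>tensor_free A B\<^esub> = frag_of (\<one>\<^bsub>A\<^esub>, \<one>\<^bsub>B\<^esub>)"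
  "frag_of (a, b) \<otimes>\<^bsub>tensor_free A B\<^esub> frag_of (a', b') = frag_of (a \<otimes>\<^bsub>A\<^esub> a', b \<otimes>\<^bsub>B\<^esub> b')"
  by (simp_all add: tensor_free_def)

lemma tensor_free_mult_diff:
  "(c - c') \<otimes>\<^bsub>tensor_free A B\<^esub> d = c \<otimes>\<^bsub>tensor_free A B\<^esub> d - c' \<otimes>\<^bsub>tensor_free A B\<^esub> d"
  "c \<otimes>\<^bsub>tensor_free A B\<^esub> (d - d') = c \<otimes>\<^bsub>tensor_free A B\<^esub> d - c \<otimes>\<^bsub>tensor_free A B\<^esub> d'"
  "(c + c') \<otimes>\<^bsub>tensor_free A B\<^esub> d = c \<otimes>\<^bsub>tensor_free A B\<^esub> d + c' \<otimes>\<^bsub>tensor_free A B\<^esub> d"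
  "c \<otimes>\<^bsub>tensor_free A B\<^esub> (d + d') = c \<otimes>\<^bsub>tensor_free A B\<^esub> d + c \<otimes>\<^bsub>tensor_free A B\<^esub> d'"
  "0 \<otimes>\<^bsub>tensor_free A B\<^esub> d = 0" "c \<otimes>\<^bsub>tensor_free A B\<^esub> 0 = 0"
  by (simp_all add: tensor_free_def frag_extend_diff frag_extend_add case_prod_unfold
    frag_extend_diff2 frag_extend_add2 frag_extend_zero2)

definition pure :: "('r, 'a, 'm) frob_alg_scheme \<Rightarrow> ('r, 'b, 'n) frob_alg_scheme \<Rightarrow> 'a \<Rightarrow> 'b
    \<Rightarrow> ('a \<times> 'b \<Rightarrow>\<^sub>0 int) set" where
  "pure A B a b = tensor_ideal A B +>\<^bsub>tensor_free A B\<^esub> frag_of (a, b)"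

abbreviation tquot where "tquot A B \<equiv> tensor_free A B Quot tensor_ideal A B"

lemma tensor_ops [simp]:
  "carrier (tensor A B) = carrier (tquot A B)"
  "cring (tensor A B) = cring (tquot A B)"
  "pcong q (tensor A B) = pcong q (tquot A B)"
  "ring_hom (tensor A B) S = ring_hom (tquot A B) S"
  "ring_hom T (tensor A B) = ring_hom T (tquot A B)"
  "add_hom (tensor A B) S = add_hom (tquot A B) S"
  "add_hom T (tensor A B) = add_hom T (tquot A B)"
  "pcompl q (tensor A B) = pcompl q (tquot A B)"
  "pcompl_inj q (tensor A B) = pcompl_inj q (tquot A B)"
  by (simp_all add: tensor_def)

lemma tensor_simps [simp]:
  "emb (tensor A B) = (\<lambda>r. pure A B (emb A r) \<one>\<^bsub>B\<^esub>)"
  "frob (tensor A B) = tensor_map A B (frob A) (frob B)"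
  by (simp_all add: tensor_def pure_def frob_alg.defs ring.defs)

locale tensor_pair =
  fixes A :: "('r::comm_ring_1, 'a, 'm) frob_alg_scheme" and B :: "('r, 'b, 'n) frob_alg_scheme"
  assumes A_cring: "cring A" and B_cring: "cring B"
    and embA: "emb A \<in> ring_hom ring_of_type_algebra A" and embB: "emb B \<in> ring_hom ring_of_type_algebra B"
begin

sublocale A: cring A by (rule A_cring)
sublocale B: cring B by (rule B_cring)

lemma embA_closed [simp]: "emb A r \<in> carrier A"
  using ring_hom_closed[OF embA, of r] by simp
lemma embB_closed [simp]: "emb B r \<in> carrier B"
  using ring_hom_closed[OF embB, of r] by simp

abbreviation "T \<equiv> tensor_free A B"
abbreviation "I \<equiv> tensor_ideal A B"

lemma keys_diff_subset: "Poly_Mapping.keys c \<subseteq> S \<Longrightarrow> Poly_Mapping.keys d \<subseteq> S \<Longrightarrow>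
    Poly_Mapping.keys (c - d) \<subseteq> S" for c d :: "'x \<Rightarrow>\<^sub>0 int"
  using keys_diff[of c d] by (meson Un_least order_trans)

lemma mult_closed:
  assumes "c \<in> carrier T" "d \<in> carrier T"
  shows "c \<otimes>\<^bsub>T\<^esub> d \<in> carrier T"
proof -
  have kd: "c - d \<in> carrier T" if "c \<in> carrier T" "d \<in> carrier T" for c d
    using that keys_diff_subset[of c _ d] by simp
  have *: "frag_of (a, b) \<otimes>\<^bsub>T\<^esub> d \<in> carrier T" if ab: "a \<in> carrier A" "b \<in> carrier B" for a b
    using assms(2)[unfolded tensor_free_simps]
  proof (induction d rule: frag_induction)
    case (one x)
    then show ?case using ab by (cases x) simp
  next
    case (diff c d)
    then show ?case unfolding tensor_free_mult_diff by (rule kd)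
  qed (simp add: tensor_free_mult_diff)
  show ?thesis
    using assms(1)[unfolded tensor_free_simps]
  proof (induction c rule: frag_induction)
    case (one x)
    then show ?case using * by (cases x) blast
  next
    case (diff c d)
    then show ?case unfolding tensor_free_mult_diff by (rule kd)
  qed (simp add: tensor_free_mult_diff)
qed

lemma mult_comm:
  assumes "c \<in> carrier T" "d \<in> carrier T"
  shows "c \<otimes>\<^bsub>T\<^esub> d = d \<otimes>\<^bsub>T\<^esub> c"
proof -
  have *: "frag_of (a, b) \<otimes>\<^bsub>T\<^esub> d = d \<otimes>\<^bsub>T\<^esub> frag_of (a, b)" if "a \<in> carrier A" "b \<in> carrier B" for a b
    using assms(2)[unfolded tensor_free_simps]
    by (induction d rule: frag_induction) (use that in \<open>auto simp: tensor_free_mult_diff A.m_comm B.m_comm\<close>)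
  show ?thesis
    using assms(1)[unfolded tensor_free_simps]
    by (induction c rule: frag_induction) (use * in \<open>auto simp: tensor_free_mult_diff\<close>)
qed

lemma mult_assoc:
  assumes "c \<in> carrier T" "d \<in> carrier T" "e \<in> carrier T"
  shows "(c \<otimes>\<^bsub>T\<^esub> d) \<otimes>\<^bsub>T\<^esub> e = c \<otimes>\<^bsub>T\<^esub> (d \<otimes>\<^bsub>T\<^esub> e)"
proof -
  have 1: "(frag_of (a, b) \<otimes>\<^bsub>T\<^esub> frag_of (a', b')) \<otimes>\<^bsub>T\<^esub> e = frag_of (a, b) \<otimes>\<^bsub>T\<^esub> (frag_of (a', b') \<otimes>\<^bsub>T\<^esub> e)"
    if "a \<in> carrier A" "b \<in> carrier B" "a' \<in> carrier A" "b' \<in> carrier B" for a b a' b'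
    using assms(3)[unfolded tensor_free_simps]
    by (induction e rule: frag_induction) (use that in \<open>auto simp: tensor_free_mult_diff A.m_assoc B.m_assoc\<close>)
  have 2: "(frag_of (a, b) \<otimes>\<^bsub>T\<^esub> d) \<otimes>\<^bsub>T\<^esub> e = frag_of (a, b) \<otimes>\<^bsub>T\<^esub> (d \<otimes>\<^bsub>T\<^esub> e)"
    if "a \<in> carrier A" "b \<in> carrier B" for a b
    using assms(2)[unfolded tensor_free_simps]
    by (induction d rule: frag_induction) (use that 1 in \<open>auto simp: tensor_free_mult_diff simp del: tensor_free_simps\<close>)
  show ?thesis
    using assms(1)[unfolded tensor_free_simps]
    by (induction c rule: frag_induction) (use 2 in \<open>auto simp: tensor_free_mult_diff\<close>)
qed

lemma mult_one: "c \<in> carrier T \<Longrightarrow> \<one>\<^bsub>T\<^esub> \<otimes>\<^bsub>T\<^esub> c = c"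
  unfolding tensor_free_simps
  by (induction c rule: frag_induction) (auto simp: tensor_free_mult_diff)

sublocale T: cring T
proof (intro cringI abelian_groupI comm_monoidI)
  fix x y assume xy: "x \<in> carrier T" "y \<in> carrier T"
  show "x \<oplus>\<^bsub>T\<^esub> y \<in> carrier T"
    using xy keys_add[of x y] by (simp only: tensor_free_simps) (meson Un_least order_trans)
  show "x \<oplus>\<^bsub>T\<^esub> y = y \<oplus>\<^bsub>T\<^esub> x" by simp
  show "x \<otimes>\<^bsub>T\<^esub> y \<in> carrier T" using mult_closed[OF xy] .
  show "x \<otimes>\<^bsub>T\<^esub> y = y \<otimes>\<^bsub>T\<^esub> x" using mult_comm[OF xy] .
  fix z assume z: "z \<in> carrier T"
  show "x \<oplus>\<^bsub>T\<^esub> y \<oplus>\<^bsub>T\<^esub> z = x \<oplus>\<^bsub>T\<^esub> (y \<oplus>\<^bsub>T\<^esub> z)" by (simp add: add.assoc)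
  show "x \<otimes>\<^bsub>T\<^esub> y \<otimes>\<^bsub>T\<^esub> z = x \<otimes>\<^bsub>T\<^esub> (y \<otimes>\<^bsub>T\<^esub> z)" using mult_assoc[OF xy z] .
  show "(x \<oplus>\<^bsub>T\<^esub> y) \<otimes>\<^bsub>T\<^esub> z = x \<otimes>\<^bsub>T\<^esub> z \<oplus>\<^bsub>T\<^esub> y \<otimes>\<^bsub>T\<^esub> z"
    by (simp add: tensor_free_mult_diff)
next
  fix x assume x: "x \<in> carrier T"
  show "\<zero>\<^bsub>T\<^esub> \<oplus>\<^bsub>T\<^esub> x = x" by simp
  show "\<one>\<^bsub>T\<^esub> \<otimes>\<^bsub>T\<^esub> x = x" using mult_one[OF x] .
  show "\<exists>y\<in>carrier T. y \<oplus>\<^bsub>T\<^esub> x = \<zero>\<^bsub>T\<^esub>"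
    using x by (intro bexI[of _ "- x"]) simp_all
qed simp_all

lemma T_minus: "c \<in> carrier T \<Longrightarrow> d \<in> carrier T \<Longrightarrow> c \<ominus>\<^bsub>T\<^esub> d = c - d"
  using keys_diff_subset[of c "carrier A \<times> carrier B" d] by (subst T.minus_eq_iff) auto

definition gens :: "('a \<times> 'b \<Rightarrow>\<^sub>0 int) set" where
  "gens = {frag_of (a \<oplus>\<^bsub>A\<^esub> a', b) - frag_of (a, b) - frag_of (a', b) | a a' b.
         a \<in> carrier A \<and> a' \<in> carrier A \<and> b \<in> carrier B} \<union>
      {frag_of (a, b \<oplus>\<^bsub>B\<^esub> b') - frag_of (a, b) - frag_of (a, b') | a b b'.
         a \<in> carrier A \<and> b \<in> carrier B \<and> b' \<in> carrier B} \<union>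
      {frag_of (emb A r \<otimes>\<^bsub>A\<^esub> a, b) - frag_of (a, emb B r \<otimes>\<^bsub>B\<^esub> b) | r a b.
         a \<in> carrier A \<and> b \<in> carrier B}"

lemma gens1: "a \<in> carrier A \<Longrightarrow> a' \<in> carrier A \<Longrightarrow> b \<in> carrier B \<Longrightarrow>
    frag_of (a \<oplus>\<^bsub>A\<^esub> a', b) - frag_of (a, b) - frag_of (a', b) \<in> gens"
  unfolding gens_def by blast

lemma gens2: "a \<in> carrier A \<Longrightarrow> b \<in> carrier B \<Longrightarrow> b' \<in> carrier B \<Longrightarrow>
    frag_of (a, b \<oplus>\<^bsub>B\<^esub> b') - frag_of (a, b) - frag_of (a, b') \<in> gens"
  unfolding gens_def by blast

lemma gens3: "a \<in> carrier A \<Longrightarrow> b \<in> carrier B \<Longrightarrow>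
    frag_of (emb A r \<otimes>\<^bsub>A\<^esub> a, b) - frag_of (a, emb B r \<otimes>\<^bsub>B\<^esub> b) \<in> gens"
  unfolding gens_def by blast

lemma gens_cases:
  assumes "g \<in> gens"
  obtains (1) a1 a2 b1 where "g = frag_of (a1 \<oplus>\<^bsub>A\<^esub> a2, b1) - frag_of (a1, b1) - frag_of (a2, b1)"
      "a1 \<in> carrier A" "a2 \<in> carrier A" "b1 \<in> carrier B"
    | (2) a1 b1 b2 where "g = frag_of (a1, b1 \<oplus>\<^bsub>B\<^esub> b2) - frag_of (a1, b1) - frag_of (a1, b2)"
      "a1 \<in> carrier A" "b1 \<in> carrier B" "b2 \<in> carrier B"
    | (3) r a1 b1 where "g = frag_of (emb A r \<otimes>\<^bsub>A\<^esub> a1, b1) - frag_of (a1, emb B r \<otimes>\<^bsub>B\<^esub> b1)"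
      "a1 \<in> carrier A" "b1 \<in> carrier B"
  using assms unfolding gens_def
  apply (elim UnE CollectE exE conjE)
  subgoal by (rule that(1))
  subgoal by (rule that(2))
  subgoal by (rule that(3))
  done

lemma I_gens: "I = Idl\<^bsub>T\<^esub> gens"
  by (simp add: tensor_ideal_def gens_def)

lemma gens_closed: "gens \<subseteq> carrier T"
  unfolding gens_def by (auto dest!: subsetD[OF keys_diff])

lemma I_ideal: "ideal I T"
  unfolding I_gens by (rule T.genideal_ideal[OF gens_closed])

lemma gens_I: "x \<in> gens \<Longrightarrow> x \<in> I"
  using T.genideal_self[OF gens_closed] by (auto simp: I_gens)

lemma I_minimal: "ideal J T \<Longrightarrow> gens \<subseteq> J \<Longrightarrow> I \<subseteq> J"
  unfolding I_gens by (rule T.genideal_minimal)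

lemma cring_tensor: "cring (tquot A B)"
  by (rule ideal.quotient_is_cring[OF I_ideal T.is_cring])

sublocale Q: cring "tquot A B" by (rule cring_tensor)

lemma coset_hom: "(+>\<^bsub>T\<^esub>) I \<in> ring_hom T (tquot A B)"
  by (rule ideal.rcos_ring_hom[OF I_ideal])

lemma pure_closed [simp]: "a \<in> carrier A \<Longrightarrow> b \<in> carrier B \<Longrightarrow> pure A B a b \<in> carrier (tquot A B)"
  using ring_hom_closed[OF coset_hom, of "frag_of (a, b)"] by (simp add: pure_def)

lemma pure_mult: "a \<in> carrier A \<Longrightarrow> b \<in> carrier B \<Longrightarrow> a' \<in> carrier A \<Longrightarrow> b' \<in> carrier B \<Longrightarrow>
    pure A B a b \<otimes>\<^bsub>tquot A B\<^esub> pure A B a' b' = pure A B (a \<otimes>\<^bsub>A\<^esub> a') (b \<otimes>\<^bsub>B\<^esub> b')"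
  using ring_hom_mult[OF coset_hom, of "frag_of (a, b)" "frag_of (a', b')"] by (simp add: pure_def)

lemma pure_one: "\<one>\<^bsub>tquot A B\<^esub> = pure A B \<one>\<^bsub>A\<^esub> \<one>\<^bsub>B\<^esub>"
  using ring_hom_one[OF coset_hom] by (simp add: pure_def)

lemma frag_of_closed: "a \<in> carrier A \<Longrightarrow> b \<in> carrier B \<Longrightarrow> frag_of (a, b) \<in> carrier T"
  by simp

lemma pure_add_l:
  assumes "a \<in> carrier A" "a' \<in> carrier A" "b \<in> carrier B"
  shows "pure A B (a \<oplus>\<^bsub>A\<^esub> a') b = pure A B a b \<oplus>\<^bsub>tquot A B\<^esub> pure A B a' b"
proof -
  have "frag_of (a \<oplus>\<^bsub>A\<^esub> a', b) \<ominus>\<^bsub>T\<^esub> (frag_of (a, b) \<oplus>\<^bsub>T\<^esub> frag_of (a', b)) \<in> I"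
    using assms T.a_closed[OF frag_of_closed[of a b] frag_of_closed[of a' b]]
    using gens_I[OF gens1[of a a' b]] by (subst T_minus) (simp_all add: diff_diff_eq[symmetric])
  then have "pure A B (a \<oplus>\<^bsub>A\<^esub> a') b = I +>\<^bsub>T\<^esub> (frag_of (a, b) \<oplus>\<^bsub>T\<^esub> frag_of (a', b))"
    unfolding pure_def using assms T.a_closed[OF frag_of_closed[of a b] frag_of_closed[of a' b]]
    by (subst T.coset_eq_iff[OF I_ideal]) auto
  then show ?thesis using ring_hom_add[OF coset_hom frag_of_closed[of a b] frag_of_closed[of a' b]] assms
    by (simp add: pure_def)
qed

lemma pure_add_r:
  assumes "a \<in> carrier A" "b \<in> carrier B" "b' \<in> carrier B"
  shows "pure A B a (b \<oplus>\<^bsub>B\<^esub> b') = pure A B a b \<oplus>\<^bsub>tquot A B\<^esub> pure A B a b'"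
proof -
  have "frag_of (a, b \<oplus>\<^bsub>B\<^esub> b') \<ominus>\<^bsub>T\<^esub> (frag_of (a, b) \<oplus>\<^bsub>T\<^esub> frag_of (a, b')) \<in> I"
    using assms T.a_closed[OF frag_of_closed[of a b] frag_of_closed[of a b']]
    using gens_I[OF gens2[of a b b']] by (subst T_minus) (simp_all add: diff_diff_eq[symmetric])
  then have "pure A B a (b \<oplus>\<^bsub>B\<^esub> b') = I +>\<^bsub>T\<^esub> (frag_of (a, b) \<oplus>\<^bsub>T\<^esub> frag_of (a, b'))"
    unfolding pure_def using assms T.a_closed[OF frag_of_closed[of a b] frag_of_closed[of a b']]
    by (subst T.coset_eq_iff[OF I_ideal]) auto
  then show ?thesis using ring_hom_add[OF coset_hom frag_of_closed[of a b] frag_of_closed[of a b']] assms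
    by (simp add: pure_def)
qed

lemma pure_balanced:
  assumes "a \<in> carrier A" "b \<in> carrier B"
  shows "pure A B (emb A r \<otimes>\<^bsub>A\<^esub> a) b = pure A B a (emb B r \<otimes>\<^bsub>B\<^esub> b)"
proof -
  have "frag_of (emb A r \<otimes>\<^bsub>A\<^esub> a, b) \<ominus>\<^bsub>T\<^esub> frag_of (a, emb B r \<otimes>\<^bsub>B\<^esub> b) \<in> I"
    using assms gens_I[OF gens3[of a b r]] by (subst T_minus) simp_all
  then show ?thesis
    unfolding pure_def using assms by (subst T.coset_eq_iff[OF I_ideal]) auto
qed

lemma pure_emb: "pure A B (emb A r) \<one>\<^bsub>B\<^esub> = pure A B \<one>\<^bsub>A\<^esub> (emb B r)"
  using pure_balanced[of "\<one>\<^bsub>A\<^esub>" "\<one>\<^bsub>B\<^esub>" r] by simp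

lemma pure_hom_l: "(\<lambda>a. pure A B a \<one>\<^bsub>B\<^esub>) \<in> ring_hom A (tquot A B)"
  by (rule ring_hom_memI) (auto simp: pure_mult pure_add_l pure_one)

lemma pure_hom_r: "(\<lambda>b. pure A B \<one>\<^bsub>A\<^esub> b) \<in> ring_hom B (tquot A B)"
  by (rule ring_hom_memI) (auto simp: pure_mult pure_add_r pure_one)

lemma emb_tensor: "emb (tensor A B) \<in> ring_hom ring_of_type_algebra (tensor A B)"
  using ring_hom_trans[OF embA pure_hom_l] by (simp add: comp_def)

lemma tensor_hom_unique:
  assumes S: "abelian_group S" and F: "F \<in> add_hom (tquot A B) S" and G: "G \<in> add_hom (tquot A B) S"
    and eq: "\<And>a b. a \<in> carrier A \<Longrightarrow> b \<in> carrier B \<Longrightarrow> F (pure A B a b) = G (pure A B a b)"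
    and u: "u \<in> carrier (tquot A B)"
  shows "F u = G u"
proof -
  obtain c where c: "u = I +>\<^bsub>T\<^esub> c" "c \<in> carrier T" using u by (auto simp: quot_carrier)
  let ?P = "\<lambda>c. c \<in> carrier T \<and> F (I +>\<^bsub>T\<^esub> c) = G (I +>\<^bsub>T\<^esub> c)"
  have "Poly_Mapping.keys c \<subseteq> carrier A \<times> carrier B" using c(2) by simp
  then have "?P c"
  proof (induction c rule: frag_induction)
    case zero
    have "I +>\<^bsub>T\<^esub> 0 = \<zero>\<^bsub>tquot A B\<^esub>"
      using ring_hom_zero[OF coset_hom T.ring_axioms Q.ring_axioms] by simp
    then show ?case
      by (simp add: add_hom_zero[OF Q.is_abelian_group S F] add_hom_zero[OF Q.is_abelian_group S G])
  next
    case (one x)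
    then show ?case using eq[of "fst x" "snd x"] by (auto simp: pure_def)
  next
    case (diff c d)
    then have cd: "c \<in> carrier T" "d \<in> carrier T" by auto
    then have "I +>\<^bsub>T\<^esub> (c - d) = (I +>\<^bsub>T\<^esub> c) \<ominus>\<^bsub>tquot A B\<^esub> (I +>\<^bsub>T\<^esub> d)"
      using add_hom_diff[OF T.is_abelian_group Q.is_abelian_group ring_hom_add_hom[OF coset_hom] cd] T_minus
      by simp
    moreover have "c - d \<in> carrier T" using T.minus_closed[OF cd] T_minus[OF cd] by simp
    ultimately show ?case
      using diff ring_hom_closed[OF coset_hom] by (simp del: tensor_free_simps
        add: add_hom_diff[OF Q.is_abelian_group S F] add_hom_diff[OF Q.is_abelian_group S G])
  qed
  then show ?thesis using c by simp
qed

text \<open>The free abelian group gives an additive map \<open>h\<close>, which must be shown to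
  vanish on \<open>I\<close>. As \<beta> is not multiplicative, the kernel of \<open>h\<close> need
  not be an ideal, whereas \<open>I\<close> is the ideal generated by the relations.\<close>

lemma tensor_hom_exists:
  assumes S: "abelian_group S"
    and bc: "\<And>a b. a \<in> carrier A \<Longrightarrow> b \<in> carrier B \<Longrightarrow> \<beta> a b \<in> carrier S"
    and b1: "\<And>a a' b. a \<in> carrier A \<Longrightarrow> a' \<in> carrier A \<Longrightarrow> b \<in> carrier B \<Longrightarrow>
      \<beta> (a \<oplus>\<^bsub>A\<^esub> a') b = \<beta> a b \<oplus>\<^bsub>S\<^esub> \<beta> a' b"
    and b2: "\<And>a b b'. a \<in> carrier A \<Longrightarrow> b \<in> carrier B \<Longrightarrow> b' \<in> carrier B \<Longrightarrow>
      \<beta> a (b \<oplus>\<^bsub>B\<^esub> b') = \<beta> a b \<oplus>\<^bsub>S\<^esub> \<beta> a b'"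
    and b3: "\<And>r a b. a \<in> carrier A \<Longrightarrow> b \<in> carrier B \<Longrightarrow>
      \<beta> (emb A r \<otimes>\<^bsub>A\<^esub> a) b = \<beta> a (emb B r \<otimes>\<^bsub>B\<^esub> b)"
  obtains F where "F \<in> add_hom (tquot A B) S"
    "\<And>a b. a \<in> carrier A \<Longrightarrow> b \<in> carrier B \<Longrightarrow> F (pure A B a b) = \<beta> a b"
proof -
  interpret S: abelian_group S by fact
  have "case_prod \<beta> ` (carrier A \<times> carrier B) \<subseteq> carrier (add_monoid S)" using bc by auto
  then obtain h where h: "h \<in> Group.hom (free_Abelian_group (carrier A \<times> carrier B)) (add_monoid S)"
    "\<And>x. x \<in> carrier A \<times> carrier B \<Longrightarrow> h (frag_of x) = case_prod \<beta> x"
    using comm_group.free_Abelian_group_universal[OF S.a_comm_group] by blast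
  have ha: "h \<in> add_hom T S" using h(1) by (auto simp: add_hom_def Group.hom_def)
  have hf: "a \<in> carrier A \<Longrightarrow> b \<in> carrier B \<Longrightarrow> h (frag_of (a, b)) = \<beta> a b" for a b using h(2) by auto
  note hd = add_hom_diff[OF T.is_abelian_group S ha] and hc = add_hom_closed[OF ha]
    and h0 = add_hom_zero[OF T.is_abelian_group S ha]
  have hd': "c \<in> carrier T \<Longrightarrow> d \<in> carrier T \<Longrightarrow> h (c - d) = h c \<ominus>\<^bsub>S\<^esub> h d" for c d
    using hd T_minus by simp
  \<comment> \<open>The largest ideal inside the kernel of \<open>h\<close>; it suffices to find the
    relations in it.\<close>
  define J where "J = {c \<in> carrier T. \<forall>e\<in>carrier T. h (e \<otimes>\<^bsub>T\<^esub> c) = \<zero>\<^bsub>S\<^esub>}"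
  have J: "ideal J T"
  proof (rule idealI[OF T.ring_axioms])
    show "subgroup J (add_monoid T)"
    proof (rule T.add.subgroupI)
      show "\<ominus>\<^bsub>T\<^esub> c \<in> J" if "c \<in> J" for c
        using that by (auto simp: J_def T.r_minus add_hom_minus[OF T.is_abelian_group S ha] simp del: tensor_free_simps)
      show "c \<oplus>\<^bsub>T\<^esub> d \<in> J" if "c \<in> J" "d \<in> J" for c d
        using that by (auto simp: J_def T.r_distr add_hom_add[OF ha] simp del: tensor_free_simps)
      have "\<zero>\<^bsub>T\<^esub> \<in> J" unfolding J_def using h0 T.zero_closed T.r_null by (simp del: tensor_free_simps)
      then show "J \<noteq> {}" by blast
    qed (auto simp: J_def simp del: tensor_free_simps)
    show "x \<otimes>\<^bsub>T\<^esub> c \<in> J" if "c \<in> J" "x \<in> carrier T" for c x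
      using that by (simp add: J_def T.m_assoc[symmetric] del: tensor_free_simps)
    then show "c \<otimes>\<^bsub>T\<^esub> x \<in> J" if "c \<in> J" "x \<in> carrier T" for c x
      using that T.m_comm[of c x] by (simp add: J_def del: tensor_free_simps)
  qed
  have "gens \<subseteq> J"
  proof
    fix g assume g: "g \<in> gens"
    have gc: "g \<in> carrier T" using g gens_closed by blast
    \<comment> \<open>A relation multiplied by a pure tensor is a relation of the same kind. This
      covers all multipliers, since pure tensors generate the free group additively.\<close>
    have *: "h (frag_of (a, b) \<otimes>\<^bsub>T\<^esub> g) = \<zero>\<^bsub>S\<^esub>" if "a \<in> carrier A" "b \<in> carrier B" for a b
    proof -
      note [simp] = that
      have kd: "Poly_Mapping.keys (frag_of x - frag_of y) \<subseteq> carrier A \<times> carrier B"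
        if "x \<in> carrier A \<times> carrier B" "y \<in> carrier A \<times> carrier B" for x y
        using that by (intro keys_diff_subset) auto
      from g show ?thesis
      proof (cases rule: gens_cases)
        case (1 a1 a2 b1)
        note [simp] = 1(2-4)
        show ?thesis unfolding 1(1)
          using bc by (simp add: tensor_free_mult_diff hd' kd hf A.r_distr b1)
            (simp add: a_minus_def S.a_assoc[symmetric] S.minus_add S.r_neg S.a_comm S.r_neg1 S.r_neg2 S.l_neg)
      next
        case (2 a1 b1 b2)
        note [simp] = 2(2-4)
        show ?thesis unfolding 2(1)
          using bc by (simp add: tensor_free_mult_diff hd' kd hf B.r_distr b2)
            (simp add: a_minus_def S.a_assoc[symmetric] S.minus_add S.r_neg S.a_comm S.r_neg1 S.r_neg2 S.l_neg)
      next
        case (3 r a1 b1)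
        note [simp] = 3(2-3)
        show ?thesis unfolding 3(1)
          by (simp add: tensor_free_mult_diff hd' kd hf bc a_minus_def A.m_lcomm[of a] B.m_lcomm[of b] b3 S.r_neg)
      qed
    qed
    have "e \<in> carrier T \<and> h (e \<otimes>\<^bsub>T\<^esub> g) = \<zero>\<^bsub>S\<^esub>" if e: "e \<in> carrier T" for e
      using e[unfolded tensor_free_simps]
    proof (induction e rule: frag_induction)
      case (diff c d)
      then have "c \<otimes>\<^bsub>T\<^esub> g \<in> carrier T" "d \<otimes>\<^bsub>T\<^esub> g \<in> carrier T" using gc mult_closed by blast+
      with diff show ?case
        using keys_diff_subset[of c _ d] by (simp add: tensor_free_mult_diff hd' a_minus_def)
    qed (use * h0 in \<open>auto simp: tensor_free_mult_diff\<close>)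
    then show "g \<in> J" using gc by (simp add: J_def del: tensor_free_simps)
  qed
  then have IJ: "I \<subseteq> J" by (rule I_minimal[OF J])
  have hI: "h c = \<zero>\<^bsub>S\<^esub>" if "c \<in> I" for c
  proof -
    have "c \<in> J" using that IJ by blast
    then show ?thesis unfolding J_def using T.one_closed T.l_one[of c] by (metis (mono_tags, lifting) mem_Collect_eq)
  qed
  have heq: "h c = h d" if cd: "c \<in> carrier T" "d \<in> carrier T" "I +>\<^bsub>T\<^esub> c = I +>\<^bsub>T\<^esub> d" for c d
  proof -
    have "h (c \<ominus>\<^bsub>T\<^esub> d) = \<zero>\<^bsub>S\<^esub>" using hI T.coset_eq_iff[OF I_ideal cd(1,2)] cd(3) by blast
    then show ?thesis using hd[OF cd(1,2)] hc[OF cd(1)] hc[OF cd(2)]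
      by (metis S.add.inv_solve_right S.l_zero S.zero_closed a_minus_def)
  qed
  \<comment> \<open>Any representative serves, as \<open>h\<close> is constant on cosets of
    \<open>I\<close>.\<close>
  define F where "F = (\<lambda>u. h (SOME c. c \<in> u))"
  have Fc: "F (I +>\<^bsub>T\<^esub> c) = h c" if c: "c \<in> carrier T" for c
  proof -
    have "(SOME d. d \<in> I +>\<^bsub>T\<^esub> c) \<in> I +>\<^bsub>T\<^esub> c"
      using T.coset_self[OF I_ideal c] by (rule someI)
    from T.coset_memD[OF I_ideal this c] show ?thesis unfolding F_def using heq c by blast
  qed
  show ?thesis
  proof (rule that)
    show "F \<in> add_hom (tquot A B) S"
    proof (rule add_homI)
      fix u v assume "u \<in> carrier (tquot A B)" "v \<in> carrier (tquot A B)"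
      then obtain c d where cd: "u = I +>\<^bsub>T\<^esub> c" "c \<in> carrier T" "v = I +>\<^bsub>T\<^esub> d" "d \<in> carrier T"
        by (auto simp: quot_carrier)
      then show "F (u \<oplus>\<^bsub>tquot A B\<^esub> v) = F u \<oplus>\<^bsub>S\<^esub> F v"
        by (simp add: ring_hom_add[OF coset_hom, symmetric] Fc add_hom_add[OF ha] T.a_closed del: tensor_free_simps)
    qed (auto simp: quot_carrier Fc hc simp del: tensor_free_simps)
    show "F (pure A B a b) = \<beta> a b" if "a \<in> carrier A" "b \<in> carrier B" for a b
      using that by (simp add: pure_def Fc hf)
  qed
qed

end

text \<open>The map \<psi> on scalars allows semilinear pairs: it is \<phi> for the Frobenius of a
  tensor product and the identity for functoriality in one factor.\<close>

lemma tensor_map_pure: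
  fixes A :: "('r::comm_ring_1, 'a, 'm) frob_alg_scheme" and B :: "('r, 'b, 'n) frob_alg_scheme"
    and C :: "('r, 'c, 'k) frob_alg_scheme" and D :: "('r, 'd, 'l) frob_alg_scheme"
  assumes AB: "tensor_pair A B" and CD: "tensor_pair C D"
    and f: "f \<in> ring_hom A C" "\<And>r. f (emb A r) = emb C (\<psi> r)"
    and g: "g \<in> ring_hom B D" "\<And>r. g (emb B r) = emb D (\<psi> r)"
  shows "tensor_map C D f g \<in> ring_hom (tquot A B) (tquot C D)"
    and "\<And>a b. a \<in> carrier A \<Longrightarrow> b \<in> carrier B \<Longrightarrow> tensor_map C D f g (pure A B a b) = pure C D (f a) (g b)"
proof -
  interpret AB: tensor_pair A B by fact
  interpret CD: tensor_pair C D by fact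
  define e where "e = frag_extend (\<lambda>(a, b). frag_of (f a, g b))"
  have e_of: "e (frag_of (a, b)) = frag_of (f a, g b)" for a b by (simp add: e_def)
  have e_diff: "e (c - d) = e c - e d" and e_add: "e (c + d) = e c + e d" and e_0: "e 0 = 0" for c d
    by (simp_all add: e_def frag_extend_diff frag_extend_add)
  note fc = ring_hom_closed[OF f(1)] and gc = ring_hom_closed[OF g(1)]
  have ec: "e c \<in> carrier CD.T" if "c \<in> carrier AB.T" for c
    using that[unfolded tensor_free_simps]
  proof (induction c rule: frag_induction)
    case (one x)
    then show ?case using fc gc by (cases x) (simp add: e_of)
  next
    case (diff c d)
    then show ?case unfolding e_diff using CD.keys_diff_subset[of "e c" _ "e d"] by simp
  qed (simp add: e_0)
  have em: "e (c \<otimes>\<^bsub>AB.T\<^esub> d) = e c \<otimes>\<^bsub>CD.T\<^esub> e d" if cd: "c \<in> carrier AB.T" "d \<in> carrier AB.T" for c d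
  proof -
    have *: "e (frag_of (a, b) \<otimes>\<^bsub>AB.T\<^esub> d) = e (frag_of (a, b)) \<otimes>\<^bsub>CD.T\<^esub> e d"
      if "a \<in> carrier A" "b \<in> carrier B" for a b
      using cd(2)[unfolded tensor_free_simps]
      by (induction d rule: frag_induction) (use that in \<open>auto simp: tensor_free_mult_diff
        e_of e_diff e_0 ring_hom_mult[OF f(1)] ring_hom_mult[OF g(1)]\<close>)
    show ?thesis using cd(1)[unfolded tensor_free_simps]
      by (induction c rule: frag_induction) (use * in \<open>auto simp: tensor_free_mult_diff e_diff e_0\<close>)
  qed
  have eh: "e \<in> ring_hom AB.T CD.T"
    by (rule ring_hom_memI) (use ec em in \<open>auto simp: e_add e_of ring_hom_one[OF f(1)] ring_hom_one[OF g(1)]\<close>)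
  interpret e: ring_hom_ring AB.T CD.T e
    by (rule ring_hom_ringI2[OF AB.T.ring_axioms CD.T.ring_axioms eh])
  have "AB.gens \<subseteq> {c \<in> carrier AB.T. e c \<in> CD.I}"
  proof (intro subsetI CollectI conjI)
    fix c assume c: "c \<in> AB.gens"
    then show "c \<in> carrier AB.T" using AB.gens_closed by blast
    show "e c \<in> CD.I"
    proof (rule CD.gens_I)
      from c show "e c \<in> CD.gens"
      proof (cases rule: AB.gens_cases)
        case (1 a1 a2 b1)
        then have "e c = frag_of (f a1 \<oplus>\<^bsub>C\<^esub> f a2, g b1) - frag_of (f a1, g b1) - frag_of (f a2, g b1)"
          by (simp add: e_diff e_of ring_hom_add[OF f(1)])
        with fc gc 1(2-) show ?thesis by (simp add: CD.gens1)
      next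
        case (2 a1 b1 b2)
        then have "e c = frag_of (f a1, g b1 \<oplus>\<^bsub>D\<^esub> g b2) - frag_of (f a1, g b1) - frag_of (f a1, g b2)"
          by (simp add: e_diff e_of ring_hom_add[OF g(1)])
        with fc gc 2(2-) show ?thesis by (simp add: CD.gens2)
      next
        case (3 r a1 b1)
        then have "e c = frag_of (emb C (\<psi> r) \<otimes>\<^bsub>C\<^esub> f a1, g b1) - frag_of (f a1, emb D (\<psi> r) \<otimes>\<^bsub>D\<^esub> g b1)"
          by (simp add: e_diff e_of ring_hom_mult[OF f(1)] ring_hom_mult[OF g(1)] f(2) g(2))
        with fc gc 3(2-) show ?thesis by (simp add: CD.gens3)
      qed
    qed
  qed
  then have "AB.I \<subseteq> {c \<in> carrier AB.T. e c \<in> CD.I}"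
    by (rule AB.I_minimal[OF e.ideal_vimage[OF CD.I_ideal]])
  then have eI: "e ` AB.I \<subseteq> CD.I" by blast
  have map: "tensor_map C D f g (AB.I +>\<^bsub>AB.T\<^esub> c) = CD.I +>\<^bsub>CD.T\<^esub> e c" if "c \<in> carrier AB.T" for c
    unfolding tensor_map_def e_def[symmetric]
    by (rule quot_map[OF AB.T.ring_axioms CD.T.ring_axioms AB.I_ideal CD.I_ideal ring_hom_add_hom[OF eh] eI that])
  show "tensor_map C D f g (pure A B a b) = pure C D (f a) (g b)" if "a \<in> carrier A" "b \<in> carrier B" for a b
    using that map[of "frag_of (a, b)"] by (simp add: pure_def e_of)
  show "tensor_map C D f g \<in> ring_hom (tquot A B) (tquot C D)"
  proof (rule ring_hom_memI)
    fix u v assume "u \<in> carrier (tquot A B)" "v \<in> carrier (tquot A B)"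
    then obtain c d where cd: "u = AB.I +>\<^bsub>AB.T\<^esub> c" "c \<in> carrier AB.T" "v = AB.I +>\<^bsub>AB.T\<^esub> d" "d \<in> carrier AB.T"
      by (auto simp: quot_carrier)
    then show "tensor_map C D f g (u \<otimes>\<^bsub>tquot A B\<^esub> v) =
        tensor_map C D f g u \<otimes>\<^bsub>tquot C D\<^esub> tensor_map C D f g v"
      "tensor_map C D f g (u \<oplus>\<^bsub>tquot A B\<^esub> v) =
        tensor_map C D f g u \<oplus>\<^bsub>tquot C D\<^esub> tensor_map C D f g v"
      using ec[OF cd(2)] ec[OF cd(4)]
      by (simp_all add: ring_hom_add[OF AB.coset_hom, symmetric] ring_hom_mult[OF AB.coset_hom, symmetric]
        map AB.T.a_closed AB.T.m_closed e.hom_add e.hom_mult ring_hom_add[OF CD.coset_hom]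
        ring_hom_mult[OF CD.coset_hom] del: tensor_free_simps)
  next
    show "tensor_map C D f g \<one>\<^bsub>tquot A B\<^esub> = \<one>\<^bsub>tquot C D\<^esub>"
      using map[of "frag_of (\<one>\<^bsub>A\<^esub>, \<one>\<^bsub>B\<^esub>)"]
      by (simp add: AB.pure_one CD.pure_one pure_def e_of ring_hom_one[OF f(1)] ring_hom_one[OF g(1)])
  next
    fix u assume "u \<in> carrier (tquot A B)"
    then obtain c where c: "u = AB.I +>\<^bsub>AB.T\<^esub> c" "c \<in> carrier AB.T" by (auto simp: quot_carrier)
    then show "tensor_map C D f g u \<in> carrier (tquot C D)"
      using map ring_hom_closed[OF CD.coset_hom ec] by (simp del: tensor_free_simps)
  qed
qed

lemma falg_tensor_pair: "falg \<phi> A \<Longrightarrow> falg \<phi> B \<Longrightarrow> tensor_pair A B"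
  by (simp add: tensor_pair_def falg_def)

lemma tensor_falg:
  assumes A: "falg \<phi> A" and B: "falg \<phi> B"
  shows "falg \<phi> (tensor A B)"
proof -
  interpret AB: tensor_pair A B using falg_tensor_pair[OF assms] .
  note m = tensor_map_pure[OF AB.tensor_pair_axioms AB.tensor_pair_axioms falgD(3)[OF A] falgD(4)[OF A]
    falgD(3)[OF B] falgD(4)[OF B]]
  show ?thesis unfolding falg_def
    using AB.cring_tensor m(1) AB.emb_tensor
    by (simp add: m(2) falgD[OF A] ring_hom_one[OF falgD(3)[OF B]])
qed

lemma tensor_map_falg_hom:
  assumes A: "falg \<phi> A" and B: "falg \<phi> B" and C: "falg \<phi> C" and f: "f \<in> falg_hom A C"
  shows "tensor_map C B f id \<in> falg_hom (tensor A B) (tensor C B)"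
    and "\<And>a b. a \<in> carrier A \<Longrightarrow> b \<in> carrier B \<Longrightarrow> tensor_map C B f id (pure A B a b) = pure C B (f a) b"
proof -
  interpret AB: tensor_pair A B using falg_tensor_pair[OF A B] .
  interpret CB: tensor_pair C B using falg_tensor_pair[OF C B] .
  note mA = tensor_map_pure[OF AB.tensor_pair_axioms AB.tensor_pair_axioms falgD(3)[OF A] falgD(4)[OF A]
    falgD(3)[OF B] falgD(4)[OF B]]
  note mC = tensor_map_pure[OF CB.tensor_pair_axioms CB.tensor_pair_axioms falgD(3)[OF C] falgD(4)[OF C]
    falgD(3)[OF B] falgD(4)[OF B]]
  note m = tensor_map_pure[OF AB.tensor_pair_axioms CB.tensor_pair_axioms falg_homD(1)[OF f],
    where \<psi> = "\<lambda>r. r" and g = id, OF falg_homD(3)[OF f] id_ring_hom, simplified id_apply, OF refl]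
  show p: "tensor_map C B f id (pure A B a b) = pure C B (f a) b" if "a \<in> carrier A" "b \<in> carrier B" for a b
    using m(2)[OF that] .
  have eq: "tensor_map C B f id (tensor_map A B (frob A) (frob B) u) =
      tensor_map C B (frob C) (frob B) (tensor_map C B f id u)" if "u \<in> carrier (tquot A B)" for u
  proof (rule AB.tensor_hom_unique[OF CB.Q.is_abelian_group _ _ _ that])
    show "(\<lambda>u. tensor_map C B f id (tensor_map A B (frob A) (frob B) u)) \<in> add_hom (tquot A B) (tquot C B)"
      using add_hom_comp[OF ring_hom_add_hom[OF mA(1)] ring_hom_add_hom[OF m(1)]] .
    show "(\<lambda>u. tensor_map C B (frob C) (frob B) (tensor_map C B f id u)) \<in> add_hom (tquot A B) (tquot C B)"
      using add_hom_comp[OF ring_hom_add_hom[OF m(1)] ring_hom_add_hom[OF mC(1)]] .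
    fix a b assume ab: "a \<in> carrier A" "b \<in> carrier B"
    show "tensor_map C B f id (tensor_map A B (frob A) (frob B) (pure A B a b)) =
        tensor_map C B (frob C) (frob B) (tensor_map C B f id (pure A B a b))"
      by (simp only: mA(2)[OF ab] p ab falgD(6)[OF A] falgD(6)[OF B] mC(2) falg_homD[OF f])
  qed
  show "tensor_map C B f id \<in> falg_hom (tensor A B) (tensor C B)"
    unfolding falg_hom_def using m(1) eq by (simp add: p falgD[OF A] falg_homD(3)[OF f])
qed

section \<open>The functor P\<close>

locale pfunctor =
  fixes p :: nat and \<phi> :: "'r::comm_ring_1 \<Rightarrow> 'r" and K :: "('r, 'k) frob_alg"
  assumes K: "falg \<phi> K"
begin

abbreviation KE :: "('r, 'a) frob_alg \<Rightarrow> ('r, nat \<Rightarrow> ('a \<times> 'k \<Rightarrow>\<^sub>0 int) set set) frob_alg" where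
  "KE A \<equiv> pcompl_alg p (tensor A K)"

abbreviation PC where "PC A \<equiv> pcompl_alg p (dlim (KE A))"

text \<open>The image of a pure tensor at stage 0 of the limit. By \<open>PC_hom_unique\<close>
  these elements determine Frobenius-compatible additive maps into complete targets with injective
  Frobenius.\<close>

definition gen :: "('r, 'a) frob_alg \<Rightarrow> 'a \<Rightarrow> 'k \<Rightarrow> nat \<Rightarrow> ((nat \<Rightarrow> ('a \<times> 'k \<Rightarrow>\<^sub>0 int) set set) \<times> nat) set set" where
  "gen A a l = pcompl_inj p (dlim (KE A)) (dlim_cls (KE A) (pcompl_inj p (tensor A K) (pure A K a l)) 0)"

definition Pmap where
  "Pmap B f = pcompl_map p (dlim (KE B)) (dlim_map (KE B) (pcompl_map p (tensor B K) (tensor_map B K f id)))"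

context
  fixes A :: "('r, 'a) frob_alg"
  assumes A: "falg \<phi> A"
begin

interpretation AK: tensor_pair A K using falg_tensor_pair[OF A K] .

lemma KE_falg: "falg \<phi> (KE A)"
  by (rule pcompl_falg[OF tensor_falg[OF A K]])

lemma PC_falg: "falg \<phi> (PC A)"
  by (rule pcompl_falg[OF dlim_falg[OF KE_falg]])

lemma PC_perfect: "perfect (PC A)"
  by (rule pcompl_perfect[OF dlim_falg[OF KE_falg] dlim_perfect[OF KE_falg]])

lemma PC_complete: "p_complete p (PC A)"
  using cring.p_complete_pcompl[OF dlim_cring[OF KE_falg]] by simp

private lemma t2: "falg \<phi> (tensor A K)" by (rule tensor_falg[OF A K])

definition gen0 where "gen0 u = pcompl_inj p (dlim (KE A)) (dlim_cls (KE A) (pcompl_inj p (tensor A K) u) 0)"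

lemma gen0_hom: "gen0 \<in> ring_hom (tquot A K) (PC A)"
  unfolding gen0_def
  using ring_hom_trans[OF ring_hom_trans[OF falg_homD(1)[OF pcompl_inj_falg_hom[OF t2]] dlim_cls_hom[OF KE_falg]]
     falg_homD(1)[OF pcompl_inj_falg_hom[OF dlim_falg[OF KE_falg]]], of p 0]
  unfolding comp_def tensor_ops(4) .

lemma gen_gen0: "gen A a l = gen0 (pure A K a l)"
  by (simp add: gen_def gen0_def)

lemma gen_closed [simp]: "a \<in> carrier A \<Longrightarrow> l \<in> carrier K \<Longrightarrow> gen A a l \<in> carrier (PC A)"
  unfolding gen_gen0 by (rule ring_hom_closed[OF gen0_hom]) simp

lemma gen_mult: "a \<in> carrier A \<Longrightarrow> l \<in> carrier K \<Longrightarrow> a' \<in> carrier A \<Longrightarrow> l' \<in> carrier K \<Longrightarrow>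
    gen A a l \<otimes>\<^bsub>PC A\<^esub> gen A a' l' = gen A (a \<otimes>\<^bsub>A\<^esub> a') (l \<otimes>\<^bsub>K\<^esub> l')"
  using ring_hom_mult[OF gen0_hom, of "pure A K a l" "pure A K a' l'"] by (simp add: gen_gen0 AK.pure_mult)

lemma gen_emb: "gen A (emb A r) \<one>\<^bsub>K\<^esub> = gen A \<one>\<^bsub>A\<^esub> (emb K r)"
  by (simp add: gen_gen0 AK.pure_emb)

lemma gen_l_hom: "(\<lambda>a. gen A a \<one>\<^bsub>K\<^esub>) \<in> ring_hom A (PC A)"
  unfolding gen_gen0 using ring_hom_trans[OF AK.pure_hom_l gen0_hom] by (simp add: comp_def)

lemma gen_r_hom: "(\<lambda>l. gen A \<one>\<^bsub>A\<^esub> l) \<in> ring_hom K (PC A)"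
  unfolding gen_gen0 using ring_hom_trans[OF AK.pure_hom_r gen0_hom] by (simp add: comp_def)

lemma frob_gen: "a \<in> carrier A \<Longrightarrow> l \<in> carrier K \<Longrightarrow> frob (PC A) (gen A a l) = gen A (frob A a) (frob K l)"
proof -
  assume al: "a \<in> carrier A" "l \<in> carrier K"
  note u = AK.pure_closed[OF al]
  have v: "pcompl_inj p (tensor A K) (pure A K a l) \<in> carrier (KE A)"
    using falg_homD(5)[OF pcompl_inj_falg_hom[OF t2], of "pure A K a l"] u by simp
  have "frob (PC A) (gen A a l) = pcompl_inj p (dlim (KE A)) (frob (dlim (KE A)) (dlim_cls (KE A) (pcompl_inj p (tensor A K) (pure A K a l)) 0))"
    unfolding gen_def
    using falg_homD(4)[OF pcompl_inj_falg_hom[OF dlim_falg[OF KE_falg]] dlim_cls_closed[OF KE_falg v]] by simp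
  also have "\<dots> = pcompl_inj p (dlim (KE A)) (dlim_cls (KE A) (frob (KE A) (pcompl_inj p (tensor A K) (pure A K a l))) 0)"
    by (simp only: dlim_frob[OF KE_falg v])
  also have "frob (KE A) (pcompl_inj p (tensor A K) (pure A K a l)) = pcompl_inj p (tensor A K) (frob (tensor A K) (pure A K a l))"
    using falg_homD(4)[OF pcompl_inj_falg_hom[OF t2], of "pure A K a l"] u by simp
  also have "frob (tensor A K) (pure A K a l) = pure A K (frob A a) (frob K l)"
    using tensor_map_pure(2)[OF AK.tensor_pair_axioms AK.tensor_pair_axioms falgD(3)[OF A] falgD(4)[OF A]
      falgD(3)[OF K] falgD(4)[OF K] al] by simp
  finally show ?thesis by (simp only: gen_def)
qed

text \<open>The layers are removed from the inside: pure tensors determine the map on the tensor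
  product, separatedness of the target extends this to the completion, injectivity of its Frobenius
  to the limit, and separatedness once more to the outer completion.\<close>

lemma PC_hom_unique:
  fixes T :: "('s, 't) frob_alg"
  assumes T: "cring T" "p_complete p T" "inj_on (frob T) (carrier T)"
    and F: "F \<in> add_hom (PC A) T" "\<And>u. u \<in> carrier (PC A) \<Longrightarrow> F (frob (PC A) u) = frob T (F u)"
    and G: "G \<in> add_hom (PC A) T" "\<And>u. u \<in> carrier (PC A) \<Longrightarrow> G (frob (PC A) u) = frob T (G u)"
    and eq: "\<And>a l. a \<in> carrier A \<Longrightarrow> l \<in> carrier K \<Longrightarrow> F (gen A a l) = G (gen A a l)"
    and u: "u \<in> carrier (PC A)"
  shows "F u = G u"
proof -
  interpret T: cring T by fact
  let ?D = "dlim (KE A)" and ?i = "pcompl_inj p (dlim (KE A))" and ?j = "pcompl_inj p (tensor A K)"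
  have i: "?i \<in> falg_hom ?D (PC A)" by (rule pcompl_inj_falg_hom[OF dlim_falg[OF KE_falg]])
  have j: "?j \<in> falg_hom (tensor A K) (KE A)" by (rule pcompl_inj_falg_hom[OF t2])
  have c: "(\<lambda>v. dlim_cls (KE A) v 0) \<in> add_hom (KE A) ?D"
    by (rule ring_hom_add_hom[OF dlim_cls_hom[OF KE_falg]])
  note Fi = add_hom_comp[OF falg_homD(2)[OF i] F(1)] and Gi = add_hom_comp[OF falg_homD(2)[OF i] G(1)]
  note Fc = add_hom_comp[OF c Fi] and Gc = add_hom_comp[OF c Gi]
  note Fj = add_hom_comp[OF falg_homD(2)[OF j] Fc] and Gj = add_hom_comp[OF falg_homD(2)[OF j] Gc]
  have 1: "F (?i (dlim_cls (KE A) (?j w) 0)) = G (?i (dlim_cls (KE A) (?j w) 0))" if "w \<in> carrier (tquot A K)" for w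
    by (rule AK.tensor_hom_unique[OF T.is_abelian_group Fj[unfolded tensor_ops(6)] Gj[unfolded tensor_ops(6)] _ that])
      (use eq in \<open>simp add: gen_def\<close>)
  have 2: "F (?i (dlim_cls (KE A) v 0)) = G (?i (dlim_cls (KE A) v 0))" if "v \<in> carrier (KE A)" for v
    by (rule p_complete_hom_unique[OF falgD(1)[OF t2] T(1,2) Fc[unfolded pcompl_alg_ops] Gc[unfolded pcompl_alg_ops] _
        that[unfolded pcompl_alg_ops]]) (use 1 in simp)
  have 3: "F (?i w) = G (?i w)" if "w \<in> carrier ?D" for w
  proof (rule dlim_hom_unique[where G = "\<lambda>w. F (?i w)" and H = "\<lambda>w. G (?i w)", OF KE_falg T(3) _ _ _ _ 2 that])
    show "(\<lambda>w. F (?i w)) \<in> carrier ?D \<rightarrow> carrier T" using Fi by (auto simp: add_hom_def)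
    show "(\<lambda>w. G (?i w)) \<in> carrier ?D \<rightarrow> carrier T" using Gi by (auto simp: add_hom_def)
    show "F (?i (frob ?D u)) = frob T (F (?i u))" if "u \<in> carrier ?D" for u
      using F(2)[OF falg_homD(5)[OF i that]] falg_homD(4)[OF i that] by simp
    show "G (?i (frob ?D u)) = frob T (G (?i u))" if "u \<in> carrier ?D" for u
      using G(2)[OF falg_homD(5)[OF i that]] falg_homD(4)[OF i that] by simp
  qed
  show ?thesis
    by (rule p_complete_hom_unique[OF dlim_cring[OF KE_falg] T(1,2) F(1)[unfolded pcompl_alg_ops] G(1)[unfolded pcompl_alg_ops] 3
      u[unfolded pcompl_alg_ops]])
qed

text \<open>Balanced maps extend through the four layers: to the tensor product, by
  \<open>pext\<close> to its completion, by \<open>dext\<close> to the limit and by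
  \<open>pext\<close> again. At each layer the compatibility with the Frobenius has to be carried
  along, because \<open>dext\<close> consumes it.\<close>

lemma PC_hom_exists:
  fixes T :: "('s, 't) frob_alg"
  assumes T: "cring T" "p_complete p T" "frob T \<in> ring_hom T T" "perfect T"
    and bc: "\<And>a l. a \<in> carrier A \<Longrightarrow> l \<in> carrier K \<Longrightarrow> \<beta> a l \<in> carrier T"
    and b1: "\<And>a a' l. a \<in> carrier A \<Longrightarrow> a' \<in> carrier A \<Longrightarrow> l \<in> carrier K \<Longrightarrow>
      \<beta> (a \<oplus>\<^bsub>A\<^esub> a') l = \<beta> a l \<oplus>\<^bsub>T\<^esub> \<beta> a' l"
    and b2: "\<And>a l l'. a \<in> carrier A \<Longrightarrow> l \<in> carrier K \<Longrightarrow> l' \<in> carrier K \<Longrightarrow>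
      \<beta> a (l \<oplus>\<^bsub>K\<^esub> l') = \<beta> a l \<oplus>\<^bsub>T\<^esub> \<beta> a l'"
    and b3: "\<And>r a l. a \<in> carrier A \<Longrightarrow> l \<in> carrier K \<Longrightarrow>
      \<beta> (emb A r \<otimes>\<^bsub>A\<^esub> a) l = \<beta> a (emb K r \<otimes>\<^bsub>K\<^esub> l)"
    and bf: "\<And>a l. a \<in> carrier A \<Longrightarrow> l \<in> carrier K \<Longrightarrow> \<beta> (frob A a) (frob K l) = frob T (\<beta> a l)"
  obtains F where "F \<in> add_hom (PC A) T" "\<And>a l. a \<in> carrier A \<Longrightarrow> l \<in> carrier K \<Longrightarrow> F (gen A a l) = \<beta> a l"
    "\<And>u. u \<in> carrier (PC A) \<Longrightarrow> F (frob (PC A) u) = frob T (F u)"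
proof -
  interpret T: cring T by fact
  let ?D = "dlim (KE A)" and ?i = "pcompl_inj p (dlim (KE A))" and ?j = "pcompl_inj p (tensor A K)"
  have i: "?i \<in> falg_hom ?D (PC A)" by (rule pcompl_inj_falg_hom[OF dlim_falg[OF KE_falg]])
  have j: "?j \<in> falg_hom (tensor A K) (KE A)" by (rule pcompl_inj_falg_hom[OF t2])
  note fT = ring_hom_add_hom[OF T(3)]
  obtain h where h: "h \<in> add_hom (tquot A K) T" "\<And>a l. a \<in> carrier A \<Longrightarrow> l \<in> carrier K \<Longrightarrow> h (pure A K a l) = \<beta> a l"
    using AK.tensor_hom_exists[OF T.is_abelian_group bc b1 b2 b3] by blast
  have ft: "frob (tensor A K) \<in> add_hom (tquot A K) (tquot A K)"
    using ring_hom_add_hom[OF falgD(3)[OF t2]] by (simp only: tensor_ops)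
  have fp: "frob (tensor A K) (pure A K a l) = pure A K (frob A a) (frob K l)" if "a \<in> carrier A" "l \<in> carrier K" for a l
    using tensor_map_pure(2)[OF AK.tensor_pair_axioms AK.tensor_pair_axioms falgD(3)[OF A] falgD(4)[OF A]
      falgD(3)[OF K] falgD(4)[OF K] that] by simp
  have hf: "h (frob (tensor A K) u) = frob T (h u)" if "u \<in> carrier (tquot A K)" for u
    by (rule AK.tensor_hom_unique[OF T.is_abelian_group add_hom_comp[OF ft h(1)] add_hom_comp[OF h(1) fT] _ that])
      (simp only: fp h(2) bf falgD(6)[OF A] falgD(6)[OF K])
  have ht: "h \<in> add_hom (tensor A K) T" using h(1) by simp
  define H where "H = pext p T h"
  have H: "H \<in> add_hom (KE A) T"
    using pext_add_hom[OF falgD(1)[OF t2] T(1,2) ht] by (simp add: H_def)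
  have Hj: "H (?j u) = h u" if "u \<in> carrier (tquot A K)" for u
    using pext_inj[OF falgD(1)[OF t2] T(1,2) ht, of u] that by (simp add: H_def)
  have fK: "frob (KE A) \<in> add_hom (KE A) (KE A)" by (rule ring_hom_add_hom[OF falgD(3)[OF KE_falg]])
  have Hf: "H (frob (KE A) v) = frob T (H v)" if "v \<in> carrier (KE A)" for v
  proof (rule p_complete_hom_unique[OF falgD(1)[OF t2] T(1,2) add_hom_comp[OF fK H, unfolded pcompl_alg_ops]
        add_hom_comp[OF H fT, unfolded pcompl_alg_ops] _ that[unfolded pcompl_alg_ops]])
    fix u assume "u \<in> carrier (tensor A K)"
    then have u: "u \<in> carrier (tquot A K)" "u \<in> carrier (tensor A K)" by simp_all
    have fu: "frob (tensor A K) u \<in> carrier (tquot A K)" using falgD(6)[OF t2 u(2)] by simp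
    show "H (frob (KE A) (?j u)) = frob T (H (?j u))"
      unfolding falg_homD(4)[OF j u(2), symmetric] Hj[OF fu] Hj[OF u(1)] using hf[OF u(1)] .
  qed
  define E where "E = dext T H"
  note dx0 = dext[where h = H, OF KE_falg T(1,3,4) H, folded E_def]
  have dx1: "E \<in> add_hom ?D T" by (rule dx0(1)) (rule Hf)
  have dx2: "(frob T ^^ i) (E (dlim_cls (KE A) a i)) = H a" if "a \<in> carrier (KE A)" for a i
    by (rule dx0(2)[OF _ that]) (rule Hf)
  have dx3: "E (frob ?D u) = frob T (E u)" if "u \<in> carrier ?D" for u by (rule dx0(3)[OF _ that]) (rule Hf)
  define F where "F = pext p T E"
  have F: "F \<in> add_hom (PC A) T" using pext_add_hom[OF dlim_cring[OF KE_falg] T(1,2) dx1] by (simp add: F_def)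
  have Fi: "F (?i w) = E w" if "w \<in> carrier ?D" for w
    using pext_inj[OF dlim_cring[OF KE_falg] T(1,2) dx1 that] by (simp add: F_def)
  have fP: "frob (PC A) \<in> add_hom (PC A) (PC A)" by (rule ring_hom_add_hom[OF falgD(3)[OF PC_falg]])
  show ?thesis
  proof (rule that[OF F])
    fix a l assume al: "a \<in> carrier A" "l \<in> carrier K"
    have v: "?j (pure A K a l) \<in> carrier (KE A)"
      using falg_homD(5)[OF j, of "pure A K a l"] al by simp
    show "F (gen A a l) = \<beta> a l"
      unfolding gen_def using Fi[OF dlim_cls_closed[OF KE_falg v]] dx2[OF v, of 0] Hj[of "pure A K a l"] h(2)[OF al] al by simp
  next
    fix u assume u: "u \<in> carrier (PC A)"
    show "F (frob (PC A) u) = frob T (F u)"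
    proof (rule p_complete_hom_unique[OF dlim_cring[OF KE_falg] T(1,2) add_hom_comp[OF fP F, unfolded pcompl_alg_ops]
        add_hom_comp[OF F fT, unfolded pcompl_alg_ops] _ u[unfolded pcompl_alg_ops]])
      fix w assume w: "w \<in> carrier ?D"
      show "F (frob (PC A) (?i w)) = frob T (F (?i w))"
        unfolding falg_homD(4)[OF i w, symmetric] Fi[OF w] Fi[OF falgD(6)[OF dlim_falg[OF KE_falg] w]] by (rule dx3[OF w])
    qed
  qed
qed

end

lemma gen_split:
  fixes B :: "('r, 'b) frob_alg"
  assumes B: "falg \<phi> B" "b \<in> carrier B" "l \<in> carrier K"
  shows "gen B b \<one>\<^bsub>K\<^esub> \<otimes>\<^bsub>PC B\<^esub> gen B \<one>\<^bsub>B\<^esub> l = gen B b l"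
proof -
  interpret B: cring B using falgD(1)[OF B(1)] .
  interpret K: cring K using falgD(1)[OF K] .
  show ?thesis using gen_mult[OF B(1,2) K.one_closed B.one_closed B(3)] B by simp
qed

lemma Pmap_hom:
  fixes A :: "('r, 'a) frob_alg" and B :: "('r, 'b) frob_alg"
  assumes A: "falg \<phi> A" and B: "falg \<phi> B" and f: "f \<in> falg_hom A B"
  shows "Pmap B f \<in> falg_hom (PC A) (PC B)"
    and "\<And>a l. a \<in> carrier A \<Longrightarrow> l \<in> carrier K \<Longrightarrow> Pmap B f (gen A a l) = gen B (f a) l"
proof -
  interpret AK: tensor_pair A K using falg_tensor_pair[OF A K] .
  note tA = tensor_falg[OF A K] and tB = tensor_falg[OF B K]
  note t = tensor_map_falg_hom[OF A K B f]
  note e = pcompl_map_falg_hom[OF tA tB t(1), of p]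
  note d = dlim_map_falg_hom[OF KE_falg[OF A] KE_falg[OF B] e]
  show "Pmap B f \<in> falg_hom (PC A) (PC B)"
    unfolding Pmap_def by (rule pcompl_map_falg_hom[OF dlim_falg[OF KE_falg[OF A]] dlim_falg[OF KE_falg[OF B]] d])
  fix a l assume al: "a \<in> carrier A" "l \<in> carrier K"
  have u: "pure A K a l \<in> carrier (tensor A K)" using al by simp
  have v: "pcompl_inj p (tensor A K) (pure A K a l) \<in> carrier (KE A)"
    using falg_homD(5)[OF pcompl_inj_falg_hom[OF tA] u] .
  show "Pmap B f (gen A a l) = gen B (f a) l"
    unfolding Pmap_def gen_def
    by (simp only: pcompl_map_inj[OF dlim_cring[OF KE_falg[OF A]] dlim_cring[OF KE_falg[OF B]] falg_homD(2)[OF d]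
        dlim_cls_closed[OF KE_falg[OF A] v]] dlim_map_cls[OF KE_falg[OF A] KE_falg[OF B] e v]
        pcompl_map_inj[OF falgD(1)[OF tA] falgD(1)[OF tB] falg_homD(2)[OF t(1)] u] t(2)[OF al])
qed

lemma PC_inj_frob: "falg \<phi> A \<Longrightarrow> inj_on (frob (PC A)) (carrier (PC A))" for A :: "('r, 'a) frob_alg"
  using PC_perfect[of A] by (simp only: perfect_def bij_betw_def)

lemma Pmap_unique:
  fixes A :: "('r, 'a) frob_alg" and B :: "('r, 'b) frob_alg"
  assumes A: "falg \<phi> A" and B: "falg \<phi> B" and F: "F \<in> falg_hom (PC A) (PC B)" and G: "G \<in> falg_hom (PC A) (PC B)"
    and eq: "\<And>a l. a \<in> carrier A \<Longrightarrow> l \<in> carrier K \<Longrightarrow> F (gen A a l) = G (gen A a l)"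
    and u: "u \<in> carrier (PC A)"
  shows "F u = G u"
  by (rule PC_hom_unique[OF A falgD(1)[OF PC_falg[OF B]] PC_complete[OF B] PC_inj_frob[OF B]
      falg_homD(2)[OF F] falg_homD(4)[OF F] falg_homD(2)[OF G] falg_homD(4)[OF G] eq u])

lemma falg_hom_comp: "f \<in> falg_hom A B \<Longrightarrow> g \<in> falg_hom B C \<Longrightarrow> (\<lambda>x. g (f x)) \<in> falg_hom A C"
  using ring_hom_trans[of f A B g C] ring_hom_closed[of f A B] by (auto simp: falg_hom_def comp_def)

text \<open>Functoriality, phrased with an \<open>h\<close> that agrees with the composite on the
  carrier only; this avoids having to deal with values outside it.\<close>

lemma Pmap_comp:
  fixes A :: "('r, 'a) frob_alg" and B :: "('r, 'b) frob_alg" and C :: "('r, 'c) frob_alg"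
  assumes A: "falg \<phi> A" and B: "falg \<phi> B" and C: "falg \<phi> C" and f: "f \<in> falg_hom A B" and g: "g \<in> falg_hom B C"
    and h: "h \<in> falg_hom A C" "\<And>a. a \<in> carrier A \<Longrightarrow> g (f a) = h a" and u: "u \<in> carrier (PC A)"
  shows "Pmap C g (Pmap B f u) = Pmap C h u"
  by (rule Pmap_unique[OF A C falg_hom_comp[OF Pmap_hom(1)[OF A B f] Pmap_hom(1)[OF B C g]] Pmap_hom(1)[OF A C h(1)] _ u])
    (simp add: Pmap_hom(2)[OF A B f] Pmap_hom(2)[OF B C g] Pmap_hom(2)[OF A C h(1)] falg_homD(5)[OF f] h(2))

section \<open>The completed direct limit of A, and its image under P\<close>

context
  fixes A :: "('r, 'a) frob_alg"
  assumes A: "falg \<phi> A"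
begin

abbreviation (input) CH where "CH \<equiv> pcompl_alg p (dlim A)"

definition can where "can y = pcompl_inj p (dlim A) (dlim_cls A y 0)"

lemma CH_falg: "falg \<phi> CH"
  by (rule pcompl_falg[OF dlim_falg[OF A]])

lemma can_hom: "can \<in> falg_hom A CH"
proof -
  have "(\<lambda>a. dlim_cls A a 0) \<in> falg_hom A (dlim A)"
    using dlim_cls_hom[OF A, of 0] by (simp add: falg_hom_def dlim_emb[OF A] dlim_frob[OF A])
  from falg_hom_comp[OF this pcompl_inj_falg_hom[OF dlim_falg[OF A]]] show ?thesis by (simp only: can_def[abs_def])
qed

text \<open>\<open>CH\<close> is the universal complete perfect algebra under \<open>A\<close>: a
  homomorphism into such an algebra extends through the limit by \<open>dext\<close> and through the
  completion by \<open>pext\<close>.\<close>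

lemma CH_hom_exists:
  fixes T :: "('r, 't) frob_alg"
  assumes T: "falg \<phi> T" "p_complete p T" "perfect T" and f: "f \<in> falg_hom A T"
  obtains g where "g \<in> falg_hom CH T" "\<And>a. a \<in> carrier A \<Longrightarrow> g (can a) = f a"
proof -
  interpret T: cring T using falgD(1)[OF T(1)] .
  note dx0 = dext[where h = f, OF A T.is_cring falgD(3)[OF T(1)] T(3) falg_homD(2)[OF f]]
  have dx1: "dext T f \<in> add_hom (dlim A) T" by (rule dx0(1)) (rule falg_homD(4)[OF f])
  have dx2: "(frob T ^^ i) (dext T f (dlim_cls A a i)) = f a" if "a \<in> carrier A" for a i
    by (rule dx0(2)[OF _ that]) (rule falg_homD(4)[OF f])
  have dx3: "dext T f (frob (dlim A) u) = frob T (dext T f u)" if "u \<in> carrier (dlim A)" for u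
    by (rule dx0(3)[OF _ that]) (rule falg_homD(4)[OF f])
  have dx4: "dext T f \<in> ring_hom (dlim A) T" by (rule dx0(4)[OF _ falg_homD(1)[OF f]]) (rule falg_homD(4)[OF f])
  define g where "g = pext p T (dext T f)"
  have gr: "g \<in> ring_hom CH T"
    using pext_ring_hom[OF dlim_cring[OF A] T.is_cring T(2) dx4] by (simp add: g_def)
  have gi: "g (pcompl_inj p (dlim A) u) = dext T f u" if "u \<in> carrier (dlim A)" for u
    using pext_inj[OF dlim_cring[OF A] T.is_cring T(2) dx1 that] by (simp add: g_def)
  have gc: "g (can a) = f a" if "a \<in> carrier A" for a
    using gi[OF dlim_cls_closed[OF A that]] dx2[OF that, of 0] by (simp add: can_def)
  have ge: "g (emb CH r) = emb T r" for r
    using gc[OF falgD(5)[OF A]] falg_homD(3)[OF can_hom] falg_homD(3)[OF f] by metis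
  note i = pcompl_inj_falg_hom[OF dlim_falg[OF A], of p]
  have gf: "g (frob CH s) = frob T (g s)" if "s \<in> carrier CH" for s
  proof (rule p_complete_hom_unique[OF dlim_cring[OF A] T.is_cring T(2)
        add_hom_comp[OF ring_hom_add_hom[OF falgD(3)[OF CH_falg]] ring_hom_add_hom[OF gr], unfolded pcompl_alg_ops]
        add_hom_comp[OF ring_hom_add_hom[OF gr] ring_hom_add_hom[OF falgD(3)[OF T(1)]], unfolded pcompl_alg_ops]
        _ that[unfolded pcompl_alg_ops]])
    fix u assume u: "u \<in> carrier (dlim A)"
    show "g (frob CH (pcompl_inj p (dlim A) u)) = frob T (g (pcompl_inj p (dlim A) u))"
      unfolding falg_homD(4)[OF i u, symmetric] gi[OF u] gi[OF falgD(6)[OF dlim_falg[OF A] u]] by (rule dx3[OF u])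
  qed
  show ?thesis by (rule that[of g]) (use gr gc ge gf in \<open>simp_all add: falg_hom_def del: pcompl_alg_ops pcompl_alg_simps\<close>)
qed

lemma CH_hom_unique:
  fixes T :: "('s, 't) frob_alg"
  assumes T: "cring T" "p_complete p T" "inj_on (frob T) (carrier T)"
    and F: "F \<in> add_hom CH T" "\<And>u. u \<in> carrier CH \<Longrightarrow> F (frob CH u) = frob T (F u)"
    and G: "G \<in> add_hom CH T" "\<And>u. u \<in> carrier CH \<Longrightarrow> G (frob CH u) = frob T (G u)"
    and eq: "\<And>a. a \<in> carrier A \<Longrightarrow> F (can a) = G (can a)"
    and u: "u \<in> carrier CH"
  shows "F u = G u"
proof (rule p_complete_hom_unique[OF dlim_cring[OF A] T(1,2) F(1)[unfolded pcompl_alg_ops] G(1)[unfolded pcompl_alg_ops] _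
      u[unfolded pcompl_alg_ops]])
  note i = pcompl_inj_falg_hom[OF dlim_falg[OF A], of p]
  fix w assume w: "w \<in> carrier (dlim A)"
  show "F (pcompl_inj p (dlim A) w) = G (pcompl_inj p (dlim A) w)"
  proof (rule dlim_hom_unique[where G = "\<lambda>w. F (pcompl_inj p (dlim A) w)" and H = "\<lambda>w. G (pcompl_inj p (dlim A) w)", OF A T(3) _ _ _ _ _ w])
    show "(\<lambda>w. F (pcompl_inj p (dlim A) w)) \<in> carrier (dlim A) \<rightarrow> carrier T"
      using add_hom_comp[OF falg_homD(2)[OF i] F(1)] by (auto simp: add_hom_def)
    show "(\<lambda>w. G (pcompl_inj p (dlim A) w)) \<in> carrier (dlim A) \<rightarrow> carrier T"
      using add_hom_comp[OF falg_homD(2)[OF i] G(1)] by (auto simp: add_hom_def)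
    show "F (pcompl_inj p (dlim A) (frob (dlim A) u)) = frob T (F (pcompl_inj p (dlim A) u))" if "u \<in> carrier (dlim A)" for u
      using F(2)[OF falg_homD(5)[OF i that]] falg_homD(4)[OF i that] by simp
    show "G (pcompl_inj p (dlim A) (frob (dlim A) u)) = frob T (G (pcompl_inj p (dlim A) u))" if "u \<in> carrier (dlim A)" for u
      using G(2)[OF falg_homD(5)[OF i that]] falg_homD(4)[OF i that] by simp
    show "F (pcompl_inj p (dlim A) (dlim_cls A a 0)) = G (pcompl_inj p (dlim A) (dlim_cls A a 0))" if "a \<in> carrier A" for a
      using eq[OF that] by (simp add: can_def)
  qed
qed

text \<open>\<open>PC A\<close> is itself complete and perfect, so it already receives a map from
  \<open>CH\<close>; combined with the image of \<open>K\<close> this gives an inverse. This is the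
  identification used to turn a map into \<open>C_hat\<close> into a cocharacter.\<close>

lemma PC_can_bij: "bij_betw (Pmap CH can) (carrier (PC A)) (carrier (PC CH))"
proof -
  note P = PC_falg[OF A] and Pc = PC_complete[OF A] and Pp = PC_perfect[OF A] and Pi = PC_inj_frob[OF A]
  interpret PA: cring "PC A" using falgD(1)[OF P] .
  interpret K: cring K using falgD(1)[OF K] .
  interpret A: cring A using falgD(1)[OF A] .
  interpret H: cring CH using falgD(1)[OF CH_falg] .
  note hm = Pmap_hom[OF A CH_falg can_hom]
  have io: "(\<lambda>a. gen A a \<one>\<^bsub>K\<^esub>) \<in> falg_hom A (PC A)"
  proof -
    have "gen A (emb A r) \<one>\<^bsub>K\<^esub> = emb (PC A) r" for r
      by (simp add: gen_def ring_hom_one[OF falgD(2)[OF K]] dlim_emb[OF KE_falg[OF A]])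
    moreover have "gen A (frob A a) \<one>\<^bsub>K\<^esub> = frob (PC A) (gen A a \<one>\<^bsub>K\<^esub>)" if "a \<in> carrier A" for a
      using frob_gen[OF A that K.one_closed] ring_hom_one[OF falgD(3)[OF K]] by metis
    ultimately show ?thesis using gen_l_hom[OF A] unfolding falg_hom_def by blast
  qed
  \<comment> \<open>The universal property of \<open>CH\<close>, applied to the map of
    \<open>A\<close> into \<open>PC A\<close>.\<close>
  obtain \<gamma> where \<gamma>: "\<gamma> \<in> falg_hom CH (PC A)" "\<And>a. a \<in> carrier A \<Longrightarrow> \<gamma> (can a) = gen A a \<one>\<^bsub>K\<^esub>"
    using CH_hom_exists[OF P Pc Pp io] by blast
  let ?k = "\<lambda>l. gen A \<one>\<^bsub>A\<^esub> l"
  have kc: "l \<in> carrier K \<Longrightarrow> ?k l \<in> carrier (PC A)" for l by (rule gen_closed[OF A A.one_closed])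
  note gc = falg_homD(5)[OF \<gamma>(1)]
  \<comment> \<open>The inverse sends the image of c \<otimes> l to \<gamma>(c) times the image of
    l. Only its additivity is requested; being a two-sided inverse is checked on
    \<open>gen\<close>.\<close>
  obtain G where G: "G \<in> add_hom (PC CH) (PC A)"
    "\<And>c l. c \<in> carrier CH \<Longrightarrow> l \<in> carrier K \<Longrightarrow> G (gen CH c l) = \<gamma> c \<otimes>\<^bsub>PC A\<^esub> ?k l"
    "\<And>u. u \<in> carrier (PC CH) \<Longrightarrow> G (frob (PC CH) u) = frob (PC A) (G u)"
  proof (rule PC_hom_exists[OF CH_falg PA.is_cring Pc falgD(3)[OF P] Pp, where \<beta> = "\<lambda>c l. \<gamma> c \<otimes>\<^bsub>PC A\<^esub> ?k l"])
    fix c l assume cl: "c \<in> carrier CH" "l \<in> carrier K"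
    show "\<gamma> c \<otimes>\<^bsub>PC A\<^esub> ?k l \<in> carrier (PC A)" by (rule PA.m_closed[OF gc[OF cl(1)] kc[OF cl(2)]])
    show "\<gamma> (frob CH c) \<otimes>\<^bsub>PC A\<^esub> ?k (frob K l) = frob (PC A) (\<gamma> c \<otimes>\<^bsub>PC A\<^esub> ?k l)"
      using frob_gen[OF A A.one_closed cl(2)] ring_hom_one[OF falgD(3)[OF A]]
      by (simp only: falg_homD(4)[OF \<gamma>(1) cl(1)] ring_hom_mult[OF falgD(3)[OF P] gc[OF cl(1)] kc[OF cl(2)]])
    fix c' assume c': "c' \<in> carrier CH"
    show "\<gamma> (c \<oplus>\<^bsub>CH\<^esub> c') \<otimes>\<^bsub>PC A\<^esub> ?k l = \<gamma> c \<otimes>\<^bsub>PC A\<^esub> ?k l \<oplus>\<^bsub>PC A\<^esub> \<gamma> c' \<otimes>\<^bsub>PC A\<^esub> ?k l"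
      by (simp only: ring_hom_add[OF falg_homD(1)[OF \<gamma>(1)] cl(1) c'] PA.l_distr[OF gc[OF cl(1)] gc[OF c'] kc[OF cl(2)]])
  next
    fix c l l' assume cl: "c \<in> carrier CH" "l \<in> carrier K" "l' \<in> carrier K"
    show "\<gamma> c \<otimes>\<^bsub>PC A\<^esub> ?k (l \<oplus>\<^bsub>K\<^esub> l') = \<gamma> c \<otimes>\<^bsub>PC A\<^esub> ?k l \<oplus>\<^bsub>PC A\<^esub> \<gamma> c \<otimes>\<^bsub>PC A\<^esub> ?k l'"
      by (simp only: ring_hom_add[OF gen_r_hom[OF A] cl(2,3)] PA.r_distr[OF kc[OF cl(2)] kc[OF cl(3)] gc[OF cl(1)]])
  next
    fix r c l assume cl: "c \<in> carrier CH" "l \<in> carrier K"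
    have e: "\<gamma> (emb CH r) = ?k (emb K r)"
      using falg_homD(3)[OF \<gamma>(1), of r] falg_homD(3)[OF io, of r] gen_emb[OF A, of r] by metis
    have "\<gamma> (emb CH r \<otimes>\<^bsub>CH\<^esub> c) \<otimes>\<^bsub>PC A\<^esub> ?k l = ?k (emb K r) \<otimes>\<^bsub>PC A\<^esub> \<gamma> c \<otimes>\<^bsub>PC A\<^esub> ?k l"
      by (simp only: ring_hom_mult[OF falg_homD(1)[OF \<gamma>(1)] falgD(5)[OF CH_falg] cl(1)] e)
    also have "\<dots> = \<gamma> c \<otimes>\<^bsub>PC A\<^esub> (?k (emb K r) \<otimes>\<^bsub>PC A\<^esub> ?k l)"
      using PA.m_comm[OF kc[OF falgD(5)[OF K]] gc[OF cl(1)]] PA.m_assoc[OF gc[OF cl(1)] kc[OF falgD(5)[OF K]] kc[OF cl(2)]]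
      by metis
    also have "?k (emb K r) \<otimes>\<^bsub>PC A\<^esub> ?k l = ?k (emb K r \<otimes>\<^bsub>K\<^esub> l)"
      by (simp only: ring_hom_mult[OF gen_r_hom[OF A] falgD(5)[OF K] cl(2)])
    finally show "\<gamma> (emb CH r \<otimes>\<^bsub>CH\<^esub> c) \<otimes>\<^bsub>PC A\<^esub> ?k l = \<gamma> c \<otimes>\<^bsub>PC A\<^esub> ?k (emb K r \<otimes>\<^bsub>K\<^esub> l)" .
  qed blast
  have id: "(\<lambda>u. u) \<in> add_hom (PC A) (PC A)" "(\<lambda>u. u) \<in> add_hom (PC CH) (PC CH)"
    by (auto simp: add_hom_def)
  have 1: "G (Pmap CH can u) = u" if u: "u \<in> carrier (PC A)" for u
  proof (rule PC_hom_unique[OF A PA.is_cring Pc Pi add_hom_comp[OF falg_homD(2)[OF hm(1)] G(1)] _ id(1) _ _ u])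
    show "G (Pmap CH can (frob (PC A) u)) = frob (PC A) (G (Pmap CH can u))" if "u \<in> carrier (PC A)" for u
      by (simp only: falg_homD(4)[OF hm(1) that] G(3)[OF falg_homD(5)[OF hm(1) that]])
    fix a l assume al: "a \<in> carrier A" "l \<in> carrier K"
    show "G (Pmap CH can (gen A a l)) = gen A a l"
      by (simp only: hm(2)[OF al] G(2)[OF falg_homD(5)[OF can_hom al(1)] al(2)] \<gamma>(2)[OF al(1)] gen_split[OF A al])
  qed (rule refl)
  have Hf: "falg \<phi> CH" by (rule CH_falg)
  interpret PH: cring "PC CH" using falgD(1)[OF PC_falg[OF Hf]] .
  have cone: "can \<one>\<^bsub>A\<^esub> = \<one>\<^bsub>CH\<^esub>" by (rule ring_hom_one[OF falg_homD(1)[OF can_hom]])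
  have iH: "(\<lambda>c. gen CH c \<one>\<^bsub>K\<^esub>) \<in> ring_hom CH (PC CH)" by (rule gen_l_hom[OF Hf])
  \<comment> \<open>Both sides are additive and commute with the Frobenius, so it is enough to
    compare them on the image of \<open>A\<close> in \<open>CH\<close>.\<close>
  have 3: "Pmap CH can (\<gamma> c) = gen CH c \<one>\<^bsub>K\<^esub>" if c: "c \<in> carrier CH" for c
  proof (rule CH_hom_unique[OF PH.is_cring PC_complete[OF Hf] PC_inj_frob[OF Hf]
        add_hom_comp[OF falg_homD(2)[OF \<gamma>(1)] falg_homD(2)[OF hm(1)]] _ ring_hom_add_hom[OF iH] _ _ c])
    show "Pmap CH can (\<gamma> (frob CH u)) = frob (PC CH) (Pmap CH can (\<gamma> u))" if "u \<in> carrier CH" for u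
      by (simp only: falg_homD(4)[OF \<gamma>(1) that] falg_homD(4)[OF hm(1) gc[OF that]])
    show "gen CH (frob CH u) \<one>\<^bsub>K\<^esub> = frob (PC CH) (gen CH u \<one>\<^bsub>K\<^esub>)" if "u \<in> carrier CH" for u
      using frob_gen[OF Hf that K.one_closed] ring_hom_one[OF falgD(3)[OF K]] by metis
    show "Pmap CH can (\<gamma> (can a)) = gen CH (can a) \<one>\<^bsub>K\<^esub>" if "a \<in> carrier A" for a
      by (simp only: \<gamma>(2)[OF that] hm(2)[OF that K.one_closed])
  qed
  have 2: "Pmap CH can (G u) = u" if u: "u \<in> carrier (PC CH)" for u
  proof (rule PC_hom_unique[OF Hf PH.is_cring PC_complete[OF Hf] PC_inj_frob[OF Hf]
        add_hom_comp[OF G(1) falg_homD(2)[OF hm(1)]] _ id(2) _ _ u])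
    show "Pmap CH can (G (frob (PC CH) u)) = frob (PC CH) (Pmap CH can (G u))" if "u \<in> carrier (PC CH)" for u
      by (simp only: G(3)[OF that] falg_homD(4)[OF hm(1) add_hom_closed[OF G(1) that]])
    fix c l assume cl: "c \<in> carrier CH" "l \<in> carrier K"
    show "Pmap CH can (G (gen CH c l)) = gen CH c l"
      by (simp only: G(2)[OF cl] ring_hom_mult[OF falg_homD(1)[OF hm(1)] gc[OF cl(1)] kc[OF cl(2)]]
          3[OF cl(1)] hm(2)[OF A.one_closed cl(2)] cone gen_split[OF Hf cl])
  qed (rule refl)
  show ?thesis
    by (rule bij_betw_byWitness[where f' = G])
      (use 1 2 falg_homD(5)[OF hm(1)] add_hom_closed[OF G(1)] in blast)+
qed

end

end

section \<open>Polynomial rings\<close>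

lemma type_algebra_simps [simp]:
  "monoid.mult ring_of_type_algebra = (*)" "monoid.one ring_of_type_algebra = 1"
  "ring.zero ring_of_type_algebra = 0" "ring.add ring_of_type_algebra = (+)"
  by (auto simp: ring_of_type_algebra_def)

text \<open>The last condition says that a variable which occurs with a negative exponent is
  invertible in \<open>poly_alg M\<close>. Homomorphisms out of \<open>poly_alg M\<close> are then
  determined by constants and variables.\<close>

definition exps :: "expo set \<Rightarrow> bool" where
  "exps M \<longleftrightarrow> Ga_exps \<subseteq> M \<and> (\<forall>m\<in>M. \<forall>m'\<in>M. m + m' \<in> M) \<and>
     (\<forall>m\<in>M. \<forall>i. Poly_Mapping.lookup m i < 0 \<longrightarrow> Poly_Mapping.single i (- 1) \<in> M)"

lemma exps_Ga: "exps Ga_exps"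
  unfolding exps_def
proof (intro conjI ballI allI impI)
  fix m :: expo and i assume "m \<in> Ga_exps" "Poly_Mapping.lookup m i < 0"
  then show "Poly_Mapping.single i (- 1) \<in> Ga_exps"
    by (metis (mono_tags, lifting) Ga_exps_def mem_Collect_eq not_le)
qed (auto simp: Ga_exps_def lookup_add)

lemma exps_Gm: "exps Gm_exps"
  unfolding exps_def
proof (intro conjI ballI allI impI)
  fix m :: expo and i assume m: "m \<in> Gm_exps" "Poly_Mapping.lookup m i < 0"
  have "i = 0"
  proof (rule ccontr)
    assume "i \<noteq> 0"
    then have "0 \<le> Poly_Mapping.lookup m i" using m(1) by (simp add: Gm_exps_def)
    then show False using m(2) by simp
  qed
  then show "Poly_Mapping.single i (- 1) \<in> Gm_exps"
    by (auto simp: Gm_exps_def lookup_single when_def)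
qed (auto simp: Gm_exps_def Ga_exps_def lookup_add)

lemma exps_zero: "exps M \<Longrightarrow> 0 \<in> M"
  by (auto simp: exps_def Ga_exps_def)

lemma exps_add: "exps M \<Longrightarrow> m \<in> M \<Longrightarrow> m' \<in> M \<Longrightarrow> m + m' \<in> M"
  by (auto simp: exps_def)

lemma exps_single: "exps M \<Longrightarrow> Poly_Mapping.single i 1 \<in> M"
  by (auto simp: exps_def Ga_exps_def lookup_single when_def)

lemma poly_alg_simps [simp]:
  "carrier (poly_alg M) = {f. Poly_Mapping.keys f \<subseteq> M}"
  "monoid.mult (poly_alg M) = (*)" "monoid.one (poly_alg M) = 1"
  "ring.zero (poly_alg M) = 0" "ring.add (poly_alg M) = (+)"
  by (auto simp: poly_alg_def)

lemma poly_keys_mult: "Poly_Mapping.keys f \<subseteq> M \<Longrightarrow> Poly_Mapping.keys g \<subseteq> M \<Longrightarrow> exps M \<Longrightarrow>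
    Poly_Mapping.keys (f * g) \<subseteq> M" for f g :: "expo \<Rightarrow>\<^sub>0 'r::comm_ring_1"
proof
  fix m assume *: "Poly_Mapping.keys f \<subseteq> M" "Poly_Mapping.keys g \<subseteq> M" "exps M" "m \<in> Poly_Mapping.keys (f * g)"
  then obtain a b where "m = a + b" "a \<in> Poly_Mapping.keys f" "b \<in> Poly_Mapping.keys g"
    using keys_mult[of f g] by blast
  then show "m \<in> M" using * exps_add by blast
qed

lemma poly_keys_add: "Poly_Mapping.keys f \<subseteq> M \<Longrightarrow> Poly_Mapping.keys g \<subseteq> M \<Longrightarrow>
    Poly_Mapping.keys (f + g) \<subseteq> M"
  using keys_add[of f g] by (meson Un_least order_trans)

lemma poly_alg_cring:
  assumes M: "exps M"
  shows "cring (poly_alg M :: (expo \<Rightarrow>\<^sub>0 'r::comm_ring_1) ring)"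
proof (intro cringI abelian_groupI comm_monoidI)
  fix x :: "expo \<Rightarrow>\<^sub>0 'r" assume x: "x \<in> carrier (poly_alg M)"
  show "\<exists>y\<in>carrier (poly_alg M). y \<oplus>\<^bsub>poly_alg M\<^esub> x = \<zero>\<^bsub>poly_alg M\<^esub>"
    using x by (intro bexI[of _ "- x"]) (auto simp: in_keys_iff)
qed (simp_all add: poly_keys_mult M poly_keys_add algebra_simps exps_zero)

lemma poly_alg_pow: "f [^]\<^bsub>poly_alg M\<^esub> (n::nat) = f ^ n"
  by (induction n) (simp_all add: nat_pow_def mult.commute)

lemma poly_alg_smult: "[(n::nat)] \<cdot>\<^bsub>poly_alg M\<^esub> f = of_nat n * f" for f :: "expo \<Rightarrow>\<^sub>0 'r::comm_ring_1"
  by (induction n) (simp_all add: add_pow_def nat_pow_def algebra_simps)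

lemma poly_alg_sum:
  assumes "exps M" "finite I" "\<And>i. i \<in> I \<Longrightarrow> Poly_Mapping.keys (f i) \<subseteq> M"
  shows "finsum (poly_alg M) f I = (\<Sum>i\<in>I. (f i :: expo \<Rightarrow>\<^sub>0 'r::comm_ring_1))"
proof -
  interpret P: cring "poly_alg M :: (expo \<Rightarrow>\<^sub>0 'r) ring" by (rule poly_alg_cring[OF assms(1)])
  from assms(2,3) show ?thesis
    by (induction I) (simp_all add: Pi_def)
qed

lemma poly_expand: "f = (\<Sum>m\<in>Poly_Mapping.keys f. Poly_Mapping.single m (Poly_Mapping.lookup f m))"
  by (rule poly_mapping_eqI) (auto simp: lookup_sum lookup_single when_def sum.delta' in_keys_iff)

lemma poly_induct [consumes 1, case_names zero single add]:
  fixes f :: "expo \<Rightarrow>\<^sub>0 'r::comm_ring_1"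
  assumes "Poly_Mapping.keys f \<subseteq> M" "P 0" "\<And>m r. m \<in> M \<Longrightarrow> P (Poly_Mapping.single m r)"
    "\<And>f g. P f \<Longrightarrow> P g \<Longrightarrow> P (f + g)"
  shows "P f"
proof -
  have "P (\<Sum>m\<in>S. Poly_Mapping.single m (Poly_Mapping.lookup f m))" if "finite S" "S \<subseteq> M" for S
    using that by (induction S) (use assms in auto)
  from this[of "Poly_Mapping.keys f"] show ?thesis using assms(1) by (simp flip: poly_expand)
qed

text \<open>Here \<open>w\<close> gives the values of whole monomials; that it is multiplicative on
  \<open>M\<close> is a hypothesis of the next lemma.\<close>

definition pev :: "('t, 'm) ring_scheme \<Rightarrow> ('r \<Rightarrow> 't) \<Rightarrow> (expo \<Rightarrow> 't) \<Rightarrow> (expo \<Rightarrow>\<^sub>0 'r::comm_ring_1) \<Rightarrow> 't" where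
  "pev T \<rho> w f = (\<Oplus>\<^bsub>T\<^esub>m\<in>Poly_Mapping.keys f. \<rho> (Poly_Mapping.lookup f m) \<otimes>\<^bsub>T\<^esub> w m)"

lemma pev:
  fixes \<rho> :: "'r::comm_ring_1 \<Rightarrow> 't"
  assumes T: "cring T" and M: "exps M" and \<rho>: "\<rho> \<in> ring_hom ring_of_type_algebra T"
    and wc: "\<And>m. m \<in> M \<Longrightarrow> w m \<in> carrier T" and w0: "w 0 = \<one>\<^bsub>T\<^esub>"
    and wa: "\<And>m m'. m \<in> M \<Longrightarrow> m' \<in> M \<Longrightarrow> w (m + m') = w m \<otimes>\<^bsub>T\<^esub> w m'"
  shows "pev T \<rho> w \<in> ring_hom (poly_alg M) T"
    and "\<And>m r. m \<in> M \<Longrightarrow> pev T \<rho> w (Poly_Mapping.single m r) = \<rho> r \<otimes>\<^bsub>T\<^esub> w m"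
proof -
  interpret T: cring T by fact
  interpret P: cring "poly_alg M :: (expo \<Rightarrow>\<^sub>0 'r) ring" by (rule poly_alg_cring[OF M])
  have \<rho>c: "\<rho> r \<in> carrier T" for r using ring_hom_closed[OF \<rho>, of r] by simp
  have \<rho>0: "\<rho> 0 = \<zero>\<^bsub>T\<^esub>" using ring_hom_zero[OF \<rho>] T.ring_axioms ring_from_type_algebra by simp
  have \<rho>a: "\<rho> (r + s) = \<rho> r \<oplus>\<^bsub>T\<^esub> \<rho> s" and \<rho>m: "\<rho> (r * s) = \<rho> r \<otimes>\<^bsub>T\<^esub> \<rho> s" for r s
    using ring_hom_add[OF \<rho>, of r s] ring_hom_mult[OF \<rho>, of r s] by simp_all
  have ext: "pev T \<rho> w f = (\<Oplus>\<^bsub>T\<^esub>m\<in>S. \<rho> (Poly_Mapping.lookup f m) \<otimes>\<^bsub>T\<^esub> w m)"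
    if "finite S" "Poly_Mapping.keys f \<subseteq> S" "S \<subseteq> M" for f S
    unfolding pev_def using that
    by (intro T.add.finprod_mono_neutral_cong_left) (auto simp: in_keys_iff \<rho>0 wc subset_iff \<rho>c)
  show 1: "pev T \<rho> w (Poly_Mapping.single m r) = \<rho> r \<otimes>\<^bsub>T\<^esub> w m" if "m \<in> M" for m r
    using that by (subst ext[of "{m}"]) (auto simp: \<rho>c wc split: if_splits)
  have cl: "pev T \<rho> w f \<in> carrier T" if "Poly_Mapping.keys f \<subseteq> M" for f
    unfolding pev_def using that by (intro T.finsum_closed) (auto simp: \<rho>c wc)
  have ad: "pev T \<rho> w (f + g) = pev T \<rho> w f \<oplus>\<^bsub>T\<^esub> pev T \<rho> w g"
    if "Poly_Mapping.keys f \<subseteq> M" "Poly_Mapping.keys g \<subseteq> M" for f g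
  proof -
    let ?S = "Poly_Mapping.keys f \<union> Poly_Mapping.keys g"
    have S: "finite ?S" "?S \<subseteq> M" using that by auto
    have c: "(\<lambda>m. \<rho> (Poly_Mapping.lookup h m) \<otimes>\<^bsub>T\<^esub> w m) \<in> ?S \<rightarrow> carrier T" for h
      using S(2) by (auto simp: \<rho>c wc)
    have "pev T \<rho> w (f + g) = (\<Oplus>\<^bsub>T\<^esub>m\<in>?S. \<rho> (Poly_Mapping.lookup f m) \<otimes>\<^bsub>T\<^esub> w m \<oplus>\<^bsub>T\<^esub> \<rho> (Poly_Mapping.lookup g m) \<otimes>\<^bsub>T\<^esub> w m)"
      using S c by (subst ext[OF S(1) keys_add S(2)], intro T.finsum_cong') (auto simp: lookup_add \<rho>a T.l_distr \<rho>c wc)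
    also have "\<dots> = pev T \<rho> w f \<oplus>\<^bsub>T\<^esub> pev T \<rho> w g"
      using T.finsum_addf[OF c[of f] c[of g]] ext[OF S(1) _ S(2), of f] ext[OF S(1) _ S(2), of g] by simp
    finally show ?thesis .
  qed
  have ml: "pev T \<rho> w (f * g) = pev T \<rho> w f \<otimes>\<^bsub>T\<^esub> pev T \<rho> w g"
    if f: "Poly_Mapping.keys f \<subseteq> M" and g: "Poly_Mapping.keys g \<subseteq> M" for f g
  proof -
    have a: "Poly_Mapping.keys g \<subseteq> M \<and> pev T \<rho> w (Poly_Mapping.single m r * g) = pev T \<rho> w (Poly_Mapping.single m r) \<otimes>\<^bsub>T\<^esub> pev T \<rho> w g"
      if m: "m \<in> M" for m r using g
    proof (induction g rule: poly_induct)
      case zero show ?case using cl[of "Poly_Mapping.single m r"] m by (simp add: pev_def)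
    next
      case (single m' s)
      then show ?case using m by (auto simp: mult_single 1 exps_add[OF M] wa \<rho>m \<rho>c wc T.m_ac)
    next
      case (add g h)
      then have k: "Poly_Mapping.keys (Poly_Mapping.single m r * g) \<subseteq> M" "Poly_Mapping.keys (Poly_Mapping.single m r * h) \<subseteq> M"
        "Poly_Mapping.keys (g + h) \<subseteq> M"
        using poly_keys_mult[OF _ _ M, of "Poly_Mapping.single m r"] poly_keys_add[of g M h] m by auto
      show ?case using add k m cl[of "Poly_Mapping.single m r"] by (simp add: distrib_left ad cl T.r_distr)
    qed
    have "Poly_Mapping.keys f \<subseteq> M \<and> pev T \<rho> w (f * g) = pev T \<rho> w f \<otimes>\<^bsub>T\<^esub> pev T \<rho> w g" using f
    proof (induction f rule: poly_induct)
      case zero show ?case using cl[OF g] by (simp add: pev_def)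
    next
      case (single m' s) then show ?case using a by auto
    next
      case (add h k)
      then have k: "Poly_Mapping.keys (h * g) \<subseteq> M" "Poly_Mapping.keys (k * g) \<subseteq> M"
        "Poly_Mapping.keys (h + k) \<subseteq> M"
        using g poly_keys_mult[OF _ _ M, of _ g] poly_keys_add[of h M k] by simp_all
      show ?case using add k g by (simp add: distrib_right ad cl T.l_distr)
    qed
    then show ?thesis by simp
  qed
  show "pev T \<rho> w \<in> ring_hom (poly_alg M) T"
    by (rule ring_hom_memI)
      (use cl ml ad 1[of 0 1] w0 exps_zero[OF M] ring_hom_one[OF \<rho>] in \<open>simp_all add: \<rho>c flip: single_one\<close>)
qed

section \<open>Evaluation of Laurent polynomials in a commutative ring\<close>

context cring begin

text \<open>For a nonnegative exponent the inverse occurs only with exponent 0, so the power has its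
  usual value even if \<open>x\<close> is not a unit.\<close>

definition zpow :: "'a \<Rightarrow> int \<Rightarrow> 'a" where
  "zpow x a = x [^] nat a \<otimes> (inv x) [^] nat (- a)"

lemma zpow_nonneg: "0 \<le> a \<Longrightarrow> x \<in> carrier R \<Longrightarrow> zpow x a = x [^] nat a"
  by (simp add: zpow_def del: pow_nat)

lemma zpow_closed: "x \<in> carrier R \<Longrightarrow> (a < 0 \<Longrightarrow> x \<in> Units R) \<Longrightarrow> zpow x a \<in> carrier R"
  by (cases "a < 0") (auto simp: zpow_def Units_inv_closed simp del: pow_nat)

lemma pow_inv_pow: "x \<in> Units R \<Longrightarrow> x [^] (k::nat) \<otimes> (inv x) [^] k = \<one>"
  by (metis Units_closed Units_inv_closed Units_r_inv nat_pow_distrib nat_pow_one)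

text \<open>A power is determined by the difference of the two exponents; stated without subtraction
  because they are natural numbers.\<close>

lemma zpow_unique:
  assumes x: "x \<in> Units R" and "k + l' = k' + (l::nat)"
  shows "x [^] k \<otimes> (inv x) [^] l = x [^] k' \<otimes> (inv x) [^] l'"
proof -
  note [simp] = Units_closed[OF x] Units_inv_closed[OF x]
  have "x [^] k \<otimes> (inv x) [^] l = x [^] k \<otimes> (inv x) [^] l \<otimes> (x [^] l' \<otimes> (inv x) [^] l')"
    by (simp add: pow_inv_pow[OF x])
  also have "\<dots> = x [^] (k + l') \<otimes> (inv x) [^] l \<otimes> (inv x) [^] l'"
    by (simp add: nat_pow_mult[symmetric] m_ac)
  also have "\<dots> = x [^] k' \<otimes> (inv x) [^] l' \<otimes> (x [^] l \<otimes> (inv x) [^] l)"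
    by (simp add: assms(2) nat_pow_mult[symmetric] m_ac)
  finally show ?thesis by (simp add: pow_inv_pow[OF x])
qed

lemma zpow_add:
  assumes x: "x \<in> carrier R" and u: "a < 0 \<or> b < 0 \<Longrightarrow> x \<in> Units R"
  shows "zpow x (a + b) = zpow x a \<otimes> zpow x b"
proof (cases "a < 0 \<or> b < 0")
  case False
  then show ?thesis using x by (simp add: zpow_nonneg nat_add_distrib nat_pow_mult del: pow_nat)
next
  case True
  then have xu: "x \<in> Units R" by (rule u)
  note [simp] = Units_inv_closed[OF xu]
  have "zpow x a \<otimes> zpow x b = x [^] (nat a + nat b) \<otimes> (inv x) [^] (nat (- a) + nat (- b))"
    using x by (simp add: zpow_def nat_pow_mult[symmetric] m_ac)
  also have "\<dots> = zpow x (a + b)" unfolding zpow_def by (rule zpow_unique[OF xu]) linarith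
  finally show ?thesis ..
qed

definition mon :: "(nat \<Rightarrow> 'a) \<Rightarrow> expo \<Rightarrow> 'a" where
  "mon v m = (\<Otimes>i\<in>Poly_Mapping.keys m. zpow (v i) (Poly_Mapping.lookup m i))"

text \<open>The condition on values of the variables under which every monomial of \<open>M\<close>
  can be evaluated; \<open>mon_eq\<close> shows that every homomorphism meets it.\<close>

definition evaluable :: "expo set \<Rightarrow> (nat \<Rightarrow> 'a) \<Rightarrow> bool" where
  "evaluable M v \<longleftrightarrow> (\<forall>i. v i \<in> carrier R) \<and> (\<forall>m\<in>M. \<forall>i. Poly_Mapping.lookup m i < 0 \<longrightarrow> v i \<in> Units R)"

lemma mon:
  assumes v: "evaluable M v" and M: "exps M"
  shows "m \<in> M \<Longrightarrow> mon v m \<in> carrier R" "mon v 0 = \<one>"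
    "m \<in> M \<Longrightarrow> m' \<in> M \<Longrightarrow> mon v (m + m') = mon v m \<otimes> mon v m'"
proof -
  have zc: "zpow (v i) (Poly_Mapping.lookup m i) \<in> carrier R" if "m \<in> M" for m i
    using v that by (intro zpow_closed) (auto simp: evaluable_def)
  show "m \<in> M \<Longrightarrow> mon v m \<in> carrier R" unfolding mon_def using zc by (intro finprod_closed) auto
  show "mon v 0 = \<one>" by (simp add: mon_def)
  assume m: "m \<in> M" "m' \<in> M"
  have ext: "mon v m = (\<Otimes>i\<in>S. zpow (v i) (Poly_Mapping.lookup m i))"
    if "finite S" "Poly_Mapping.keys m \<subseteq> S" "m \<in> M" for m S
    unfolding mon_def using that zc
    by (intro finprod_mono_neutral_cong_left) (auto simp: in_keys_iff zpow_def)
  let ?S = "Poly_Mapping.keys m \<union> Poly_Mapping.keys m'"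
  have S: "finite ?S" by auto
  have "mon v (m + m') = (\<Otimes>i\<in>?S. zpow (v i) (Poly_Mapping.lookup m i) \<otimes> zpow (v i) (Poly_Mapping.lookup m' i))"
    using m v zc by (subst ext[OF S keys_add exps_add[OF M m]], intro finprod_cong')
      (auto simp: lookup_add evaluable_def intro!: zpow_add)
  also have "\<dots> = mon v m \<otimes> mon v m'"
    using finprod_multf[of "\<lambda>i. zpow (v i) (Poly_Mapping.lookup m i)" ?S "\<lambda>i. zpow (v i) (Poly_Mapping.lookup m' i)"]
      ext[OF S _ m(1)] ext[OF S _ m(2)] zc m by (simp add: Pi_def)
  finally show "mon v (m + m') = mon v m \<otimes> mon v m'" .
qed

lemma mon_single: "v i \<in> carrier R \<Longrightarrow> mon v (Poly_Mapping.single i 1) = v i"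
  by (simp add: mon_def zpow_nonneg)

text \<open>Every homomorphism out of \<open>poly_alg M\<close> is an evaluation: a variable with a
  negative exponent somewhere in \<open>M\<close> has its inverse in \<open>poly_alg M\<close>, and
  the homomorphism preserves inverses.\<close>

lemma mon_eq:
  fixes F :: "(expo \<Rightarrow>\<^sub>0 'r::comm_ring_1) \<Rightarrow> 'a"
  assumes M: "exps M" and F: "F \<in> ring_hom (poly_alg M) R" and m: "m \<in> M"
  shows "F (Poly_Mapping.single m 1) = mon (\<lambda>i. F (poly_var i)) m"
    and "evaluable M (\<lambda>i. F (poly_var i))"
proof -
  interpret P: cring "poly_alg M :: (expo \<Rightarrow>\<^sub>0 'r) ring" by (rule poly_alg_cring[OF M])
  interpret F: ring_hom_ring "poly_alg M" R F by (rule ring_hom_ringI2[OF P.ring_axioms ring_axioms F])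
  have vc: "poly_var i \<in> carrier (poly_alg M :: (expo \<Rightarrow>\<^sub>0 'r) ring)" for i
    using exps_single[OF M] by (simp add: poly_var_def)
  have neg: "F (poly_var i) \<in> Units R \<and> inv (F (poly_var i)) = F (Poly_Mapping.single (Poly_Mapping.single i (-1)) 1)"
    if "Poly_Mapping.single i (- 1) \<in> M" for i
  proof -
    let ?y = "Poly_Mapping.single (Poly_Mapping.single i (-1)) 1 :: expo \<Rightarrow>\<^sub>0 'r"
    have y: "?y \<in> carrier (poly_alg M)" using that by simp
    have "F (poly_var i) \<otimes> F ?y = F (poly_var i * ?y)" using F.hom_mult[OF vc y] by simp
    also have "poly_var i * ?y = 1" by (simp add: poly_var_def mult_single flip: single_add)
    finally have *: "F (poly_var i) \<otimes> F ?y = \<one>" using F.hom_one by simp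
    then show ?thesis using F.hom_closed[OF vc] F.hom_closed[OF y] m_comm comm_inv_char
      by (auto simp: Units_def intro!: bexI[of _ "F ?y"])
  qed
  show ev: "evaluable M (\<lambda>i. F (poly_var i))"
    unfolding evaluable_def using F.hom_closed[OF vc] neg M by (auto simp: exps_def)
  have z: "F (Poly_Mapping.single (Poly_Mapping.single i (Poly_Mapping.lookup m i)) 1) = zpow (F (poly_var i)) (Poly_Mapping.lookup m i)" for i
  proof (cases "Poly_Mapping.lookup m i < 0")
    case False
    define k where "k = nat (Poly_Mapping.lookup m i)"
    have k: "Poly_Mapping.lookup m i = int k" using False by (simp add: k_def)
    have "F ((poly_var i :: expo \<Rightarrow>\<^sub>0 'r) ^ k) = F (poly_var i) [^] k"
      using F.hom_nat_pow[OF vc, of i k] by (simp add: poly_alg_pow)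
    moreover have "(poly_var i :: expo \<Rightarrow>\<^sub>0 'r) ^ k = Poly_Mapping.single (Poly_Mapping.single i (int k)) 1"
      by (induction k) (simp_all add: poly_var_def mult_single single_add[symmetric] add.commute)
    ultimately show ?thesis using F.hom_closed[OF vc] by (simp add: k zpow_nonneg)
  next
    case True
    then have n: "Poly_Mapping.single i (- 1) \<in> M" using M m by (auto simp: exps_def)
    define k where "k = nat (- Poly_Mapping.lookup m i)"
    have k: "Poly_Mapping.lookup m i = - int k" using True by (simp add: k_def)
    let ?y = "Poly_Mapping.single (Poly_Mapping.single i (-1)) 1 :: expo \<Rightarrow>\<^sub>0 'r"
    have y: "?y \<in> carrier (poly_alg M)" using n by simp
    have "F (?y ^ k) = F ?y [^] k" using F.hom_nat_pow[OF y, of k] by (simp add: poly_alg_pow)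
    moreover have "?y ^ k = Poly_Mapping.single (Poly_Mapping.single i (- int k)) 1"
      by (induction k) (simp_all add: mult_single single_add[symmetric] algebra_simps)
    ultimately show ?thesis using F.hom_closed[OF y] neg[OF n] by (simp add: k zpow_def)
  qed
  have "F (Poly_Mapping.single (\<Sum>i\<in>S. Poly_Mapping.single i (Poly_Mapping.lookup m i)) 1) =
      (\<Otimes>i\<in>S. zpow (F (poly_var i)) (Poly_Mapping.lookup m i)) \<and> (\<Sum>i\<in>S. Poly_Mapping.single i (Poly_Mapping.lookup m i)) \<in> M"
    if "finite S" for S
    using that
  proof (induction S)
    case empty
    show ?case using F.hom_one by (simp add: exps_zero[OF M])
  next
    case (insert i S)
    have si: "Poly_Mapping.single i (Poly_Mapping.lookup m i) \<in> M"
    proof (cases "Poly_Mapping.lookup m i < 0")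
      case True
      then have n: "Poly_Mapping.single i (- 1) \<in> M" using M m by (auto simp: exps_def)
      have "Poly_Mapping.single i (- int k) \<in> M" for k
      proof (induction k)
        case (Suc k)
        then have "Poly_Mapping.single i (- 1) + Poly_Mapping.single i (- int k) \<in> M" using exps_add[OF M n] by blast
        then show ?case by (simp add: single_add[symmetric])
      qed (simp add: exps_zero[OF M])
      from this[of "nat (- Poly_Mapping.lookup m i)"] show ?thesis using True by simp
    next
      case False
      then have "Poly_Mapping.single i (Poly_Mapping.lookup m i) \<in> Ga_exps"
        by (auto simp: Ga_exps_def lookup_single when_def)
      then show ?thesis using M by (auto simp: exps_def)
    qed
    let ?s = "\<Sum>i\<in>S. Poly_Mapping.single i (Poly_Mapping.lookup m i)"
    have "F (Poly_Mapping.single (Poly_Mapping.single i (Poly_Mapping.lookup m i) + ?s) 1) =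
        F (Poly_Mapping.single (Poly_Mapping.single i (Poly_Mapping.lookup m i)) 1) \<otimes> F (Poly_Mapping.single ?s 1)"
      using F.hom_mult[of "Poly_Mapping.single (Poly_Mapping.single i (Poly_Mapping.lookup m i)) 1" "Poly_Mapping.single ?s 1"]
        insert si by (simp add: mult_single)
    moreover have "zpow (F (poly_var j)) (Poly_Mapping.lookup m j) \<in> carrier R" for j
      using ev m by (intro zpow_closed) (auto simp: evaluable_def)
    ultimately show ?case using insert si exps_add[OF M] by (simp add: z Pi_def)
  qed
  from this[of "Poly_Mapping.keys m"] show "F (Poly_Mapping.single m 1) = mon (\<lambda>i. F (poly_var i)) m"
    by (simp add: mon_def flip: poly_expand)
qed

lemma poly_hom_exists:
  fixes \<rho> :: "'r::comm_ring_1 \<Rightarrow> 'a"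
  assumes M: "exps M" and \<rho>: "\<rho> \<in> ring_hom ring_of_type_algebra R" and v: "evaluable M v"
  obtains F where "F \<in> ring_hom (poly_alg M) R" "\<And>r. F (poly_const r) = \<rho> r" "\<And>i. F (poly_var i) = v i"
proof -
  note p = pev[OF is_cring M \<rho> mon[OF v M]]
  have \<rho>c: "\<rho> r \<in> carrier R" for r using ring_hom_closed[OF \<rho>, of r] by simp
  have vc: "v i \<in> carrier R" for i using v by (simp add: evaluable_def)
  show ?thesis
    by (rule that[OF p(1)])
      (simp_all add: poly_const_def poly_var_def p(2) exps_zero[OF M] exps_single[OF M] mon(2)[OF v M] \<rho>c
        mon_single vc ring_hom_one[OF \<rho>, simplified])
qed

lemma poly_hom_unique:
  fixes F :: "(expo \<Rightarrow>\<^sub>0 'r::comm_ring_1) \<Rightarrow> 'a"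
  assumes M: "exps M" and F: "F \<in> ring_hom (poly_alg M) R" and G: "G \<in> ring_hom (poly_alg M) R"
    and c: "\<And>r. F (poly_const r) = G (poly_const r)" and v: "\<And>i. F (poly_var i) = G (poly_var i)"
    and f: "f \<in> carrier (poly_alg M)"
  shows "F f = G f"
proof -
  have "Poly_Mapping.keys f \<subseteq> M" using f by simp
  then have "Poly_Mapping.keys f \<subseteq> M \<and> F f = G f"
  proof (induction f rule: poly_induct)
    case zero
    interpret P: cring "poly_alg M :: (expo \<Rightarrow>\<^sub>0 'r) ring" by (rule poly_alg_cring[OF M])
    show ?case using ring_hom_zero[OF F P.ring_axioms ring_axioms] ring_hom_zero[OF G P.ring_axioms ring_axioms] by simp
  next
    case (single m r)
    have cc: "poly_const r \<in> carrier (poly_alg M)" "Poly_Mapping.single m 1 \<in> carrier (poly_alg M)"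
      using exps_zero[OF M] single by (auto simp: poly_const_def)
    have "Poly_Mapping.single m r = poly_const r * Poly_Mapping.single m 1" by (simp add: poly_const_def mult_single)
    then have "F (Poly_Mapping.single m r) = F (poly_const r) \<otimes> F (Poly_Mapping.single m 1)"
      "G (Poly_Mapping.single m r) = G (poly_const r) \<otimes> G (Poly_Mapping.single m 1)"
      using ring_hom_mult[OF F cc] ring_hom_mult[OF G cc] by simp_all
    then show ?case using single by (simp add: c mon_eq(1)[OF M F] mon_eq(1)[OF M G] v)
  next
    case (add f g)
    then show ?case using ring_hom_add[OF F, of f g] ring_hom_add[OF G, of f g] poly_keys_add[of f M g] by simp
  qed
  then show ?thesis by simp
qed

section \<open>The binomial theorem and p-th powers modulo p\<close>

lemma int_hom: "(\<lambda>n::int. [n] \<cdot> \<one>) \<in> ring_hom ring_of_type_algebra R"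
proof (rule ring_hom_memI)
  fix a b :: int
  show "[(a \<otimes>\<^bsub>ring_of_type_algebra\<^esub> b)] \<cdot> \<one> = ([a] \<cdot> \<one>) \<otimes> ([b] \<cdot> \<one>)"
    by (simp add: add_pow_ldistr_int add.int_pow_pow mult.commute)
  show "[(a \<oplus>\<^bsub>ring_of_type_algebra\<^esub> b)] \<cdot> \<one> = ([a] \<cdot> \<one>) \<oplus> ([b] \<cdot> \<one>)"
    by (simp add: add.int_pow_mult)
qed (simp_all add: add_pow_int_ge)

text \<open>Polynomial identities hold in every commutative ring: evaluate integral polynomials.\<close>

lemma binomial:
  assumes a: "a \<in> carrier R" and b: "b \<in> carrier R"
  shows "(a \<oplus> b) [^] (n::nat) = (\<Oplus>k\<in>{..n}. [(n choose k)] \<cdot> (a [^] k \<otimes> b [^] (n - k)))"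
proof -
  define v where "v = (\<lambda>i::nat. if i = 0 then a else b)"
  have "Poly_Mapping.lookup m i \<ge> 0" if "m \<in> Ga_exps" for m i using that by (simp add: Ga_exps_def)
  then have "evaluable Ga_exps v" using a b unfolding evaluable_def v_def by (auto simp: not_less[symmetric])
  then obtain F where F: "F \<in> ring_hom (poly_alg Ga_exps) R" "\<And>i. F (poly_var i :: expo \<Rightarrow>\<^sub>0 int) = v i"
    using poly_hom_exists[OF exps_Ga int_hom] by metis
  interpret P: cring "poly_alg Ga_exps :: (expo \<Rightarrow>\<^sub>0 int) ring" by (rule poly_alg_cring[OF exps_Ga])
  interpret F: ring_hom_ring "poly_alg Ga_exps" R F by (rule ring_hom_ringI2[OF P.ring_axioms ring_axioms F(1)])
  define s t where "s = (poly_var 0 :: expo \<Rightarrow>\<^sub>0 int)" and "t = (poly_var 1 :: expo \<Rightarrow>\<^sub>0 int)"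
  have st: "s \<in> carrier (poly_alg Ga_exps)" "t \<in> carrier (poly_alg Ga_exps)"
    using exps_single[OF exps_Ga, of 0] exps_single[OF exps_Ga, of 1] by (simp_all add: s_def t_def poly_var_def)
  have Fs: "F s = a" "F t = b" using F(2)[of 0] F(2)[of 1] by (simp_all add: s_def t_def v_def)
  let ?P = "poly_alg Ga_exps :: (expo \<Rightarrow>\<^sub>0 int) ring"
  have "(s \<oplus>\<^bsub>?P\<^esub> t) [^]\<^bsub>?P\<^esub> n = (\<Oplus>\<^bsub>?P\<^esub>k\<in>{..n}. [(n choose k)] \<cdot>\<^bsub>?P\<^esub> (s [^]\<^bsub>?P\<^esub> k \<otimes>\<^bsub>?P\<^esub> t [^]\<^bsub>?P\<^esub> (n - k)))"
  proof (subst poly_alg_sum[OF exps_Ga])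
    show "Poly_Mapping.keys ([(n choose k)] \<cdot>\<^bsub>?P\<^esub> (s [^]\<^bsub>?P\<^esub> k \<otimes>\<^bsub>?P\<^esub> t [^]\<^bsub>?P\<^esub> (n - k))) \<subseteq> Ga_exps" for k
      using P.add.nat_pow_closed[OF P.m_closed[OF P.nat_pow_closed[OF st(1)] P.nat_pow_closed[OF st(2)]]] by simp
  qed (simp_all add: poly_alg_pow poly_alg_smult binomial_ring mult.assoc)
  then have "F ((s \<oplus>\<^bsub>?P\<^esub> t) [^]\<^bsub>?P\<^esub> n) = F (\<Oplus>\<^bsub>?P\<^esub>k\<in>{..n}. [(n choose k)] \<cdot>\<^bsub>?P\<^esub> (s [^]\<^bsub>?P\<^esub> k \<otimes>\<^bsub>?P\<^esub> t [^]\<^bsub>?P\<^esub> (n - k)))"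
    by simp
  also have "F ((s \<oplus>\<^bsub>?P\<^esub> t) [^]\<^bsub>?P\<^esub> n) = (a \<oplus> b) [^] n"
    using F.hom_nat_pow[OF P.a_closed[OF st]] F.hom_add[OF st] by (simp only: Fs)
  also have "F (\<Oplus>\<^bsub>?P\<^esub>k\<in>{..n}. [(n choose k)] \<cdot>\<^bsub>?P\<^esub> (s [^]\<^bsub>?P\<^esub> k \<otimes>\<^bsub>?P\<^esub> t [^]\<^bsub>?P\<^esub> (n - k))) =
      (\<Oplus>k\<in>{..n}. [(n choose k)] \<cdot> (a [^] k \<otimes> b [^] (n - k)))"
    using P.m_closed[OF P.nat_pow_closed[OF st(1)] P.nat_pow_closed[OF st(2)]]
    by (subst add_hom_finsum[OF P.is_abelian_group is_abelian_group ring_hom_add_hom[OF F(1)]])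
      (auto simp: add_hom_smult[OF P.is_abelian_group is_abelian_group ring_hom_add_hom[OF F(1)]] F.hom_mult[OF P.nat_pow_closed[OF st(1)] P.nat_pow_closed[OF st(2)]]
        F.hom_nat_pow[OF st(1)] F.hom_nat_pow[OF st(2)] Fs simp del: poly_alg_simps)
  finally show ?thesis .
qed

lemma freshman:
  assumes p: "Factorial_Ring.prime p" and a: "a \<in> carrier R" and b: "b \<in> carrier R"
  shows "pcong p R 1 ((a \<oplus> b) [^] p) (a [^] p \<oplus> b [^] p)"
proof -
  have p0: "p > 0" using p by (simp add: prime_gt_0_nat)
  let ?t = "\<lambda>k. [(p choose k)] \<cdot> (a [^] k \<otimes> b [^] (p - k))"
  let ?g = "\<lambda>k. if k = 0 then b [^] p else if k = p then a [^] p else \<zero>"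
  have "pcong p R 1 (\<Oplus>k\<in>{..p}. ?t k) (\<Oplus>k\<in>{..p}. ?g k)"
  proof (rule pcong_finsum)
    fix k assume k: "k \<in> {..p}"
    show "pcong p R 1 (?t k) (?g k)"
    proof (cases "k = 0 \<or> k = p")
      case True
      then show ?thesis using a b p0 by auto
    next
      case False
      then have "p dvd (p choose k)" using k p by (intro dvd_choose_prime) auto
      then obtain q where q: "p choose k = p * q" by blast
      have "?t k = [(p ^ 1)] \<cdot> ([q] \<cdot> (a [^] k \<otimes> b [^] (p - k)))"
        using a b by (simp add: q smult_smult)
      then show ?thesis using False a b unfolding pcong_def by auto
    qed
  qed (use a b in auto)
  moreover have "(\<Oplus>k\<in>{..p}. ?g k) = a [^] p \<oplus> b [^] p"
  proof -
    have "(\<Oplus>k\<in>{..p}. ?g k) = (\<Oplus>k\<in>{0, p}. ?g k)"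
      using a b by (intro add.finprod_mono_neutral_cong_right) auto
    also have "\<dots> = a [^] p \<oplus> b [^] p" using a b p0 by (simp add: a_comm)
    finally show ?thesis .
  qed
  ultimately show ?thesis using binomial[OF a b, of p] by simp
qed

end

section \<open>Complete torsion-free rings\<close>

definition ptf :: "nat \<Rightarrow> ('a, 'm) ring_scheme \<Rightarrow> bool" where
  "ptf p A \<longleftrightarrow> (\<forall>a\<in>carrier A. [p] \<cdot>\<^bsub>A\<^esub> a = \<zero>\<^bsub>A\<^esub> \<longrightarrow> a = \<zero>\<^bsub>A\<^esub>)"

lemma ptf_extend [simp]: "ptf p (ring.extend R m) = ptf p R"
  by (simp add: ptf_def)

context cring begin

lemma smult_pow: "w \<in> carrier R \<Longrightarrow> ([(k::nat)] \<cdot> w) [^] (n::nat) = [(k ^ n)] \<cdot> (w [^] n)"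
  by (induction n) (simp_all add: smult_l smult_r smult_smult mult.commute)

text \<open>Geometric series: with y = 1 - q and q divisible by p, the partial sums of the powers of
  q converge to an inverse of y.\<close>

lemma Units_pcong_one:
  assumes comp: "p_complete p R" and y: "pcong p R 1 y \<one>"
  shows "y \<in> Units R"
proof -
  obtain t where t: "t \<in> carrier R" "y = \<one> \<oplus> [(p ^ 1)] \<cdot> t" using y unfolding pcong_def by blast
  define w where "w = \<ominus> t"
  define q where "q = [p] \<cdot> w"
  have w: "w \<in> carrier R" and q: "q \<in> carrier R" using t by (auto simp: w_def q_def)
  have yq: "y = \<one> \<ominus> q" using t by (simp add: q_def w_def smult_minus a_minus_def)
  have yc: "y \<in> carrier R" using yq q by simp
  define s where "s = rec_nat \<zero> (\<lambda>n u. u \<oplus> q [^] (n::nat))"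
  have s0: "s 0 = \<zero>" and sS: "s (Suc n) = s n \<oplus> q [^] n" for n by (auto simp: s_def)
  have sc: "s n \<in> carrier R" for n by (induction n) (auto simp: s0 sS q)
  have qn: "q [^] n = [(p ^ n)] \<cdot> (w [^] n)" for n :: nat unfolding q_def by (rule smult_pow[OF w])
  have ys: "y \<otimes> s n = \<one> \<ominus> q [^] n" for n
  proof (induction n)
    case 0 show ?case using yc by (simp add: s0 a_minus_def r_neg)
  next
    case (Suc n)
    have "y \<otimes> s (Suc n) = (\<one> \<ominus> q [^] n) \<oplus> (\<one> \<ominus> q) \<otimes> q [^] n"
      using Suc yc sc q by (simp add: sS r_distr yq[symmetric])
    also have "\<dots> = \<one> \<ominus> q [^] n \<otimes> q" using q nat_pow_closed[OF q, of n] by algebra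
    finally show ?case by simp
  qed
  have "coherent p R s" using w sc by (auto simp: coherent_def sS qn pcong_def)
  then obtain l where l: "l \<in> carrier R" "\<And>n. pcong p R n l (s n)" using p_complete_lim[OF comp] by blast
  have "y \<otimes> l = \<one>"
  proof (rule p_complete_sep[OF comp])
    fix n
    have "pcong p R n (y \<otimes> l) (y \<otimes> s n)" using l sc yc by (intro pcong_mult_l) auto
    moreover have "pcong p R n (\<one> \<ominus> q [^] n) (\<one> \<ominus> \<zero>)"
      using w by (intro pcong_diff) (auto simp: qn pcong_zero_iff)
    ultimately show "pcong p R n (y \<otimes> l) \<one>" using ys[of n] pcong_trans[of p n "y \<otimes> l" "y \<otimes> s n" "\<one>"]
      by (simp add: a_minus_def)
  qed (use yc l in auto)
  then show ?thesis using yc l(1) m_comm by (auto simp: Units_def)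
qed

lemma Units_add_smult:
  assumes comp: "p_complete p R" and u: "u \<in> Units R" and t: "t \<in> carrier R"
  shows "u \<oplus> [p] \<cdot> t \<in> Units R"
proof -
  have "u \<oplus> [p] \<cdot> t = u \<otimes> (\<one> \<oplus> [p] \<cdot> (inv u \<otimes> t))"
    using u t Units_closed[OF u] Units_inv_closed[OF u] by (simp add: r_distr smult_r m_assoc[symmetric])
  moreover have "\<one> \<oplus> [p] \<cdot> (inv u \<otimes> t) \<in> Units R"
    by (rule Units_pcong_one[OF comp]) (use u t in \<open>auto simp: pcong_def\<close>)
  ultimately show ?thesis using u by simp
qed

lemma ptf_pow: "ptf p R \<Longrightarrow> a \<in> carrier R \<Longrightarrow> [(p ^ n)] \<cdot> a = \<zero> \<Longrightarrow> a = \<zero>"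
proof (induction n)
  case (Suc n)
  then have "[p] \<cdot> ([(p ^ n)] \<cdot> a) = \<zero>" by (simp add: smult_smult)
  then have "[(p ^ n)] \<cdot> a = \<zero>" using Suc.prems(1,2) by (auto simp: ptf_def)
  with Suc show ?case by simp
qed auto

lemma ptf_cancel:
  assumes "ptf p R" "a \<in> carrier R" "b \<in> carrier R" "[(p ^ n)] \<cdot> a = [(p ^ n)] \<cdot> b"
  shows "a = b"
proof -
  have "[(p ^ n)] \<cdot> (a \<ominus> b) = \<zero>" using assms(2-4) by (simp add: smult_diff)
  then have "a \<ominus> b = \<zero>" using ptf_pow[OF assms(1)] assms(2,3) by blast
  then show ?thesis using assms(2,3) by simp
qed

lemma ptf_pcong_cancel:
  assumes "ptf p R" "a \<in> carrier R" "b \<in> carrier R" "pcong p R (m + n) ([(p ^ m)] \<cdot> a) ([(p ^ m)] \<cdot> b)"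
  shows "pcong p R n a b"
proof -
  obtain t where t: "t \<in> carrier R" "[(p ^ m)] \<cdot> a = [(p ^ m)] \<cdot> b \<oplus> [(p ^ (m + n))] \<cdot> t"
    using assms(4) by (auto simp: pcong_def)
  then have "[(p ^ m)] \<cdot> a = [(p ^ m)] \<cdot> (b \<oplus> [(p ^ n)] \<cdot> t)"
    using assms(3) by (simp add: smult_add smult_smult power_add)
  from ptf_cancel[OF assms(1,2) _ this] have "a = b \<oplus> [(p ^ n)] \<cdot> t" using assms(3) t(1) by simp
  then show ?thesis using t by (auto simp: pcong_def)
qed

text \<open>Write n = p^k m with m prime to p. The factor p^k is cancelled by hypothesis. An element
  killed by m is divisible by every p^j, by a Bezout relation between m and p^j, and so vanishes by
  separatedness.\<close>

lemma ptf_nat: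
  fixes n :: nat
  assumes comp: "p_complete p R" and tf: "ptf p R" and p: "Factorial_Ring.prime p"
    and n: "n > 0" and a: "a \<in> carrier R" and z: "[n] \<cdot> a = \<zero>"
  shows "a = \<zero>"
proof -
  obtain k m where km: "n = p ^ k * m" "\<not> p dvd m"
    using multiplicity_decompose'[of n p] n p by (metis not_prime_unit not_gr_zero)
  have "[(p ^ k)] \<cdot> ([m] \<cdot> a) = \<zero>" using z a by (simp add: km smult_smult)
  then have m: "[m] \<cdot> a = \<zero>" using ptf_pow[OF tf] a by blast
  have m0: "m > 0" using km n by (cases m) auto
  show ?thesis
  proof (rule p_complete_sep[OF comp a zero_closed])
    fix j
    have "coprime m (p ^ j)" using km(2) p by (metis coprime_commute coprime_power_right_iff prime_imp_coprime_nat)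
    then obtain u v where uv: "m * u = p ^ j * v + 1" using bezout_nat[of m "p ^ j"] m0 by auto
    have "\<zero> = [(m * u)] \<cdot> a" using m a by (metis add.nat_pow_one mult.commute smult_smult)
    also have "\<dots> = [(p ^ j)] \<cdot> ([v] \<cdot> a) \<oplus> a" using a by (simp add: uv smult_smult)
    finally have "a = [(p ^ j)] \<cdot> (\<ominus> ([v] \<cdot> a))"
      using a by (metis add.inv_closed add.nat_pow_closed minus_equality minus_minus smult_minus a_comm)
    then show "pcong p R j a \<zero>" unfolding pcong_zero_iff using a by blast
  qed
qed

lemma smult_cancel:
  fixes n :: nat
  assumes comp: "p_complete p R" and tf: "ptf p R" and p: "Factorial_Ring.prime p"
    and n: "n > 0" and a: "a \<in> carrier R" "b \<in> carrier R" and z: "[n] \<cdot> a = [n] \<cdot> b"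
  shows "a = b"
proof -
  have "[n] \<cdot> (a \<ominus> b) = \<zero>" using a z by (simp add: smult_diff)
  then have "a \<ominus> b = \<zero>" using ptf_nat[OF comp tf p n] a by blast
  then show ?thesis using a by simp
qed

lemma nat_div_eq:
  assumes "p_complete p R" "ptf p R" "Factorial_Ring.prime p" "n > 0" "y \<in> carrier R" "[n] \<cdot> y = x"
  shows "nat_div R n x = y"
  unfolding nat_div_def using smult_cancel[OF assms(1-4)] assms(5,6) by (intro the_equality) auto

text \<open>A Bezout relation m u = p v + 1 makes m u a unit, by the geometric series.\<close>

lemma coprime_div:
  assumes comp: "p_complete p R" and p: "Factorial_Ring.prime p" and m: "\<not> p dvd m" and a: "a \<in> carrier R"
  obtains b where "b \<in> carrier R" "[m] \<cdot> b = a"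
proof -
  have m0: "m > 0" using m by (cases m) auto
  have "coprime m p" using m p by (metis coprime_commute prime_imp_coprime_nat)
  then obtain u v where uv: "m * u = p * v + 1" using bezout_nat[of m p] m0 by auto
  have "[m] \<cdot> ([u] \<cdot> \<one>) = \<one> \<oplus> [(p ^ 1)] \<cdot> ([v] \<cdot> \<one>)" by (simp add: smult_smult uv a_comm)
  then have un: "[m] \<cdot> ([u] \<cdot> \<one>) \<in> Units R" by (intro Units_pcong_one[OF comp]) (auto simp: pcong_def)
  define y where "y = inv ([m] \<cdot> ([u] \<cdot> \<one>)) \<otimes> a"
  have y: "y \<in> carrier R" using un a by (simp add: y_def)
  have "[m] \<cdot> (([u] \<cdot> \<one>) \<otimes> y) = ([m] \<cdot> ([u] \<cdot> \<one>)) \<otimes> y" using y smult_l[of "[u] \<cdot> \<one>" y m] by simp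
  also have "\<dots> = a" unfolding y_def using un a
    by (metis Units_closed Units_inv_closed Units_r_inv l_one m_assoc)
  finally show ?thesis using that[of "([u] \<cdot> \<one>) \<otimes> y"] y by simp
qed

lemma ptf_pcompl:
  assumes tf: "ptf p R"
  shows "ptf p (pcompl p R)"
  unfolding ptf_def
proof (intro ballI impI)
  interpret C: cring "pcompl p R" by (rule pcompl_cring)
  fix s assume s: "s \<in> carrier (pcompl p R)" "[p] \<cdot>\<^bsub>pcompl p R\<^esub> s = \<zero>\<^bsub>pcompl p R\<^esub>"
  obtain x where x: "coherent p R x" "s = clim p R x" using s by (auto simp: carrier_pcompl)
  note c = coherent_closed[OF x(1)]
  have 1: "pcong p R n ([p] \<cdot> x n) \<zero>" for n
    using s(2) by (simp add: x(2) clim_smult[OF x(1)] clim_zero clim_eq_iff coherent_const)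
  have "pcong p R n (x n) \<zero>" for n
  proof -
    \<comment> \<open>Cancelling p loses one level, so the statement at level n is drawn from level
      n+1.\<close>
    have "pcong p R (1 + n) ([(p ^ 1)] \<cdot> x (Suc n)) ([(p ^ 1)] \<cdot> \<zero>)" using 1[of "Suc n"] by simp
    then have "pcong p R n (x (Suc n)) \<zero>" using ptf_pcong_cancel[OF tf c zero_closed] by blast
    moreover have "pcong p R n (x n) (x (Suc n))" using x(1) c by (auto simp: coherent_def intro: pcong_sym)
    ultimately show ?thesis using pcong_trans by blast
  qed
  then show "s = \<zero>\<^bsub>pcompl p R\<^esub>" by (simp add: x(2) clim_zero clim_eq_iff x(1) coherent_const)
qed

end

lemma pcompl_alg_ptf [simp]: "ptf q (pcompl_alg p A) = ptf q (pcompl p A)"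
  by (simp add: pcompl_alg_def)

lemma ptf_dlim:
  assumes A: "falg \<phi> A" and tf: "ptf p A"
  shows "ptf p (dlim A)"
  unfolding ptf_def
proof (intro ballI impI)
  interpret A: cring A using falgD(1)[OF A] .
  interpret D: cring "dlim A" by (rule dlim_cring[OF A])
  fix u assume u: "u \<in> carrier (dlim A)" "[p] \<cdot>\<^bsub>dlim A\<^esub> u = \<zero>\<^bsub>dlim A\<^esub>"
  obtain a i where a: "a \<in> carrier A" "u = dlim_cls A a i" using u(1) by (auto simp: carrier_dlim[OF A])
  have Fh: "frob A ^^ k \<in> ring_hom A A" for k by (rule funpow_ring_hom[OF falgD(3)[OF A]])
  have F0: "(frob A ^^ k) \<zero>\<^bsub>A\<^esub> = \<zero>\<^bsub>A\<^esub>" for k by (rule ring_hom_zero[OF Fh A.ring_axioms A.ring_axioms])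
  have "dlim_cls A ([p] \<cdot>\<^bsub>A\<^esub> a) i = dlim_cls A \<zero>\<^bsub>A\<^esub> i"
    using u(2) add_hom_smult[OF A.is_abelian_group D.is_abelian_group ring_hom_add_hom[OF dlim_cls_hom[OF A]] a(1), of p i]
    by (simp add: a(2) dlim_zero[OF A, of i])
  then obtain k where "(frob A ^^ (i + k)) ([p] \<cdot>\<^bsub>A\<^esub> a) = (frob A ^^ (i + k)) \<zero>\<^bsub>A\<^esub>"
    using dlim_cls_eq[OF A, of "[p] \<cdot>\<^bsub>A\<^esub> a" "\<zero>\<^bsub>A\<^esub>" i i] a(1) by auto
  then have "[p] \<cdot>\<^bsub>A\<^esub> ((frob A ^^ (i + k)) a) = \<zero>\<^bsub>A\<^esub>"
    using add_hom_smult[OF A.is_abelian_group A.is_abelian_group ring_hom_add_hom[OF Fh] a(1)] F0 by metis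
  then have "(frob A ^^ (i + k)) a = (frob A ^^ (i + k)) \<zero>\<^bsub>A\<^esub>"
    using tf ring_hom_closed[OF Fh a(1)] F0 by (auto simp: ptf_def)
  then show "u = \<zero>\<^bsub>dlim A\<^esub>"
    using dlim_cls_eq[OF A a(1) A.zero_closed, of i i] unfolding a(2) dlim_zero[OF A, of i] by blast
qed

section \<open>Lifts of Frobenius\<close>

text \<open>The second half of \<open>frobenius_lift\<close>, with a congruence in place of ideal
  membership.\<close>

definition frob_lift :: "nat \<Rightarrow> ('a, 'm) ring_scheme \<Rightarrow> ('a \<Rightarrow> 'a) \<Rightarrow> bool" where
  "frob_lift p A f \<longleftrightarrow> (\<forall>a\<in>carrier A. pcong p A 1 (f a) (a [^]\<^bsub>A\<^esub> p))"

lemma ring_hom_nat_pow: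
  assumes "cring A" "cring B" "f \<in> ring_hom A B" "a \<in> carrier A"
  shows "f (a [^]\<^bsub>A\<^esub> (n::nat)) = f a [^]\<^bsub>B\<^esub> n"
proof -
  interpret A: cring A by fact
  interpret B: cring B by fact
  show ?thesis
    by (induction n) (simp_all add: ring_hom_one[OF assms(3)] ring_hom_mult[OF assms(3)] assms(4))
qed

text \<open>Modulo p every element of the completion comes from \<open>A\<close>, and both sides
  depend only on the class modulo p.\<close>

lemma frob_lift_pcompl:
  assumes A: "cring A" and f: "f \<in> ring_hom A A" "frob_lift p A f"
  shows "frob_lift p (pcompl p A) (pcompl_map p A f)"
  unfolding frob_lift_def
proof
  interpret A: cring A by fact
  interpret C: cring "pcompl p A" by (rule A.pcompl_cring)
  fix s assume s: "s \<in> carrier (pcompl p A)"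
  obtain a where a: "a \<in> carrier A" "pcong p (pcompl p A) 1 s (pcompl_inj p A a)" using A.pcompl_dense[OF s] .
  note ic = ring_hom_closed[OF A.pcompl_inj_hom]
  note m = pcompl_map_ring_hom[OF A A f(1), of p]
  have "pcong p (pcompl p A) 1 (pcompl_map p A f s) (pcompl_map p A f (pcompl_inj p A a))"
    by (rule add_hom_pcong[OF C.ring_axioms C.ring_axioms ring_hom_add_hom[OF m] a(2) ic[OF a(1)]])
  moreover have "pcong p (pcompl p A) 1 (pcompl_inj p A (f a)) (pcompl_inj p A (a [^]\<^bsub>A\<^esub> p))"
    using f a ring_hom_closed[OF f(1)] by (simp add: A.pcompl_inj_pcong frob_lift_def)
  moreover have "pcong p (pcompl p A) 1 (pcompl_inj p A (a [^]\<^bsub>A\<^esub> p)) (s [^]\<^bsub>pcompl p A\<^esub> p)"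
    unfolding ring_hom_nat_pow[OF A C.is_cring A.pcompl_inj_hom a(1)]
    by (rule C.pcong_pow[OF C.pcong_sym[OF a(2) ic[OF a(1)]] s])
  ultimately show "pcong p (pcompl p A) 1 (pcompl_map p A f s) (s [^]\<^bsub>pcompl p A\<^esub> p)"
    unfolding pcompl_map_inj[OF A A ring_hom_add_hom[OF f(1)] a(1)]
    using C.pcong_trans s ic[OF ring_hom_closed[OF f(1) a(1)]] ic[OF A.nat_pow_closed[OF a(1)]]
    by (meson C.nat_pow_closed C.pcong_trans)
qed

lemma frob_lift_dlim:
  assumes A: "falg \<phi> A" and f: "frob_lift p A (frob A)"
  shows "frob_lift p (dlim A) (frob (dlim A))"
  unfolding frob_lift_def
proof
  interpret A: cring A using falgD(1)[OF A] .
  interpret D: cring "dlim A" by (rule dlim_cring[OF A])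
  fix u assume "u \<in> carrier (dlim A)"
  then obtain a i where a: "a \<in> carrier A" "u = dlim_cls A a i" by (auto simp: carrier_dlim[OF A])
  have "pcong p (dlim A) 1 (dlim_cls A (frob A a) i) (dlim_cls A (a [^]\<^bsub>A\<^esub> p) i)"
    using dlim_pcong[OF A, of p 1 "frob A a" "a [^]\<^bsub>A\<^esub> p" i] f a(1) by (simp add: frob_lift_def)
  moreover have "dlim_cls A (a [^]\<^bsub>A\<^esub> p) i = dlim_cls A a i [^]\<^bsub>dlim A\<^esub> p"
    by (rule ring_hom_nat_pow[OF A.is_cring D.is_cring dlim_cls_hom[OF A] a(1)])
  ultimately show "pcong p (dlim A) 1 (frob (dlim A) u) (u [^]\<^bsub>dlim A\<^esub> p)"
    unfolding a(2) dlim_frob[OF A a(1)] by simp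
qed

section \<open>Jet algebras\<close>

lemma poly_const_hom: "exps M \<Longrightarrow> poly_const \<in> ring_hom ring_of_type_algebra (poly_alg M)"
  by (rule ring_hom_memI) (auto simp: poly_const_def mult_single single_add exps_zero)

lemma poly_var_closed: "exps M \<Longrightarrow> poly_var i \<in> carrier (poly_alg M :: (expo \<Rightarrow>\<^sub>0 'r::comm_ring_1) ring)"
  using exps_single[of M i] by (simp add: poly_var_def)

lemma poly_alg_ptf:
  assumes "\<And>r::'r::comm_ring_1. of_nat p * r = 0 \<Longrightarrow> r = 0"
  shows "ptf p (poly_alg M :: (expo \<Rightarrow>\<^sub>0 'r) ring)"
  unfolding ptf_def
proof (intro ballI impI)
  fix a :: "expo \<Rightarrow>\<^sub>0 'r" assume "[p] \<cdot>\<^bsub>poly_alg M\<^esub> a = \<zero>\<^bsub>poly_alg M\<^esub>"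
  then have *: "of_nat p * a = 0" by (simp add: poly_alg_smult)
  have l: "Poly_Mapping.lookup (of_nat n * a) m = of_nat n * Poly_Mapping.lookup a m" for n m
    by (induction n) (simp_all add: distrib_right lookup_add)
  have "Poly_Mapping.lookup a m = 0" for m
    using arg_cong[OF *, of "\<lambda>f. Poly_Mapping.lookup f m"] assms l by simp
  then show "a = \<zero>\<^bsub>poly_alg M\<^esub>" by (simp add: poly_mapping_eqI)
qed

context
  fixes p :: nat and M :: "expo set"
  assumes M: "exps M"
begin

lemma jet_ring_cring: "cring (jet_ring p M :: 'r::comm_ring_1 jet ring)"
  unfolding jet_ring_def by (rule cring.pcompl_cring[OF poly_alg_cring[OF M]])

lemma jet_ring_complete: "p_complete p (jet_ring p M :: 'r::comm_ring_1 jet ring)"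
  unfolding jet_ring_def by (rule cring.p_complete_pcompl[OF poly_alg_cring[OF M]])

lemma jet_const_hom: "jet_const p M \<in> ring_hom ring_of_type_algebra (jet_ring p M :: 'r::comm_ring_1 jet ring)"
  using ring_hom_trans[OF poly_const_hom[OF M] cring.pcompl_inj_hom[OF poly_alg_cring[OF M]], of p]
  by (simp add: jet_ring_def jet_const_def[abs_def] comp_def)

lemma jet_const_closed: "jet_const p M r \<in> carrier (jet_ring p M)"
  using ring_hom_closed[OF jet_const_hom, of r] by simp

lemma jet_var_closed: "jet_var p M i \<in> carrier (jet_ring p M :: 'r::comm_ring_1 jet ring)"
  using ring_hom_closed[OF cring.pcompl_inj_hom[OF poly_alg_cring[OF M]] poly_var_closed[OF M]]
  by (simp add: jet_ring_def jet_var_def)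

lemma jet_evaluable: "cring.evaluable (jet_ring p M :: 'r::comm_ring_1 jet ring) M (jet_var p M)"
  using cring.mon_eq(2)[OF jet_ring_cring M cring.pcompl_inj_hom[OF poly_alg_cring[OF M], of p, folded jet_ring_def] exps_zero[OF M]]
  by (simp add: jet_var_def[abs_def])

lemma jet_hom_exists:
  fixes \<rho> :: "'r::comm_ring_1 \<Rightarrow> 't"
  assumes T: "cring T" "p_complete p T" and \<rho>: "\<rho> \<in> ring_hom ring_of_type_algebra T"
    and v: "cring.evaluable T M v"
  obtains F where "F \<in> ring_hom (jet_ring p M) T" "\<And>r. F (jet_const p M r) = \<rho> r" "\<And>i. F (jet_var p M i) = v i"
proof -
  interpret T: cring T by fact
  interpret P: cring "poly_alg M :: (expo \<Rightarrow>\<^sub>0 'r) ring" by (rule poly_alg_cring[OF M])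
  obtain G where G: "G \<in> ring_hom (poly_alg M) T" "\<And>r. G (poly_const r) = \<rho> r" "\<And>i. G (poly_var i) = v i"
    using T.poly_hom_exists[OF M \<rho> v] by blast
  note e = pext_inj[OF P.is_cring T ring_hom_add_hom[OF G(1)]]
  show ?thesis
    by (rule that[of "pext p T G"])
      (use pext_ring_hom[OF P.is_cring T G(1)] e[OF ring_hom_closed[OF poly_const_hom[OF M]]] e[OF poly_var_closed[OF M]] G
       in \<open>simp_all add: jet_ring_def jet_const_def jet_var_def\<close>)
qed

text \<open>Separatedness is all that is asked of the target, so that it may be the quotient of a
  jet ring by p, as in \<open>jet_frob_lift\<close>.\<close>

lemma jet_hom_unique:
  fixes F :: "'r::comm_ring_1 jet \<Rightarrow> 't"
  assumes T: "cring T" and sep: "\<And>x y. x \<in> carrier T \<Longrightarrow> y \<in> carrier T \<Longrightarrow> (\<And>n. pcong p T n x y) \<Longrightarrow> x = y"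
    and F: "F \<in> ring_hom (jet_ring p M) T" and G: "G \<in> ring_hom (jet_ring p M) T"
    and c: "\<And>r. F (jet_const p M r) = G (jet_const p M r)" and v: "\<And>i. F (jet_var p M i) = G (jet_var p M i)"
    and a: "a \<in> carrier (jet_ring p M)"
  shows "F a = G a"
proof -
  interpret T: cring T by fact
  interpret P: cring "poly_alg M :: (expo \<Rightarrow>\<^sub>0 'r) ring" by (rule poly_alg_cring[OF M])
  note i = P.pcompl_inj_hom[of p]
  note F' = F[unfolded jet_ring_def] and G' = G[unfolded jet_ring_def]
  show ?thesis
  proof (rule pcompl_hom_unique[OF P.is_cring T sep ring_hom_add_hom[OF F'] ring_hom_add_hom[OF G'] _ a[unfolded jet_ring_def]])
    fix f :: "expo \<Rightarrow>\<^sub>0 'r" assume f: "f \<in> carrier (poly_alg M)"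
    show "F (pcompl_inj p (poly_alg M) f) = G (pcompl_inj p (poly_alg M) f)"
      using T.poly_hom_unique[OF M ring_hom_trans[OF i F'] ring_hom_trans[OF i G'] _ _ f] c v
      by (simp add: jet_const_def jet_var_def)
  qed blast
qed

end

text \<open>Makes the p-th power modulo p a homomorphism to which \<open>jet_hom_unique\<close>
  applies. The quotient is separated for the trivial reason that p is zero in it.\<close>

lemma frob_lift_quot:
  assumes A: "cring A" and p: "Factorial_Ring.prime p"
  defines "I \<equiv> pideal p A 1"
  shows "(\<lambda>a. I +>\<^bsub>A\<^esub> (a [^]\<^bsub>A\<^esub> p)) \<in> ring_hom A (A Quot I)"
    and "\<And>x y n. n \<ge> 1 \<Longrightarrow> x \<in> carrier (A Quot I) \<Longrightarrow> y \<in> carrier (A Quot I) \<Longrightarrow> pcong p (A Quot I) n x y \<Longrightarrow> x = y"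
proof -
  interpret A: cring A by fact
  have id: "ideal I A" unfolding I_def by (rule A.pideal_ideal)
  interpret Q: cring "A Quot I" by (rule ideal.quotient_is_cring[OF id A])
  note h = ideal.rcos_ring_hom[OF id]
  show "(\<lambda>a. I +>\<^bsub>A\<^esub> (a [^]\<^bsub>A\<^esub> p)) \<in> ring_hom A (A Quot I)"
  proof (rule ring_hom_memI)
    fix a b assume ab: "a \<in> carrier A" "b \<in> carrier A"
    show "I +>\<^bsub>A\<^esub> ((a \<otimes>\<^bsub>A\<^esub> b) [^]\<^bsub>A\<^esub> p) = (I +>\<^bsub>A\<^esub> (a [^]\<^bsub>A\<^esub> p)) \<otimes>\<^bsub>A Quot I\<^esub> (I +>\<^bsub>A\<^esub> (b [^]\<^bsub>A\<^esub> p))"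
      using ab by (simp add: A.nat_pow_distrib ring_hom_mult[OF h])
    have "I +>\<^bsub>A\<^esub> ((a \<oplus>\<^bsub>A\<^esub> b) [^]\<^bsub>A\<^esub> p) = I +>\<^bsub>A\<^esub> (a [^]\<^bsub>A\<^esub> p \<oplus>\<^bsub>A\<^esub> b [^]\<^bsub>A\<^esub> p)"
      unfolding I_def using A.freshman[OF p ab] ab by (subst A.pcoset_eq) auto
    then show "I +>\<^bsub>A\<^esub> ((a \<oplus>\<^bsub>A\<^esub> b) [^]\<^bsub>A\<^esub> p) = (I +>\<^bsub>A\<^esub> (a [^]\<^bsub>A\<^esub> p)) \<oplus>\<^bsub>A Quot I\<^esub> (I +>\<^bsub>A\<^esub> (b [^]\<^bsub>A\<^esub> p))"
      using ab by (simp add: ring_hom_add[OF h])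
  qed (auto simp: ring_hom_one[OF h] intro: ring_hom_closed[OF h])
  fix x y n assume n: "n \<ge> (1::nat)" and xy: "x \<in> carrier (A Quot I)" "y \<in> carrier (A Quot I)" "pcong p (A Quot I) n x y"
  have "pcong p (A Quot I) 1 x y" using Q.pcong_mono[OF xy(3) n] .
  then obtain t where t: "t \<in> carrier (A Quot I)" "x = y \<oplus>\<^bsub>A Quot I\<^esub> [p] \<cdot>\<^bsub>A Quot I\<^esub> t" by (auto simp: pcong_def)
  then obtain a where a: "a \<in> carrier A" "t = I +>\<^bsub>A\<^esub> a" by (auto simp: quot_carrier)
  have "[p] \<cdot>\<^bsub>A Quot I\<^esub> t = I +>\<^bsub>A\<^esub> ([p] \<cdot>\<^bsub>A\<^esub> a)"
    using add_hom_smult[OF A.is_abelian_group Q.is_abelian_group ring_hom_add_hom[OF h] a(1)] by (simp add: a(2))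
  also have "\<dots> = I +>\<^bsub>A\<^esub> \<zero>\<^bsub>A\<^esub>"
    unfolding I_def using a(1) by (subst A.pcoset_eq) (auto simp: A.pcong_zero_iff)
  also have "\<dots> = \<zero>\<^bsub>A Quot I\<^esub>" by (rule ring_hom_zero[OF h A.ring_axioms Q.ring_axioms])
  finally show "x = y" using t xy by simp
qed

lemma jet_alg_ops [simp]:
  fixes \<phi> :: "'r::comm_ring_1 \<Rightarrow> 'r"
  shows
  "carrier (jet_alg p \<phi> M) = carrier (jet_ring p M)"
  "cring (jet_alg p \<phi> M) = cring (jet_ring p M :: 'r jet ring)"
  "p_complete q (jet_alg p \<phi> M) = p_complete q (jet_ring p M :: 'r jet ring)"
  "ptf q (jet_alg p \<phi> M) = ptf q (jet_ring p M :: 'r jet ring)"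
  "pcong q (jet_alg p \<phi> M) = pcong q (jet_ring p M)"
  "ring_hom (jet_alg p \<phi> M) S = ring_hom (jet_ring p M) S"
  "ring_hom T (jet_alg p \<phi> M) = ring_hom T (jet_ring p M)"
  "add_hom (jet_alg p \<phi> M) S = add_hom (jet_ring p M) S"
  "add_hom T (jet_alg p \<phi> M) = add_hom T (jet_ring p M)"
  "a [^]\<^bsub>jet_alg p \<phi> M\<^esub> (n::nat) = a [^]\<^bsub>jet_ring p M\<^esub> n"
  "[n] \<cdot>\<^bsub>jet_alg p \<phi> M\<^esub> a = [n] \<cdot>\<^bsub>jet_ring p M\<^esub> a"
  "[(k::int)] \<cdot>\<^bsub>jet_alg p \<phi> M\<^esub> a = [k] \<cdot>\<^bsub>jet_ring p M\<^esub> a"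
  "a \<otimes>\<^bsub>jet_alg p \<phi> M\<^esub> b = a \<otimes>\<^bsub>jet_ring p M\<^esub> b"
  "a \<oplus>\<^bsub>jet_alg p \<phi> M\<^esub> b = a \<oplus>\<^bsub>jet_ring p M\<^esub> b"
  "a \<ominus>\<^bsub>jet_alg p \<phi> M\<^esub> b = a \<ominus>\<^bsub>jet_ring p M\<^esub> b"
  "inv\<^bsub>jet_alg p \<phi> M\<^esub> a = inv\<^bsub>jet_ring p M\<^esub> a"
  "\<one>\<^bsub>jet_alg p \<phi> M\<^esub> = \<one>\<^bsub>jet_ring p M\<^esub>"
  by (simp_all add: jet_alg_def)

lemma jet_alg_simps [simp]:
  "emb (jet_alg p \<phi> M) = jet_const p M" "frob (jet_alg p \<phi> M) = jet_frob p \<phi> M"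
  by (simp_all add: jet_alg_def frob_alg.defs ring.defs)

section \<open>The Frobenius lift on jet algebras\<close>

locale frob_base =
  fixes p :: nat and \<phi> :: "'r::comm_ring_1 \<Rightarrow> 'r"
  assumes p: "Factorial_Ring.prime p"
    and \<phi>: "\<phi> \<in> ring_hom ring_of_type_algebra ring_of_type_algebra" "bij \<phi>"
    and \<phi>_lift: "frob_lift p ring_of_type_algebra \<phi>"
    and R_complete: "p_complete p (ring_of_type_algebra :: 'r ring)"
    and R_ptf: "\<And>r::'r. of_nat p * r = 0 \<Longrightarrow> r = 0"
begin

lemma jet_frob:
  assumes M: "exps M"
  shows "jet_frob p \<phi> M \<in> ring_hom (jet_ring p M) (jet_ring p M)"
    and "jet_frob p \<phi> M (jet_const p M r) = jet_const p M (\<phi> r)"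
    and "jet_frob p \<phi> M (jet_var p M i) = jet_var p M i [^]\<^bsub>jet_ring p M\<^esub> p \<oplus>\<^bsub>jet_ring p M\<^esub>
        [p] \<cdot>\<^bsub>jet_ring p M\<^esub> jet_var p M (Suc i)"
proof -
  interpret J: cring "jet_ring p M :: 'r jet ring" by (rule jet_ring_cring[OF M])
  note comp = jet_ring_complete[OF M, of p]
  note xc = jet_var_closed[OF M, of p]
  let ?J = "jet_ring p M :: 'r jet ring" and ?x = "jet_var p M :: nat \<Rightarrow> 'r jet"
  let ?v = "\<lambda>i. ?x i [^]\<^bsub>?J\<^esub> p \<oplus>\<^bsub>?J\<^esub> [p] \<cdot>\<^bsub>?J\<^esub> ?x (Suc i)"
  let ?P = "\<lambda>f. f \<in> ring_hom ?J ?J \<and> f \<in> extensional (carrier ?J) \<and>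
     (\<forall>r. f (jet_const p M r) = jet_const p M (\<phi> r)) \<and> (\<forall>i. f (?x i) = ?v i)"
  \<comment> \<open>Where a variable must be invertible, the prescribed value is the p-th power of a
    unit plus a multiple of p, which is a unit by completeness.\<close>
  have ev: "J.evaluable M ?v"
    using jet_evaluable[OF M, of p, where 'r = 'r] xc J.Units_add_smult[OF comp J.Units_pow_closed] unfolding J.evaluable_def by auto
  have \<rho>: "(\<lambda>r. jet_const p M (\<phi> r)) \<in> ring_hom ring_of_type_algebra ?J"
    using ring_hom_trans[OF \<phi>(1) jet_const_hom[OF M]] by (simp add: comp_def)
  obtain F where F: "F \<in> ring_hom ?J ?J" "\<And>r. F (jet_const p M r) = jet_const p M (\<phi> r)" "\<And>i. F (?x i) = ?v i"
    using jet_hom_exists[OF M J.is_cring comp \<rho> ev] by blast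
  have r: "restrict F (carrier ?J) \<in> ring_hom ?J ?J" by (rule J.ring_hom_restrict[OF F(1)]) simp
  have "?P (restrict F (carrier ?J))"
    using r by (simp add: F(2,3) xc jet_const_closed[OF M, of p])
  moreover have "f = restrict F (carrier ?J)" if f: "?P f" for f
  proof (rule extensionalityI[of _ "carrier ?J"])
    fix a assume a: "a \<in> carrier ?J"
    have fh: "f \<in> ring_hom ?J ?J" and fc: "\<And>r. f (jet_const p M r) = jet_const p M (\<phi> r)" and fx: "\<And>i. f (?x i) = ?v i"
      using f by blast+
    have "f a = F a"
      by (rule jet_hom_unique[OF M J.is_cring J.p_complete_sep[OF comp] fh F(1) _ _ a]) (simp_all only: fc fx F(2,3))
    then show "f a = restrict F (carrier ?J) a" using a by simp
  qed (use f in auto)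
  ultimately have "?P (jet_frob p \<phi> M)" unfolding jet_frob_def by (rule theI)
  then show "jet_frob p \<phi> M \<in> ring_hom ?J ?J" "jet_frob p \<phi> M (jet_const p M r) = jet_const p M (\<phi> r)"
    "jet_frob p \<phi> M (?x i) = ?v i" by blast+
qed

lemma jet_falg: "exps M \<Longrightarrow> falg \<phi> (jet_alg p \<phi> M)"
  by (simp add: falg_def jet_frob jet_ring_cring jet_const_hom)

lemma jet_ptf: "exps M \<Longrightarrow> ptf p (jet_alg p \<phi> M)"
  using cring.ptf_pcompl[OF poly_alg_cring[of M] poly_alg_ptf[OF R_ptf]] by (simp add: jet_ring_def)

lemma jet_complete: "exps M \<Longrightarrow> p_complete p (jet_alg p \<phi> M)"
  by (simp add: jet_ring_complete)

text \<open>The Frobenius and the p-th power induce two homomorphisms from the jet ring to its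
  quotient by p. They agree on constants, as \<phi> is a lift of Frobenius, and on variables by
  construction.\<close>

lemma jet_frob_lift:
  assumes M: "exps M"
  shows "frob_lift p (jet_alg p \<phi> M) (frob (jet_alg p \<phi> M))"
  unfolding frob_lift_def
proof
  let ?J = "jet_ring p M :: 'r jet ring" and ?x = "jet_var p M :: nat \<Rightarrow> 'r jet"
  interpret J: cring ?J by (rule jet_ring_cring[OF M])
  interpret R: cring "ring_of_type_algebra :: 'r ring" by (rule cring_from_type_algebra)
  let ?I = "pideal p ?J 1"
  have id: "ideal ?I ?J" by (rule J.pideal_ideal)
  interpret Q: cring "?J Quot ?I" by (rule ideal.quotient_is_cring[OF id J.is_cring])
  note h = ideal.rcos_ring_hom[OF id]
  note q = frob_lift_quot[OF J.is_cring p]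
  note jf = jet_frob[OF M] and xc = jet_var_closed[OF M, of p] and cc = jet_const_closed[OF M, of p]
  fix a assume "a \<in> carrier (jet_alg p \<phi> M)"
  then have a: "a \<in> carrier ?J" by simp
  have "?I +>\<^bsub>?J\<^esub> (jet_frob p \<phi> M a) = ?I +>\<^bsub>?J\<^esub> (a [^]\<^bsub>?J\<^esub> p)"
  proof (rule jet_hom_unique[OF M Q.is_cring _ ring_hom_trans[OF jf(1) h, unfolded comp_def] q(1) _ _ a])
    show "x = y" if "x \<in> carrier (?J Quot ?I)" "y \<in> carrier (?J Quot ?I)" "\<And>n. pcong p (?J Quot ?I) n x y" for x y
      using q(2)[OF _ that(1,2) that(3)[of 1]] by simp
    fix r :: 'r
    have pr: "pcong p ring_of_type_algebra 1 (\<phi> r) (r [^]\<^bsub>ring_of_type_algebra\<^esub> p)" using \<phi>_lift by (simp add: frob_lift_def)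
    have "pcong p ?J 1 (jet_const p M (\<phi> r)) (jet_const p M (r [^]\<^bsub>ring_of_type_algebra\<^esub> p))"
      by (rule add_hom_pcong[OF R.ring_axioms J.ring_axioms ring_hom_add_hom[OF jet_const_hom[OF M]] pr]) simp
    then have "pcong p ?J 1 (jet_const p M (\<phi> r)) (jet_const p M r [^]\<^bsub>?J\<^esub> p)"
      by (simp add: ring_hom_nat_pow[OF R.is_cring J.is_cring jet_const_hom[OF M]])
    then show "?I +>\<^bsub>?J\<^esub> (jet_frob p \<phi> M (jet_const p M r)) = ?I +>\<^bsub>?J\<^esub> (jet_const p M r [^]\<^bsub>?J\<^esub> p)"
      unfolding jf(2) using cc by (subst J.pcoset_eq) auto
  next
    fix i
    have "pcong p ?J 1 (jet_frob p \<phi> M (?x i)) (?x i [^]\<^bsub>?J\<^esub> p)"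
      unfolding jf(3) pcong_def using xc by auto
    then show "?I +>\<^bsub>?J\<^esub> (jet_frob p \<phi> M (?x i)) = ?I +>\<^bsub>?J\<^esub> (?x i [^]\<^bsub>?J\<^esub> p)"
      using xc ring_hom_closed[OF jf(1) xc] by (subst J.pcoset_eq) auto
  qed
  then have "pcong p ?J 1 (jet_frob p \<phi> M a) (a [^]\<^bsub>?J\<^esub> p)"
    using a ring_hom_closed[OF jf(1) a] by (subst (asm) J.pcoset_eq) auto
  then show "pcong p (jet_alg p \<phi> M) 1 (frob (jet_alg p \<phi> M) a) (a [^]\<^bsub>jet_alg p \<phi> M\<^esub> p)"
    by simp
qed

end

section \<open>The perfectoid base\<close>

lemma quot_lift:
  assumes V: "ring V" and T: "ring T" and I: "ideal I V" and h: "h \<in> ring_hom V T"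
    and z: "\<And>x. x \<in> I \<Longrightarrow> h x = \<zero>\<^bsub>T\<^esub>"
  obtains g where "g \<in> ring_hom (V Quot I) T" "\<And>x. x \<in> carrier V \<Longrightarrow> g (I +>\<^bsub>V\<^esub> x) = h x"
proof -
  interpret V: ring V by fact
  interpret T: ring T by fact
  define g where "g = (\<lambda>u. h (SOME c. c \<in> u))"
  have g: "g (I +>\<^bsub>V\<^esub> x) = h x" if x: "x \<in> carrier V" for x
  proof -
    have "(SOME c. c \<in> I +>\<^bsub>V\<^esub> x) \<in> I +>\<^bsub>V\<^esub> x" using V.coset_self[OF I x] by (rule someI)
    note m = V.coset_memD[OF I this x]
    have "h ((SOME c. c \<in> I +>\<^bsub>V\<^esub> x) \<ominus>\<^bsub>V\<^esub> x) = \<zero>\<^bsub>T\<^esub>" using z V.coset_eq_iff[OF I m(1) x] m(2) by blast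
    then show ?thesis unfolding g_def
      using add_hom_diff[OF V.is_abelian_group T.is_abelian_group ring_hom_add_hom[OF h] m(1) x]
        ring_hom_closed[OF h x] ring_hom_closed[OF h m(1)] by simp
  qed
  note c = ideal.rcos_ring_hom[OF I]
  show ?thesis
  proof (rule that[OF _ g])
    show "g \<in> ring_hom (V Quot I) T"
    proof (rule ring_hom_memI)
      fix u v assume "u \<in> carrier (V Quot I)" "v \<in> carrier (V Quot I)"
      then obtain x y where xy: "u = I +>\<^bsub>V\<^esub> x" "x \<in> carrier V" "v = I +>\<^bsub>V\<^esub> y" "y \<in> carrier V"
        by (auto simp: quot_carrier)
      then show "g (u \<otimes>\<^bsub>V Quot I\<^esub> v) = g u \<otimes>\<^bsub>T\<^esub> g v" "g (u \<oplus>\<^bsub>V Quot I\<^esub> v) = g u \<oplus>\<^bsub>T\<^esub> g v"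
        by (simp_all add: g ring_hom_mult[OF c, symmetric] ring_hom_add[OF c, symmetric] ring_hom_mult[OF h] ring_hom_add[OF h])
    next
      show "g \<one>\<^bsub>V Quot I\<^esub> = \<one>\<^bsub>T\<^esub>" using g[OF V.one_closed] by (simp add: ring_hom_one[OF c] ring_hom_one[OF h])
    qed (auto simp: quot_carrier g ring_hom_closed[OF h])
  qed
qed

context
  fixes p :: nat
begin

definition root_gens :: "(expo \<Rightarrow>\<^sub>0 'r::comm_ring_1) set" where
  "root_gens = insert (poly_var 0 - of_nat p) {poly_var (Suc m) ^ p - poly_var m | m. True}"

lemma root_gens_closed: "root_gens \<subseteq> carrier (poly_alg Ga_exps :: (expo \<Rightarrow>\<^sub>0 'r::comm_ring_1) ring)"
proof -
  let ?P = "poly_alg Ga_exps :: (expo \<Rightarrow>\<^sub>0 'r) ring"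
  interpret P: cring ?P by (rule poly_alg_cring[OF exps_Ga])
  have mn: "f \<ominus>\<^bsub>?P\<^esub> g = f - g" if "f \<in> carrier ?P" "g \<in> carrier ?P" for f g
    using that P.minus_closed[OF that] by (metis P.minus_eq_iff add_diff_cancel_left' poly_alg_simps(5))
  note vc = poly_var_closed[OF exps_Ga]
  have "(poly_var 0 :: expo \<Rightarrow>\<^sub>0 'r) - of_nat p = poly_var 0 \<ominus>\<^bsub>?P\<^esub> ([p] \<cdot>\<^bsub>?P\<^esub> \<one>\<^bsub>?P\<^esub>)"
    using mn[OF vc[of 0] P.add.nat_pow_closed[OF P.one_closed, of p]] by (simp add: poly_alg_smult)
  moreover have "(poly_var (Suc m) :: expo \<Rightarrow>\<^sub>0 'r) ^ p - poly_var m = poly_var (Suc m) [^]\<^bsub>?P\<^esub> p \<ominus>\<^bsub>?P\<^esub> poly_var m" for m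
    using mn[OF P.nat_pow_closed[OF vc[of "Suc m"], of p] vc[of m]] by (simp add: poly_alg_pow)
  ultimately have "(poly_var 0 :: expo \<Rightarrow>\<^sub>0 'r) - of_nat p \<in> carrier ?P"
    "(poly_var (Suc m) :: expo \<Rightarrow>\<^sub>0 'r) ^ p - poly_var m \<in> carrier ?P" for m
    using P.minus_closed[OF vc P.add.nat_pow_closed[OF P.one_closed]] P.minus_closed[OF P.nat_pow_closed[OF vc] vc]
    by (simp_all only:)
  then show ?thesis unfolding root_gens_def by blast
qed

lemma root_ideal_ideal: "ideal (root_ideal p) (poly_alg Ga_exps :: (expo \<Rightarrow>\<^sub>0 'r::comm_ring_1) ring)"
  unfolding root_ideal_def root_gens_def[symmetric]
  by (rule ring.genideal_ideal[OF cring.axioms(1)[OF poly_alg_cring[OF exps_Ga]] root_gens_closed])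

lemma root_ring_cring: "cring (root_ring p :: (expo \<Rightarrow>\<^sub>0 'r::comm_ring_1) set ring)"
  unfolding root_ring_def by (rule ideal.quotient_is_cring[OF root_ideal_ideal poly_alg_cring[OF exps_Ga]])

lemma root_class_hom: "root_class p \<in> ring_hom (poly_alg Ga_exps) (root_ring p :: (expo \<Rightarrow>\<^sub>0 'r::comm_ring_1) set ring)"
  unfolding root_class_def[abs_def] root_ring_def by (rule ideal.rcos_ring_hom[OF root_ideal_ideal])

text \<open>The quotient by \<open>root_ideal\<close> is the universal algebra with a compatible
  system of p-power roots of p.\<close>

lemma root_hom_exists:
  fixes \<rho> :: "'r::comm_ring_1 \<Rightarrow> 't"
  assumes T: "cring T" and \<rho>: "\<rho> \<in> ring_hom ring_of_type_algebra T"
    and v: "\<And>m. v m \<in> carrier T" "v 0 = [p] \<cdot>\<^bsub>T\<^esub> \<one>\<^bsub>T\<^esub>" "\<And>m. v (Suc m) [^]\<^bsub>T\<^esub> p = v m"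
  obtains F where "F \<in> ring_hom (root_ring p) T" "\<And>r. F (root_class p (poly_const r)) = \<rho> r"
    "\<And>m. F (root_class p (poly_var m)) = v m"
proof -
  interpret T: cring T by fact
  let ?P = "poly_alg Ga_exps :: (expo \<Rightarrow>\<^sub>0 'r) ring"
  interpret P: cring ?P by (rule poly_alg_cring[OF exps_Ga])
  have "Poly_Mapping.lookup m i \<ge> 0" if "m \<in> Ga_exps" for m i using that by (simp add: Ga_exps_def)
  then have "T.evaluable Ga_exps v" using v(1) unfolding T.evaluable_def by (auto simp: not_less[symmetric])
  then obtain G where G: "G \<in> ring_hom ?P T" "\<And>r. G (poly_const r) = \<rho> r" "\<And>i. G (poly_var i) = v i"
    using T.poly_hom_exists[OF exps_Ga \<rho>] by blast
  interpret G: ring_hom_ring ?P T G by (rule ring_hom_ringI2[OF P.ring_axioms T.ring_axioms G(1)])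
  note vc = poly_var_closed[OF exps_Ga]
  have "root_gens \<subseteq> a_kernel ?P T G"
  proof
    fix g :: "expo \<Rightarrow>\<^sub>0 'r" assume g: "g \<in> root_gens"
    then have gc: "g \<in> carrier ?P" using root_gens_closed by blast
    have "G g = \<zero>\<^bsub>T\<^esub>"
    proof -
      consider "g = poly_var 0 - of_nat p" | m where "g = poly_var (Suc m) ^ p - poly_var m"
        using g unfolding root_gens_def by blast
      then show ?thesis
      proof cases
        case 1
        then have e: "g \<oplus>\<^bsub>?P\<^esub> [p] \<cdot>\<^bsub>?P\<^esub> \<one>\<^bsub>?P\<^esub> = poly_var 0" by (simp add: poly_alg_smult)
        have "G (g \<oplus>\<^bsub>?P\<^esub> [p] \<cdot>\<^bsub>?P\<^esub> \<one>\<^bsub>?P\<^esub>) = G g \<oplus>\<^bsub>T\<^esub> [p] \<cdot>\<^bsub>T\<^esub> \<one>\<^bsub>T\<^esub>"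
          using G.hom_add[OF gc P.add.nat_pow_closed[OF P.one_closed]] G.hom_one
            add_hom_smult[OF P.is_abelian_group T.is_abelian_group ring_hom_add_hom[OF G(1)] P.one_closed] by metis
        then show ?thesis unfolding e G(3) v(2) using G.hom_closed[OF gc] by (metis T.add.l_cancel_one' T.add.nat_pow_closed T.add.r_cancel_one' T.one_closed)
      next
        case 2
        then have e: "g \<oplus>\<^bsub>?P\<^esub> poly_var m = poly_var (Suc m) [^]\<^bsub>?P\<^esub> p" by (simp add: poly_alg_pow)
        have "G g \<oplus>\<^bsub>T\<^esub> v m = v m"
          using G.hom_add[OF gc vc, of m] unfolding e G(3) using G.hom_nat_pow[OF vc] G(3) v(3) by metis
        then show ?thesis using G.hom_closed[OF gc] v(1) by (metis T.add.r_cancel_one)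
      qed
    qed
    then show "g \<in> a_kernel ?P T G" unfolding a_kernel_def' using gc by blast
  qed
  then have "root_ideal p \<subseteq> a_kernel ?P T G"
    unfolding root_ideal_def root_gens_def[symmetric] by (rule P.genideal_minimal[OF G.kernel_is_ideal])
  then have z: "G x = \<zero>\<^bsub>T\<^esub>" if "x \<in> root_ideal p" for x using that unfolding a_kernel_def' by blast
  obtain g where g: "g \<in> ring_hom (?P Quot root_ideal p) T" "\<And>x. x \<in> carrier ?P \<Longrightarrow> g (root_ideal p +>\<^bsub>?P\<^esub> x) = G x"
    using quot_lift[OF P.ring_axioms T.ring_axioms root_ideal_ideal G(1) z] by blast
  show ?thesis
  proof (rule that[of g])
    show "g \<in> ring_hom (root_ring p) T" using g(1) by (simp add: root_ring_def)
    have pc: "poly_const r \<in> carrier ?P" for r :: 'r using ring_hom_closed[OF poly_const_hom[OF exps_Ga], of r] by simp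
    show "g (root_class p (poly_const r)) = \<rho> r" for r unfolding root_class_def g(2)[OF pc] by (rule G(2))
    show "g (root_class p (poly_var m)) = v m" for m unfolding root_class_def g(2)[OF vc] by (rule G(3))
  qed
qed

lemma K_hom_unique:
  fixes F :: "'r::comm_ring_1 perf \<Rightarrow> 't"
  assumes T: "cring T" "p_complete p T"
    and F: "F \<in> ring_hom (pcompl p (root_ring p)) T" and G: "G \<in> ring_hom (pcompl p (root_ring p)) T"
    and c: "\<And>r. F (K_const p r) = G (K_const p r)" and v: "\<And>m. F (K_root p m) = G (K_root p m)"
    and a: "a \<in> carrier (pcompl p (root_ring p))"
  shows "F a = G a"
proof (rule p_complete_hom_unique[OF root_ring_cring T ring_hom_add_hom[OF F] ring_hom_add_hom[OF G] _ a])
  interpret T: cring T by fact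
  note i = cring.pcompl_inj_hom[OF root_ring_cring, of p]
  fix u :: "(expo \<Rightarrow>\<^sub>0 'r) set" assume "u \<in> carrier (root_ring p)"
  then obtain f where f: "f \<in> carrier (poly_alg Ga_exps)" "u = root_class p f"
    by (auto simp: root_ring_def root_class_def quot_carrier)
  show "F (pcompl_inj p (root_ring p) u) = G (pcompl_inj p (root_ring p) u)"
    using T.poly_hom_unique[OF exps_Ga ring_hom_trans[OF ring_hom_trans[OF root_class_hom i] F]
        ring_hom_trans[OF ring_hom_trans[OF root_class_hom i] G] _ _ f(1)] c v
    by (simp add: f(2) K_const_def K_root_def)
qed

end

lemma K_circ_ops [simp]:
  fixes \<phi> :: "'r::comm_ring_1 \<Rightarrow> 'r"
  shows
  "carrier (K_circ p \<phi>) = carrier (pcompl p (root_ring p))"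
  "cring (K_circ p \<phi>) = cring (pcompl p (root_ring p) :: 'r perf ring)"
  "ring_hom (K_circ p \<phi>) S = ring_hom (pcompl p (root_ring p)) S"
  "ring_hom T (K_circ p \<phi>) = ring_hom T (pcompl p (root_ring p))"
  "add_hom (K_circ p \<phi>) S = add_hom (pcompl p (root_ring p)) S"
  "add_hom T (K_circ p \<phi>) = add_hom T (pcompl p (root_ring p))"
  by (simp_all add: K_circ_def)

lemma K_circ_simps [simp]:
  "emb (K_circ p \<phi>) = K_const p" "frob (K_circ p \<phi>) = K_frob p \<phi>"
  by (simp_all add: K_circ_def frob_alg.defs ring.defs)

context frob_base begin

abbreviation "Kr \<equiv> pcompl p (root_ring p) :: 'r perf ring"

lemma K_const_hom: "K_const p \<in> ring_hom ring_of_type_algebra Kr"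
  using ring_hom_trans[OF ring_hom_trans[OF poly_const_hom[OF exps_Ga] root_class_hom] cring.pcompl_inj_hom[OF root_ring_cring], of p p]
  by (simp add: K_const_def[abs_def] comp_def)

lemma K_const_closed: "K_const p r \<in> carrier Kr"
  using ring_hom_closed[OF K_const_hom, of r] by simp

lemma K_root: "K_root p m \<in> carrier Kr" "K_root p 0 = [p] \<cdot>\<^bsub>Kr\<^esub> \<one>\<^bsub>Kr\<^esub>"
  "K_root p (Suc m) [^]\<^bsub>Kr\<^esub> p = K_root p m"
proof -
  let ?P = "poly_alg Ga_exps :: (expo \<Rightarrow>\<^sub>0 'r) ring"
  interpret P: cring ?P by (rule poly_alg_cring[OF exps_Ga])
  interpret Q: cring "root_ring p :: (expo \<Rightarrow>\<^sub>0 'r) set ring" by (rule root_ring_cring)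
  interpret C: cring Kr by (rule Q.pcompl_cring)
  have g: "(\<lambda>f. pcompl_inj p (root_ring p) (root_class p f)) \<in> ring_hom ?P Kr"
    using ring_hom_trans[OF root_class_hom Q.pcompl_inj_hom, of p] by (simp add: comp_def)
  note vc = poly_var_closed[OF exps_Ga]
  show "K_root p m \<in> carrier Kr" unfolding K_root_def by (rule ring_hom_closed[OF g vc])
  have mn: "f \<ominus>\<^bsub>?P\<^esub> g = f - g" if "f \<in> carrier ?P" "g \<in> carrier ?P" for f g
    using that P.minus_closed[OF that] by (metis P.minus_eq_iff add_diff_cancel_left' poly_alg_simps(5))
  have eq: "root_class p f = root_class p g" if "f \<in> carrier ?P" "g \<in> carrier ?P" "f - g \<in> root_gens p" for f g
  proof -
    have "f \<ominus>\<^bsub>?P\<^esub> g \<in> root_ideal p"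
      unfolding mn[OF that(1,2)] root_ideal_def root_gens_def[symmetric] using P.genideal_self[OF root_gens_closed] that(3) by blast
    then show ?thesis unfolding root_class_def using P.coset_eq_iff[OF root_ideal_ideal that(1,2)] by blast
  qed
  have "root_class p (poly_var 0) = root_class p ([p] \<cdot>\<^bsub>?P\<^esub> \<one>\<^bsub>?P\<^esub>)"
    by (rule eq[OF vc P.add.nat_pow_closed[OF P.one_closed]]) (simp add: poly_alg_smult root_gens_def)
  then show "K_root p 0 = [p] \<cdot>\<^bsub>Kr\<^esub> \<one>\<^bsub>Kr\<^esub>"
    unfolding K_root_def
    using add_hom_smult[OF P.is_abelian_group C.is_abelian_group ring_hom_add_hom[OF g] P.one_closed, of p] ring_hom_one[OF g] by simp
  have "root_class p (poly_var (Suc m) [^]\<^bsub>?P\<^esub> p) = root_class p (poly_var m)"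
    by (rule eq[OF P.nat_pow_closed[OF vc] vc]) (auto simp: poly_alg_pow root_gens_def)
  then show "K_root p (Suc m) [^]\<^bsub>Kr\<^esub> p = K_root p m"
    unfolding K_root_def using ring_hom_nat_pow[OF P.is_cring C.is_cring g vc, of "Suc m" p] by simp
qed

text \<open>Stated for an arbitrary \<psi> so as to serve \<phi> and its inverse; the two extensions
  are mutually inverse, as \<open>K_frob\<close> demands an automorphism.\<close>

lemma K_endo:
  assumes "\<psi> \<in> ring_hom ring_of_type_algebra (ring_of_type_algebra :: 'r ring)"
  obtains F where "F \<in> ring_hom Kr Kr" "\<And>r. F (K_const p r) = K_const p (\<psi> r)" "\<And>m. F (K_root p m) = K_root p m"
proof -
  interpret Q: cring "root_ring p :: (expo \<Rightarrow>\<^sub>0 'r) set ring" by (rule root_ring_cring)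
  interpret C: cring Kr by (rule Q.pcompl_cring)
  have \<rho>: "(\<lambda>r. K_const p (\<psi> r)) \<in> ring_hom ring_of_type_algebra Kr"
    using ring_hom_trans[OF assms K_const_hom] by (simp add: comp_def)
  obtain F where F: "F \<in> ring_hom (root_ring p) Kr" "\<And>r. F (root_class p (poly_const r)) = K_const p (\<psi> r)"
    "\<And>m. F (root_class p (poly_var m)) = K_root p m"
    using root_hom_exists[OF C.is_cring \<rho> K_root] by blast
  note e = pext_inj[OF Q.is_cring C.is_cring Q.p_complete_pcompl ring_hom_add_hom[OF F(1)]]
  have pc: "root_class p (poly_const r) \<in> carrier (root_ring p)" for r :: 'r
    using ring_hom_closed[OF root_class_hom ring_hom_closed[OF poly_const_hom[OF exps_Ga]], of r p] by simp
  have vc: "root_class p (poly_var m) \<in> carrier (root_ring p :: (expo \<Rightarrow>\<^sub>0 'r) set ring)" for m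
    by (rule ring_hom_closed[OF root_class_hom poly_var_closed[OF exps_Ga]])
  show ?thesis
    by (rule that[of "pext p Kr F"])
      (simp_all only: pext_ring_hom[OF Q.is_cring C.is_cring Q.p_complete_pcompl F(1)] F(2,3) e[OF pc] e[OF vc]
       K_const_def[of p r for r] K_root_def[of p m for m])
qed

lemma K_frob: "K_frob p \<phi> \<in> ring_hom Kr Kr" "K_frob p \<phi> (K_const p r) = K_const p (\<phi> r)"
    "K_frob p \<phi> (K_root p m) = K_root p m"
proof -
  interpret Q: cring "root_ring p :: (expo \<Rightarrow>\<^sub>0 'r) set ring" by (rule root_ring_cring)
  interpret C: cring Kr by (rule Q.pcompl_cring)
  interpret R: cring "ring_of_type_algebra :: 'r ring" by (rule cring_from_type_algebra)
  have \<psi>: "inv_into UNIV \<phi> \<in> ring_hom ring_of_type_algebra ring_of_type_algebra"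
    using inv_into_ring_hom[OF R.ring_axioms \<phi>(1)] \<phi>(2) by simp
  obtain F where F: "F \<in> ring_hom Kr Kr" "\<And>r. F (K_const p r) = K_const p (\<phi> r)" "\<And>m. F (K_root p m) = K_root p m"
    using K_endo[OF \<phi>(1)] by blast
  obtain G where G: "G \<in> ring_hom Kr Kr" "\<And>r. G (K_const p r) = K_const p (inv_into UNIV \<phi> r)" "\<And>m. G (K_root p m) = K_root p m"
    using K_endo[OF \<psi>] by blast
  have id: "(\<lambda>a. a) \<in> ring_hom Kr Kr" using id_ring_hom[of Kr] by (simp add: id_def)
  note u = K_hom_unique[OF C.is_cring Q.p_complete_pcompl]
  have GF: "G (F a) = a" if "a \<in> carrier Kr" for a
    using u[OF ring_hom_trans[OF F(1) G(1)] id _ _ that] F(2,3) G(2,3) \<phi>(2) by (simp add: bij_is_inj)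
  have FG: "F (G a) = a" if "a \<in> carrier Kr" for a
    using u[OF ring_hom_trans[OF G(1) F(1)] id _ _ that] F(2,3) G(2,3) \<phi>(2) by (simp add: bij_is_surj surj_f_inv_f)
  have bij: "bij_betw F (carrier Kr) (carrier Kr)"
    by (rule bij_betw_byWitness[of _ G]) (use GF FG ring_hom_closed[OF F(1)] ring_hom_closed[OF G(1)] in auto)
  let ?P = "\<lambda>f. f \<in> ring_iso Kr Kr \<and> f \<in> extensional (carrier Kr) \<and>
     (\<forall>r. f (K_const p r) = K_const p (\<phi> r)) \<and> (\<forall>m. f (K_root p m) = K_root p m)"
  have b2: "bij_betw (restrict F (carrier Kr)) (carrier Kr) (carrier Kr)"
    using bij by (simp add: bij_betw_restrict_eq)
  have r2: "restrict F (carrier Kr) \<in> ring_hom Kr Kr"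
    by (rule C.ring_hom_restrict[OF F(1)]) simp
  have "?P (restrict F (carrier Kr))"
    using b2 r2 by (simp add: ring_iso_def F(2,3) K_const_closed K_root(1))
  moreover have "f = restrict F (carrier Kr)" if f: "?P f" for f
  proof (rule extensionalityI[of _ "carrier Kr"])
    fix a assume a: "a \<in> carrier Kr"
    have fh: "f \<in> ring_hom Kr Kr" and fc: "\<And>r. f (K_const p r) = K_const p (\<phi> r)" and fx: "\<And>m. f (K_root p m) = K_root p m"
      using f by (auto simp: ring_iso_def)
    have "f a = F a" by (rule u[OF fh F(1) _ _ a]) (simp_all only: fc fx F(2,3))
    then show "f a = restrict F (carrier Kr) a" using a by simp
  qed (use f in auto)
  ultimately have "?P (K_frob p \<phi>)" unfolding K_frob_def by (rule theI)
  then show "K_frob p \<phi> \<in> ring_hom Kr Kr" "K_frob p \<phi> (K_const p r) = K_const p (\<phi> r)"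
    "K_frob p \<phi> (K_root p m) = K_root p m" by (auto simp: ring_iso_def)
qed

lemma K_falg: "falg \<phi> (K_circ p \<phi>)"
  using cring.pcompl_cring[OF root_ring_cring, of p p] by (simp add: falg_def K_const_hom K_frob)

end

section \<open>Sums of p-adically null families\<close>

context cring begin

lemma has_psum_iff:
  assumes "f \<in> I \<rightarrow> carrier R"
  shows "has_psum p R f I s \<longleftrightarrow> s \<in> carrier R \<and> (\<forall>k. \<exists>F. finite F \<and> F \<subseteq> I \<and>
    (\<forall>G. finite G \<and> F \<subseteq> G \<and> G \<subseteq> I \<longrightarrow> pcong p R k (\<Oplus>i\<in>G. f i) s))"
proof -
  have "(\<Oplus>i\<in>G. f i) \<ominus> s \<in> pideal p R k \<longleftrightarrow> pcong p R k (\<Oplus>i\<in>G. f i) s" if "G \<subseteq> I" "s \<in> carrier R" for G k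
    using that assms by (intro minus_in_pideal finsum_closed) auto
  then show ?thesis unfolding has_psum_def by (metis (no_types, lifting))
qed

lemma has_psum_unique:
  assumes comp: "p_complete p R" and f: "f \<in> I \<rightarrow> carrier R" and s: "has_psum p R f I s" "has_psum p R f I t"
  shows "s = t"
proof (rule p_complete_sep[OF comp])
  show c: "s \<in> carrier R" "t \<in> carrier R" using s by (auto simp: has_psum_def)
  fix k
  obtain F where F: "finite F" "F \<subseteq> I" "\<And>G. finite G \<Longrightarrow> F \<subseteq> G \<Longrightarrow> G \<subseteq> I \<Longrightarrow> pcong p R k (\<Oplus>i\<in>G. f i) s"
    using s(1)[unfolded has_psum_iff[OF f]] by metis
  obtain G where G: "finite G" "G \<subseteq> I" "\<And>H. finite H \<Longrightarrow> G \<subseteq> H \<Longrightarrow> H \<subseteq> I \<Longrightarrow> pcong p R k (\<Oplus>i\<in>H. f i) t"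
    using s(2)[unfolded has_psum_iff[OF f]] by metis
  have 1: "pcong p R k (\<Oplus>i\<in>F \<union> G. f i) s" by (rule F(3)) (use F G in auto)
  have 2: "pcong p R k (\<Oplus>i\<in>F \<union> G. f i) t" by (rule G(3)) (use F G in auto)
  show "pcong p R k s t" using pcong_trans[OF pcong_sym[OF 1 c(1)] 2 c(2)] .
qed

lemma psum_eq:
  assumes "p_complete p R" "f \<in> I \<rightarrow> carrier R" "has_psum p R f I s"
  shows "psum p R f I = s"
  unfolding psum_def by (rule the_equality[where P = "has_psum p R f I"]) (use assms has_psum_unique in blast)+

lemma pcong_finsum_subset:
  assumes "finite G" "F \<subseteq> G" "f \<in> G \<rightarrow> carrier R" "\<And>i. i \<in> G - F \<Longrightarrow> pcong p R k (f i) \<zero>"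
  shows "pcong p R k (\<Oplus>i\<in>G. f i) (\<Oplus>i\<in>F. f i)"
proof -
  have "pcong p R k (\<Oplus>i\<in>G. f i) (\<Oplus>i\<in>G. if i \<in> F then f i else \<zero>)"
    by (rule pcong_finsum) (use assms in \<open>auto simp: Pi_iff\<close>)
  moreover have "(\<Oplus>i\<in>G. if i \<in> F then f i else \<zero>) = (\<Oplus>i\<in>F. f i)"
    using assms by (intro add.finprod_mono_neutral_cong_right) auto
  ultimately show ?thesis by simp
qed

lemma has_psum_approx:
  assumes f: "f \<in> I \<rightarrow> carrier R" and s: "has_psum p R f I s" and F: "finite F" "F \<subseteq> I"
    "\<And>i. i \<in> I - F \<Longrightarrow> pcong p R k (f i) \<zero>"
  shows "pcong p R k s (\<Oplus>i\<in>F. f i)"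
proof -
  have sc: "s \<in> carrier R" using s by (simp add: has_psum_def)
  have cl: "(\<Oplus>i\<in>F. f i) \<in> carrier R" using f F by (intro finsum_closed) auto
  obtain G where G: "finite G" "G \<subseteq> I" "\<And>H. finite H \<Longrightarrow> G \<subseteq> H \<Longrightarrow> H \<subseteq> I \<Longrightarrow> pcong p R k (\<Oplus>i\<in>H. f i) s"
    using s[unfolded has_psum_iff[OF f]] by metis
  have 1: "pcong p R k (\<Oplus>i\<in>F \<union> G. f i) s" by (rule G(3)) (use F G in auto)
  have 2: "pcong p R k (\<Oplus>i\<in>F \<union> G. f i) (\<Oplus>i\<in>F. f i)"
    by (rule pcong_finsum_subset) (use F G f in auto)
  show ?thesis using pcong_trans[OF pcong_sym[OF 1 sc] 2 cl] .
qed

text \<open>Convergence to 0 along the cofinite filter, without an order on the index set; the index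
  sets used are sets of natural numbers and the set of all integers.\<close>

definition null :: "nat \<Rightarrow> ('i \<Rightarrow> 'a) \<Rightarrow> 'i set \<Rightarrow> bool" where
  "null p f I \<longleftrightarrow> f \<in> I \<rightarrow> carrier R \<and> (\<forall>k. finite {i \<in> I. \<not> pcong p R k (f i) \<zero>})"

text \<open>The sums over the finite sets of terms that are nonzero modulo p^k form a coherent
  sequence, and its limit is the sum.\<close>

lemma has_psum_exists:
  assumes comp: "p_complete p R" and f: "null p f I"
  obtains s where "has_psum p R f I s"
proof -
  let ?S = "\<lambda>k. {i \<in> I. \<not> pcong p R k (f i) \<zero>}"
  have fc: "f \<in> I \<rightarrow> carrier R" and fin: "\<And>k. finite (?S k)" using f by (auto simp: null_def)
  define x where "x = (\<lambda>k. \<Oplus>i\<in>?S k. f i)"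
  have xc: "x k \<in> carrier R" for k unfolding x_def using fc by (intro finsum_closed) auto
  have sub: "?S k \<subseteq> ?S (Suc k)" for k using pcong_mono[of p "Suc k" _ \<zero> k] by auto
  have "pcong p R k (x (Suc k)) (x k)" for k
    unfolding x_def by (rule pcong_finsum_subset[OF fin sub]) (use fc in auto)
  then have "coherent p R x" using xc by (simp add: coherent_def)
  then obtain l where l: "l \<in> carrier R" "\<And>n. pcong p R n l (x n)" using p_complete_lim[OF comp] by blast
  have "has_psum p R f I l" unfolding has_psum_iff[OF fc]
  proof (intro conjI allI l(1) exI[of _ "?S k" for k] impI)
    fix k G assume G: "finite G \<and> ?S k \<subseteq> G \<and> G \<subseteq> I"
    have "pcong p R k (\<Oplus>i\<in>G. f i) (x k)"
      unfolding x_def by (rule pcong_finsum_subset) (use G fc in auto)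
    then show "pcong p R k (\<Oplus>i\<in>G. f i) l" using pcong_trans[OF _ pcong_sym[OF l(2) xc] l(1)] by blast
  qed (use fin in auto)
  then show ?thesis by (rule that)
qed

lemma has_psum_psum:
  assumes "p_complete p R" "null p f I"
  shows "has_psum p R f I (psum p R f I)"
proof -
  obtain s where s: "has_psum p R f I s" using has_psum_exists[OF assms] .
  then show ?thesis using psum_eq[OF assms(1) _ s] assms(2) by (simp add: null_def)
qed

lemma has_psum_finite:
  assumes "finite F" "F \<subseteq> I" "f \<in> I \<rightarrow> carrier R" "\<And>i. i \<in> I - F \<Longrightarrow> f i = \<zero>"
  shows "has_psum p R f I (\<Oplus>i\<in>F. f i)"
  unfolding has_psum_iff[OF assms(3)]
proof (intro conjI allI exI[of _ F] impI)
  show "(\<Oplus>i\<in>F. f i) \<in> carrier R" using assms by (intro finsum_closed) auto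
  fix k G assume "finite G \<and> F \<subseteq> G \<and> G \<subseteq> I"
  then show "pcong p R k (\<Oplus>i\<in>G. f i) (\<Oplus>i\<in>F. f i)"
    using assms by (intro pcong_finsum_subset) auto
qed (use assms in auto)

lemma has_psum_add:
  assumes f: "f \<in> I \<rightarrow> carrier R" and g: "g \<in> I \<rightarrow> carrier R" and s: "has_psum p R f I s" and t: "has_psum p R g I t"
  shows "has_psum p R (\<lambda>i. f i \<oplus> g i) I (s \<oplus> t)"
proof -
  have fg: "(\<lambda>i. f i \<oplus> g i) \<in> I \<rightarrow> carrier R" using f g by auto
  have c: "s \<in> carrier R" "t \<in> carrier R" using s t by (auto simp: has_psum_def)
  show ?thesis unfolding has_psum_iff[OF fg]
  proof (intro conjI allI)
    fix k
    obtain F where F: "finite F" "F \<subseteq> I" "\<And>H. finite H \<Longrightarrow> F \<subseteq> H \<Longrightarrow> H \<subseteq> I \<Longrightarrow> pcong p R k (\<Oplus>i\<in>H. f i) s"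
      using s[unfolded has_psum_iff[OF f]] by metis
    obtain G where G: "finite G" "G \<subseteq> I" "\<And>H. finite H \<Longrightarrow> G \<subseteq> H \<Longrightarrow> H \<subseteq> I \<Longrightarrow> pcong p R k (\<Oplus>i\<in>H. g i) t"
      using t[unfolded has_psum_iff[OF g]] by metis
    have "pcong p R k (\<Oplus>i\<in>H. f i \<oplus> g i) (s \<oplus> t)" if "finite H" "F \<union> G \<subseteq> H" "H \<subseteq> I" for H
    proof -
      have "(\<Oplus>i\<in>H. f i \<oplus> g i) = (\<Oplus>i\<in>H. f i) \<oplus> (\<Oplus>i\<in>H. g i)"
        using that f g by (intro finsum_addf) auto
      then show ?thesis using pcong_add[OF F(3) G(3) c] that by simp
    qed
    then show "\<exists>F. finite F \<and> F \<subseteq> I \<and> (\<forall>H. finite H \<and> F \<subseteq> H \<and> H \<subseteq> I \<longrightarrow> pcong p R k (\<Oplus>i\<in>H. f i \<oplus> g i) (s \<oplus> t))"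
      using F(1,2) G(1,2) by (intro exI[of _ "F \<union> G"]) auto
  qed (use c in auto)
qed

lemma has_psum_reindex:
  assumes h: "bij_betw h J I" and f: "f \<in> I \<rightarrow> carrier R" and s: "has_psum p R f I s"
  shows "has_psum p R (\<lambda>j. f (h j)) J s"
proof -
  have inj: "inj_on h J" and im: "h ` J = I" using h by (auto simp: bij_betw_def)
  have fh: "(\<lambda>j. f (h j)) \<in> J \<rightarrow> carrier R" using f im by auto
  show ?thesis unfolding has_psum_iff[OF fh]
  proof (intro conjI allI)
    show "s \<in> carrier R" using s by (simp add: has_psum_def)
    fix k
    obtain F where F: "finite F" "F \<subseteq> I" "\<And>H. finite H \<Longrightarrow> F \<subseteq> H \<Longrightarrow> H \<subseteq> I \<Longrightarrow> pcong p R k (\<Oplus>i\<in>H. f i) s"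
      using s[unfolded has_psum_iff[OF f]] by metis
    obtain F' where F': "F' \<subseteq> J" "h ` F' = F" "inj_on h F'"
      using F(2) im inj by (metis (no_types, lifting) subset_image_inj inj_on_subset)
    have fin: "finite F'" using F(1) F' by (metis finite_imageD)
    have "pcong p R k (\<Oplus>j\<in>H. f (h j)) s" if H: "finite H" "F' \<subseteq> H" "H \<subseteq> J" for H
    proof -
      have "(\<Oplus>i\<in>h ` H. f i) = (\<Oplus>j\<in>H. f (h j))"
        using H f im inj by (intro finsum_reindex) (auto intro: inj_on_subset)
      moreover have "pcong p R k (\<Oplus>i\<in>h ` H. f i) s" by (rule F(3)) (use H F' im in auto)
      ultimately show ?thesis by simp
    qed
    then show "\<exists>F. finite F \<and> F \<subseteq> J \<and> (\<forall>H. finite H \<and> F \<subseteq> H \<and> H \<subseteq> J \<longrightarrow> pcong p R k (\<Oplus>j\<in>H. f (h j)) s)"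
      using fin F'(1) by (intro exI[of _ F']) auto
  qed
qed

end

lemma has_psum_hom:
  assumes A: "cring A" and B: "cring B" and g: "g \<in> add_hom A B" and f: "f \<in> I \<rightarrow> carrier A"
    and s: "has_psum p A f I s"
  shows "has_psum p B (\<lambda>i. g (f i)) I (g s)"
proof -
  interpret A: cring A by fact
  interpret B: cring B by fact
  have gf: "(\<lambda>i. g (f i)) \<in> I \<rightarrow> carrier B" using f add_hom_closed[OF g] by auto
  have sc: "s \<in> carrier A" using s by (simp add: has_psum_def)
  show ?thesis unfolding B.has_psum_iff[OF gf]
  proof (intro conjI allI)
    show "g s \<in> carrier B" by (rule add_hom_closed[OF g sc])
    fix k
    obtain F where F: "finite F" "F \<subseteq> I" "\<And>H. finite H \<Longrightarrow> F \<subseteq> H \<Longrightarrow> H \<subseteq> I \<Longrightarrow> pcong p A k (\<Oplus>\<^bsub>A\<^esub>i\<in>H. f i) s"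
      using s[unfolded A.has_psum_iff[OF f]] by metis
    have "pcong p B k (\<Oplus>\<^bsub>B\<^esub>i\<in>H. g (f i)) (g s)" if H: "finite H" "F \<subseteq> H" "H \<subseteq> I" for H
    proof -
      have "f \<in> H \<rightarrow> carrier A" using f H by auto
      then show ?thesis
        using add_hom_pcong[OF A.ring_axioms B.ring_axioms g F(3)[OF H] sc]
          add_hom_finsum[OF A.is_abelian_group B.is_abelian_group g] by metis
    qed
    then show "\<exists>F. finite F \<and> F \<subseteq> I \<and> (\<forall>H. finite H \<and> F \<subseteq> H \<and> H \<subseteq> I \<longrightarrow> pcong p B k (\<Oplus>\<^bsub>B\<^esub>i\<in>H. g (f i)) (g s))"
      using F(1,2) by (intro exI[of _ F]) auto
  qed
qed

section \<open>Exponential and logarithm\<close>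

text \<open>Legendre's recursion: among 1, ..., n the multiples of p contribute p^(n div p) (n div
  p)!, and the other factors are prime to p.\<close>

lemma fact_prime_split:
  assumes "Factorial_Ring.prime (p::nat)"
  shows "\<exists>m. fact n = p ^ (n div p) * fact (n div p) * m \<and> \<not> p dvd m"
proof (induction n)
  case 0
  show ?case using assms by (auto simp: not_prime_unit intro: exI[of _ 1])
next
  case (Suc n)
  then obtain m where m: "fact n = p ^ (n div p) * fact (n div p) * m" "\<not> p dvd m" by blast
  show ?case
  proof (cases "p dvd Suc n")
    case True
    then obtain q where q: "Suc n = p * q" by blast
    define r where "r = n div p"
    have 1: "Suc n div p = Suc r" using True by (simp add: r_def div_Suc dvd_eq_mod_eq_0)
    then have 2: "Suc n = p * Suc r" using True by (metis dvd_mult_div_cancel)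
    have "fact (Suc n) = Suc n * fact n" by simp
    also have "\<dots> = (p * Suc r) * (p ^ r * fact r * m)" using m(1) 2 by (simp only: r_def)
    also have "\<dots> = p ^ Suc r * fact (Suc r) * m" by (simp add: algebra_simps)
    finally have "fact (Suc n) = p ^ (Suc n div p) * fact (Suc n div p) * m" by (simp only: 1)
    then show ?thesis using m(2) by blast
  next
    case False
    then have "Suc n div p = n div p" by (simp add: div_Suc dvd_eq_mod_eq_0)
    then have "fact (Suc n) = p ^ (Suc n div p) * fact (Suc n div p) * (Suc n * m)"
      using m(1) by (simp add: algebra_simps)
    moreover have "\<not> p dvd Suc n * m" using False m(2) assms by (simp add: prime_dvd_mult_iff del: mult_Suc)
    ultimately show ?thesis by blast
  qed
qed

text \<open>The p-adic valuation of \<open>n!\<close> is at most \<open>(n - 1) / (p - 1)\<close>, hence less than \<open>n / 2\<close> for odd \<open>p\<close>.\<close>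

lemma fact_valuation:
  assumes p: "Factorial_Ring.prime (p::nat)" "odd p" and "n > 0"
  shows "\<exists>e m. fact n = p ^ e * m \<and> \<not> p dvd m \<and> 2 * e < n"
  using \<open>n > 0\<close>
proof (induction n rule: less_induct)
  case (less n)
  have p3: "p \<ge> 3" using p prime_ge_2_nat[of p] by (cases "p = 2") auto
  obtain m where m: "fact n = p ^ (n div p) * fact (n div p) * m" "\<not> p dvd m"
    using fact_prime_split[OF p(1)] by blast
  show ?case
  proof (cases "n div p = 0")
    case True
    then show ?thesis using m less.prems by (intro exI[of _ 0] exI[of _ m]) auto
  next
    case False
    have "n div p < n" using less.prems p3 by simp
    then obtain e k where ek: "fact (n div p) = p ^ e * k" "\<not> p dvd k" "2 * e < n div p"
      using less.IH[of "n div p"] False by auto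
    have "n div p * 3 \<le> n" using p3 by (meson div_times_less_eq_dividend le_trans mult_le_mono2)
    \<comment> \<open>With r = n div p and e the valuation of r!, one has 2(r + e) < 3r, and 3r is
      at most n because p is at least 3.\<close>
    moreover have "2 * (r + e) < l" if "2 * e < r" "r * 3 \<le> l" for e r l :: nat using that by arith
    ultimately have "2 * (n div p + e) < n" using ek(3) by blast
    moreover have "fact n = p ^ (n div p + e) * (k * m)" using m(1) ek(1) by (simp add: power_add)
    moreover have "\<not> p dvd k * m" using m(2) ek(2) p(1) by (simp add: prime_dvd_mult_iff)
    ultimately show ?thesis by blast
  qed
qed

text \<open>The product (N - 1)(N - 2)...(N - m) equals \<open>((N - 1) choose m) * fact m\<close>,
  and each factor N - i is congruent to -i modulo N.\<close>

lemma binomial_fact_cong: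
  assumes "N > 0"
  shows "int N dvd int ((N - 1) choose m) * fact m - (-1) ^ m * fact m"
proof (induction m)
  case (Suc m)
  have "Suc m * ((N - 1) choose Suc m) = (N - 1 - m) * ((N - 1) choose m)"
    by (metis binomial_absorb_comp binomial_absorption diff_diff_left plus_1_eq_Suc Suc_times_binomial_eq mult.commute)
  then have "int (Suc m) * int ((N - 1) choose Suc m) = int (N - 1 - m) * int ((N - 1) choose m)"
    by (metis of_nat_mult)
  also have "\<dots> = (int N - 1 - int m) * int ((N - 1) choose m)"
    using assms by (cases "m \<le> N - 1") (auto simp: of_nat_diff binomial_eq_0)
  finally have *: "int (Suc m) * int ((N - 1) choose Suc m) = (int N - 1 - int m) * int ((N - 1) choose m)" .
  have "int ((N - 1) choose Suc m) * fact (Suc m) - (-1) ^ Suc m * fact (Suc m) =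
      (int (Suc m) * int ((N - 1) choose Suc m)) * fact m + (-1) ^ m * (int (Suc m) * fact m)"
    by (simp add: fact_Suc algebra_simps)
  also have "\<dots> = int N * (int ((N - 1) choose m) * fact m) - int (Suc m) * (int ((N - 1) choose m) * fact m - (-1) ^ m * fact m)"
    unfolding * by (simp add: algebra_simps)
  finally show ?case using dvd_diff[OF dvd_triv_left dvd_mult[OF Suc.IH]] by metis
qed simp

section \<open>Divided powers and the exponential\<close>

locale pring = cring R for R (structure) +
  fixes p :: nat
  assumes comp: "p_complete p R" and tf: "ptf p R" and prime: "Factorial_Ring.prime p" and odd: "odd p"
begin

text \<open>Division by n! costs e = v_p(n!) factors of p, and the remaining part of n! is prime to
  p, hence can be divided out. The bound 2e < n comes from \<open>fact_valuation\<close>.\<close>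

lemma fact_div:
  assumes n: "n > 0" and y: "y \<in> carrier R"
  obtains e x where "2 * e < n" "x \<in> carrier R" "\<And>c. [(fact n :: nat)] \<cdot> ([(p ^ c)] \<cdot> x) = [(p ^ (c + e))] \<cdot> y"
proof -
  obtain e m where em: "fact n = p ^ e * m" "\<not> p dvd m" "2 * e < n"
    using fact_valuation[OF prime odd n] by blast
  obtain x where x: "x \<in> carrier R" "[m] \<cdot> x = y" using coprime_div[OF comp prime em(2) y] by blast
  have "[(fact n :: nat)] \<cdot> ([(p ^ c)] \<cdot> x) = [(p ^ (c + e))] \<cdot> y" for c
    unfolding em(1) x(2)[symmetric] using x(1) by (simp add: smult_smult power_add ac_simps)
  then show ?thesis using that em(3) x(1) by blast
qed

text \<open>Holds since v_p(n!) is at most n - 1.\<close>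

lemma fact_pcong:
  assumes n: "n > 0" and y: "y \<in> carrier R" and x: "x \<in> carrier R"
    and eq: "[(fact n :: nat)] \<cdot> x = [(p ^ (c + (n - 1)))] \<cdot> y"
  shows "pcong p R c x \<zero>"
proof -
  obtain e z where ez: "2 * e < n" "z \<in> carrier R" "\<And>c. [(fact n :: nat)] \<cdot> ([(p ^ c)] \<cdot> z) = [(p ^ (c + e))] \<cdot> y"
    using fact_div[OF n y] by blast
  have "c + (n - 1) = c + (n - 1 - e) + e" using ez(1) by simp
  then have "[(fact n :: nat)] \<cdot> x = [(fact n :: nat)] \<cdot> ([(p ^ (c + (n - 1 - e)))] \<cdot> z)" using eq ez(3) by metis
  then have "x = [(p ^ (c + (n - 1 - e)))] \<cdot> z"
    by (rule smult_cancel[OF comp tf prime fact_gt_zero x, rotated]) (use ez(2) in simp)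
  also have "\<dots> = [(p ^ c)] \<cdot> ([(p ^ (n - 1 - e))] \<cdot> z)" using ez(2) by (simp add: smult_smult power_add)
  finally show ?thesis unfolding pcong_zero_iff using ez(2) by blast
qed

text \<open>The divided power y^n / n!. For y divisible by p it exists and tends to 0, because
  v_p(n!) < n/2. For p = 2 this would fail: 2^n / n! has valuation 1 whenever n is a power of
  2.\<close>

definition dpow :: "nat \<Rightarrow> 'a \<Rightarrow> 'a" where
  "dpow n y = nat_div R (fact n) (y [^] n)"

lemma dpow:
  assumes w: "w \<in> carrier R" and y: "y = [p] \<cdot> w"
  shows "dpow n y \<in> carrier R" "[(fact n :: nat)] \<cdot> dpow n y = y [^] n"
    "\<exists>c t. n \<le> 2 * c \<and> t \<in> carrier R \<and> dpow n y = [(p ^ c)] \<cdot> t"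
proof -
  have yn: "y [^] n = [(p ^ n)] \<cdot> (w [^] n)" unfolding y by (rule smult_pow[OF w])
  obtain c t where ct: "n \<le> 2 * c" "t \<in> carrier R" "[(fact n :: nat)] \<cdot> ([(p ^ c)] \<cdot> t) = y [^] n"
  proof (cases "n = 0")
    case True
    then show ?thesis using that[of 0 \<one>] by simp
  next
    case False
    then obtain e x where ex: "2 * e < n" "x \<in> carrier R" "\<And>c. [(fact n :: nat)] \<cdot> ([(p ^ c)] \<cdot> x) = [(p ^ (c + e))] \<cdot> (w [^] n)"
      using fact_div[of n "w [^] n"] w by auto
    \<comment> \<open>Of the p^n in y^n the division by n! uses up p^e; the remaining exponent n - e
      is at least n/2 as 2e < n.\<close>
    show ?thesis by (rule that[of "n - e" x]) (use ex yn in auto)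
  qed
  have "dpow n y = [(p ^ c)] \<cdot> t"
    unfolding dpow_def by (rule nat_div_eq[OF comp tf prime _ _ ct(3)]) (use ct in auto)
  then show "dpow n y \<in> carrier R" "[(fact n :: nat)] \<cdot> dpow n y = y [^] n"
    "\<exists>c t. n \<le> 2 * c \<and> t \<in> carrier R \<and> dpow n y = [(p ^ c)] \<cdot> t" using ct by auto
qed

lemma dpow_unique:
  assumes w: "w \<in> carrier R" and y: "y = [p] \<cdot> w" and x: "x \<in> carrier R" "[(fact n :: nat)] \<cdot> x = y [^] n"
  shows "dpow n y = x"
  unfolding dpow_def by (rule nat_div_eq[OF comp tf prime _ x]) simp

lemma dpow_mult_pcong:
  assumes "w \<in> carrier R" "y = [p] \<cdot> w" "w' \<in> carrier R" "y' = [p] \<cdot> w'" "2 * k \<le> i + j"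
  shows "pcong p R k (dpow i y \<otimes> dpow j y') \<zero>"
proof -
  obtain c t where ct: "i \<le> 2 * c" "t \<in> carrier R" "dpow i y = [(p ^ c)] \<cdot> t" using dpow(3)[OF assms(1,2)] by blast
  obtain d u where du: "j \<le> 2 * d" "u \<in> carrier R" "dpow j y' = [(p ^ d)] \<cdot> u" using dpow(3)[OF assms(3,4)] by blast
  have "k \<le> c + d" using ct(1) du(1) assms(5) by linarith
  moreover have "dpow i y \<otimes> dpow j y' = [(p ^ (c + d))] \<cdot> (t \<otimes> u)"
    using ct du by (simp add: smult_l smult_r smult_smult power_add mult.commute)
  then have "pcong p R (c + d) (dpow i y \<otimes> dpow j y') \<zero>" unfolding pcong_zero_iff using ct du by blast
  ultimately show ?thesis by (rule pcong_mono[rotated])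
qed

lemma dpow_0: "w \<in> carrier R \<Longrightarrow> y = [p] \<cdot> w \<Longrightarrow> dpow 0 y = \<one>"
  by (rule dpow_unique) auto

lemma dpow_pcong:
  assumes "w \<in> carrier R" "y = [p] \<cdot> w" "2 * k \<le> i"
  shows "pcong p R k (dpow i y) \<zero>"
  using dpow_mult_pcong[OF assms(1,2,1,2), of k i 0] dpow_0[OF assms(1,2)] dpow(1)[OF assms(1,2)] assms(3) by simp

lemma dpow_null: "w \<in> carrier R \<Longrightarrow> y = [p] \<cdot> w \<Longrightarrow> null p (\<lambda>n. dpow n y) UNIV"
  unfolding null_def
proof (intro conjI allI)
  fix k assume "w \<in> carrier R" "y = [p] \<cdot> w"
  then have "{i \<in> UNIV. \<not> pcong p R k (dpow i y) \<zero>} \<subseteq> {..<2 * k}"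
    using dpow_pcong[of w y k] by (auto simp: not_le[symmetric])
  then show "finite {i \<in> UNIV. \<not> pcong p R k (dpow i y) \<zero>}" by (rule finite_subset) simp
qed (use dpow(1) in auto)

lemma pexp_dpow: "pexp p R y = psum p R (\<lambda>n. dpow n y) UNIV"
  by (simp add: pexp_def dpow_def)

lemma has_psum_pexp: "w \<in> carrier R \<Longrightarrow> y = [p] \<cdot> w \<Longrightarrow> has_psum p R (\<lambda>n. dpow n y) UNIV (pexp p R y)"
  unfolding pexp_dpow by (rule has_psum_psum[OF comp dpow_null])

lemma pexp_closed: "w \<in> carrier R \<Longrightarrow> y = [p] \<cdot> w \<Longrightarrow> pexp p R y \<in> carrier R"
  using has_psum_pexp by (auto simp: has_psum_def)

lemma pexp_approx:
  assumes "w \<in> carrier R" "y = [p] \<cdot> w" "2 * k \<le> Suc n"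
  shows "pcong p R k (pexp p R y) (\<Oplus>i\<in>{..n}. dpow i y)"
  by (rule has_psum_approx[OF _ has_psum_pexp[OF assms(1,2)]])
    (use dpow(1)[OF assms(1,2)] dpow_pcong[OF assms(1,2), of k] assms(3) in auto)

text \<open>The binomial theorem divided by n!, which is legitimate because n! can be
  cancelled.\<close>

lemma dpow_add:
  assumes w: "w \<in> carrier R" "y = [p] \<cdot> w" and w': "w' \<in> carrier R" "y' = [p] \<cdot> w'"
  shows "dpow n (y \<oplus> y') = (\<Oplus>i\<in>{..n}. dpow i y \<otimes> dpow (n - i) y')"
proof (rule dpow_unique[of "w \<oplus> w'"])
  note d = dpow[OF w] and d' = dpow[OF w']
  have yc: "y \<in> carrier R" "y' \<in> carrier R" using w w' by auto
  have t: "(\<lambda>i. dpow i y \<otimes> dpow (n - i) y') \<in> {..n} \<rightarrow> carrier R" using d(1) d'(1) by auto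
  have "[(fact n :: nat)] \<cdot> (\<Oplus>i\<in>{..n}. dpow i y \<otimes> dpow (n - i) y') = (\<Oplus>i\<in>{..n}. [(fact n :: nat)] \<cdot> (dpow i y \<otimes> dpow (n - i) y'))"
    by (rule add_hom_finsum[OF is_abelian_group is_abelian_group _ t]) (auto intro!: add_homI simp: smult_add)
  also have "\<dots> = (\<Oplus>i\<in>{..n}. [(n choose i)] \<cdot> (y [^] i \<otimes> y' [^] (n - i)))"
  proof (rule finsum_cong'[OF refl])
    fix i assume i: "i \<in> {..n}"
    have "fact n = (n choose i) * (fact i * fact (n - i))"
      using i binomial_fact_lemma[of i n] by (simp add: ac_simps)
    then have "[(fact n :: nat)] \<cdot> (dpow i y \<otimes> dpow (n - i) y') =
        [(n choose i)] \<cdot> ([(fact i * fact (n - i) :: nat)] \<cdot> (dpow i y \<otimes> dpow (n - i) y'))"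
      using d(1) d'(1) by (simp add: smult_smult)
    also have "[(fact i * fact (n - i) :: nat)] \<cdot> (dpow i y \<otimes> dpow (n - i) y') =
        ([(fact i :: nat)] \<cdot> dpow i y) \<otimes> ([(fact (n - i) :: nat)] \<cdot> dpow (n - i) y')"
      using d(1) d'(1) by (simp add: smult_l smult_r smult_smult mult.commute)
    finally show "[(fact n :: nat)] \<cdot> (dpow i y \<otimes> dpow (n - i) y') = [(n choose i)] \<cdot> (y [^] i \<otimes> y' [^] (n - i))"
      by (simp add: d(2) d'(2))
  qed (use yc in auto)
  also have "\<dots> = (y \<oplus> y') [^] n" by (rule binomial[OF yc, symmetric])
  finally show "[(fact n :: nat)] \<cdot> (\<Oplus>i\<in>{..n}. dpow i y \<otimes> dpow (n - i) y') = (y \<oplus> y') [^] n" .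
  show "(\<Oplus>i\<in>{..n}. dpow i y \<otimes> dpow (n - i) y') \<in> carrier R" by (rule finsum_closed[OF t])
qed (use w w' in \<open>auto simp: smult_add\<close>)

lemma pexp_add:
  assumes w: "w \<in> carrier R" "y = [p] \<cdot> w" and w': "w' \<in> carrier R" "y' = [p] \<cdot> w'"
  shows "pexp p R (y \<oplus> y') = pexp p R y \<otimes> pexp p R y'"
proof (rule p_complete_sep[OF comp])
  have yy: "w \<oplus> w' \<in> carrier R" "y \<oplus> y' = [p] \<cdot> (w \<oplus> w')" using w w' by (auto simp: smult_add)
  note ec = pexp_closed[OF w] pexp_closed[OF w'] pexp_closed[OF yy]
  show "pexp p R (y \<oplus> y') \<in> carrier R" "pexp p R y \<otimes> pexp p R y' \<in> carrier R" using ec by auto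
  fix k :: nat
  \<comment> \<open>Modulo p^k the divided powers of degree at least 2k vanish. The sequences cut
    off at \<open>L\<close> have finite support, so the Cauchy product applies to them, and products
    of total degree beyond \<open>L\<close> vanish modulo p^k as well.\<close>
  define L where "L = 2 * k"
  define f where "f = (\<lambda>i. if i \<le> L then dpow i y else \<zero>)"
  define g where "g = (\<lambda>i. if i \<le> L then dpow i y' else \<zero>)"
  have fc: "f i \<in> carrier R" and gc: "g i \<in> carrier R" for i using dpow(1)[OF w] dpow(1)[OF w'] by (auto simp: f_def g_def)
  have fs: "(\<Oplus>i\<in>{..L}. f i) = (\<Oplus>i\<in>{..L}. dpow i y)" "(\<Oplus>i\<in>{..L}. g i) = (\<Oplus>i\<in>{..L}. dpow i y')"
    using dpow(1)[OF w] dpow(1)[OF w'] by (auto simp: f_def g_def intro!: finsum_cong')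
  have sc: "(\<Oplus>i\<in>{..L}. f i) \<in> carrier R" "(\<Oplus>i\<in>{..L}. g i) \<in> carrier R" using fc gc by (auto intro!: finsum_closed)
  have a1: "pcong p R k (pexp p R y \<otimes> pexp p R y') ((\<Oplus>i\<in>{..L}. f i) \<otimes> (\<Oplus>i\<in>{..L}. g i))"
    by (rule pcong_mult[OF _ _ sc]) (unfold fs, rule pexp_approx[OF w], simp add: L_def, rule pexp_approx[OF w'], simp add: L_def)
  have a2: "(\<Oplus>i\<in>{..L}. f i) \<otimes> (\<Oplus>i\<in>{..L}. g i) = (\<Oplus>n\<in>{..L + L}. \<Oplus>i\<in>{..n}. f i \<otimes> g (n - i))"
    by (rule cauchy_product[symmetric]) (use fc gc in \<open>auto simp: f_def g_def bound_def\<close>)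
  have a3: "pcong p R k (\<Oplus>n\<in>{..L + L}. \<Oplus>i\<in>{..n}. f i \<otimes> g (n - i)) (\<Oplus>n\<in>{..L + L}. dpow n (y \<oplus> y'))"
  proof (rule pcong_finsum)
    fix n
    show "pcong p R k (\<Oplus>i\<in>{..n}. f i \<otimes> g (n - i)) (dpow n (y \<oplus> y'))"
    proof (cases "n \<le> L")
      case True
      then have "(\<Oplus>i\<in>{..n}. f i \<otimes> g (n - i)) = dpow n (y \<oplus> y')"
        unfolding dpow_add[OF w w'] using dpow(1)[OF w] dpow(1)[OF w'] by (intro finsum_cong') (auto simp: f_def g_def)
      then show ?thesis using dpow(1)[OF yy] by simp
    next
      case False
      have "pcong p R k (\<Oplus>i\<in>{..n}. f i \<otimes> g (n - i)) (\<Oplus>i\<in>{..n}. \<zero>)"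
      proof (rule pcong_finsum)
        fix i assume "i \<in> {..n}"
        then show "pcong p R k (f i \<otimes> g (n - i)) \<zero>"
          using False dpow_mult_pcong[OF w w', of k i "n - i"] dpow(1)[OF w] dpow(1)[OF w'] by (auto simp: f_def g_def L_def)
      qed auto
      then have 1: "pcong p R k (\<Oplus>i\<in>{..n}. f i \<otimes> g (n - i)) \<zero>" by simp
      have 2: "pcong p R k (dpow n (y \<oplus> y')) \<zero>" using False dpow_pcong[OF yy, of k n] by (simp add: L_def)
      show ?thesis by (rule pcong_trans[OF 1 pcong_sym[OF 2 zero_closed] dpow(1)[OF yy]])
    qed
  qed (use dpow(1)[OF yy] in auto)
  have a4: "pcong p R k (pexp p R (y \<oplus> y')) (\<Oplus>n\<in>{..L + L}. dpow n (y \<oplus> y'))"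
    by (rule pexp_approx[OF yy]) (simp add: L_def)
  have a5: "(\<Oplus>n\<in>{..L + L}. dpow n (y \<oplus> y')) \<in> carrier R" using dpow(1)[OF yy] by (auto intro!: finsum_closed)
  have "pcong p R k (pexp p R y \<otimes> pexp p R y') (\<Oplus>n\<in>{..L + L}. dpow n (y \<oplus> y'))"
    by (rule pcong_trans[OF a1[unfolded a2] a3 a5])
  then show "pcong p R k (pexp p R (y \<oplus> y')) (pexp p R y \<otimes> pexp p R y')"
    using pcong_trans[OF a4 pcong_sym] a5 ec by simp
qed

lemma pexp_zero: "pexp p R \<zero> = \<one>"
proof -
  have z: "\<zero> \<in> carrier R" "\<zero> = [p] \<cdot> \<zero>" by auto
  have d: "dpow n \<zero> = \<zero>" if "n \<noteq> 0" for n using that by (intro dpow_unique[OF z]) (auto simp: nat_pow_zero)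
  have "has_psum p R (\<lambda>n. dpow n \<zero>) UNIV (\<Oplus>n\<in>{0}. dpow n \<zero>)"
    by (rule has_psum_finite) (use d dpow(1)[OF z] in auto)
  then have "psum p R (\<lambda>n. dpow n \<zero>) UNIV = (\<Oplus>n\<in>{0}. dpow n \<zero>)"
    by (rule psum_eq[OF comp, rotated]) (use dpow(1)[OF z] in auto)
  then show ?thesis unfolding pexp_dpow using dpow_0[OF z] dpow(1)[OF z] by simp
qed

lemma pexp_smult:
  assumes w: "w \<in> carrier R" "y = [p] \<cdot> w"
  shows "pexp p R ([(n::nat)] \<cdot> y) = pexp p R y [^] n"
proof (induction n)
  case (Suc n)
  have "[n] \<cdot> y = [p] \<cdot> ([n] \<cdot> w)" using w by (simp add: smult_smult mult.commute)
  then have "pexp p R ([n] \<cdot> y \<oplus> y) = pexp p R ([n] \<cdot> y) \<otimes> pexp p R y" using w by (intro pexp_add) auto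
  then show ?case using Suc by simp
qed (simp add: pexp_zero)

text \<open>The term of degree n of the exponential of p^k y is p^(kn) times the divided power of y,
  so all terms from degree 2 on vanish modulo p^(2k).\<close>

lemma pexp_pcong:
  assumes w: "w \<in> carrier R" "y = [p] \<cdot> w"
  shows "pcong p R (2 * k) (pexp p R ([(p ^ k)] \<cdot> y)) (\<one> \<oplus> [(p ^ k)] \<cdot> y)"
proof -
  have yc: "y \<in> carrier R" using w by auto
  let ?y = "[(p ^ k)] \<cdot> y"
  have z: "[(p ^ k)] \<cdot> w \<in> carrier R" "?y = [p] \<cdot> ([(p ^ k)] \<cdot> w)" using w by (auto simp: smult_smult mult.commute)
  have d: "dpow n ?y = [(p ^ (k * n))] \<cdot> dpow n y" for n
  proof (rule dpow_unique[OF z])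
    show "[(fact n :: nat)] \<cdot> ([(p ^ (k * n))] \<cdot> dpow n y) = ?y [^] n"
      using dpow(1,2)[OF w, of n] by (simp add: smult_pow[OF yc] smult_smult power_mult mult.commute[of "fact n"])
        (simp add: smult_smult[symmetric])
  qed (use dpow(1)[OF w] in auto)
  have "pcong p R (2 * k) (pexp p R ?y) (\<Oplus>n\<in>{0, 1}. dpow n ?y)"
  proof (rule has_psum_approx[OF _ has_psum_pexp[OF z]])
    fix n :: nat assume "n \<in> UNIV - {0, 1}"
    then have "2 * k \<le> k * n" by (simp add: mult.commute)
    moreover have "pcong p R (k * n) (dpow n ?y) \<zero>" unfolding d pcong_zero_iff using dpow(1)[OF w] by blast
    ultimately show "pcong p R (2 * k) (dpow n ?y) \<zero>" by (rule pcong_mono[rotated])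
  qed (use dpow(1)[OF z] in auto)
  moreover have "dpow 1 ?y = ?y" by (rule dpow_unique[OF z]) (use yc in auto)
  ultimately show ?thesis using dpow_0[OF z] yc by simp
qed

text \<open>Modulo p only the terms of degree 0 and 1 count, and the latter is \<open>y\<close>, a
  multiple of p.\<close>

lemma pexp_unit:
  assumes w: "w \<in> carrier R" "y = [p] \<cdot> w"
  shows "pexp p R y \<in> Units R"
proof (rule Units_pcong_one[OF comp])
  have "pcong p R 1 (pexp p R y) (\<Oplus>i\<in>{..1}. dpow i y)" by (rule pexp_approx[OF w]) simp
  moreover have "dpow 1 y = y" using w by (intro dpow_unique[OF w]) auto
  moreover have "pcong p R 1 (\<one> \<oplus> y) \<one>" using w by (auto simp: pcong_def)
  ultimately show "pcong p R 1 (pexp p R y) \<one>" using w dpow_0[OF w] dpow(1)[OF w]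
    by (simp add: a_comm pcong_trans)
qed

section \<open>The logarithm series\<close>

definition log_coeff :: "nat \<Rightarrow> 'a" where
  "log_coeff n = nat_div R n ([(p ^ (n - 1))] \<cdot> \<one>)"

lemma log_coeff:
  assumes n: "n > 0"
  shows "log_coeff n \<in> carrier R" "[n] \<cdot> log_coeff n = [(p ^ (n - 1))] \<cdot> \<one>"
    "2 * k \<le> n - 1 \<Longrightarrow> pcong p R k (log_coeff n) \<zero>"
proof -
  obtain e x where ex: "2 * e < n" "x \<in> carrier R" "\<And>c. [(fact n :: nat)] \<cdot> ([(p ^ c)] \<cdot> x) = [(p ^ (c + e))] \<cdot> \<one>"
    using fact_div[OF n one_closed] by blast
  \<comment> \<open>The quotient by n is (n - 1)! times the quotient by n!. At most half of the
    factors p are lost in this way, which is enough for the coefficients to tend to 0.\<close>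
  let ?q = "[(fact (n - 1) :: nat)] \<cdot> ([(p ^ (n - 1 - e))] \<cdot> x)"
  have "[n] \<cdot> ?q = [(fact n :: nat)] \<cdot> ([(p ^ (n - 1 - e))] \<cdot> x)"
    using n ex(2) by (simp add: smult_smult fact_reduce[of n] mult.assoc)
  also have "\<dots> = [(p ^ (n - 1))] \<cdot> \<one>" unfolding ex(3) using ex(1) by simp
  finally have q: "[n] \<cdot> ?q = [(p ^ (n - 1))] \<cdot> \<one>" .
  have "log_coeff n = ?q"
    unfolding log_coeff_def by (rule nat_div_eq[OF comp tf prime n _ q]) (use ex in auto)
  moreover have "pcong p R k ?q \<zero>" if k: "2 * k \<le> n - 1"
  proof -
    have "k \<le> n - 1 - e" using k ex(1) by linarith
    moreover have "?q = [(p ^ (n - 1 - e))] \<cdot> ([(fact (n - 1) :: nat)] \<cdot> x)" using ex(2) by (simp add: smult_smult mult.commute)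
    then have "pcong p R (n - 1 - e) ?q \<zero>" unfolding pcong_zero_iff using ex(2) by blast
    ultimately show ?thesis by (rule pcong_mono[rotated])
  qed
  ultimately show "log_coeff n \<in> carrier R" "[n] \<cdot> log_coeff n = [(p ^ (n - 1))] \<cdot> \<one>"
    "2 * k \<le> n - 1 \<Longrightarrow> pcong p R k (log_coeff n) \<zero>" using q ex by auto
qed

text \<open>The n-th term of (1/p) log(1 + p w), with the factor p^(n-1)/n kept in the ring. For w =
  x'/x^p these are the terms of \<Psi>.\<close>

definition log_term :: "'a \<Rightarrow> nat \<Rightarrow> 'a" where
  "log_term w n = [((- 1 :: int) ^ (n - 1))] \<cdot> (log_coeff n \<otimes> w [^] n)"

lemma log_term_closed: "w \<in> carrier R \<Longrightarrow> n > 0 \<Longrightarrow> log_term w n \<in> carrier R"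
  by (simp add: log_term_def log_coeff)

lemma log_term_null: "w \<in> carrier R \<Longrightarrow> null p (log_term w) {1..}"
  unfolding null_def
proof (intro conjI allI)
  assume w: "w \<in> carrier R"
  show "log_term w \<in> {1..} \<rightarrow> carrier R" using log_term_closed[OF w] by auto
  fix k
  have "pcong p R k (log_term w n) \<zero>" if n: "n \<ge> 1" "2 * k \<le> n - 1" for n
  proof -
    obtain t where t: "t \<in> carrier R" "log_coeff n = [(p ^ k)] \<cdot> t"
      using log_coeff(3)[of n k] n by (auto simp: pcong_zero_iff)
    have "log_term w n = [(p ^ k)] \<cdot> ([((- 1 :: int) ^ (n - 1))] \<cdot> (t \<otimes> w [^] n))"
      unfolding log_term_def t(2) using t(1) w
      by (cases "even (n - 1)") (simp_all add: smult_l smult_minus add.int_pow_neg)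
    then show ?thesis unfolding pcong_zero_iff using t(1) w by (meson add.int_pow_closed m_closed nat_pow_closed)
  qed
  then have "{n \<in> {1..}. \<not> pcong p R k (log_term w n) \<zero>} \<subseteq> {..<2 * k + 1}" by force
  then show "finite {n \<in> {1..}. \<not> pcong p R k (log_term w n) \<zero>}" by (rule finite_subset) simp
qed

text \<open>
  With \<open>N = p^k\<close>, the coefficient of \<open>w^n\<close> in \<open>(1 + p w)^N - 1\<close> is \<open>N/n * (N-1 choose n-1) * p^n\<close>, and
  \<open>(N-1 choose n-1)\<close> is close to \<open>(-1)^(n-1)\<close>.  So the logarithm is the limit of \<open>(u^N - 1) / N\<close>.
\<close>

lemma log_term_pcong:
  assumes w: "w \<in> carrier R" and n: "n > 0"
  shows "pcong p R (2 * k + 1) ([((p ^ k) choose n)] \<cdot> (([p] \<cdot> w) [^] n)) ([(p ^ (k + 1))] \<cdot> log_term w n)"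
proof -
  define N where "N = p ^ k"
  have N: "N > 0" using prime by (simp add: N_def prime_gt_0_nat)
  define s :: int where "s = (- 1) ^ (n - 1)"
  \<comment> \<open>The difference of the coefficients of w^n on the two sides. Multiplied by n! it
    becomes an integer divisible by p^(2k+1+(n-1)), and dividing by n! again costs at most n - 1
    factors of p.\<close>
  define D where "D = [(int (N choose n) * int (p ^ n))] \<cdot> \<one> \<ominus> [(s * int (p ^ (k + 1)))] \<cdot> log_coeff n"
  have Dc: "D \<in> carrier R" using log_coeff(1)[OF n] by (simp add: D_def)
  obtain t where t: "int ((N - 1) choose (n - 1)) * fact (n - 1) - s * fact (n - 1) = int N * t"
    using binomial_fact_cong[OF N, of "n - 1"] unfolding s_def by (elim dvdE)
  have fn: "fact n = fact (n - 1) * n" using n by (simp add: fact_reduce[of n] mult.commute)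
  have "[(fact n :: nat)] \<cdot> D = [(int (fact n))] \<cdot> D" by (simp only: add_pow_int_ge of_nat_0_le_iff nat_int)
  also have "\<dots> = [(int (fact n) * (int (N choose n) * int (p ^ n)))] \<cdot> \<one> \<ominus> [(int (fact n) * (s * int (p ^ (k + 1))))] \<cdot> log_coeff n"
    using log_coeff(1)[OF n] unfolding D_def a_minus_def
    by (simp add: add.int_pow_distrib add.int_pow_pow add.int_pow_inv mult.commute)
  also have "[(int (fact n) * (s * int (p ^ (k + 1))))] \<cdot> log_coeff n = [(int (fact (n - 1)) * (s * int (p ^ (k + 1))))] \<cdot> ([(int n)] \<cdot> log_coeff n)"
    using log_coeff(1)[OF n] by (simp add: fn add.int_pow_pow ac_simps del: fact_Suc)
  also have "[(int n)] \<cdot> log_coeff n = [(int (p ^ (n - 1)))] \<cdot> \<one>"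
    using log_coeff(2)[OF n] by (simp only: add_pow_int_ge of_nat_0_le_iff nat_int)
  also have "[(int (fact (n - 1)) * (s * int (p ^ (k + 1))))] \<cdot> ([(int (p ^ (n - 1)))] \<cdot> \<one>) =
      [(int (fact (n - 1)) * (s * int (p ^ (k + 1))) * int (p ^ (n - 1)))] \<cdot> \<one>"
    by (simp only: add.int_pow_pow[OF one_closed] mult.commute)
  also have "[(int (fact n) * (int (N choose n) * int (p ^ n)))] \<cdot> \<one> \<ominus>
      [(int (fact (n - 1)) * (s * int (p ^ (k + 1))) * int (p ^ (n - 1)))] \<cdot> \<one> =
      [(int (fact n) * (int (N choose n) * int (p ^ n)) - int (fact (n - 1)) * (s * int (p ^ (k + 1))) * int (p ^ (n - 1)))] \<cdot> \<one>"
    by (simp add: add.int_pow_diff a_minus_def)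
  also have "int (fact n) * (int (N choose n) * int (p ^ n)) - int (fact (n - 1)) * (s * int (p ^ (k + 1))) * int (p ^ (n - 1)) =
      int (p ^ (2 * k + 1 + (n - 1))) * t"
  proof -
    \<comment> \<open>One factor N comes from absorbing n into the binomial coefficient and a second
      one from \<open>binomial_fact_cong\<close>; with one factor p from p^n they give the exponent
      2k + 1.\<close>
    have nN: "int n * int (N choose n) = int N * int ((N - 1) choose (n - 1))"
      using times_binomial_minus1_eq[OF n, of N] by (metis of_nat_mult)
    have pn: "int (p ^ n) = int p * int (p ^ (n - 1))" using n by (metis Suc_diff_1 of_nat_mult power_Suc)
    have "int (fact n) * (int (N choose n) * int (p ^ n)) = int (fact (n - 1)) * (int n * int (N choose n)) * int (p ^ n)"
      by (simp add: fn)
    also have "\<dots> = int N * int p * int (p ^ (n - 1)) * (int ((N - 1) choose (n - 1)) * fact (n - 1))"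
      unfolding nN pn by (simp add: ac_simps)
    finally have 1: "int (fact n) * (int (N choose n) * int (p ^ n)) = int N * int p * int (p ^ (n - 1)) * (int ((N - 1) choose (n - 1)) * fact (n - 1))" .
    have 2: "int (fact (n - 1)) * (s * int (p ^ (k + 1))) * int (p ^ (n - 1)) = int N * int p * int (p ^ (n - 1)) * (s * fact (n - 1))"
      by (simp add: N_def ac_simps)
    have "int N * int p * int (p ^ (n - 1)) * (int N * t) = int (p ^ (2 * k + 1 + (n - 1))) * t"
    proof -
      have "p ^ (2 * k + 1 + (n - 1)) = N * N * p * p ^ (n - 1)"
        by (simp only: N_def power_add mult_2 power_one_right)
      then show ?thesis by (simp only: of_nat_mult ac_simps)
    qed
    then show ?thesis unfolding 1 2 right_diff_distrib[symmetric] t .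
  qed
  also have "[(int (p ^ (2 * k + 1 + (n - 1))) * t)] \<cdot> \<one> = [(p ^ (2 * k + 1 + (n - 1)))] \<cdot> ([t] \<cdot> \<one>)"
    by (metis add.int_pow_pow add_pow_int_ge mult.commute nat_int of_nat_0_le_iff one_closed)
  finally have "[(fact n :: nat)] \<cdot> D = [(p ^ (2 * k + 1 + (n - 1)))] \<cdot> ([t] \<cdot> \<one>)" .
  from fact_pcong[OF n _ Dc this] have "pcong p R (2 * k + 1) D \<zero>" by simp
  then have "pcong p R (2 * k + 1) (D \<otimes> w [^] n) (\<zero> \<otimes> w [^] n)" by (rule pcong_mult_r) (use w in auto)
  moreover have "D \<otimes> w [^] n = [(N choose n)] \<cdot> (([p] \<cdot> w) [^] n) \<ominus> [(p ^ (k + 1))] \<cdot> log_term w n"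
  proof -
    have 1: "([(int (N choose n) * int (p ^ n))] \<cdot> \<one>) \<otimes> w [^] n = [(N choose n)] \<cdot> (([p] \<cdot> w) [^] n)"
      using w by (simp add: smult_pow add_pow_ldistr_int smult_smult) (metis add_pow_int_ge nat_int nat_pow_closed of_nat_0_le_iff of_nat_mult of_nat_power)
    have 2: "([(s * int (p ^ (k + 1)))] \<cdot> log_coeff n) \<otimes> w [^] n = [(p ^ (k + 1))] \<cdot> log_term w n"
    proof -
      have "([(s * int (p ^ (k + 1)))] \<cdot> log_coeff n) \<otimes> w [^] n = [(s * int (p ^ (k + 1)))] \<cdot> (log_coeff n \<otimes> w [^] n)"
        using w log_coeff(1)[OF n] by (simp add: add_pow_ldistr_int)
      also have "\<dots> = [(int (p ^ (k + 1)))] \<cdot> ([s] \<cdot> (log_coeff n \<otimes> w [^] n))"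
        using w log_coeff(1)[OF n] by (simp only: add.int_pow_pow m_closed nat_pow_closed mult.commute)
      finally show ?thesis unfolding log_term_def s_def by (simp only: add_pow_int_ge of_nat_0_le_iff nat_int)
    qed
    show ?thesis unfolding D_def a_minus_def
      using w log_coeff(1)[OF n] 1 2 by (simp only: l_distr l_minus add.int_pow_closed one_closed nat_pow_closed a_inv_closed)
  qed
  ultimately show ?thesis
    using w log_term_closed[OF w n] pcong_iff_minus[of "[(N choose n)] \<cdot> (([p] \<cdot> w) [^] n)" "[(p ^ (k + 1))] \<cdot> log_term w n" p "2 * k + 1"]
    by (simp add: N_def)
qed

lemma log_limit:
  assumes w: "w \<in> carrier R" and s: "has_psum p R (log_term w) {1..} s"
  shows "pcong p R (2 * k + 1) ((\<one> \<oplus> [p] \<cdot> w) [^] (p ^ k)) (\<one> \<oplus> [(p ^ (k + 1))] \<cdot> s)"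
proof -
  define N where "N = p ^ k"
  \<comment> \<open>\<open>L\<close> is at least N, so the whole binomial expansion is included, and
    large enough for the later terms of the logarithm to vanish modulo p^k.\<close>
  define L where "L = max N (4 * k + 4)"
  let ?c = "\<lambda>n. [(N choose n)] \<cdot> (([p] \<cdot> w) [^] n)"
  have wc: "[p] \<cdot> w \<in> carrier R" using w by simp
  have sc: "s \<in> carrier R" using s by (simp add: has_psum_def)
  have lc: "log_term w \<in> {1..L} \<rightarrow> carrier R" using log_term_closed[OF w] by auto
  have lS: "(\<Oplus>n\<in>{1..L}. log_term w n) \<in> carrier R" using lc by (rule finsum_closed)
  have cc: "?c \<in> S \<rightarrow> carrier R" for S using wc by auto
  have "(\<one> \<oplus> [p] \<cdot> w) [^] N = (\<Oplus>n\<in>{..N}. ?c n)"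
  proof -
    have "([p] \<cdot> w \<oplus> \<one>) [^] N = (\<Oplus>n\<in>{..N}. [(N choose n)] \<cdot> (([p] \<cdot> w) [^] n \<otimes> \<one> [^] (N - n)))"
      by (rule binomial[OF wc one_closed])
    also have "\<dots> = (\<Oplus>n\<in>{..N}. ?c n)" using wc by (intro finsum_cong') auto
    finally show ?thesis using wc by (simp add: a_comm)
  qed
  also have "\<dots> = (\<Oplus>n\<in>{..L}. ?c n)"
    using wc by (intro add.finprod_mono_neutral_cong_left) (auto simp: L_def binomial_eq_0)
  also have "\<dots> = (\<Oplus>n\<in>insert 0 {1..L}. ?c n)" by (rule arg_cong[where f = "finsum R ?c"]) auto
  also have "\<dots> = \<one> \<oplus> (\<Oplus>n\<in>{1..L}. ?c n)" using cc by (subst finsum_insert) auto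
  finally have eq: "(\<one> \<oplus> [p] \<cdot> w) [^] N = \<one> \<oplus> (\<Oplus>n\<in>{1..L}. ?c n)" .
  have a1: "pcong p R (2 * k + 1) (\<Oplus>n\<in>{1..L}. ?c n) (\<Oplus>n\<in>{1..L}. [(p ^ (k + 1))] \<cdot> log_term w n)"
    by (rule pcong_finsum) (use log_term_pcong[OF w, of _ k] log_term_closed[OF w] in \<open>auto simp: N_def\<close>)
  have a2: "(\<Oplus>n\<in>{1..L}. [(p ^ (k + 1))] \<cdot> log_term w n) = [(p ^ (k + 1))] \<cdot> (\<Oplus>n\<in>{1..L}. log_term w n)"
    by (rule add_hom_finsum[OF is_abelian_group is_abelian_group _ lc, symmetric]) (auto intro!: add_homI simp: smult_add)
  have a3: "pcong p R (2 * k + 1) ([(p ^ (k + 1))] \<cdot> (\<Oplus>n\<in>{1..L}. log_term w n)) ([(p ^ (k + 1))] \<cdot> s)"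
  proof -
    have "pcong p R k s (\<Oplus>n\<in>{1..L}. log_term w n)"
    proof (rule has_psum_approx[OF _ s])
      fix n assume "n \<in> {1..} - {1..L}"
      then have n: "n > 0" "2 * k \<le> n - 1" by (auto simp: L_def)
      have "pcong p R k (log_coeff n \<otimes> w [^] n) (\<zero> \<otimes> w [^] n)"
        by (rule pcong_mult_r[OF log_coeff(3)[OF n]]) (use w in auto)
      then show "pcong p R k (log_term w n) \<zero>"
        unfolding log_term_def using w log_coeff(1)[OF n(1)] pcong_minus[of p k "log_coeff n \<otimes> w [^] n" \<zero>]
        by (cases "even (n - 1)") (auto simp: add.int_pow_neg)
    qed (use lc log_term_closed[OF w] in auto)
    \<comment> \<open>Precision p^k for the sum becomes p^(2k+1) after multiplication by
      p^(k+1).\<close>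
    from pcong_smult[OF pcong_sym[OF this lS] sc, of "k + 1"] show ?thesis by (simp add: mult_2 add.commute)
  qed
  have "pcong p R (2 * k + 1) (\<Oplus>n\<in>{1..L}. ?c n) ([(p ^ (k + 1))] \<cdot> s)"
    by (rule pcong_trans[OF a1[unfolded a2] a3]) (use sc in simp)
  then show ?thesis using sc unfolding N_def[symmetric] eq by (intro pcong_add) auto
qed

text \<open>With s = (1/p) log(1 + p w), this is the logarithm of the hypothesis \<open>eq\<close>.
  Raise \<open>eq\<close> to the power N = p^k: modulo p^(2k) each exponential becomes 1 plus N
  times its argument, and (1 + p w)^N becomes 1 + N p s. Comparing linear parts and cancelling N
  leaves the identity modulo p^k, for every k.\<close>

lemma log_exp:
  assumes v: "v \<in> carrier R" "y = [p] \<cdot> v" and v': "v' \<in> carrier R" "y' = [p] \<cdot> v'"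
    and w: "w \<in> carrier R" and s: "has_psum p R (log_term w) {1..} s"
    and eq: "(\<one> \<oplus> [p] \<cdot> w) \<otimes> pexp p R y [^] p = pexp p R y'"
  shows "[p] \<cdot> s \<oplus> [p] \<cdot> y = y'"
proof (rule p_complete_sep[OF comp])
  have sc: "s \<in> carrier R" using s by (simp add: has_psum_def)
  have yc: "y \<in> carrier R" "y' \<in> carrier R" using v v' by auto
  show "[p] \<cdot> s \<oplus> [p] \<cdot> y \<in> carrier R" "y' \<in> carrier R" using sc yc by auto
  fix k
  define N where "N = p ^ k"
  let ?u = "\<one> \<oplus> [p] \<cdot> w"
  have ec: "pexp p R y \<in> carrier R" "pexp p R y' \<in> carrier R" using pexp_closed[OF v] pexp_closed[OF v'] by auto
  have "pexp p R y' [^] N = ?u [^] N \<otimes> (pexp p R y [^] p) [^] N"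
    unfolding eq[symmetric] using w ec by (simp add: nat_pow_distrib)
  also have "(pexp p R y [^] p) [^] N = pexp p R ([N] \<cdot> ([p] \<cdot> y))"
  proof -
    have "[N] \<cdot> ([p] \<cdot> y) = [(p * N)] \<cdot> y" using yc by (simp add: smult_smult mult.commute)
    then show ?thesis using ec by (simp only: nat_pow_pow pexp_smult[OF v])
  qed
  finally have e: "pexp p R ([N] \<cdot> y') = ?u [^] N \<otimes> pexp p R ([N] \<cdot> ([p] \<cdot> y))"
    by (simp add: pexp_smult[OF v'])
  have 1: "pcong p R (2 * k) (?u [^] N) (\<one> \<oplus> [(p ^ (k + 1))] \<cdot> s)"
    using log_limit[OF w s, of k] pcong_mono[of p "2 * k + 1" _ _ "2 * k"] by (simp add: N_def)
  have 2: "pcong p R (2 * k) (pexp p R ([N] \<cdot> ([p] \<cdot> y))) (\<one> \<oplus> [N] \<cdot> ([p] \<cdot> y))"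
    unfolding N_def by (rule pexp_pcong[of y]) (use yc in auto)
  have 3: "pcong p R (2 * k) (pexp p R ([N] \<cdot> y')) (\<one> \<oplus> [N] \<cdot> y')"
    unfolding N_def by (rule pexp_pcong[OF v'])
  have c: "\<one> \<oplus> [(p ^ (k + 1))] \<cdot> s \<in> carrier R" "\<one> \<oplus> [N] \<cdot> ([p] \<cdot> y) \<in> carrier R" "\<one> \<oplus> [N] \<cdot> y' \<in> carrier R"
    using sc yc by auto
  let ?A = "[N] \<cdot> ([p] \<cdot> s \<oplus> [p] \<cdot> y)"
  \<comment> \<open>The cross term carries N^2 = p^(2k) and disappears at this precision.\<close>
  have prod: "(\<one> \<oplus> [(p ^ (k + 1))] \<cdot> s) \<otimes> (\<one> \<oplus> [N] \<cdot> ([p] \<cdot> y)) = (\<one> \<oplus> ?A) \<oplus> [(N * N)] \<cdot> ([(p * p)] \<cdot> (s \<otimes> y))"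
    using sc yc by (simp add: l_distr r_distr smult_l smult_r smult_smult smult_add N_def a_ac power_add mult_2 ac_simps)
  have b1: "pcong p R (2 * k) ((\<one> \<oplus> [(p ^ (k + 1))] \<cdot> s) \<otimes> (\<one> \<oplus> [N] \<cdot> ([p] \<cdot> y))) (\<one> \<oplus> ?A)"
  proof -
    have "N * N = p ^ (2 * k)" by (simp only: N_def mult_2 power_add)
    then show ?thesis unfolding prod pcong_def using sc yc by (metis add.nat_pow_closed m_closed)
  qed
  have b2: "pcong p R (2 * k) (pexp p R ([N] \<cdot> y')) ((\<one> \<oplus> [(p ^ (k + 1))] \<cdot> s) \<otimes> (\<one> \<oplus> [N] \<cdot> ([p] \<cdot> y)))"
    unfolding e by (rule pcong_mult[OF 1 2 c(1,2)])
  have b3: "\<one> \<oplus> ?A \<in> carrier R" using sc yc by auto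
  have "pcong p R (2 * k) (\<one> \<oplus> [N] \<cdot> y') (\<one> \<oplus> ?A)"
    by (rule pcong_trans[OF pcong_sym[OF 3 c(3)] pcong_trans[OF b2 b1 b3] b3])
  from pcong_add[OF pcong_refl this _ b3, of "\<ominus> \<one>"]
  have "pcong p R (2 * k) (\<ominus> \<one> \<oplus> (\<one> \<oplus> [N] \<cdot> y')) (\<ominus> \<one> \<oplus> (\<one> \<oplus> ?A))"
    by blast
  moreover have "\<ominus> \<one> \<oplus> (\<one> \<oplus> [N] \<cdot> y') = [N] \<cdot> y'" "\<ominus> \<one> \<oplus> (\<one> \<oplus> ?A) = ?A"
    using sc yc by (simp_all add: a_assoc[symmetric] l_neg)
  ultimately have "pcong p R (k + k) ([(p ^ k)] \<cdot> y') ([(p ^ k)] \<cdot> ([p] \<cdot> s \<oplus> [p] \<cdot> y))"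
    by (simp only: N_def mult_2)
  \<comment> \<open>Half of the precision 2k is spent on cancelling p^k.\<close>
  then have "pcong p R k y' ([p] \<cdot> s \<oplus> [p] \<cdot> y)" using ptf_pcong_cancel[OF tf yc(2)] sc yc by simp
  then show "pcong p R k ([p] \<cdot> s \<oplus> [p] \<cdot> y) y'" by (rule pcong_sym) (use sc yc in simp)
qed

end

section \<open>Homomorphisms compatible with p-derivations\<close>

lemma (in cring) has_psum_cong:
  assumes "\<And>i. i \<in> I \<Longrightarrow> f i = g i" "g \<in> I \<rightarrow> carrier R" "has_psum p R f I s"
  shows "has_psum p R g I s"
proof -
  have "(\<Oplus>i\<in>G. f i) = (\<Oplus>i\<in>G. g i)" if "G \<subseteq> I" for G
    using that assms(1,2) by (intro finsum_cong') auto
  then show ?thesis using assms(3) unfolding has_psum_def by metis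
qed

lemma ring_hom_int_smult:
  assumes "cring A" "cring B" "f \<in> add_hom A B" "x \<in> carrier A"
  shows "f ([((- 1 :: int) ^ n)] \<cdot>\<^bsub>A\<^esub> x) = [((- 1 :: int) ^ n)] \<cdot>\<^bsub>B\<^esub> f x"
proof -
  interpret A: cring A by fact
  interpret B: cring B by fact
  have fx: "f x \<in> carrier B" using add_hom_closed[OF assms(3,4)] .
  have "[(- 1 :: int)] \<cdot>\<^bsub>A\<^esub> x = \<ominus>\<^bsub>A\<^esub> x" "[(- 1 :: int)] \<cdot>\<^bsub>B\<^esub> f x = \<ominus>\<^bsub>B\<^esub> f x"
    using assms(4) fx by (simp_all add: add_pow_def int_pow_def2 a_inv_def)
  moreover have "(- 1 :: int) ^ n = 1 \<or> (- 1 :: int) ^ n = - 1" by (cases "even n") auto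
  ultimately show ?thesis
    using assms(4) fx add_hom_minus[OF A.abelian_group_axioms B.abelian_group_axioms assms(3,4)]
    by auto
qed

lemma ring_hom_Units_inv:
  assumes "cring A" "cring B" "f \<in> ring_hom A B" "x \<in> Units A"
  shows "f x \<in> Units B" "f (inv\<^bsub>A\<^esub> x) = inv\<^bsub>B\<^esub> (f x)"
proof -
  interpret A: cring A by fact
  interpret B: cring B by fact
  have c: "x \<in> carrier A" "inv\<^bsub>A\<^esub> x \<in> carrier A" using assms(4) by auto
  have c': "f x \<in> carrier B" "f (inv\<^bsub>A\<^esub> x) \<in> carrier B" using ring_hom_closed[OF assms(3)] c by auto
  have 1: "f x \<otimes>\<^bsub>B\<^esub> f (inv\<^bsub>A\<^esub> x) = \<one>\<^bsub>B\<^esub>"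
    using ring_hom_mult[OF assms(3) c] ring_hom_one[OF assms(3)] assms(4) by simp
  then show "f x \<in> Units B" using c' B.m_comm[OF c'] unfolding Units_def by auto
  show "f (inv\<^bsub>A\<^esub> x) = inv\<^bsub>B\<^esub> (f x)" using B.comm_inv_char[OF c' 1] by simp
qed

text \<open>Divided powers are characterized by an equation with n!, which can be cancelled in the
  target; so a homomorphism preserves them, and it preserves convergent sums.\<close>

lemma pexp_hom:
  assumes A: "pring A p" and B: "pring B p" and f: "f \<in> ring_hom A B" and w: "w \<in> carrier A" "y = [p] \<cdot>\<^bsub>A\<^esub> w"
  shows "f (pexp p A y) = pexp p B (f y)"
proof -
  interpret A: pring A p by fact
  interpret B: pring B p by fact
  have fa: "f \<in> add_hom A B" by (rule ring_hom_add_hom[OF f])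
  note ag = A.abelian_group_axioms B.abelian_group_axioms fa
  have yc: "y \<in> carrier A" using w by simp
  have w': "f w \<in> carrier B" "f y = [p] \<cdot>\<^bsub>B\<^esub> f w"
    using w add_hom_smult[OF ag w(1)] ring_hom_closed[OF f] by auto
  have d: "f (A.dpow n y) = B.dpow n (f y)" for n
  proof (rule B.dpow_unique[OF w', symmetric])
    show "f (A.dpow n y) \<in> carrier B" using ring_hom_closed[OF f A.dpow(1)[OF w]] .
    show "[(fact n :: nat)] \<cdot>\<^bsub>B\<^esub> f (A.dpow n y) = f y [^]\<^bsub>B\<^esub> n"
      using add_hom_smult[OF ag A.dpow(1)[OF w], of "fact n" n] A.dpow(2)[OF w, of n]
        ring_hom_nat_pow[OF A.is_cring B.is_cring f yc] by simp
  qed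
  have "has_psum p B (\<lambda>n. f (A.dpow n y)) UNIV (f (pexp p A y))"
    by (rule has_psum_hom[OF A.is_cring B.is_cring fa _ A.has_psum_pexp[OF w]]) (use A.dpow(1)[OF w] in auto)
  then have "has_psum p B (\<lambda>n. B.dpow n (f y)) UNIV (f (pexp p A y))" by (simp only: d)
  then show ?thesis
    using B.has_psum_unique[OF B.comp _ _ B.has_psum_pexp[OF w']] B.dpow(1)[OF w'] by blast
qed

lemma log_term_hom:
  assumes A: "pring A p" and B: "pring B p" and f: "f \<in> ring_hom A B" and w: "w \<in> carrier A" and n: "n > 0"
  shows "f (pring.log_term A p w n) = pring.log_term B p (f w) n"
proof -
  interpret A: pring A p by fact
  interpret B: pring B p by fact
  have fa: "f \<in> add_hom A B" by (rule ring_hom_add_hom[OF f])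
  note ag = A.abelian_group_axioms B.abelian_group_axioms fa
  have c: "f (A.log_coeff n) \<in> carrier B" using ring_hom_closed[OF f A.log_coeff(1)[OF n]] .
  have "[n] \<cdot>\<^bsub>B\<^esub> f (A.log_coeff n) = [n] \<cdot>\<^bsub>B\<^esub> B.log_coeff n"
    using add_hom_smult[OF ag A.log_coeff(1)[OF n], of n] A.log_coeff(2)[OF n] B.log_coeff(2)[OF n]
      add_hom_smult[OF ag A.one_closed, of "p ^ (n - 1)"] ring_hom_one[OF f] by simp
  then have e: "f (A.log_coeff n) = B.log_coeff n"
    by (rule B.smult_cancel[OF B.comp B.tf B.prime n c B.log_coeff(1)[OF n]])
  show ?thesis unfolding A.log_term_def B.log_term_def
    using w n A.log_coeff(1)[OF n]
    by (simp add: ring_hom_int_smult[OF A.is_cring B.is_cring fa] ring_hom_mult[OF f] e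
        ring_hom_nat_pow[OF A.is_cring B.is_cring f])
qed

section \<open>p-derivations and homomorphisms out of jet algebras\<close>

definition dalg :: "nat \<Rightarrow> ('r::comm_ring_1 \<Rightarrow> 'r) \<Rightarrow> ('r, 'a, 'm) frob_alg_scheme \<Rightarrow> bool" where
  "dalg p \<phi> A \<longleftrightarrow> falg \<phi> A \<and> p_complete p A \<and> ptf p A \<and> frob_lift p A (frob A)"

context frob_base begin

lemma p_deriv:
  assumes A: "dalg p \<phi> A" and a: "a \<in> carrier A"
  shows "p_deriv p A a \<in> carrier A" "frob A a = a [^]\<^bsub>A\<^esub> p \<oplus>\<^bsub>A\<^esub> [p] \<cdot>\<^bsub>A\<^esub> p_deriv p A a"
    and "d \<in> carrier A \<Longrightarrow> frob A a = a [^]\<^bsub>A\<^esub> p \<oplus>\<^bsub>A\<^esub> [p] \<cdot>\<^bsub>A\<^esub> d \<Longrightarrow> p_deriv p A a = d"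
proof -
  have A': "falg \<phi> A" "p_complete p A" "ptf p A" "frob_lift p A (frob A)" using A by (auto simp: dalg_def)
  interpret A: cring A using falgD(1)[OF A'(1)] .
  have p0: "p > 0" using p by (rule prime_gt_0_nat)
  have fc: "frob A a \<in> carrier A" using falgD(6)[OF A'(1) a] .
  have ex: "p_deriv p A a = d" if d: "d \<in> carrier A" "frob A a = a [^]\<^bsub>A\<^esub> p \<oplus>\<^bsub>A\<^esub> [p] \<cdot>\<^bsub>A\<^esub> d" for d
  proof -
    have "[p] \<cdot>\<^bsub>A\<^esub> d = frob A a \<ominus>\<^bsub>A\<^esub> a [^]\<^bsub>A\<^esub> p"
      using A.minus_eq_iff[of "frob A a" "a [^]\<^bsub>A\<^esub> p" "[p] \<cdot>\<^bsub>A\<^esub> d"] d a fc by auto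
    from A.nat_div_eq[OF A'(2,3) p p0 d(1) this] show ?thesis unfolding p_deriv_def .
  qed
  then show "d \<in> carrier A \<Longrightarrow> frob A a = a [^]\<^bsub>A\<^esub> p \<oplus>\<^bsub>A\<^esub> [p] \<cdot>\<^bsub>A\<^esub> d \<Longrightarrow> p_deriv p A a = d" .
  obtain t where t: "t \<in> carrier A" "frob A a = a [^]\<^bsub>A\<^esub> p \<oplus>\<^bsub>A\<^esub> [p] \<cdot>\<^bsub>A\<^esub> t"
    using A'(4) a by (auto simp: frob_lift_def pcong_def)
  show "p_deriv p A a \<in> carrier A" "frob A a = a [^]\<^bsub>A\<^esub> p \<oplus>\<^bsub>A\<^esub> [p] \<cdot>\<^bsub>A\<^esub> p_deriv p A a"
    using ex[OF t] t by auto
qed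

text \<open>In these algebras p can be cancelled, so the Frobenius and the p-derivation determine
  each other. This lemma and the next one replace compatibility with p-derivations by the easier
  compatibility with the Frobenius.\<close>

lemma delta_hom_falg_hom:
  assumes A: "dalg p \<phi> A" and B: "dalg p \<phi> B" and g: "g \<in> delta_hom p A B"
  shows "g \<in> falg_hom A B"
proof -
  interpret A: cring A using A falgD(1) by (auto simp: dalg_def)
  interpret B: cring B using B falgD(1) by (auto simp: dalg_def)
  have gr: "g \<in> ring_hom A B" and ge: "\<And>r. g (emb A r) = emb B r"
    and gd: "\<And>a. a \<in> carrier A \<Longrightarrow> g (p_deriv p A a) = p_deriv p B (g a)"
    using g by (auto simp: delta_hom_def)
  note ga = ring_hom_add_hom[OF gr]
  have "g (frob A a) = frob B (g a)" if a: "a \<in> carrier A" for a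
  proof -
    have da: "p_deriv p A a \<in> carrier A" using p_deriv(1)[OF A a] .
    have "g (frob A a) = g a [^]\<^bsub>B\<^esub> p \<oplus>\<^bsub>B\<^esub> [p] \<cdot>\<^bsub>B\<^esub> g (p_deriv p A a)"
      unfolding p_deriv(2)[OF A a] using a da
      by (simp add: ring_hom_add[OF gr] ring_hom_nat_pow[OF A.is_cring B.is_cring gr]
        add_hom_smult[OF A.abelian_group_axioms B.abelian_group_axioms ga])
    then show ?thesis using p_deriv(2)[OF B ring_hom_closed[OF gr a]] gd[OF a] by simp
  qed
  then show ?thesis using gr ge by (auto simp: falg_hom_def)
qed

lemma falg_hom_delta_hom:
  assumes A: "dalg p \<phi> A" and B: "dalg p \<phi> B" and g: "g \<in> falg_hom A B"
  shows "restrict g (carrier A) \<in> delta_hom p A B"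
proof -
  have Af: "falg \<phi> A" and Bf: "falg \<phi> B" using A B by (auto simp: dalg_def)
  interpret A: cring A using falgD(1)[OF Af] .
  interpret B: cring B using falgD(1)[OF Bf] .
  note gr = falg_homD(1)[OF g] and ga = falg_homD(2)[OF g]
  have "g (p_deriv p A a) = p_deriv p B (g a)" if a: "a \<in> carrier A" for a
  proof (rule p_deriv(3)[OF B falg_homD(5)[OF g a], symmetric])
    have da: "p_deriv p A a \<in> carrier A" using p_deriv(1)[OF A a] .
    show "g (p_deriv p A a) \<in> carrier B" using ring_hom_closed[OF gr da] .
    have "frob B (g a) = g (frob A a)" using falg_homD(4)[OF g a] by simp
    also have "\<dots> = g a [^]\<^bsub>B\<^esub> p \<oplus>\<^bsub>B\<^esub> [p] \<cdot>\<^bsub>B\<^esub> g (p_deriv p A a)"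
      unfolding p_deriv(2)[OF A a] using a da
      by (simp add: ring_hom_add[OF gr] ring_hom_nat_pow[OF A.is_cring B.is_cring gr]
        add_hom_smult[OF A.abelian_group_axioms B.abelian_group_axioms ga])
    finally show "frob B (g a) = g a [^]\<^bsub>B\<^esub> p \<oplus>\<^bsub>B\<^esub> [p] \<cdot>\<^bsub>B\<^esub> g (p_deriv p A a)" .
  qed
  moreover have "restrict g (carrier A) \<in> ring_hom A B"
    using gr by (auto simp: ring_hom_def Pi_def)
  ultimately show ?thesis
    using p_deriv(1)[OF A] falgD(5)[OF Af] falg_homD(3)[OF g] by (auto simp: delta_hom_def)
qed

lemma jet_dalg: "exps M \<Longrightarrow> dalg p \<phi> (jet_alg p \<phi> M)"
  unfolding dalg_def using jet_falg jet_ptf jet_complete jet_frob_lift by blast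

text \<open>The i-th coordinate is sent to the i-th iterated p-derivation of \<open>y\<close>.
  Commutation with the Frobenius is then, on variables, the defining formula of the
  p-derivation.\<close>

lemma jet_falg_hom_exists:
  fixes T :: "('r, 't, 'm) frob_alg_scheme"
  assumes M: "exps M" and T: "dalg p \<phi> T" and v: "cring.evaluable T M (\<lambda>i. (p_deriv p T ^^ i) y)"
  obtains g where "g \<in> falg_hom (jet_alg p \<phi> M) T" "g (jet_var p M 0) = y"
proof -
  have Tf: "falg \<phi> T" "p_complete p T" using T by (auto simp: dalg_def)
  interpret T: cring T using falgD(1)[OF Tf(1)] .
  interpret J: cring "jet_ring p M :: 'r jet ring" by (rule jet_ring_cring[OF M])
  obtain g where g: "g \<in> ring_hom (jet_ring p M) T" "\<And>r. g (jet_const p M r) = emb T r"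
      "\<And>i. g (jet_var p M i) = (p_deriv p T ^^ i) y"
    by (rule jet_hom_exists[OF M T.is_cring Tf(2) falgD(2)[OF Tf(1)] v]) blast
  note gg = ring_hom_mult[OF g(1)] ring_hom_add[OF g(1)]
  have c: "(p_deriv p T ^^ i) y \<in> carrier T" for i using v by (auto simp: T.evaluable_def)
  have vc: "jet_var p M i \<in> carrier (jet_ring p M :: 'r jet ring)" for i by (rule jet_var_closed[OF M])
  have "g (jet_frob p \<phi> M a) = frob T (g a)" if a: "a \<in> carrier (jet_ring p M)" for a
  proof (rule jet_hom_unique[OF M T.is_cring T.p_complete_sep[OF Tf(2)] _ _ _ _ a,
      where F = "\<lambda>a. g (jet_frob p \<phi> M a)" and G = "\<lambda>a. frob T (g a)"])
    show "(\<lambda>a. g (jet_frob p \<phi> M a)) \<in> ring_hom (jet_ring p M) T"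
      using ring_hom_trans[OF jet_frob(1)[OF M] g(1)] by (simp add: comp_def)
    show "(\<lambda>a. frob T (g a)) \<in> ring_hom (jet_ring p M) T"
      using ring_hom_trans[OF g(1) falgD(3)[OF Tf(1)]] by (simp add: comp_def)
    show "g (jet_frob p \<phi> M (jet_const p M r)) = frob T (g (jet_const p M r))" for r
      by (simp add: jet_frob(2)[OF M] g(2) falgD(4)[OF Tf(1)])
    have "g (jet_frob p \<phi> M (jet_var p M i)) = g (jet_var p M i) [^]\<^bsub>T\<^esub> p \<oplus>\<^bsub>T\<^esub> [p] \<cdot>\<^bsub>T\<^esub> g (jet_var p M (Suc i))" for i
      unfolding jet_frob(3)[OF M] using vc
      by (simp add: ring_hom_add[OF g(1)] ring_hom_nat_pow[OF J.is_cring T.is_cring g(1)]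
        add_hom_smult[OF J.abelian_group_axioms T.abelian_group_axioms ring_hom_add_hom[OF g(1)]])
    then show "g (jet_frob p \<phi> M (jet_var p M i)) = frob T (g (jet_var p M i))" for i
      using p_deriv(2)[OF T c[of i]] by (simp add: g(3))
  qed
  with g have "g \<in> falg_hom (jet_alg p \<phi> M) T" by (simp add: falg_hom_def)
  then show ?thesis using g(3)[of 0] that by auto
qed

lemma jet_falg_hom_Suc:
  fixes T :: "('r, 't, 'm) frob_alg_scheme"
  assumes M: "exps M" and T: "dalg p \<phi> T" and f: "f \<in> falg_hom (jet_alg p \<phi> M) T"
  shows "frob T (f (jet_var p M i)) = f (jet_var p M i) [^]\<^bsub>T\<^esub> p \<oplus>\<^bsub>T\<^esub> [p] \<cdot>\<^bsub>T\<^esub> f (jet_var p M (Suc i))"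
proof -
  have Tf: "falg \<phi> T" "p_complete p T" using T by (auto simp: dalg_def)
  interpret T: cring T using falgD(1)[OF Tf(1)] .
  interpret J: cring "jet_ring p M :: 'r jet ring" by (rule jet_ring_cring[OF M])
  have vc: "jet_var p M i \<in> carrier (jet_ring p M :: 'r jet ring)" for i by (rule jet_var_closed[OF M])
  have fr: "f \<in> ring_hom (jet_ring p M) T" using falg_homD(1)[OF f] by simp
  have "f (jet_frob p \<phi> M (jet_var p M i)) = frob T (f (jet_var p M i))"
    using falg_homD(4)[OF f] vc by simp
  then show ?thesis unfolding jet_frob(3)[OF M] using vc
      by (simp add: ring_hom_add[OF fr] ring_hom_nat_pow[OF J.is_cring T.is_cring fr]
        add_hom_smult[OF J.abelian_group_axioms T.abelian_group_axioms ring_hom_add_hom[OF fr]])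
qed

text \<open>The Frobenius of the i-th coordinate involves p times the next one. As p can be
  cancelled in \<open>T\<close>, the values on all coordinates follow from the value on the
  first.\<close>

lemma jet_falg_hom_unique:
  fixes T :: "('r, 't, 'm) frob_alg_scheme"
  assumes M: "exps M" and T: "dalg p \<phi> T" and f: "f \<in> falg_hom (jet_alg p \<phi> M) T"
    and g: "g \<in> falg_hom (jet_alg p \<phi> M) T" and eq: "f (jet_var p M 0) = g (jet_var p M 0)"
    and a: "a \<in> carrier (jet_ring p M)"
  shows "f a = g a"
proof -
  have Tf: "falg \<phi> T" "p_complete p T" "ptf p T" using T by (auto simp: dalg_def)
  interpret T: cring T using falgD(1)[OF Tf(1)] .
  have vc: "jet_var p M i \<in> carrier (jet_ring p M :: 'r jet ring)" for i by (rule jet_var_closed[OF M])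
  have fr: "f \<in> ring_hom (jet_ring p M) T" "g \<in> ring_hom (jet_ring p M) T"
    using falg_homD(1)[OF f] falg_homD(1)[OF g] by simp_all
  have cl: "f (jet_var p M i) \<in> carrier T" "g (jet_var p M i) \<in> carrier T" for i
    using ring_hom_closed[OF fr(1) vc] ring_hom_closed[OF fr(2) vc] by auto
  have "f (jet_var p M i) = g (jet_var p M i)" for i
  proof (induction i)
    case (Suc i)
    from jet_falg_hom_Suc[OF M T f, of i] jet_falg_hom_Suc[OF M T g, of i]
    have "g (jet_var p M i) [^]\<^bsub>T\<^esub> p \<oplus>\<^bsub>T\<^esub> [p] \<cdot>\<^bsub>T\<^esub> f (jet_var p M (Suc i))
        = g (jet_var p M i) [^]\<^bsub>T\<^esub> p \<oplus>\<^bsub>T\<^esub> [p] \<cdot>\<^bsub>T\<^esub> g (jet_var p M (Suc i))" unfolding Suc by simp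
    then have "[p] \<cdot>\<^bsub>T\<^esub> f (jet_var p M (Suc i)) = [p] \<cdot>\<^bsub>T\<^esub> g (jet_var p M (Suc i))"
      using cl by (simp add: T.add.l_cancel)
    then show ?case using T.ptf_cancel[OF Tf(3), of _ _ 1] cl by simp
  qed (rule eq)
  note var = this
  have const: "f (jet_const p M r) = g (jet_const p M r)" for r
    using falg_homD(3)[OF f, of r] falg_homD(3)[OF g, of r] by simp
  show ?thesis
    by (rule jet_hom_unique[OF M T.is_cring T.p_complete_sep[OF Tf(2)] fr const var a])
qed

text \<open>Resolves the descriptions in \<open>psi_hom\<close> and \<open>cochar_delta_hom\<close>
  together; the hypothesis \<open>h\<close> is meant to be instantiated with their
  definitions.\<close>

lemma jet_delta_hom_the:
  fixes T :: "('r, 't, 'm) frob_alg_scheme"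
  assumes M: "exps M" and T: "dalg p \<phi> T" and v: "cring.evaluable T M (\<lambda>i. (p_deriv p T ^^ i) y)"
    and h: "h = (THE g. g \<in> delta_hom p (jet_alg p \<phi> M) T \<and> g (jet_var p M 0) = y)"
  shows "h \<in> falg_hom (jet_alg p \<phi> M) T" "h (jet_var p M 0) = y"
proof -
  let ?J = "jet_alg p \<phi> M"
  note J = jet_dalg[OF M]
  obtain g where g: "g \<in> falg_hom ?J T" "g (jet_var p M 0) = y"
    by (rule jet_falg_hom_exists[OF M T v])
  have x: "jet_var p M 0 \<in> carrier (jet_ring p M :: 'r jet ring)" by (rule jet_var_closed[OF M])
  have "h = restrict g (carrier ?J)" unfolding h
  proof (rule the_equality, intro conjI)
    show "restrict g (carrier ?J) \<in> delta_hom p ?J T" by (rule falg_hom_delta_hom[OF J T g(1)])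
    show "restrict g (carrier ?J) (jet_var p M 0) = y" using g(2) x by simp
    fix f assume f: "f \<in> delta_hom p ?J T \<and> f (jet_var p M 0) = y"
    then have ff: "f \<in> falg_hom ?J T" using delta_hom_falg_hom[OF J T] by blast
    show "f = restrict g (carrier ?J)"
    proof (rule extensionalityI[of _ "carrier ?J"])
      show "f \<in> extensional (carrier ?J)" using f by (auto simp: delta_hom_def)
      fix a assume "a \<in> carrier ?J"
      then show "f a = restrict g (carrier ?J) a"
        using jet_falg_hom_unique[OF M T ff g(1)] f g(2) by simp
    qed simp
  qed
  moreover have "restrict g (carrier ?J) \<in> falg_hom ?J T"
    by (rule delta_hom_falg_hom[OF J T falg_hom_delta_hom[OF J T g(1)]])
  ultimately show "h \<in> falg_hom ?J T" "h (jet_var p M 0) = y" using x g(2) by auto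
qed

lemma p_deriv_funpow_closed:
  assumes T: "dalg p \<phi> T" and y: "y \<in> carrier T"
  shows "(p_deriv p T ^^ i) y \<in> carrier T"
  by (induction i) (use y p_deriv(1)[OF T] in auto)

lemma evaluable_Ga:
  assumes T: "dalg p \<phi> T" and y: "y \<in> carrier T"
  shows "cring.evaluable T Ga_exps (\<lambda>i. (p_deriv p T ^^ i) y)"
proof -
  interpret T: cring T using T falgD(1) by (auto simp: dalg_def)
  have "\<not> Poly_Mapping.lookup m i < 0" if "m \<in> Ga_exps" for m i
    using that by (simp add: Ga_exps_def not_less)
  then show ?thesis using p_deriv_funpow_closed[OF T y] by (auto simp: T.evaluable_def)
qed

text \<open>Among the variables of the multiplicative group only the one of index 0 is inverted, so
  a unit \<open>y\<close> is all that is required.\<close>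

lemma evaluable_Gm:
  assumes T: "dalg p \<phi> T" and y: "y \<in> Units T"
  shows "cring.evaluable T Gm_exps (\<lambda>i. (p_deriv p T ^^ i) y)"
proof -
  interpret T: cring T using T falgD(1) by (auto simp: dalg_def)
  have "i = 0" if "m \<in> Gm_exps" "Poly_Mapping.lookup m i < 0" for m i
  proof (rule ccontr)
    assume "i \<noteq> 0"
    then have "0 \<le> Poly_Mapping.lookup m i" using that(1) by (simp add: Gm_exps_def)
    then show False using that(2) by simp
  qed
  then have "(p_deriv p T ^^ i) y \<in> Units T" if "m \<in> Gm_exps" "Poly_Mapping.lookup m i < 0" for m i
    using that y by (metis funpow_0)
  then show ?thesis using p_deriv_funpow_closed[OF T] y T.Units_closed by (auto simp: T.evaluable_def)
qed

abbreviation (input) "JGa \<equiv> jet_alg p \<phi> Ga_exps"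

lemma C_hat_dalg: "dalg p \<phi> (C_hat p \<phi>)"
proof -
  have J: "falg \<phi> JGa" "ptf p JGa" "frob_lift p JGa (frob JGa)" using jet_dalg[OF exps_Ga] by (auto simp: dalg_def)
  note D = dlim_falg[OF J(1)]
  interpret D: cring "dlim JGa" using falgD(1)[OF D] .
  have "frob_lift p (pcompl_alg p (dlim JGa)) (pcompl_map p (dlim JGa) (frob (dlim JGa)))"
    using frob_lift_pcompl[OF D.is_cring falgD(3)[OF D] frob_lift_dlim[OF J(1,3)]]
    by (simp add: frob_lift_def pcompl_alg_def)
  then show ?thesis unfolding dalg_def C_hat_def C_alg_def
    using pcompl_falg[OF D] D.p_complete_pcompl D.ptf_pcompl[OF ptf_dlim[OF J(1,2)]] by simp
qed

end

section \<open>The canonical character along a cocharacter\<close>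

lemma type_algebra_pow [simp]: "r [^]\<^bsub>ring_of_type_algebra\<^esub> (n::nat) = (r :: 'r::comm_ring_1) ^ n"
  by (induction n) (simp_all add: nat_pow_def mult.commute)

lemma type_algebra_smult [simp]: "[(n::nat)] \<cdot>\<^bsub>ring_of_type_algebra\<^esub> (r :: 'r::comm_ring_1) = of_nat n * r"
  by (induction n) (simp_all add: add_pow_def nat_pow_def algebra_simps)

lemma type_algebra_pcong [simp]: "pcong p ring_of_type_algebra n x y \<longleftrightarrow> of_nat p ^ n dvd x - (y :: 'r::comm_ring_1)"
  by (auto simp: pcong_def dvd_def algebra_simps)

text \<open>R as an algebra over itself, perfect because \<phi> is bijective: the target of the
  evaluations.\<close>

definition base_alg :: "('r::comm_ring_1 \<Rightarrow> 'r) \<Rightarrow> ('r, 'r) frob_alg" where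
  "base_alg \<phi> = ring.extend ring_of_type_algebra (frob_alg.fields id \<phi>)"

lemma base_alg_simps [simp]:
  "carrier (base_alg \<phi>) = UNIV" "monoid.mult (base_alg \<phi>) = (*)" "monoid.one (base_alg \<phi>) = 1"
  "ring.zero (base_alg \<phi>) = 0" "ring.add (base_alg \<phi>) = (+)" "emb (base_alg \<phi>) = id" "frob (base_alg \<phi>) = \<phi>"
  "r [^]\<^bsub>base_alg \<phi>\<^esub> (n::nat) = r ^ n" "[n] \<cdot>\<^bsub>base_alg \<phi>\<^esub> r = of_nat n * r"
  "pcong p (base_alg \<phi>) n x y \<longleftrightarrow> of_nat p ^ n dvd x - y"
  "cring (base_alg \<phi>)"
proof -
  show "emb (base_alg \<phi>) = id" "frob (base_alg \<phi>) = \<phi>"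
    by (simp_all add: base_alg_def ring.defs frob_alg.defs)
qed (simp_all add: base_alg_def cring_from_type_algebra)

text \<open>The convergence half of \<open>admissible\<close>. Divisibility of all terms by p is
  demanded separately, where an exponential is formed.\<close>

definition nullseq :: "nat \<Rightarrow> (int \<Rightarrow> 'r::comm_ring_1) \<Rightarrow> bool" where
  "nullseq p c \<longleftrightarrow> (\<forall>k. finite {n. \<not> of_nat p ^ k dvd c n})"

lemma nullseq_admissible:
  assumes "admissible p a"
  shows "nullseq p a"
  unfolding nullseq_def
proof
  fix k
  obtain N where "\<forall>n. N \<le> \<bar>n\<bar> \<longrightarrow> of_nat p ^ k dvd a n" using assms unfolding admissible_def by blast
  then have "\<bar>n\<bar> \<le> N" if "\<not> of_nat p ^ k dvd a n" for n using that by (meson linear)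
  then have "{n. \<not> of_nat p ^ k dvd a n} \<subseteq> {-N..N}" by (fastforce simp: abs_le_iff)
  then show "finite {n. \<not> of_nat p ^ k dvd a n}" by (rule finite_subset) simp
qed

locale delta_base = frob_base p \<phi> for p :: nat and \<phi> :: "'r::comm_ring_1 \<Rightarrow> 'r" +
  assumes odd: "odd p"

context frob_base begin

lemma base_dalg: "dalg p \<phi> (base_alg \<phi>)"
proof -
  have "falg \<phi> (base_alg \<phi>)" using \<phi>(1) by (auto simp: falg_def ring_hom_def)
  then show ?thesis using R_complete R_ptf \<phi>_lift
    by (auto simp: dalg_def ptf_def frob_lift_def) (simp add: base_alg_def)
qed

lemma base_perfect: "perfect (base_alg \<phi>)"
  using \<phi>(2) by (simp add: perfect_def)

sublocale P: pfunctor p \<phi> "K_circ p \<phi>"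
  by unfold_locales (rule K_falg)

lemma C_hat_eq: "C_hat p \<phi> = pcompl_alg p (dlim (jet_alg p \<phi> Ga_exps))"
  by (simp add: C_hat_def C_alg_def)

lemma jet_falg_Ga: "falg \<phi> (jet_alg p \<phi> Ga_exps)"
  and jet_falg_Gm: "falg \<phi> (jet_alg p \<phi> Gm_exps)"
  by (rule jet_falg[OF exps_Ga], rule jet_falg[OF exps_Gm])

lemma C_can_eq: "C_can p \<phi> = pfunctor.can p (jet_alg p \<phi> Ga_exps)"
  by (rule ext) (simp add: P.can_def[OF jet_falg_Ga] C_can_def C_alg_def)

lemma C_can_hom: "C_can p \<phi> \<in> falg_hom (jet_alg p \<phi> Ga_exps) (C_hat p \<phi>)"
  unfolding C_can_eq C_hat_eq by (rule P.can_hom[OF jet_falg_Ga])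

lemma z_closed: "jet_var p Ga_exps 0 \<in> carrier (jet_alg p \<phi> Ga_exps)"
  using jet_var_closed[OF exps_Ga] by simp

lemma C_shift_closed: "C_shift p \<phi> n \<in> carrier (C_hat p \<phi>)"
proof -
  let ?J = "jet_alg p \<phi> Ga_exps"
  interpret J: cring "jet_ring p Ga_exps :: 'r jet ring" by (rule jet_ring_cring[OF exps_Ga])
  interpret D: cring "dlim ?J" using falgD(1)[OF dlim_falg[OF jet_falg_Ga]] .
  have "(frob ?J ^^ k) (jet_var p Ga_exps 0) \<in> carrier ?J" for k
    using ring_hom_closed[OF funpow_ring_hom[OF falgD(3)[OF jet_falg_Ga]] z_closed] .
  then have "dlim_cls ?J ((frob ?J ^^ k) (jet_var p Ga_exps 0)) i \<in> carrier (dlim ?J)" for k i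
    by (rule dlim_cls_closed[OF jet_falg_Ga])
  from this[of 0] this show ?thesis
    using ring_hom_closed[OF D.pcompl_inj_hom] by (simp add: C_shift_def C_alg_def C_hat_eq Let_def)
qed

lemma C_shift_0: "C_shift p \<phi> 0 = C_can p \<phi> (jet_var p Ga_exps 0)"
  by (simp add: C_shift_def C_can_def Let_def)

text \<open>For n at least 1 the Frobenius lowers the stage of \<open>z\<close>; for the other n it
  adds one more Frobenius iterate at stage 0.\<close>

lemma frob_C_shift: "frob (C_hat p \<phi>) (C_shift p \<phi> n) = C_shift p \<phi> (n - 1)"
proof -
  let ?J = "jet_alg p \<phi> Ga_exps" and ?z = "jet_var p Ga_exps 0"
  note D = dlim_falg[OF jet_falg_Ga]
  interpret D: cring "dlim ?J" using falgD(1)[OF D] .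
  note fi = pcompl_map_inj[OF D.is_cring D.is_cring ring_hom_add_hom[OF falgD(3)[OF D]]]
  have zc: "(frob ?J ^^ k) ?z \<in> carrier ?J" for k
    using ring_hom_closed[OF funpow_ring_hom[OF falgD(3)[OF jet_falg_Ga]] z_closed] .
  note dc = dlim_cls_closed[OF jet_falg_Ga]
  show ?thesis
  proof (cases "n \<ge> 1")
    case True
    then obtain i where i: "nat n = Suc i" "nat (n - 1) = i" by (metis One_nat_def Suc_nat_eq_nat_zadd1 diff_add_cancel diff_ge_0_iff_ge add.commute)
    have "frob (C_hat p \<phi>) (C_shift p \<phi> n) = pcompl_inj p (dlim ?J) (frob (dlim ?J) (dlim_cls ?J ?z (Suc i)))"
      using True i fi[OF dc[OF z_closed]] by (simp add: C_shift_def C_alg_def C_hat_eq Let_def del: dlim_frob)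
    then show ?thesis using True i dlim_frob_Suc[OF jet_falg_Ga z_closed]
      by (simp add: C_shift_def C_alg_def Let_def)
  next
    case False
    then obtain k where k: "n = - int k" by (metis linorder_not_le int_one_le_iff_zero_less nonpos_int_cases)
    have e: "C_shift p \<phi> (- int j) = pcompl_inj p (dlim ?J) (dlim_cls ?J ((frob ?J ^^ j) ?z) 0)" for j
      by (cases j) (simp_all add: C_shift_def C_alg_def Let_def nat_add_distrib)
    have "frob (C_hat p \<phi>) (C_shift p \<phi> n) = pcompl_inj p (dlim ?J) (frob (dlim ?J) (dlim_cls ?J ((frob ?J ^^ k) ?z) 0))"
      unfolding k e using fi[OF dc[OF zc]] by (simp add: C_hat_eq del: dlim_frob)
    also have "\<dots> = C_shift p \<phi> (- int (Suc k))" unfolding e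
      using dlim_frob[OF jet_falg_Ga zc, of k 0] by simp
    also have "- int (Suc k) = n - 1" using k by simp
    finally show ?thesis .
  qed
qed

abbreviation (input) "Ch \<equiv> C_hat p \<phi>"

lemma Ch: "falg \<phi> Ch" "p_complete p Ch" "ptf p Ch"
  using C_hat_dalg by (auto simp: dalg_def)

lemma emb_dvd:
  assumes T: "falg \<phi> T" and d: "of_nat p ^ k dvd r"
  shows "pcong p T k (emb T r) \<zero>\<^bsub>T\<^esub>"
proof -
  interpret T: cring T using falgD(1)[OF T] .
  interpret R: cring "ring_of_type_algebra :: 'r ring" by (rule cring_from_type_algebra)
  have "pcong p T k (emb T r) (emb T \<zero>\<^bsub>ring_of_type_algebra\<^esub>)"
    by (rule add_hom_pcong[OF R.ring_axioms T.ring_axioms ring_hom_add_hom[OF falgD(2)[OF T]]]) (use d in simp_all)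
  then show ?thesis
    using add_hom_zero[OF R.abelian_group_axioms T.abelian_group_axioms ring_hom_add_hom[OF falgD(2)[OF T]]] by simp
qed

section \<open>Series in the elements \<phi>^(-n)(z)\<close>

definition ser_term :: "(int \<Rightarrow> 'r) \<Rightarrow> int \<Rightarrow> 'r Calg" where
  "ser_term c n = emb Ch (c n) \<otimes>\<^bsub>Ch\<^esub> C_shift p \<phi> n"

definition ser :: "(int \<Rightarrow> 'r) \<Rightarrow> 'r Calg" where
  "ser c = psum p Ch (ser_term c) UNIV"

lemma ser_term_closed: "ser_term c n \<in> carrier Ch"
proof -
  interpret C: cring Ch using falgD(1)[OF Ch(1)] .
  show ?thesis unfolding ser_term_def using falgD(5)[OF Ch(1)] C_shift_closed by simp
qed

lemma ser_term_dvd: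
  assumes "of_nat p ^ k dvd c n"
  shows "pcong p Ch k (ser_term c n) \<zero>\<^bsub>Ch\<^esub>"
proof -
  interpret C: cring Ch using falgD(1)[OF Ch(1)] .
  from C.pcong_mult_r[OF emb_dvd[OF Ch(1) assms] C.zero_closed C_shift_closed, of n]
  show ?thesis unfolding ser_term_def using C_shift_closed by simp
qed

lemma ser_has_psum:
  assumes "nullseq p c"
  shows "has_psum p Ch (ser_term c) UNIV (ser c)"
proof -
  interpret C: cring Ch using falgD(1)[OF Ch(1)] .
  have "finite {n. \<not> pcong p Ch k (ser_term c n) \<zero>\<^bsub>Ch\<^esub>}" for k
    by (rule finite_subset[of _ "{n. \<not> of_nat p ^ k dvd c n}"])
      (use assms ser_term_dvd[of k c] in \<open>auto simp: nullseq_def\<close>)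
  then have "C.null p (ser_term c) UNIV" using ser_term_closed by (auto simp: C.null_def)
  from C.has_psum_psum[OF Ch(2) this] show ?thesis unfolding ser_def .
qed

lemma ser_eqI: "nullseq p c \<Longrightarrow> has_psum p Ch (ser_term c) UNIV s \<Longrightarrow> ser c = s"
  using cring.has_psum_unique[OF falgD(1)[OF Ch(1)] Ch(2) _ ser_has_psum] ser_term_closed by blast

lemma ser_closed: "nullseq p c \<Longrightarrow> ser c \<in> carrier Ch"
  using ser_has_psum by (auto simp: has_psum_def)

text \<open>All terms vanish modulo p, so the sum is congruent to the empty sum. This supplies the
  witness that \<open>pexp\<close> needs.\<close>

lemma ser_smult:
  assumes "nullseq p c" "\<And>n. of_nat p dvd c n"
  obtains w where "w \<in> carrier Ch" "ser c = [p] \<cdot>\<^bsub>Ch\<^esub> w"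
proof -
  interpret C: cring Ch using falgD(1)[OF Ch(1)] .
  have "pcong p Ch 1 (ser c) (\<Oplus>\<^bsub>Ch\<^esub>i\<in>{}. ser_term c i)"
    by (rule C.has_psum_approx[OF _ ser_has_psum[OF assms(1)]])
      (use assms(2) ser_term_closed ser_term_dvd[of 1 c] in auto)
  then show ?thesis using that by (auto simp: C.pcong_zero_iff)
qed

lemma nullseq_shift:
  assumes "nullseq p c"
  shows "nullseq p (\<lambda>n. \<phi> (c (n + 1)))"
  unfolding nullseq_def
proof
  fix k
  have d: "of_nat p ^ k dvd \<phi> r" if "of_nat p ^ k dvd r" for r
  proof -
    from that obtain t where "r = of_nat p ^ k * t" by (auto simp: dvd_def)
    moreover have "\<phi> (of_nat p ^ k) = of_nat p ^ k"
    proof -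
      interpret R: cring "ring_of_type_algebra :: 'r ring" by (rule cring_from_type_algebra)
      have "\<phi> (of_nat m) = of_nat m" for m
        using add_hom_smult[OF R.abelian_group_axioms R.abelian_group_axioms ring_hom_add_hom[OF \<phi>(1)], of 1 m]
          ring_hom_one[OF \<phi>(1)] by simp
      from this[of "p ^ k"] show ?thesis by simp
    qed
    ultimately show ?thesis using ring_hom_mult[OF \<phi>(1), of "of_nat p ^ k" t] by simp
  qed
  have "{n. \<not> of_nat p ^ k dvd \<phi> (c (n + 1))} \<subseteq> (\<lambda>n. n - 1) ` {n. \<not> of_nat p ^ k dvd c n}"
  proof
    fix n assume "n \<in> {n. \<not> of_nat p ^ k dvd \<phi> (c (n + 1))}"
    then have "n + 1 \<in> {n. \<not> of_nat p ^ k dvd c n}" using d by auto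
    then have "n + 1 - 1 \<in> (\<lambda>n. n - 1) ` {n. \<not> of_nat p ^ k dvd c n}" by (rule imageI)
    then show "n \<in> (\<lambda>n. n - 1) ` {n. \<not> of_nat p ^ k dvd c n}" by simp
  qed
  then show "finite {n. \<not> of_nat p ^ k dvd \<phi> (c (n + 1))}"
    using assms by (auto simp: nullseq_def intro: finite_subset)
qed

text \<open>The Frobenius maps the term of index n+1 to one of index n and applies \<phi> to its
  coefficient; the sum is then reindexed.\<close>

lemma frob_ser:
  assumes c: "nullseq p c"
  shows "frob Ch (ser c) = ser (\<lambda>n. \<phi> (c (n + 1)))"
proof -
  interpret C: cring Ch using falgD(1)[OF Ch(1)] .
  note fr = falgD(3)[OF Ch(1)]
  let ?d = "\<lambda>n. \<phi> (c (n + 1))"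
  have b: "bij_betw (\<lambda>n. n + 1) UNIV (UNIV :: int set)"
    by (rule bij_betwI[of _ _ _ "\<lambda>n. n - 1"]) auto
  have "has_psum p Ch (\<lambda>n. frob Ch (ser_term c n)) UNIV (frob Ch (ser c))"
    by (rule has_psum_hom[OF C.is_cring C.is_cring ring_hom_add_hom[OF fr] _ ser_has_psum[OF c]])
      (use ser_term_closed in auto)
  from C.has_psum_reindex[OF b _ this]
  have "has_psum p Ch (\<lambda>n. frob Ch (ser_term c (n + 1))) UNIV (frob Ch (ser c))"
    using falgD(6)[OF Ch(1) ser_term_closed] by blast
  moreover have "frob Ch (ser_term c (n + 1)) = ser_term ?d n" for n
    unfolding ser_term_def ring_hom_mult[OF fr falgD(5)[OF Ch(1)] C_shift_closed] frob_C_shift falgD(4)[OF Ch(1)] by simp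
  ultimately show ?thesis using ser_eqI[OF nullseq_shift[OF c]] by simp
qed

end

section \<open>The canonical character along a cocharacter\<close>

context delta_base begin

lemma pring_dalg: "dalg p \<phi> T \<Longrightarrow> pring T p"
  using p odd falgD(1) by (auto simp: dalg_def pring_def pring_axioms_def)

abbreviation (input) "x0 \<equiv> jet_var p Gm_exps 0 :: 'r jet"
abbreviation (input) "wm \<equiv> jet_var p Gm_exps 1 \<otimes>\<^bsub>jet_alg p \<phi> Gm_exps\<^esub> inv\<^bsub>jet_alg p \<phi> Gm_exps\<^esub> (x0 [^]\<^bsub>jet_alg p \<phi> Gm_exps\<^esub> p)"

lemma x0_unit: "x0 \<in> Units (jet_alg p \<phi> Gm_exps)"
proof -
  interpret J: cring "jet_ring p Gm_exps :: 'r jet ring" by (rule jet_ring_cring[OF exps_Gm])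
  have "Poly_Mapping.single 0 (- 1) \<in> Gm_exps" by (auto simp: Gm_exps_def lookup_single)
  moreover have "J.evaluable Gm_exps (jet_var p Gm_exps)" by (rule jet_evaluable[OF exps_Gm])
  moreover have "Poly_Mapping.lookup (Poly_Mapping.single (0::nat) (- 1 :: int)) 0 < 0" by simp
  ultimately have "x0 \<in> Units (jet_ring p Gm_exps)" unfolding J.evaluable_def by blast
  then show ?thesis by (simp add: jet_alg_def)
qed

lemma wm_closed: "wm \<in> carrier (jet_alg p \<phi> Gm_exps)"
proof -
  interpret J: cring "jet_alg p \<phi> Gm_exps" using falgD(1)[OF jet_falg_Gm] .
  have "x0 [^]\<^bsub>jet_alg p \<phi> Gm_exps\<^esub> p \<in> Units (jet_alg p \<phi> Gm_exps)" using x0_unit by (rule J.Units_pow_closed)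
  moreover have "jet_var p Gm_exps 1 \<in> carrier (jet_alg p \<phi> Gm_exps)" using jet_var_closed[OF exps_Gm] by simp
  ultimately show ?thesis by blast
qed

lemma Psi_has_psum: "has_psum p (jet_alg p \<phi> Gm_exps) (pring.log_term (jet_alg p \<phi> Gm_exps) p wm) {1..} (Psi p \<phi>)"
proof -
  interpret J: pring "jet_alg p \<phi> Gm_exps" p by (rule pring_dalg[OF jet_dalg[OF exps_Gm]])
  have "Psi p \<phi> = psum p (jet_alg p \<phi> Gm_exps) (J.log_term wm) {1..}"
    unfolding Psi_def Let_def J.log_term_def J.log_coeff_def ..
  then show ?thesis using J.has_psum_psum[OF J.comp J.log_term_null[OF wm_closed]] by simp
qed

lemma Psi_closed: "Psi p \<phi> \<in> carrier (jet_alg p \<phi> Gm_exps)"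
  using Psi_has_psum by (auto simp: has_psum_def)

lemma psi_hom: "psi_hom p \<phi> \<in> falg_hom (jet_alg p \<phi> Ga_exps) (jet_alg p \<phi> Gm_exps)"
    "psi_hom p \<phi> (jet_var p Ga_exps 0) = Psi p \<phi>"
  by (rule jet_delta_hom_the[OF exps_Ga jet_dalg[OF exps_Gm] evaluable_Ga[OF jet_dalg[OF exps_Gm] Psi_closed] psi_hom_def])+

context
  fixes a :: "int \<Rightarrow> 'r"
  assumes a: "admissible p a"
begin

lemma Sigma_ser_eq: "Sigma_ser p \<phi> a = pexp p Ch (ser a)"
  by (simp add: Sigma_ser_def ser_def ser_term_def[abs_def])

lemma Sigma_unit: "Sigma_ser p \<phi> a \<in> Units Ch"
proof -
  interpret C: pring Ch p by (rule pring_dalg[OF C_hat_dalg])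
  obtain w where "w \<in> carrier Ch" "ser a = [p] \<cdot>\<^bsub>Ch\<^esub> w"
    using ser_smult[OF nullseq_admissible[OF a]] a by (auto simp: admissible_def)
  then show ?thesis unfolding Sigma_ser_eq by (rule C.pexp_unit)
qed

lemma cochar_delta_hom: "cochar_delta_hom p \<phi> a \<in> falg_hom (jet_alg p \<phi> Gm_exps) Ch"
    "cochar_delta_hom p \<phi> a x0 = Sigma_ser p \<phi> a"
  by (rule jet_delta_hom_the[OF exps_Gm C_hat_dalg evaluable_Gm[OF C_hat_dalg Sigma_unit] cochar_delta_hom_def])+

text \<open>\<open>p \<Psi>\<close> is the logarithm of \<open>\<phi>(x) / x^p\<close>, and \<open>x\<close> is sent to \<open>exp\<close> of \<open>ser a\<close>.\<close>

lemma cochar_Psi: "[p] \<cdot>\<^bsub>Ch\<^esub> cochar_delta_hom p \<phi> a (Psi p \<phi>) \<oplus>\<^bsub>Ch\<^esub> [p] \<cdot>\<^bsub>Ch\<^esub> ser a = ser (\<lambda>n. \<phi> (a (n + 1)))"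
proof -
  let ?J = "jet_alg p \<phi> Gm_exps" and ?g = "cochar_delta_hom p \<phi> a" and ?S = "Sigma_ser p \<phi> a"
  interpret J: pring ?J p by (rule pring_dalg[OF jet_dalg[OF exps_Gm]])
  interpret C: pring Ch p by (rule pring_dalg[OF C_hat_dalg])
  note g = cochar_delta_hom and nl = nullseq_admissible[OF a]
  note gr = falg_homD(1)[OF g(1)]
  note fr = falgD(3)[OF Ch(1)]
  obtain v where v: "v \<in> carrier Ch" "ser a = [p] \<cdot>\<^bsub>Ch\<^esub> v"
    using ser_smult[OF nl] a by (auto simp: admissible_def)
  have v': "frob Ch v \<in> carrier Ch" "frob Ch (ser a) = [p] \<cdot>\<^bsub>Ch\<^esub> frob Ch v"
    using v falgD(6)[OF Ch(1)] add_hom_smult[OF C.abelian_group_axioms C.abelian_group_axioms ring_hom_add_hom[OF fr] v(1), of p] by auto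
  have Sc: "?S \<in> carrier Ch" using C.Units_closed[OF Sigma_unit] .
  have Sp: "?S [^]\<^bsub>Ch\<^esub> p \<in> Units Ch" by (rule C.Units_pow_closed[OF Sigma_unit])
  have x1: "jet_var p Gm_exps 1 \<in> carrier ?J" using jet_var_closed[OF exps_Gm] by simp
  have xp: "x0 [^]\<^bsub>?J\<^esub> p \<in> Units ?J" by (rule J.Units_pow_closed[OF x0_unit])
  note gp = ring_hom_Units_inv[OF J.is_cring C.is_cring gr xp]
  have "?g wm = ?g (jet_var p Gm_exps 1) \<otimes>\<^bsub>Ch\<^esub> ?g (inv\<^bsub>?J\<^esub> (x0 [^]\<^bsub>?J\<^esub> p))"
    by (rule ring_hom_mult[OF gr x1 J.Units_inv_closed[OF xp]])
  also have "\<dots> = ?g (jet_var p Gm_exps 1) \<otimes>\<^bsub>Ch\<^esub> inv\<^bsub>Ch\<^esub> (?S [^]\<^bsub>Ch\<^esub> p)"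
    unfolding gp(2) ring_hom_nat_pow[OF J.is_cring C.is_cring gr J.Units_closed[OF x0_unit]] g(2) ..
  finally have gw: "?g wm = ?g (jet_var p Gm_exps 1) \<otimes>\<^bsub>Ch\<^esub> inv\<^bsub>Ch\<^esub> (?S [^]\<^bsub>Ch\<^esub> p)" .
  have gx1: "?g (jet_var p Gm_exps 1) \<in> carrier Ch" using ring_hom_closed[OF gr x1] .
  have gwc: "?g wm \<in> carrier Ch" using ring_hom_closed[OF gr wm_closed] .
  have gwS: "?g wm \<otimes>\<^bsub>Ch\<^esub> ?S [^]\<^bsub>Ch\<^esub> p = ?g (jet_var p Gm_exps 1)"
    unfolding gw C.m_assoc[OF gx1 C.Units_inv_closed[OF Sp] C.Units_closed[OF Sp]] C.Units_l_inv[OF Sp]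
    using gx1 by (rule C.r_one)
  have fS: "frob Ch ?S = ?S [^]\<^bsub>Ch\<^esub> p \<oplus>\<^bsub>Ch\<^esub> [p] \<cdot>\<^bsub>Ch\<^esub> ?g (jet_var p Gm_exps 1)"
    using jet_falg_hom_Suc[OF exps_Gm C_hat_dalg g(1), of 0] g(2) by simp
  \<comment> \<open>As \<open>wm\<close> is x'/x^p, the left side is the image of x^p + p x' =
    \<phi>(x), that is, the Frobenius of the exponential. This is the hypothesis on which
    \<open>log_exp\<close> operates.\<close>
  have "(\<one>\<^bsub>Ch\<^esub> \<oplus>\<^bsub>Ch\<^esub> [p] \<cdot>\<^bsub>Ch\<^esub> ?g wm) \<otimes>\<^bsub>Ch\<^esub> ?S [^]\<^bsub>Ch\<^esub> p = ?S [^]\<^bsub>Ch\<^esub> p \<oplus>\<^bsub>Ch\<^esub> [p] \<cdot>\<^bsub>Ch\<^esub> (?g wm \<otimes>\<^bsub>Ch\<^esub> ?S [^]\<^bsub>Ch\<^esub> p)"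
    using gwc Sc by (simp add: C.l_distr C.smult_l)
  also have "\<dots> = frob Ch ?S" unfolding gwS fS ..
  also have "\<dots> = pexp p Ch (frob Ch (ser a))" unfolding Sigma_ser_eq
    by (rule pexp_hom[OF C.pring_axioms C.pring_axioms fr v])
  finally have eq: "(\<one>\<^bsub>Ch\<^esub> \<oplus>\<^bsub>Ch\<^esub> [p] \<cdot>\<^bsub>Ch\<^esub> ?g wm) \<otimes>\<^bsub>Ch\<^esub> pexp p Ch (ser a) [^]\<^bsub>Ch\<^esub> p = pexp p Ch (frob Ch (ser a))"
    unfolding Sigma_ser_eq .
  have "has_psum p Ch (\<lambda>n. ?g (J.log_term wm n)) {1..} (?g (Psi p \<phi>))"
    by (rule has_psum_hom[OF J.is_cring C.is_cring ring_hom_add_hom[OF gr] _ Psi_has_psum])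
      (use J.log_term_closed[OF wm_closed] in auto)
  from C.has_psum_cong[OF _ _ this, of "C.log_term (?g wm)"]
  have "has_psum p Ch (C.log_term (?g wm)) {1..} (?g (Psi p \<phi>))"
    using log_term_hom[OF J.pring_axioms C.pring_axioms gr wm_closed] C.log_term_closed[OF gwc] by auto
  from C.log_exp[OF v v' gwc this eq] show ?thesis unfolding frob_ser[OF nl] .
qed

end

end

section \<open>A functional on the perfectoid base\<close>

lemma poly_roots_mod:
  fixes f :: "'r::idom poly"
  assumes prime: "\<And>x y. q dvd x * y \<Longrightarrow> q dvd x \<or> q dvd y"
    and "finite S" "\<And>s t. s \<in> S \<Longrightarrow> t \<in> S \<Longrightarrow> s \<noteq> t \<Longrightarrow> \<not> q dvd s - t"
    and "\<And>s. s \<in> S \<Longrightarrow> q dvd poly f s" "degree f < card S"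
  shows "[:q:] dvd f"
  using assms(2-)
proof (induction "degree f" arbitrary: f S)
  case 0
  then obtain c where c: "f = [:c:]" using degree_eq_zeroE by metis
  from 0 have "S \<noteq> {}" by auto
  then show ?case using 0(4) c by auto
next
  case (Suc n)
  from Suc have "S \<noteq> {}" by auto
  then obtain s where s: "s \<in> S" by blast
  let ?g = "synthetic_div f s"
  have f: "f = [:- s, 1:] * ?g + [:poly f s:]" using synthetic_div_correct'[of s f] by simp
  have "q dvd poly ?g t" if t: "t \<in> S - {s}" for t
  proof -
    have "poly f t - poly f s = (t - s) * poly ?g t"
      by (subst (1) f) (simp add: algebra_simps)
    moreover have "q dvd poly f t - poly f s" using Suc.prems(3) t s by (intro dvd_diff) auto
    ultimately have "q dvd (t - s) * poly ?g t" by simp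
    then show ?thesis using prime Suc.prems(2)[of t s] t s by blast
  qed
  moreover have "degree ?g = n" using Suc(2) by (simp add: degree_synthetic_div)
  moreover have "card (S - {s}) > n" using Suc(2) Suc.prems(1,4) s by simp
  ultimately have "[:q:] dvd ?g" using Suc.hyps(1)[of ?g "S - {s}"] Suc.prems(1,2) by auto
  moreover have "[:q:] dvd [:poly f s:]" using Suc.prems(3)[OF s] by simp
  ultimately show ?case by (subst f) (intro dvd_add dvd_mult)
qed

text \<open>
  The monomial \<open>m\<close> stands for \<open>p\<close> to the power \<open>wt p m\<close>.  The functional projects onto the
  integral powers of \<open>p\<close>; the other powers are sent to 0.
\<close>

definition wt :: "nat \<Rightarrow> expo \<Rightarrow> rat" where
  "wt p m = (\<Sum>i\<in>Poly_Mapping.keys m. of_int (Poly_Mapping.lookup m i) / of_nat p ^ i)"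

definition wval :: "nat \<Rightarrow> expo \<Rightarrow> 'r::comm_ring_1" where
  "wval p m = (if wt p m \<in> \<int> then of_nat p ^ nat \<lfloor>wt p m\<rfloor> else 0)"

definition root_fun :: "nat \<Rightarrow> (expo \<Rightarrow>\<^sub>0 'r::comm_ring_1) \<Rightarrow> 'r" where
  "root_fun p f = (\<Sum>m\<in>Poly_Mapping.keys f. Poly_Mapping.lookup f m * wval p m)"

lemma wt_superset: "finite S \<Longrightarrow> Poly_Mapping.keys m \<subseteq> S \<Longrightarrow>
    wt p m = (\<Sum>i\<in>S. of_int (Poly_Mapping.lookup m i) / of_nat p ^ i)"
  unfolding wt_def by (rule sum.mono_neutral_left) (auto simp: in_keys_iff)

lemma wt_add: "wt p (m + m') = wt p m + wt p m'"
proof -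
  let ?S = "Poly_Mapping.keys m \<union> Poly_Mapping.keys m'"
  have "wt p (m + m') = (\<Sum>i\<in>?S. of_int (Poly_Mapping.lookup (m + m') i) / of_nat p ^ i)"
    by (rule wt_superset) (use Poly_Mapping.keys_add[of m m'] in auto)
  then show ?thesis
    using wt_superset[of ?S m p] wt_superset[of ?S m' p]
    by (simp add: lookup_add add_divide_distrib sum.distrib)
qed

lemma wt_single: "wt p (Poly_Mapping.single i k) = of_int k / of_nat p ^ i"
  by (simp add: wt_def)

lemma wt_nonneg: "m \<in> Ga_exps \<Longrightarrow> 0 \<le> wt p m"
  unfolding wt_def by (intro sum_nonneg divide_nonneg_nonneg) (auto simp: Ga_exps_def)

lemma wval_Suc:
  assumes "m \<in> Ga_exps" "wt p m' = wt p m + 1"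
  shows "wval p m' = of_nat p * wval p m"
proof -
  have "nat \<lfloor>wt p m + 1\<rfloor> = Suc (nat \<lfloor>wt p m\<rfloor>)" using wt_nonneg[OF assms(1), of p]
    by (simp add: nat_add_distrib)
  moreover have "wt p m + 1 \<in> \<int> \<longleftrightarrow> wt p m \<in> \<int>" by (metis Ints_1 Ints_add Ints_diff add_diff_cancel_right')
  ultimately show ?thesis using assms(2) by (simp add: wval_def)
qed

lemma root_fun_superset: "finite S \<Longrightarrow> Poly_Mapping.keys f \<subseteq> S \<Longrightarrow>
    root_fun p f = (\<Sum>m\<in>S. Poly_Mapping.lookup f m * wval p m)"
  unfolding root_fun_def by (rule sum.mono_neutral_left) (auto simp: in_keys_iff)

lemma root_fun_add: "root_fun p (f + g) = root_fun p f + root_fun p g"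
proof -
  let ?S = "Poly_Mapping.keys f \<union> Poly_Mapping.keys g"
  have "root_fun p (f + g) = (\<Sum>m\<in>?S. Poly_Mapping.lookup (f + g) m * wval p m)"
    by (rule root_fun_superset) (use Poly_Mapping.keys_add[of f g] in auto)
  then show ?thesis
    using root_fun_superset[of ?S f p] root_fun_superset[of ?S g p]
    by (simp add: lookup_add sum.distrib algebra_simps)
qed

lemma root_fun_single: "root_fun p (Poly_Mapping.single m r) = r * wval p m"
  using root_fun_superset[of "{m}" "Poly_Mapping.single m r" p] by simp

lemma root_fun_0 [simp]: "root_fun p 0 = 0"
  by (simp add: root_fun_def)

lemma root_fun_minus: "root_fun p (f - g) = root_fun p f - root_fun p g"
  using root_fun_add[of p "f - g" g] by (simp add: algebra_simps)

lemma root_fun_const_mult: "root_fun p (poly_const r * f) = r * root_fun p f"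
proof -
  have "Poly_Mapping.keys f \<subseteq> UNIV" by simp
  then show ?thesis
  proof (induction f rule: poly_induct)
    case (single m s)
    show ?case by (simp add: poly_const_def mult_single root_fun_single algebra_simps)
  qed (simp_all add: distrib_left root_fun_add)
qed

lemma poly_var_pow: "poly_var i ^ n = Poly_Mapping.single (Poly_Mapping.single i (int n)) (1 :: 'r::comm_ring_1)"
  by (induction n) (simp_all add: poly_var_def mult_single single_add[symmetric] add.commute)

lemma of_nat_poly: "of_nat n = Poly_Mapping.single (0::expo) (of_nat n :: 'r::comm_ring_1)"
  by (induction n) (simp_all add: single_add)

text \<open>The functional sees a monomial only through its weight: t_0 raises the weight by 1,
  which multiplies the value by p, while t_(n+1)^p and t_n have the same weight.\<close>

lemma root_fun_gens:
  fixes f g :: "expo \<Rightarrow>\<^sub>0 'r::comm_ring_1"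
  assumes "Factorial_Ring.prime p" "f \<in> root_gens p" "Poly_Mapping.keys g \<subseteq> Ga_exps"
  shows "root_fun p (g * f) = 0"
  using assms(3)
proof (induction g rule: poly_induct)
  case (single m r)
  have p0: "(of_nat p :: rat) \<noteq> 0" using assms(1) by auto
  from assms(2) consider "f = poly_var 0 - of_nat p" | n where "f = poly_var (Suc n) ^ p - poly_var n"
    by (auto simp: root_gens_def)
  then show ?case
  proof cases
    case 1
    have "wval p (m + Poly_Mapping.single 0 1) = of_nat p * (wval p m :: 'r)"
      by (rule wval_Suc[OF single]) (simp add: wt_add wt_single[of p 0 1, simplified])
    then show ?thesis
      unfolding 1 right_diff_distrib root_fun_minus poly_var_def of_nat_poly mult_single root_fun_single
      by (simp only: mult_1_right add_0_right mult.assoc) simp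
  next
    case 2
    have "wt p (m + Poly_Mapping.single (Suc n) (int p)) = wt p (m + Poly_Mapping.single n 1)"
      using p0 by (simp add: wt_add wt_single)
    then have "wval p (m + Poly_Mapping.single (Suc n) (int p)) = (wval p (m + Poly_Mapping.single n 1) :: 'r)"
      by (simp add: wval_def)
    then show ?thesis
      unfolding 2 right_diff_distrib root_fun_minus poly_var_pow unfolding poly_var_def mult_single root_fun_single
      by (simp only: diff_self)
  qed
qed (simp_all add: distrib_right root_fun_add)

text \<open>The functional is not multiplicative, so its kernel is not known to be an ideal. As for
  tensor products, one passes to the largest ideal contained in the kernel.\<close>

lemma root_fun_ideal:
  fixes f :: "expo \<Rightarrow>\<^sub>0 'r::comm_ring_1"
  assumes p: "Factorial_Ring.prime p" and f: "f \<in> root_ideal p"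
  shows "root_fun p f = 0"
proof -
  let ?V = "poly_alg Ga_exps :: (expo \<Rightarrow>\<^sub>0 'r) ring"
  interpret V: cring ?V by (rule poly_alg_cring[OF exps_Ga])
  let ?J = "{f \<in> carrier ?V. \<forall>g\<in>carrier ?V. root_fun p (g * f) = 0}"
  have "ideal ?J ?V"
  proof (rule idealI[OF V.ring_axioms])
    show "subgroup ?J (add_monoid ?V)"
    proof (rule V.add.subgroupI)
      show "?J \<noteq> {}" by (auto intro!: exI[of _ 0])
      fix x assume x: "x \<in> ?J"
      have "\<ominus>\<^bsub>?V\<^esub> x \<oplus>\<^bsub>?V\<^esub> x = \<zero>\<^bsub>?V\<^esub>" using x by (intro V.l_neg) simp
      then have e: "\<ominus>\<^bsub>?V\<^esub> x = - x" by (simp add: eq_neg_iff_add_eq_0)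
      have "\<ominus>\<^bsub>?V\<^esub> x \<in> carrier ?V" using x by (intro V.a_inv_closed) simp
      moreover have "root_fun p (g * - x) = - root_fun p (g * x)" for g
        using root_fun_minus[of p 0 "g * x"] by simp
      ultimately show "\<ominus>\<^bsub>?V\<^esub> x \<in> ?J" using x unfolding e by simp
      fix y assume y: "y \<in> ?J"
      then have "x \<oplus>\<^bsub>?V\<^esub> y \<in> carrier ?V" using x by (intro V.a_closed) simp_all
      then show "x \<oplus>\<^bsub>?V\<^esub> y \<in> ?J" using x y by (simp add: distrib_left root_fun_add)
    qed auto
    fix a x assume a: "a \<in> ?J" and x: "x \<in> carrier ?V"
    have c: "g * x \<in> carrier ?V" if "g \<in> carrier ?V" for g using V.m_closed[OF that x] by simp
    have ax: "a * x \<in> carrier ?V" using V.m_closed[of a x] a x by simp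
    have "root_fun p (g * (a * x)) = 0" if "g \<in> carrier ?V" for g
    proof -
      have "root_fun p ((g * x) * a) = 0" using a c[OF that] by blast
      then show ?thesis by (simp only: mult_ac)
    qed
    with ax show "a \<otimes>\<^bsub>?V\<^esub> x \<in> ?J" "x \<otimes>\<^bsub>?V\<^esub> a \<in> ?J" by (simp_all add: mult.commute)
  qed
  moreover have "root_gens p \<subseteq> ?J" using root_gens_closed root_fun_gens[OF p] by auto
  ultimately have "root_ideal p \<subseteq> ?J"
    unfolding root_ideal_def root_gens_def[symmetric] by (rule V.genideal_minimal)
  then have "f \<in> ?J" using f by blast
  then have "root_fun p (\<one>\<^bsub>?V\<^esub> * f) = 0" using V.one_closed by blast
  then show ?thesis by simp
qed

section \<open>Functionals on the perfectoid base and on P\<close>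

context frob_base begin

lemma phi_of_nat: "\<phi> (of_nat n) = of_nat n"
proof -
  interpret R: cring "ring_of_type_algebra :: 'r ring" by (rule cring_from_type_algebra)
  show ?thesis
    using add_hom_smult[OF R.abelian_group_axioms R.abelian_group_axioms ring_hom_add_hom[OF \<phi>(1)], of 1 n]
      ring_hom_one[OF \<phi>(1)] by simp
qed

lemma phi_simps: "\<phi> (x * y) = \<phi> x * \<phi> y" "\<phi> (x + y) = \<phi> x + \<phi> y" "\<phi> 0 = 0" "\<phi> 1 = 1"
    "\<phi> (of_nat p ^ k) = of_nat p ^ k" "\<phi> (x - y) = \<phi> x - \<phi> y"
proof -
  show *: "\<phi> (x + y) = \<phi> x + \<phi> y" for x y using ring_hom_add[OF \<phi>(1), of x y] by simp
  show "\<phi> (x * y) = \<phi> x * \<phi> y" using ring_hom_mult[OF \<phi>(1), of x y] by simp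
  show "\<phi> 0 = 0" "\<phi> 1 = 1" using phi_of_nat[of 0] phi_of_nat[of 1] by simp_all
  show "\<phi> (of_nat p ^ k) = of_nat p ^ k" using phi_of_nat[of "p ^ k"] by simp
  show "\<phi> (x - y) = \<phi> x - \<phi> y" using *[of "x - y" y] by (simp add: algebra_simps)
qed

lemma phi_root_fun: "\<phi> (wval p m) = wval p m"
  by (simp add: wval_def phi_simps)

abbreviation (input) "Rb \<equiv> base_alg \<phi>"

text \<open>R-linearity and compatibility with the Frobenius are what \<open>PC_hom_exists\<close>
  requires for the second factor. The latter holds because \<open>K_frob\<close> fixes all roots of
  p and acts on coefficients only, and because the values \<open>wval\<close> are powers of p or 0,
  hence fixed by \<phi>.\<close>

lemma K_functional:
  obtains E where "E \<in> add_hom Kr Rb" "E \<one>\<^bsub>Kr\<^esub> = 1" "\<And>r l. l \<in> carrier Kr \<Longrightarrow> E (K_const p r \<otimes>\<^bsub>Kr\<^esub> l) = r * E l"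
    "\<And>l. l \<in> carrier Kr \<Longrightarrow> E (K_frob p \<phi> l) = \<phi> (E l)"
proof -
  let ?V = "poly_alg Ga_exps :: (expo \<Rightarrow>\<^sub>0 'r) ring" and ?Q = "root_ring p :: (expo \<Rightarrow>\<^sub>0 'r) set ring"
  let ?in = "\<lambda>f. pcompl_inj p ?Q (root_class p f)"
  interpret V: cring ?V by (rule poly_alg_cring[OF exps_Ga])
  interpret Q: cring ?Q by (rule root_ring_cring)
  interpret Kr: cring Kr by (rule Q.pcompl_cring)
  interpret Rb: cring Rb by simp
  interpret I: ideal "root_ideal p :: (expo \<Rightarrow>\<^sub>0 'r) set" ?V by (rule root_ideal_ideal)
  note Rc = Rb.is_cring
  have Rcomp: "p_complete p Rb" using base_dalg by (simp add: dalg_def)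
  \<comment> \<open>Any representative may be chosen, since \<open>root_fun\<close> vanishes on
    \<open>root_ideal\<close>.\<close>
  define E0 :: "(expo \<Rightarrow>\<^sub>0 'r) set \<Rightarrow> 'r" where "E0 u = root_fun p (SOME f. f \<in> carrier ?V \<and> u = root_class p f)" for u
  have E0: "E0 (root_class p f) = root_fun p f" if f: "f \<in> carrier ?V" for f
  proof -
    let ?g = "SOME g. g \<in> carrier ?V \<and> root_class p f = root_class p g"
    have g: "?g \<in> carrier ?V \<and> root_class p f = root_class p ?g" by (rule someI[of _ f]) (use f in simp)
    then have "f \<ominus>\<^bsub>?V\<^esub> ?g \<in> root_ideal p"
      using V.quotient_eq_iff_same_a_r_cos[OF I.ideal_axioms f, of ?g] by (simp add: root_class_def)
    then have 0: "root_fun p (f \<ominus>\<^bsub>?V\<^esub> ?g) = 0" by (rule root_fun_ideal[OF p])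
    have gc: "?g \<in> carrier ?V" using g by (rule conjunct1)
    have "f = ?g \<oplus>\<^bsub>?V\<^esub> (f \<ominus>\<^bsub>?V\<^esub> ?g)"
      using V.minus_eq_iff[OF f gc V.minus_closed[OF f gc]] by (rule iffD1) (rule refl)
    then have "root_fun p f = root_fun p (?g \<oplus>\<^bsub>?V\<^esub> (f \<ominus>\<^bsub>?V\<^esub> ?g))" by (rule arg_cong)
    also have "\<dots> = root_fun p ?g" unfolding poly_alg_simps(5) root_fun_add 0 by simp
    finally show ?thesis unfolding E0_def by (rule sym)
  qed
  have Q_cases: "\<exists>f\<in>carrier ?V. u = root_class p f" if "u \<in> carrier ?Q" for u
    using that by (auto simp: root_ring_def FactRing_def A_RCOSETS_def' root_class_def)
  note rc = root_class_hom[of p]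
  have E0h: "E0 \<in> add_hom ?Q Rb"
  proof (rule add_homI)
    fix u v assume "u \<in> carrier ?Q" "v \<in> carrier ?Q"
    then obtain f g where fg: "f \<in> carrier ?V" "u = root_class p f" "g \<in> carrier ?V" "v = root_class p g"
      using Q_cases by metis
    have "u \<oplus>\<^bsub>?Q\<^esub> v = root_class p (f \<oplus>\<^bsub>?V\<^esub> g)" using ring_hom_add[OF rc fg(1,3)] fg by simp
    then show "E0 (u \<oplus>\<^bsub>?Q\<^esub> v) = E0 u \<oplus>\<^bsub>Rb\<^esub> E0 v"
      using E0[OF V.a_closed[OF fg(1,3)]] E0[OF fg(1)] E0[OF fg(3)] fg(2,4) by (simp add: root_fun_add)
  qed simp
  define E where "E = pext p Rb E0"
  have Eh: "E \<in> add_hom Kr Rb" unfolding E_def by (rule pext_add_hom[OF Q.is_cring Rc Rcomp E0h])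
  have Ein: "E (?in f) = root_fun p f" if f: "f \<in> carrier ?V" for f
    unfolding E_def using pext_inj[OF Q.is_cring Rc Rcomp E0h ring_hom_closed[OF rc f]] E0[OF f] by simp
  have inh: "?in \<in> ring_hom ?V Kr"
    using ring_hom_trans[OF rc Q.pcompl_inj_hom[of p]] by (simp add: comp_def)
  \<comment> \<open>Two additive maps on the completed root ring agree if they agree on single
    terms; both properties of \<open>E\<close> are checked in this way.\<close>
  have fin: "x \<in> carrier Kr \<Longrightarrow> G x = H x" if G: "G \<in> add_hom Kr Rb" and H: "H \<in> add_hom Kr Rb"
    and eq: "\<And>m r. m \<in> Ga_exps \<Longrightarrow> G (?in (Poly_Mapping.single m r)) = H (?in (Poly_Mapping.single m r))" for G H x
  proof (rule p_complete_hom_unique[OF Q.is_cring Rc Rcomp G H])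
    fix u assume "u \<in> carrier ?Q"
    then obtain f where f: "f \<in> carrier ?V" "u = root_class p f" using Q_cases by blast
    have G': "(\<lambda>f. G (?in f)) \<in> add_hom ?V Rb" "(\<lambda>f. H (?in f)) \<in> add_hom ?V Rb"
      using add_hom_comp[OF ring_hom_add_hom[OF inh] G] add_hom_comp[OF ring_hom_add_hom[OF inh] H] .
    have kf: "Poly_Mapping.keys f \<subseteq> Ga_exps" using f(1) by simp
    have "Poly_Mapping.keys f \<subseteq> Ga_exps \<and> G (?in f) = H (?in f)" using kf
    proof (induction f rule: poly_induct)
      case zero
      show ?case using add_hom_zero[OF V.abelian_group_axioms Rb.abelian_group_axioms G'(1)]
        add_hom_zero[OF V.abelian_group_axioms Rb.abelian_group_axioms G'(2)] by simp
    next
      case (add f g)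
      then show ?case using add_hom_add[OF G'(1), of f g] add_hom_add[OF G'(2), of f g] poly_keys_add[of f Ga_exps g] by simp
    qed (use eq in auto)
    then show "G (pcompl_inj p ?Q u) = H (pcompl_inj p ?Q u)" using f by simp
  qed
  have Kc: "K_const p r = ?in (poly_const r)" for r by (simp add: K_const_def)
  have sc: "Poly_Mapping.single m r \<in> carrier ?V" if "m \<in> Ga_exps" for m r using that by simp
  have cc: "poly_const r \<in> carrier ?V" for r
    using ring_hom_closed[OF poly_const_hom[OF exps_Ga], of r] by simp
  show ?thesis
  proof
    show "E \<in> add_hom Kr Rb" by (rule Eh)
    have "E (?in \<one>\<^bsub>?V\<^esub>) = root_fun p \<one>\<^bsub>?V\<^esub>" by (rule Ein) (rule V.one_closed)
    moreover have "root_fun p (1 :: expo \<Rightarrow>\<^sub>0 'r) = 1"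
      using root_fun_single[of p 0 "1::'r"] by (simp add: wval_def wt_def)
    ultimately show "E \<one>\<^bsub>Kr\<^esub> = 1" using ring_hom_one[OF inh] by simp
  next
    fix r l assume l: "l \<in> carrier Kr"
    show "E (K_const p r \<otimes>\<^bsub>Kr\<^esub> l) = r * E l"
    proof (rule fin[OF _ _ _ l])
      show "(\<lambda>l. E (K_const p r \<otimes>\<^bsub>Kr\<^esub> l)) \<in> add_hom Kr Rb"
        by (rule add_homI) (simp_all add: Kr.r_distr K_const_closed add_hom_add[OF Eh])
      show "(\<lambda>l. r * E l) \<in> add_hom Kr Rb"
        by (rule add_homI) (simp_all add: add_hom_add[OF Eh] distrib_left)
      fix m s assume m: "m \<in> Ga_exps"
      have "K_const p r \<otimes>\<^bsub>Kr\<^esub> ?in (Poly_Mapping.single m s) = ?in (poly_const r * Poly_Mapping.single m s)"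
        unfolding Kc using ring_hom_mult[OF inh cc sc[OF m]] by simp
      moreover have "poly_const r * Poly_Mapping.single m s \<in> carrier ?V"
        using V.m_closed[OF cc sc[OF m]] by simp
      ultimately show "E (K_const p r \<otimes>\<^bsub>Kr\<^esub> ?in (Poly_Mapping.single m s)) = r * E (?in (Poly_Mapping.single m s))"
        using Ein sc[OF m] by (simp add: root_fun_const_mult)
    qed
  next
    fix l assume l: "l \<in> carrier Kr"
    note Kf = K_frob(1)
    show "E (K_frob p \<phi> l) = \<phi> (E l)"
    proof (rule fin[OF _ _ _ l])
      show "(\<lambda>l. E (K_frob p \<phi> l)) \<in> add_hom Kr Rb" by (rule add_hom_comp[OF ring_hom_add_hom[OF Kf] Eh])
      show "(\<lambda>l. \<phi> (E l)) \<in> add_hom Kr Rb"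
        by (rule add_homI) (simp_all add: add_hom_add[OF Eh] phi_simps)
      fix m s assume m: "m \<in> Ga_exps"
      have fh: "(\<lambda>f. K_frob p \<phi> (?in f)) \<in> ring_hom ?V Kr"
        using ring_hom_trans[OF inh Kf] by (simp add: comp_def)
      have var: "K_frob p \<phi> (?in (poly_var i)) = ?in (poly_var i)" for i
        using K_frob(3)[of i] by (simp add: K_root_def)
      \<comment> \<open>Two homomorphisms that agree on the variables agree on each monomial with
        coefficient 1, by \<open>mon_eq\<close>.\<close>
      have 1: "K_frob p \<phi> (?in (Poly_Mapping.single m 1)) = ?in (Poly_Mapping.single m 1)"
        using Kr.mon_eq(1)[OF exps_Ga fh m] Kr.mon_eq(1)[OF exps_Ga inh m] by (simp add: var)
      have pm: "Poly_Mapping.single m t = poly_const t \<otimes>\<^bsub>?V\<^esub> Poly_Mapping.single m 1" for t :: 'r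
        by (simp add: poly_const_def mult_single)
      have e: "?in (Poly_Mapping.single m t) = K_const p t \<otimes>\<^bsub>Kr\<^esub> ?in (Poly_Mapping.single m 1)" for t :: 'r
        unfolding Kc using arg_cong[OF pm[of t], of ?in] ring_hom_mult[OF inh cc sc[OF m, of 1], of t] by (rule trans)
      have "K_frob p \<phi> (?in (Poly_Mapping.single m s)) = ?in (Poly_Mapping.single m (\<phi> s))"
        unfolding e[of s] e[of "\<phi> s"] ring_hom_mult[OF Kf K_const_closed ring_hom_closed[OF inh sc[OF m, of 1]], of s]
          K_frob(2) 1 ..
      then show "E (K_frob p \<phi> (?in (Poly_Mapping.single m s))) = \<phi> (E (?in (Poly_Mapping.single m s)))"
        using Ein sc[OF m] by (simp add: root_fun_single phi_simps phi_root_fun)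
    qed
  qed
qed

text \<open>The functional sends the image of a \<otimes> l to e(a) E(l). Evaluated at l = 1 it
  recovers \<open>e\<close>, so values of \<open>e\<close> can be read off from elements of
  \<open>PC A\<close>.\<close>

lemma PC_functional:
  fixes A :: "('r, 'a) frob_alg"
  assumes A: "falg \<phi> A" and e: "e \<in> falg_hom A Rb"
  obtains G where "G \<in> add_hom (P.PC A) Rb" "\<And>c. c \<in> carrier A \<Longrightarrow> G (P.gen A c \<one>\<^bsub>Kr\<^esub>) = e c"
proof -
  obtain E where E: "E \<in> add_hom Kr Rb" "E \<one>\<^bsub>Kr\<^esub> = 1" "\<And>r l. l \<in> carrier Kr \<Longrightarrow> E (K_const p r \<otimes>\<^bsub>Kr\<^esub> l) = r * E l"
    "\<And>l. l \<in> carrier Kr \<Longrightarrow> E (K_frob p \<phi> l) = \<phi> (E l)" using K_functional by blast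
  interpret A: cring A using falgD(1)[OF A] .
  interpret Kr: cring Kr by (rule cring.pcompl_cring[OF root_ring_cring])
  have Kops: "monoid.mult (K_circ p \<phi>) = monoid.mult Kr" "ring.add (K_circ p \<phi>) = ring.add Kr" by (simp_all add: K_circ_def)
  have R: "cring Rb" "p_complete p Rb" "frob Rb \<in> ring_hom Rb Rb"
    using base_dalg falgD by (auto simp: dalg_def simp del: base_alg_simps)
  note er = falg_homD(1)[OF e] and ea = falg_homD(2)[OF e]
  obtain G where "G \<in> add_hom (P.PC A) Rb" "\<And>a l. a \<in> carrier A \<Longrightarrow> l \<in> carrier (K_circ p \<phi>) \<Longrightarrow> G (P.gen A a l) = e a * E l"
  proof (rule P.PC_hom_exists[OF A R base_perfect, where \<beta> = "\<lambda>a l. e a * E l"])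
    fix r a l assume "a \<in> carrier A" "l \<in> carrier (K_circ p \<phi>)"
    then show "e (emb A r \<otimes>\<^bsub>A\<^esub> a) * E l = e a * E (emb (K_circ p \<phi>) r \<otimes>\<^bsub>K_circ p \<phi>\<^esub> l)"
      using ring_hom_mult[OF er falgD(5)[OF A]] falg_homD(3)[OF e] by (simp add: E(3) Kops)
  next
    fix a l assume al: "a \<in> carrier A" "l \<in> carrier (K_circ p \<phi>)"
    then show "e (frob A a) * E (frob (K_circ p \<phi>) l) = frob Rb (e a * E l)"
      using falg_homD(4)[OF e] by (simp add: E(4) phi_simps)
  qed (use add_hom_add[OF ea] add_hom_add[OF E(1)] in \<open>auto simp: Kops algebra_simps\<close>)
  then show ?thesis using that E(2) Kr.one_closed by simp
qed

end

section \<open>The coefficients of a right inverse\<close>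

lemma base_alg_finsum: "finite F \<Longrightarrow> finsum (base_alg \<phi>) f F = sum f F"
proof (induction F rule: finite_induct)
  case empty
  interpret B: cring "base_alg \<phi>" by simp
  show ?case by (simp only: B.finsum_empty sum.empty base_alg_simps)
next
  case (insert x F)
  interpret B: cring "base_alg \<phi>" by simp
  show ?case using insert B.finsum_insert[of F x f] by simp
qed

context frob_base begin

lemma emb_nat_mult:
  assumes "falg \<phi> T"
  shows "emb T (of_nat m * r) = [m] \<cdot>\<^bsub>T\<^esub> emb T r"
proof -
  interpret T: cring T using falgD(1)[OF assms] .
  interpret R: cring "ring_of_type_algebra :: 'r ring" by (rule cring_from_type_algebra)
  show ?thesis
    using add_hom_smult[OF R.abelian_group_axioms T.abelian_group_axioms ring_hom_add_hom[OF falgD(2)[OF assms]], of r m] by simp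
qed

lemma emb_zero: "falg \<phi> T \<Longrightarrow> emb T 0 = \<zero>\<^bsub>T\<^esub>"
proof -
  assume T: "falg \<phi> T"
  interpret T: cring T using falgD(1)[OF T] .
  show "emb T 0 = \<zero>\<^bsub>T\<^esub>" using emb_nat_mult[OF T, of 0 0] by simp
qed

text \<open>Evaluation at z = \<phi>^N(s) sends \<phi>^(-n)(z) to \<phi>^(N-n)(s). For n at most N
  only nonnegative iterates of \<phi> appear, and these are polynomials in s modulo p.\<close>

lemma eval_exists:
  obtains e where "e \<in> falg_hom Ch Rb" "\<And>j. e (C_shift p \<phi> (int N - int j)) = (\<phi> ^^ j) s"
proof -
  obtain f where f: "f \<in> falg_hom (jet_alg p \<phi> Ga_exps) Rb" "f (jet_var p Ga_exps 0) = (\<phi> ^^ N) s"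
    by (rule jet_falg_hom_exists[OF exps_Ga base_dalg evaluable_Ga[OF base_dalg]]) auto
  have R: "falg \<phi> Rb" "p_complete p Rb" using base_dalg by (auto simp: dalg_def simp del: base_alg_simps)
  obtain e where e: "e \<in> falg_hom Ch Rb" "\<And>a. a \<in> carrier (jet_alg p \<phi> Ga_exps) \<Longrightarrow> e (C_can p \<phi> a) = f a"
    using P.CH_hom_exists[OF jet_falg_Ga R base_perfect f(1)] unfolding C_hat_eq[symmetric] C_can_eq[symmetric] by blast
  have step: "\<phi> (e (C_shift p \<phi> n)) = e (C_shift p \<phi> (n - 1))" for n
    using falg_homD(4)[OF e(1) C_shift_closed, of n] by (simp add: frob_C_shift)
  have "(\<phi> ^^ n) (e (C_shift p \<phi> (int n))) = (\<phi> ^^ N) s" for n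
  proof (induction n)
    case 0
    then show ?case using e(2)[OF z_closed] f(2) by (simp add: C_shift_0)
  next
    case (Suc n)
    then show ?case using step[of "int (Suc n)"] by (simp add: funpow_swap1)
  qed
  \<comment> \<open>The Frobenius iterates of the value are known; injectivity of \<phi> gives the
    value itself.\<close>
  from this[of N] have "e (C_shift p \<phi> (int N)) = s"
    using \<phi>(2) by (meson bij_is_inj inj_eq inj_fn)
  then have "e (C_shift p \<phi> (int N - int j)) = (\<phi> ^^ j) s" for j
  proof (induction j)
    case (Suc j)
    have eq: "int N - int (Suc j) = int N - int j - 1" by simp
    show ?case using step[of "int N - int j"] Suc unfolding eq by simp
  qed simp
  then show ?thesis using that e(1) by blast
qed

lemma eval_ser:
  assumes e: "e \<in> falg_hom Ch Rb" and c: "nullseq p c" and F: "finite F" "{n. \<not> of_nat p ^ k dvd c n} \<subseteq> F"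
  shows "of_nat p ^ k dvd e (ser c) - (\<Sum>n\<in>F. c n * e (C_shift p \<phi> n))"
proof -
  interpret C: cring Ch using falgD(1)[OF Ch(1)] .
  interpret B: cring Rb by simp
  note er = falg_homD(1)[OF e] and ea = falg_homD(2)[OF e]
  have "pcong p Ch k (ser c) (\<Oplus>\<^bsub>Ch\<^esub>n\<in>F. ser_term c n)"
  proof (rule C.has_psum_approx[OF _ ser_has_psum[OF c] F(1)])
    fix n assume "n \<in> UNIV - F"
    then have "of_nat p ^ k dvd c n" using F(2) by blast
    then show "pcong p Ch k (ser_term c n) \<zero>\<^bsub>Ch\<^esub>" by (rule ser_term_dvd)
  qed (use ser_term_closed in auto)
  then have "pcong p Rb k (e (ser c)) (e (\<Oplus>\<^bsub>Ch\<^esub>n\<in>F. ser_term c n))"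
    by (rule add_hom_pcong[OF C.ring_axioms B.ring_axioms ea]) (use ser_term_closed in \<open>auto intro!: C.finsum_closed\<close>)
  moreover have "e (\<Oplus>\<^bsub>Ch\<^esub>n\<in>F. ser_term c n) = (\<Sum>n\<in>F. c n * e (C_shift p \<phi> n))"
    using add_hom_finsum[OF C.abelian_group_axioms B.abelian_group_axioms ea, of "ser_term c" F] ser_term_closed
      ring_hom_mult[OF er falgD(5)[OF Ch(1)] C_shift_closed] falg_homD(3)[OF e]
    by (simp add: base_alg_finsum[OF F(1)] ser_term_def)
  ultimately show ?thesis by simp
qed

lemma R_separated: "(\<And>k. of_nat p ^ k dvd (x::'r)) \<Longrightarrow> x = 0"
proof -
  assume d: "\<And>k. of_nat p ^ k dvd (x::'r)"
  interpret R: cring "ring_of_type_algebra :: 'r ring" by (rule cring_from_type_algebra)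
  show ?thesis using R.p_complete_sep[OF R_complete, of x 0] d by simp
qed

lemma phi_pow_cong: "of_nat p dvd (\<phi> ^^ j) s - s ^ (p ^ j)"
proof -
  interpret R: cring "ring_of_type_algebra :: 'r ring" by (rule cring_from_type_algebra)
  have "pcong p ring_of_type_algebra 1 ((\<phi> ^^ j) s) (s ^ (p ^ j))"
  proof (induction j)
    case (Suc j)
    have 1: "pcong p ring_of_type_algebra 1 (\<phi> ((\<phi> ^^ j) s)) ((\<phi> ^^ j) s [^]\<^bsub>ring_of_type_algebra\<^esub> p)"
      using \<phi>_lift unfolding frob_lift_def by (rule bspec) simp
    have 2: "pcong p ring_of_type_algebra 1 ((\<phi> ^^ j) s [^]\<^bsub>ring_of_type_algebra\<^esub> p) (s ^ (p ^ j) [^]\<^bsub>ring_of_type_algebra\<^esub> p)"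
      by (rule R.pcong_pow[OF Suc]) simp
    from R.pcong_trans[OF 1 2] show ?case by (simp add: power_mult[symmetric] mult.commute del: type_algebra_pcong)
  qed simp
  then show ?thesis by simp
qed

end

section \<open>The sequence p^n and the corresponding cocharacter\<close>

definition cochar_seq :: "nat \<Rightarrow> int \<Rightarrow> 'r::comm_ring_1" where
  "cochar_seq p = (\<lambda>n. if 1 \<le> n then of_nat p ^ nat n else 0)"

lemma cochar_seq_admissible: "admissible p (cochar_seq p :: int \<Rightarrow> 'r::comm_ring_1)"
proof -
  have "of_nat p dvd (of_nat p :: 'r) ^ nat n" if "1 \<le> n" for n
    using that by (intro dvd_power) auto
  moreover have "\<exists>N. \<forall>n. N \<le> \<bar>n\<bar> \<longrightarrow> of_nat p ^ k dvd (cochar_seq p n :: 'r)" for k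
    by (rule exI[of _ "int k"]) (auto simp: cochar_seq_def intro!: le_imp_power_dvd)
  ultimately show ?thesis by (auto simp: admissible_def cochar_seq_def)
qed

context delta_base begin

lemma cochar_seq_Psi: "cochar_delta_hom p \<phi> (cochar_seq p) (Psi p \<phi>) = C_shift p \<phi> 0"
proof -
  let ?a = "cochar_seq p :: int \<Rightarrow> 'r" and ?g = "cochar_delta_hom p \<phi> (cochar_seq p)"
  let ?b = "\<lambda>n. \<phi> (?a (n + 1))" and ?z = "C_shift p \<phi> 0"
  note ad = cochar_seq_admissible and nl = nullseq_admissible[OF cochar_seq_admissible]
  interpret C: pring Ch p by (rule pring_dalg[OF C_hat_dalg])
  \<comment> \<open>The element p z as a series supported at n = 0, so that both sides can be
    compared term by term.\<close>
  let ?t = "\<lambda>n::int. if n = 0 then [p] \<cdot>\<^bsub>Ch\<^esub> ?z else \<zero>\<^bsub>Ch\<^esub>"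
  have zc: "?z \<in> carrier Ch" by (rule C_shift_closed)
  have tc: "?t \<in> UNIV \<rightarrow> carrier Ch" using zc by auto
  have "(\<lambda>x. [p] \<cdot>\<^bsub>Ch\<^esub> x) \<in> add_hom Ch Ch" by (rule add_homI) (simp_all add: C.smult_add)
  from has_psum_hom[OF C.is_cring C.is_cring this _ ser_has_psum[OF nl]]
  have 1: "has_psum p Ch (\<lambda>n. [p] \<cdot>\<^bsub>Ch\<^esub> ser_term ?a n) UNIV ([p] \<cdot>\<^bsub>Ch\<^esub> ser ?a)" using ser_term_closed by simp
  have "has_psum p Ch ?t UNIV (\<Oplus>\<^bsub>Ch\<^esub>n\<in>{0}. ?t n)"
    by (rule C.has_psum_finite[where f = ?t]) (use tc in auto)
  then have 2: "has_psum p Ch ?t UNIV ([p] \<cdot>\<^bsub>Ch\<^esub> ?z)" using zc by simp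
  have "has_psum p Ch (\<lambda>n. ?t n \<oplus>\<^bsub>Ch\<^esub> [p] \<cdot>\<^bsub>Ch\<^esub> ser_term ?a n) UNIV ([p] \<cdot>\<^bsub>Ch\<^esub> ?z \<oplus>\<^bsub>Ch\<^esub> [p] \<cdot>\<^bsub>Ch\<^esub> ser ?a)"
    by (rule C.has_psum_add[OF tc _ 2 1]) (use ser_term_closed in auto)
  \<comment> \<open>On coefficients this is \<phi>(a_(n+1)) = p a_n, with p added when n = 0. It
    holds because \<phi> fixes powers of p, and the correction at n = 0 is a_1 = p.\<close>
  moreover have "?t n \<oplus>\<^bsub>Ch\<^esub> [p] \<cdot>\<^bsub>Ch\<^esub> ser_term ?a n = ser_term ?b n" for n
  proof -
    have "[p] \<cdot>\<^bsub>Ch\<^esub> ser_term ?a n = emb Ch (of_nat p * ?a n) \<otimes>\<^bsub>Ch\<^esub> C_shift p \<phi> n"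
      unfolding ser_term_def emb_nat_mult[OF Ch(1)]
      by (rule C.smult_l[symmetric, OF falgD(5)[OF Ch(1)] C_shift_closed])
    moreover consider "n = 0" | "n > 0" | "n < 0" by linarith
    then have "?t n \<oplus>\<^bsub>Ch\<^esub> emb Ch (of_nat p * ?a n) \<otimes>\<^bsub>Ch\<^esub> C_shift p \<phi> n = ser_term ?b n"
    proof cases
      case 1
      have e1: "emb Ch (of_nat p) = [p] \<cdot>\<^bsub>Ch\<^esub> \<one>\<^bsub>Ch\<^esub>"
        using emb_nat_mult[OF Ch(1), of p 1] ring_hom_one[OF falgD(2)[OF Ch(1)]] by simp
      have "ser_term ?b n = emb Ch (of_nat p) \<otimes>\<^bsub>Ch\<^esub> ?z"
        using 1 by (simp add: ser_term_def cochar_seq_def phi_of_nat)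
      also have "\<dots> = [p] \<cdot>\<^bsub>Ch\<^esub> ?z" unfolding e1 using zc by (simp add: C.smult_l)
      finally show ?thesis using 1 zc by (simp add: cochar_seq_def emb_zero[OF Ch(1)])
    next
      case 2
      then have "?b n = of_nat p * ?a n" by (simp add: cochar_seq_def phi_simps nat_add_distrib phi_of_nat)
      then show ?thesis using 2 ser_term_closed[of "?b" n] by (simp add: ser_term_def)
    next
      case 3
      then show ?thesis using C_shift_closed by (simp add: ser_term_def cochar_seq_def phi_simps emb_zero[OF Ch(1)])
    qed
    ultimately show ?thesis by simp
  qed
  ultimately have "ser ?b = [p] \<cdot>\<^bsub>Ch\<^esub> ?z \<oplus>\<^bsub>Ch\<^esub> [p] \<cdot>\<^bsub>Ch\<^esub> ser ?a"
    using ser_eqI[OF nullseq_shift[OF nl]] by simp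
  with cochar_Psi[OF ad] have "[p] \<cdot>\<^bsub>Ch\<^esub> ?g (Psi p \<phi>) \<oplus>\<^bsub>Ch\<^esub> [p] \<cdot>\<^bsub>Ch\<^esub> ser ?a = [p] \<cdot>\<^bsub>Ch\<^esub> ?z \<oplus>\<^bsub>Ch\<^esub> [p] \<cdot>\<^bsub>Ch\<^esub> ser ?a"
    by (rule trans)
  moreover have gc: "?g (Psi p \<phi>) \<in> carrier Ch" by (rule falg_homD(5)[OF cochar_delta_hom(1)[OF ad] Psi_closed])
  ultimately have "[p] \<cdot>\<^bsub>Ch\<^esub> ?g (Psi p \<phi>) = [p] \<cdot>\<^bsub>Ch\<^esub> ?z"
    using zc ser_closed[OF nl] by (simp add: C.add.r_cancel)
  then show ?thesis using C.ptf_cancel[OF C.tf gc zc, of 1] by simp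
qed

text \<open>Homomorphisms that commute with the Frobenius and start from the jet algebra of the
  additive group are determined by the image of z, and both sides send z to its canonical
  image.\<close>

lemma cochar_seq_psi:
  assumes y: "y \<in> carrier (jet_alg p \<phi> Ga_exps)"
  shows "cochar_delta_hom p \<phi> (cochar_seq p) (psi_hom p \<phi> y) = C_can p \<phi> y"
proof (rule jet_falg_hom_unique[OF exps_Ga C_hat_dalg _ C_can_hom,
    where f = "\<lambda>y. cochar_delta_hom p \<phi> (cochar_seq p) (psi_hom p \<phi> y)"])
  show "(\<lambda>y. cochar_delta_hom p \<phi> (cochar_seq p) (psi_hom p \<phi> y)) \<in> falg_hom (jet_alg p \<phi> Ga_exps) Ch"
    by (rule P.falg_hom_comp[OF psi_hom(1) cochar_delta_hom(1)[OF cochar_seq_admissible]])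
  show "cochar_delta_hom p \<phi> (cochar_seq p) (psi_hom p \<phi> (jet_var p Ga_exps 0)) = C_can p \<phi> (jet_var p Ga_exps 0)"
    unfolding psi_hom(2) cochar_seq_Psi C_shift_0 ..
qed (use y in simp)

section \<open>The induced homomorphisms between the rings P_circ\<close>

lemma P_circ_eq: "P_circ p \<phi> A = P.PC A"
  by (simp add: P_circ_def K_ext_def)

lemma P_circ_map_eq: "P_circ_map p \<phi> B f = P.Pmap B f"
  by (simp add: P_circ_map_def P.Pmap_def K_ext_def fun_eq_iff)

abbreviation (input) "PGa \<equiv> P_circ p \<phi> (jet_alg p \<phi> Ga_exps)"
abbreviation (input) "PGm \<equiv> P_circ p \<phi> (jet_alg p \<phi> Gm_exps)"
abbreviation (input) "Pcan \<equiv> P_circ_map p \<phi> Ch (C_can p \<phi>)"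
abbreviation (input) "Ppsi \<equiv> P_circ_map p \<phi> (jet_alg p \<phi> Gm_exps) (psi_hom p \<phi>)"

lemma PGa_cring: "cring PGa" and PGm_cring: "cring PGm"
  unfolding P_circ_eq
  by (rule falgD(1)[OF P.PC_falg[OF jet_falg_Ga]], rule falgD(1)[OF P.PC_falg[OF jet_falg_Gm]])

lemma Pcan_bij: "bij_betw Pcan (carrier PGa) (carrier (P_circ p \<phi> Ch))"
  unfolding P_circ_eq P_circ_map_eq C_can_eq C_hat_eq by (rule P.PC_can_bij[OF jet_falg_Ga])

lemma Pcan_hom: "Pcan \<in> ring_hom PGa (P_circ p \<phi> Ch)"
  unfolding P_circ_eq P_circ_map_eq by (rule falg_homD(1)[OF P.Pmap_hom(1)[OF jet_falg_Ga Ch(1) C_can_hom]])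

lemma Ppsi_hom: "Ppsi \<in> ring_hom PGa PGm"
  unfolding P_circ_eq P_circ_map_eq by (rule falg_homD(1)[OF P.Pmap_hom(1)[OF jet_falg_Ga jet_falg_Gm psi_hom(1)]])

lemma cochar_P_circ_hom:
  assumes a: "admissible p a"
  shows "cochar_P_circ p \<phi> a \<in> ring_hom PGm PGa"
proof -
  have "P_circ_map p \<phi> Ch (cochar_delta_hom p \<phi> a) \<in> ring_hom PGm (P_circ p \<phi> Ch)"
    unfolding P_circ_eq P_circ_map_eq
    by (rule falg_homD(1)[OF P.Pmap_hom(1)[OF jet_falg_Gm Ch(1) cochar_delta_hom(1)[OF a]]])
  from ring_hom_trans[OF this inv_into_ring_hom[OF cring.axioms(1)[OF PGa_cring] Pcan_hom Pcan_bij]]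
  show ?thesis by (simp add: comp_def cochar_P_circ_def[abs_def])
qed

lemma cochar_P_circ_seq:
  assumes y: "y \<in> carrier PGa"
  shows "cochar_P_circ p \<phi> (cochar_seq p) (Ppsi y) = y"
proof -
  have y': "y \<in> carrier (P.PC (jet_alg p \<phi> Ga_exps))" using y unfolding P_circ_eq .
  have "P_circ_map p \<phi> Ch (cochar_delta_hom p \<phi> (cochar_seq p)) (Ppsi y) = Pcan y"
    unfolding P_circ_map_eq
    by (rule P.Pmap_comp[OF jet_falg_Ga jet_falg_Gm Ch(1) psi_hom(1) cochar_delta_hom(1)[OF cochar_seq_admissible]
        C_can_hom], rule cochar_seq_psi, assumption, rule y')
  then show ?thesis unfolding cochar_P_circ_def
    using inv_into_f_f[OF bij_betw_imp_inj_on[OF Pcan_bij] y] by simp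
qed

text \<open>The image of z in \<open>PGa\<close>, at which the identity of a right inverse will be
  tested.\<close>

definition ztil :: "('r, 'r jet) Pcirc" where
  "ztil = P.gen (jet_alg p \<phi> Ga_exps) (jet_var p Ga_exps 0) \<one>\<^bsub>Kr\<^esub>"

lemma K_one: "\<one>\<^bsub>Kr\<^esub> \<in> carrier (K_circ p \<phi>)"
  using cring.cring_simprules(6)[OF cring.pcompl_cring[OF root_ring_cring]] by simp

lemma ztil_closed: "ztil \<in> carrier PGa"
  unfolding ztil_def P_circ_eq by (rule P.gen_closed[OF jet_falg_Ga z_closed K_one])

text \<open>The factor p^k is what equality of fractions in P provides. It is not cancelled in
  P_circ but in R, after an additive functional extending \<open>e\<close> has been applied.\<close>

lemma cochar_P_circ_ztil:
  assumes a: "admissible p a" and eq: "[(p ^ k)] \<cdot>\<^bsub>PGa\<^esub> cochar_P_circ p \<phi> a (Ppsi ztil) = [(p ^ k)] \<cdot>\<^bsub>PGa\<^esub> ztil"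
    and e: "e \<in> falg_hom Ch Rb"
  shows "e (cochar_delta_hom p \<phi> a (Psi p \<phi>)) = e (C_shift p \<phi> 0)"
proof -
  let ?g = "cochar_delta_hom p \<phi> a" and ?PC = "P_circ p \<phi> Ch"
  let ?G = "P_circ_map p \<phi> Ch ?g"
  note g = cochar_delta_hom(1)[OF a]
  interpret PGa: cring PGa by (rule PGa_cring)
  interpret PC: cring ?PC unfolding P_circ_eq by (rule falgD(1)[OF P.PC_falg[OF Ch(1)]])
  interpret B: cring Rb by simp
  have gc: "?g (Psi p \<phi>) \<in> carrier Ch" by (rule falg_homD(5)[OF g Psi_closed])
  have Gh: "?G \<in> ring_hom PGm ?PC" unfolding P_circ_eq P_circ_map_eq
    by (rule falg_homD(1)[OF P.Pmap_hom(1)[OF jet_falg_Gm Ch(1) g]])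
  have pc: "Ppsi ztil \<in> carrier PGm" by (rule ring_hom_closed[OF Ppsi_hom ztil_closed])
  have sc: "cochar_P_circ p \<phi> a (Ppsi ztil) \<in> carrier PGa" by (rule ring_hom_closed[OF cochar_P_circ_hom[OF a] pc])
  have "?G (Ppsi ztil) = P.gen Ch (?g (Psi p \<phi>)) \<one>\<^bsub>Kr\<^esub>"
    unfolding P_circ_map_eq ztil_def
    unfolding P.Pmap_hom(2)[OF jet_falg_Ga jet_falg_Gm psi_hom(1) z_closed K_one] psi_hom(2)
    by (rule P.Pmap_hom(2)[OF jet_falg_Gm Ch(1) g Psi_closed K_one])
  moreover have "Pcan ztil = P.gen Ch (C_shift p \<phi> 0) \<one>\<^bsub>Kr\<^esub>"
    unfolding P_circ_map_eq ztil_def C_shift_0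
    by (rule P.Pmap_hom(2)[OF jet_falg_Ga Ch(1) C_can_hom z_closed K_one])
  moreover have "Pcan (cochar_P_circ p \<phi> a (Ppsi ztil)) = ?G (Ppsi ztil)"
    unfolding cochar_P_circ_def
    by (rule bij_betw_inv_into_right[OF Pcan_bij ring_hom_closed[OF Gh pc]])
  moreover have "[(p ^ k)] \<cdot>\<^bsub>?PC\<^esub> Pcan (cochar_P_circ p \<phi> a (Ppsi ztil)) = [(p ^ k)] \<cdot>\<^bsub>?PC\<^esub> Pcan ztil"
    using arg_cong[OF eq, of Pcan]
    unfolding add_hom_smult[OF PGa.abelian_group_axioms PC.abelian_group_axioms ring_hom_add_hom[OF Pcan_hom] sc]
      add_hom_smult[OF PGa.abelian_group_axioms PC.abelian_group_axioms ring_hom_add_hom[OF Pcan_hom] ztil_closed] .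
  ultimately have eq2: "[(p ^ k)] \<cdot>\<^bsub>?PC\<^esub> P.gen Ch (?g (Psi p \<phi>)) \<one>\<^bsub>Kr\<^esub> = [(p ^ k)] \<cdot>\<^bsub>?PC\<^esub> P.gen Ch (C_shift p \<phi> 0) \<one>\<^bsub>Kr\<^esub>"
    by metis
  obtain G where G: "G \<in> add_hom (P.PC Ch) Rb" "\<And>c. c \<in> carrier Ch \<Longrightarrow> G (P.gen Ch c \<one>\<^bsub>Kr\<^esub>) = e c"
    using PC_functional[OF Ch(1) e] by blast
  note G' = G(1)[folded P_circ_eq]
  have gn: "P.gen Ch c \<one>\<^bsub>Kr\<^esub> \<in> carrier ?PC" if "c \<in> carrier Ch" for c
    unfolding P_circ_eq by (rule P.gen_closed[OF Ch(1) that K_one])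
  have "G ([(p ^ k)] \<cdot>\<^bsub>?PC\<^esub> P.gen Ch c \<one>\<^bsub>Kr\<^esub>) = of_nat (p ^ k) * e c" if c: "c \<in> carrier Ch" for c
    using add_hom_smult[OF PC.abelian_group_axioms B.abelian_group_axioms G' gn[OF c], of "p ^ k"] G(2)[OF c]
    unfolding base_alg_simps by simp
  from this[OF gc] this[OF C_shift_closed[of 0]]
  have "of_nat (p ^ k) * e (?g (Psi p \<phi>)) = of_nat (p ^ k) * e (C_shift p \<phi> 0)" unfolding eq2 by simp
  moreover have "ptf p Rb" using base_dalg by (simp add: dalg_def)
  ultimately show ?thesis using B.ptf_cancel[of p "e (?g (Psi p \<phi>))" "e (C_shift p \<phi> 0)" k] by simp
qed

end

section \<open>Uniqueness of the coefficients\<close>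

locale delta_domain = delta_base p \<phi> for p :: nat and \<phi> :: "'r::idom \<Rightarrow> 'r" +
  assumes prime_R: "\<And>x y::'r. of_nat p dvd x * y \<Longrightarrow> of_nat p dvd x \<or> of_nat p dvd y"
    and residues: "\<And>m. \<exists>S::'r set. finite S \<and> card S = m \<and> (\<forall>s\<in>S. \<forall>t\<in>S. s \<noteq> t \<longrightarrow> \<not> of_nat p dvd s - t)"
    and p_nonzero: "(of_nat p :: 'r) \<noteq> 0"
begin

text \<open>
  The terms of the sum are \<open>c\<^sub>n \<phi>^(-n)(r)\<close>.  If \<open>p^k\<close> divides all \<open>c\<^sub>n\<close>, finitely many terms matter
  modulo \<open>p^(k+1)\<close>, and for \<open>r = \<phi>^N(s)\<close> they form a polynomial in \<open>s\<close> modulo \<open>p\<close>, after division by \<open>p^k\<close>.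
\<close>

lemma coefficients:
  fixes a :: "int \<Rightarrow> 'r"
  assumes a: "admissible p a"
    and ev: "\<And>e. e \<in> falg_hom Ch Rb \<Longrightarrow> e (cochar_delta_hom p \<phi> a (Psi p \<phi>)) = e (C_shift p \<phi> 0)"
  shows "\<phi> (a (n + 1)) = of_nat p * a n + (if n = 0 then of_nat p else 0)"
proof -
  let ?b = "\<lambda>n. \<phi> (a (n + 1))"
  \<comment> \<open>The coefficient of \<phi>^(-n)(z) in p times the difference of the image of
    \<Psi> and z, by \<open>cochar_Psi\<close>.\<close>
  define c where "c n = ?b n - of_nat p * a n - (if n = 0 then of_nat p else 0)" for n
  note nl = nullseq_admissible[OF a] and nb = nullseq_shift[OF nullseq_admissible[OF a]]
  interpret C: pring Ch p by (rule pring_dalg[OF C_hat_dalg])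
  interpret B: cring Rb by simp
  have "of_nat p ^ k dvd c n" for k n
  proof (induction k arbitrary: n)
    case (Suc k)
    \<comment> \<open>Outside of this finite set all terms vanish modulo p^(k+1). The index 0 is
      included to account for the summand p z.\<close>
    define F where "F = {n. \<not> of_nat p ^ Suc k dvd ?b n} \<union> {n. \<not> of_nat p ^ Suc k dvd a n} \<union> {0}"
    have F: "finite F" using nl nb by (simp add: F_def nullseq_def del: power_Suc)
    show ?case
    proof (cases "n \<in> F")
      case False
      then show ?thesis by (auto simp: F_def c_def simp del: power_Suc intro!: dvd_diff)
    next
      case n: True
      from Suc have "\<forall>n. \<exists>t. c n = of_nat p ^ k * t" by (auto simp: dvd_def)
      then obtain d where d: "\<And>n. c n = of_nat p ^ k * d n" by metis
      \<comment> \<open>An upper bound of F, so that N - m is a natural number for every m in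
        F.\<close>
      define N where "N = nat (Max F)"
      have N: "m \<le> int N" if "m \<in> F" for m
        using Max_ge[OF F that] by (simp add: N_def)
      \<comment> \<open>Modulo p the m-th value \<phi>^(N-m)(s) is s^(p^(N-m)). Distinct indices
        give distinct exponents, hence the coefficients of f are the d_m.\<close>
      define f where "f = (\<Sum>m\<in>F. monom (d m) (p ^ nat (int N - m)))"
      have root: "of_nat p dvd poly f s" for s
      proof -
        obtain e where e: "e \<in> falg_hom Ch Rb" "\<And>j. e (C_shift p \<phi> (int N - int j)) = (\<phi> ^^ j) s"
          using eval_exists[of N s] by blast
        let ?u = "\<lambda>m. e (C_shift p \<phi> m)"
        note er = falg_homD(1)[OF e(1)] and ea = falg_homD(2)[OF e(1)]
        have gc: "cochar_delta_hom p \<phi> a (Psi p \<phi>) \<in> carrier Ch"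
          by (rule falg_homD(5)[OF cochar_delta_hom(1)[OF a] Psi_closed])
        have "e ([p] \<cdot>\<^bsub>Ch\<^esub> cochar_delta_hom p \<phi> a (Psi p \<phi>) \<oplus>\<^bsub>Ch\<^esub> [p] \<cdot>\<^bsub>Ch\<^esub> ser a) = of_nat p * ?u 0 + of_nat p * e (ser a)"
          using gc ser_closed[OF nl] ev[OF e(1)]
          by (simp add: add_hom_add[OF ea] add_hom_smult[OF C.abelian_group_axioms B.abelian_group_axioms ea])
        then have eq: "e (ser ?b) = of_nat p * ?u 0 + of_nat p * e (ser a)" unfolding cochar_Psi[OF a] .
        have 1: "of_nat p ^ Suc k dvd e (ser ?b) - (\<Sum>m\<in>F. ?b m * ?u m)"
          by (rule eval_ser[OF e(1) nb F]) (auto simp: F_def)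
        have "of_nat p ^ Suc k dvd e (ser a) - (\<Sum>m\<in>F. a m * ?u m)"
          by (rule eval_ser[OF e(1) nl F]) (auto simp: F_def)
        then have 2: "of_nat p ^ Suc k dvd of_nat p * (e (ser a) - (\<Sum>m\<in>F. a m * ?u m))" by (rule dvd_mult)
        have "(\<Sum>m\<in>F. (if m = 0 then of_nat p else 0) * ?u m) = (\<Sum>m\<in>F. if m = 0 then of_nat p * ?u 0 else 0)"
          by (rule sum.cong) auto
        also have "\<dots> = of_nat p * ?u 0" using F by (simp add: F_def)
        finally have "(\<Sum>m\<in>F. c m * ?u m) = (\<Sum>m\<in>F. ?b m * ?u m) - of_nat p * (\<Sum>m\<in>F. a m * ?u m) - of_nat p * ?u 0"
          unfolding c_def by (simp add: left_diff_distrib sum_subtractf sum_distrib_left mult.assoc)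
        also have "\<dots> = of_nat p * (e (ser a) - (\<Sum>m\<in>F. a m * ?u m)) - (e (ser ?b) - (\<Sum>m\<in>F. ?b m * ?u m))"
          unfolding eq by (simp add: algebra_simps)
        finally have "of_nat p ^ Suc k dvd (\<Sum>m\<in>F. c m * ?u m)" using dvd_diff[OF 2 1] by metis
        moreover have "(\<Sum>m\<in>F. c m * ?u m) = of_nat p ^ k * (\<Sum>m\<in>F. d m * ?u m)"
          by (simp add: d sum_distrib_left mult.assoc)
        ultimately have "of_nat p ^ k * of_nat p dvd of_nat p ^ k * (\<Sum>m\<in>F. d m * ?u m)"
          by (simp only: power_Suc2)
        \<comment> \<open>The vanishing is known modulo p^(k+1) and all c_m are multiples of p^k, so
          one factor p remains for the sum of the d_m.\<close>
        then have "of_nat p ^ k = (0::'r) \<or> of_nat p dvd (\<Sum>m\<in>F. d m * ?u m)" by (simp only: dvd_mult_cancel_left)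
        then have 3: "of_nat p dvd (\<Sum>m\<in>F. d m * ?u m)" using p_nonzero by auto
        have "of_nat p dvd (\<Sum>m\<in>F. d m * (?u m - s ^ (p ^ nat (int N - m))))"
        proof (rule dvd_sum, rule dvd_mult)
          fix m assume m: "m \<in> F"
          have "?u m = (\<phi> ^^ nat (int N - m)) s" using e(2)[of "nat (int N - m)"] N[OF m] by simp
          then show "of_nat p dvd ?u m - s ^ (p ^ nat (int N - m))" using phi_pow_cong by simp
        qed
        then have "of_nat p dvd (\<Sum>m\<in>F. d m * ?u m) - (\<Sum>m\<in>F. d m * s ^ (p ^ nat (int N - m)))"
          by (simp add: right_diff_distrib sum_subtractf)
        from dvd_diff[OF 3 this] have "of_nat p dvd (\<Sum>m\<in>F. d m * s ^ (p ^ nat (int N - m)))"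
          by (simp only: diff_diff_eq2 add_diff_cancel_left')
        then show ?thesis by (simp add: f_def poly_sum poly_monom)
      qed
      obtain S :: "'r set" where S: "finite S" "card S = Suc (degree f)" "\<forall>s\<in>S. \<forall>t\<in>S. s \<noteq> t \<longrightarrow> \<not> of_nat p dvd s - t"
        using residues by blast
      \<comment> \<open>Every element of R is a root of f modulo p, and there are more incongruent
        elements than the degree of f allows.\<close>
      have "[:of_nat p:] dvd f" by (rule poly_roots_mod[OF prime_R S(1)]) (use S root in auto)
      then have "of_nat p dvd coeff f (p ^ nat (int N - n))" by (simp add: const_poly_dvd_iff)
      moreover have "coeff f (p ^ nat (int N - n)) = d n"
      proof -
        have p1: "p > 1" using p by (rule prime_gt_1_nat)
        have "p ^ nat (int N - m) = p ^ nat (int N - n) \<longleftrightarrow> m = n" if m: "m \<in> F" for m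
          using N[OF m] N[OF n] by (auto simp: power_inject_exp[OF p1])
        then have "coeff f (p ^ nat (int N - n)) = (\<Sum>m\<in>F. if m = n then d n else 0)"
          unfolding f_def coeff_sum by (intro sum.cong) auto
        then show ?thesis using F n by simp
      qed
      ultimately show ?thesis unfolding d[of n] power_Suc2 by (simp add: mult_dvd_mono)
    qed
  qed simp
  then have "c n = 0" by (rule R_separated)
  then show ?thesis by (simp add: c_def algebra_simps)
qed

text \<open>The difference d of two solutions satisfies \<phi>(d_(n+1)) = p d_n, so divisibility by
  p^k passes from each index to the next. It holds at sufficiently negative indices because both
  sequences tend to 0 there.\<close>

lemma coefficients_unique:
  fixes a :: "int \<Rightarrow> 'r"
  assumes a: "admissible p a"
    and ev: "\<And>e. e \<in> falg_hom Ch Rb \<Longrightarrow> e (cochar_delta_hom p \<phi> a (Psi p \<phi>)) = e (C_shift p \<phi> 0)"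
  shows "a = cochar_seq p"
proof
  fix n
  define d where "d n = a n - cochar_seq p n" for n
  \<comment> \<open>At n = 0 the extra p accounts for the jump from a_0 = 0 to a_1 = p.\<close>
  have s: "\<phi> (cochar_seq p (n + 1)) = of_nat p * cochar_seq p n + (if n = 0 then of_nat p else 0)" for n
    by (auto simp: cochar_seq_def phi_simps nat_add_distrib phi_of_nat)
  have rec: "\<phi> (d (n + 1)) = of_nat p * d n" for n
    using coefficients[OF a ev, of n] s[of n] by (simp add: d_def phi_simps algebra_simps)
  have up: "of_nat p ^ k dvd d (n + 1)" if k: "of_nat p ^ k dvd d n" for k n
  proof -
    obtain t where t: "d n = of_nat p ^ k * t" using k by (auto simp: dvd_def)
    obtain s where s: "\<phi> s = of_nat p * t" using \<phi>(2) by (metis bij_pointE)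
    have "\<phi> (d (n + 1)) = \<phi> (of_nat p ^ k * s)" unfolding rec t phi_simps s by (simp only: mult_ac)
    then have "d (n + 1) = of_nat p ^ k * s" using \<phi>(2) by (metis bij_pointE)
    then show ?thesis by simp
  qed
  have "of_nat p ^ k dvd d n" for k
  proof -
    obtain N where N: "\<And>n. N \<le> \<bar>n\<bar> \<Longrightarrow> of_nat p ^ k dvd a n" using a unfolding admissible_def by blast
    \<comment> \<open>A starting index below n at which a_m is divisible by p^k and which is not
      positive, so that \<open>cochar_seq\<close> vanishes there.\<close>
    define m where "m = - \<bar>n\<bar> - \<bar>N\<bar>"
    have m: "m \<le> n" "m \<le> 0" "N \<le> \<bar>m\<bar>" unfolding m_def by arith+
    show ?thesis using m(1)
    proof (induction n rule: int_ge_induct)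
      case base
      show ?case using N[OF m(3)] m(2) by (simp add: d_def cochar_seq_def)
    qed (rule up)
  qed
  then have "d n = 0" by (rule R_separated)
  then show "a n = cochar_seq p n" by (simp add: d_def)
qed

end

section \<open>Localizations and morphisms of adic spectra\<close>

text \<open>For the operations of \<open>loc\<close>, which are written as double unions over
  representatives.\<close>

lemma UN2_const:
  assumes "u0 \<in> U" "v0 \<in> V" "\<And>a n b m. (a, n) \<in> U \<Longrightarrow> (b, m) \<in> V \<Longrightarrow> H a n b m = c"
  shows "(\<Union>(a, n)\<in>U. \<Union>(b, m)\<in>V. H a n b m) = c"
proof -
  have 1: "(\<Union>(b, m)\<in>V. H a n b m) = c" if "(a, n) \<in> U" for a n
    by (rule SUP_eq_const) (use assms(2,3) that in auto)
  show ?thesis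
  proof (rule SUP_eq_const)
    show "U \<noteq> {}" using assms(1) by blast
    fix x assume "x \<in> U"
    then show "(case x of (a, n) \<Rightarrow> \<Union>(b, m)\<in>V. H a n b m) = c"
      using 1[of "fst x" "snd x"] by (simp add: case_prod_beta)
  qed
qed

section \<open>The ring A[1/p]\<close>

context cring begin

context
  fixes p :: nat
begin

lemma loc_cls_memD: "(b, m) \<in> loc_cls p R a n \<Longrightarrow> b \<in> carrier R \<and> (\<exists>k. [(p ^ (m + k))] \<cdot> a = [(p ^ (n + k))] \<cdot> b)"
  by (simp add: loc_cls_def)

lemma loc_cls_self: "a \<in> carrier R \<Longrightarrow> (a, n) \<in> loc_cls p R a n"
  by (auto simp: loc_cls_def)

text \<open>The extra exponent k is kept throughout because p-torsion is not excluded; transitivity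
  is obtained by adding up the exponents.\<close>

lemma loc_cls_eqI:
  assumes a: "a \<in> carrier R" and b: "b \<in> carrier R" and k: "[(p ^ (m + k))] \<cdot> a = [(p ^ (n + k))] \<cdot> b"
  shows "loc_cls p R a n = loc_cls p R b m"
proof -
  have sub: "loc_cls p R a n \<subseteq> loc_cls p R b m" if a: "a \<in> carrier R" and b: "b \<in> carrier R"
    and k: "[(p ^ (m + k))] \<cdot> a = [(p ^ (n + k))] \<cdot> b" for a b n m k
  proof clarify
    fix c l assume "(c, l) \<in> loc_cls p R a n"
    then obtain j where c: "c \<in> carrier R" and j: "[(p ^ (l + j))] \<cdot> a = [(p ^ (n + j))] \<cdot> c" by (auto simp: loc_cls_def)
    have "[(p ^ (l + (n + k + j)))] \<cdot> b = [(p ^ (l + j))] \<cdot> ([(p ^ (n + k))] \<cdot> b)"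
      using b by (simp add: smult_smult power_add[symmetric] add_ac)
    also have "\<dots> = [(p ^ (m + k))] \<cdot> ([(p ^ (l + j))] \<cdot> a)"
      unfolding k[symmetric] using a by (simp add: smult_smult mult.commute)
    also have "\<dots> = [(p ^ (m + (n + k + j)))] \<cdot> c"
      unfolding j using c by (simp add: smult_smult power_add[symmetric] add_ac)
    finally show "(c, l) \<in> loc_cls p R b m" using c by (auto simp: loc_cls_def)
  qed
  show ?thesis using sub[OF a b k] sub[OF b a k[symmetric]] by blast
qed

lemma loc_cls_eq: "a \<in> carrier R \<Longrightarrow> b \<in> carrier R \<Longrightarrow>
    loc_cls p R a n = loc_cls p R b m \<longleftrightarrow> (\<exists>k. [(p ^ (m + k))] \<cdot> a = [(p ^ (n + k))] \<cdot> b)"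
  using loc_cls_self[of b m] loc_cls_memD[of b m a n] loc_cls_eqI by blast

lemma loc_cls_shift: "a \<in> carrier R \<Longrightarrow> loc_cls p R a n = loc_cls p R ([(p ^ k)] \<cdot> a) (n + k)"
  by (rule loc_cls_eqI[where k = 0]) (simp_all add: smult_smult power_add)

lemma carrier_loc: "carrier (loc p R) = {loc_cls p R a n | a n. a \<in> carrier R}"
  by (simp add: loc_def)

lemma loc_cls_closed [simp]: "a \<in> carrier R \<Longrightarrow> loc_cls p R a n \<in> carrier (loc p R)"
  by (auto simp: carrier_loc)

lemma smult_shift:
  assumes "[(p ^ i)] \<cdot> a = [(p ^ j)] \<cdot> b" "a \<in> carrier R" "b \<in> carrier R"
  shows "[(p ^ (x + i))] \<cdot> a = [(p ^ (x + j))] \<cdot> b"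
  using arg_cong[OF assms(1), of "\<lambda>t. [(p ^ x)] \<cdot> t"] assms(2,3) by (simp add: smult_smult power_add)

lemma loc_mult [simp]:
  assumes a: "a \<in> carrier R" and b: "b \<in> carrier R"
  shows "loc_cls p R a n \<otimes>\<^bsub>loc p R\<^esub> loc_cls p R b m = loc_cls p R (a \<otimes> b) (n + m)"
proof -
  have "loc_cls p R (a' \<otimes> b') (n' + m') = loc_cls p R (a \<otimes> b) (n + m)"
    if a': "(a', n') \<in> loc_cls p R a n" and b': "(b', m') \<in> loc_cls p R b m" for a' n' b' m'
  proof -
    obtain k j where c: "a' \<in> carrier R" "b' \<in> carrier R"
      and k: "[(p ^ (n' + k))] \<cdot> a = [(p ^ (n + k))] \<cdot> a'" and j: "[(p ^ (m' + j))] \<cdot> b = [(p ^ (m + j))] \<cdot> b'"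
      using loc_cls_memD[OF a'] loc_cls_memD[OF b'] by blast
    have pp: "([x] \<cdot> s) \<otimes> ([y] \<cdot> t) = [(x * y)] \<cdot> (s \<otimes> t)" if "s \<in> carrier R" "t \<in> carrier R" for x y :: nat and s t
      using that by (simp add: smult_l smult_r smult_smult mult.commute)
    have "[(p ^ (n + k) * p ^ (m + j))] \<cdot> (a' \<otimes> b') = [(p ^ (n' + k) * p ^ (m' + j))] \<cdot> (a \<otimes> b)"
      unfolding pp[OF c, symmetric] pp[OF a b, symmetric] k j ..
    then have "[(p ^ ((n + m) + (k + j)))] \<cdot> (a' \<otimes> b') = [(p ^ ((n' + m') + (k + j)))] \<cdot> (a \<otimes> b)"
      by (simp only: power_add mult_ac)
    then show ?thesis by (rule loc_cls_eqI[rotated 2]) (use a b c in auto)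
  qed
  from UN2_const[where H = "\<lambda>a n b m. loc_cls p R (a \<otimes> b) (n + m)", OF loc_cls_self[OF a] loc_cls_self[OF b] this]
  show ?thesis unfolding loc_def monoid.simps ring.simps .
qed

lemma loc_add_gen:
  assumes a: "a \<in> carrier R" and b: "b \<in> carrier R"
  shows "loc_cls p R a n \<oplus>\<^bsub>loc p R\<^esub> loc_cls p R b m = loc_cls p R ([(p ^ m)] \<cdot> a \<oplus> [(p ^ n)] \<cdot> b) (n + m)"
proof -
  have "loc_cls p R ([(p ^ m')] \<cdot> a' \<oplus> [(p ^ n')] \<cdot> b') (n' + m') = loc_cls p R ([(p ^ m)] \<cdot> a \<oplus> [(p ^ n)] \<cdot> b) (n + m)"
    if a': "(a', n') \<in> loc_cls p R a n" and b': "(b', m') \<in> loc_cls p R b m" for a' n' b' m'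
  proof -
    obtain k j where c: "a' \<in> carrier R" "b' \<in> carrier R"
      and k: "[(p ^ (n' + k))] \<cdot> a = [(p ^ (n + k))] \<cdot> a'" and j: "[(p ^ (m' + j))] \<cdot> b = [(p ^ (m + j))] \<cdot> b'"
      using loc_cls_memD[OF a'] loc_cls_memD[OF b'] by blast
    have 1: "[(p ^ (n' + m' + (k + j) + m))] \<cdot> a = [(p ^ (n + m + (k + j) + m'))] \<cdot> a'"
      using smult_shift[OF k a c(1), of "m' + j + m"] by (simp only: add_ac)
    have 2: "[(p ^ (n' + m' + (k + j) + n))] \<cdot> b = [(p ^ (n + m + (k + j) + n'))] \<cdot> b'"
      using smult_shift[OF j b c(2), of "n' + k + n"] by (simp only: add_ac)
    have pp: "[(p ^ x)] \<cdot> ([(p ^ y)] \<cdot> s \<oplus> [(p ^ z)] \<cdot> t) = [(p ^ (x + y))] \<cdot> s \<oplus> [(p ^ (x + z))] \<cdot> t"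
      if "s \<in> carrier R" "t \<in> carrier R" for x y z s t
      using that by (simp add: smult_add smult_smult power_add)
    have "[(p ^ ((n + m) + (k + j)))] \<cdot> ([(p ^ m')] \<cdot> a' \<oplus> [(p ^ n')] \<cdot> b')
        = [(p ^ ((n' + m') + (k + j)))] \<cdot> ([(p ^ m)] \<cdot> a \<oplus> [(p ^ n)] \<cdot> b)"
      unfolding pp[OF c] pp[OF a b] 1 2 ..
    then show ?thesis by (rule loc_cls_eqI[rotated 2]) (use a b c in auto)
  qed
  from UN2_const[where H = "\<lambda>a n b m. loc_cls p R ([(p ^ m)] \<cdot> a \<oplus> [(p ^ n)] \<cdot> b) (n + m)",
    OF loc_cls_self[OF a] loc_cls_self[OF b] this]
  show ?thesis unfolding loc_def monoid.simps ring.simps .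
qed

lemma loc_add [simp]:
  assumes a: "a \<in> carrier R" and b: "b \<in> carrier R"
  shows "loc_cls p R a n \<oplus>\<^bsub>loc p R\<^esub> loc_cls p R b n = loc_cls p R (a \<oplus> b) n"
  unfolding loc_add_gen[OF a b] smult_add[OF a b, symmetric]
  by (rule loc_cls_shift[symmetric]) (use a b in simp)

lemma loc_one: "\<one>\<^bsub>loc p R\<^esub> = loc_cls p R \<one> 0" and loc_zero: "\<zero>\<^bsub>loc p R\<^esub> = loc_cls p R \<zero> n"
  using loc_cls_shift[of \<zero> 0 n] by (simp_all add: loc_def)

text \<open>Fractions are brought to a common denominator, which reduces the ring axioms to those of
  the numerators.\<close>

lemma loc_common3:
  assumes "u \<in> carrier (loc p R)" "v \<in> carrier (loc p R)" "w \<in> carrier (loc p R)"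
  obtains a b c n where "a \<in> carrier R" "b \<in> carrier R" "c \<in> carrier R"
    "u = loc_cls p R a n" "v = loc_cls p R b n" "w = loc_cls p R c n"
proof -
  obtain a b c i j k where *: "a \<in> carrier R" "b \<in> carrier R" "c \<in> carrier R"
    "u = loc_cls p R a i" "v = loc_cls p R b j" "w = loc_cls p R c k" using assms by (auto simp: carrier_loc)
  show ?thesis
  proof (rule that[of "[(p ^ (j + k))] \<cdot> a" "[(p ^ (i + k))] \<cdot> b" "[(p ^ (i + j))] \<cdot> c" "i + (j + k)"])
    show "u = loc_cls p R ([(p ^ (j + k))] \<cdot> a) (i + (j + k))" unfolding *(4) by (rule loc_cls_shift[OF *(1)])
    show "v = loc_cls p R ([(p ^ (i + k))] \<cdot> b) (i + (j + k))"
      unfolding *(5) using loc_cls_shift[OF *(2), of j "i + k"] by (simp only: add_ac)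
    show "w = loc_cls p R ([(p ^ (i + j))] \<cdot> c) (i + (j + k))"
      unfolding *(6) using loc_cls_shift[OF *(3), of k "i + j"] by (simp only: add_ac)
  qed (use * in auto)
qed

lemma loc_cring: "cring (loc p R)"
proof (rule cringI)
  show "abelian_group (loc p R)"
  proof (rule abelian_groupI)
    fix u v assume u: "u \<in> carrier (loc p R)" and v: "v \<in> carrier (loc p R)"
    show "u \<oplus>\<^bsub>loc p R\<^esub> v \<in> carrier (loc p R)" by (rule loc_common3[OF u v v]) simp
    show "u \<oplus>\<^bsub>loc p R\<^esub> v = v \<oplus>\<^bsub>loc p R\<^esub> u" by (rule loc_common3[OF u v v]) (simp add: a_comm)
    fix w assume w: "w \<in> carrier (loc p R)"
    show "u \<oplus>\<^bsub>loc p R\<^esub> v \<oplus>\<^bsub>loc p R\<^esub> w = u \<oplus>\<^bsub>loc p R\<^esub> (v \<oplus>\<^bsub>loc p R\<^esub> w)"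
      by (rule loc_common3[OF u v w]) (simp add: a_assoc)
  next
    show "\<zero>\<^bsub>loc p R\<^esub> \<in> carrier (loc p R)" by (simp add: loc_zero[of 0])
    fix u assume u: "u \<in> carrier (loc p R)"
    then obtain a n where a: "a \<in> carrier R" "u = loc_cls p R a n" by (auto simp: carrier_loc)
    show "\<zero>\<^bsub>loc p R\<^esub> \<oplus>\<^bsub>loc p R\<^esub> u = u" unfolding loc_zero[of n] a(2) using a(1) by simp
    show "\<exists>v\<in>carrier (loc p R). v \<oplus>\<^bsub>loc p R\<^esub> u = \<zero>\<^bsub>loc p R\<^esub>"
      by (rule bexI[of _ "loc_cls p R (\<ominus> a) n"]) (use a(1) in \<open>simp_all add: a(2) loc_zero[of n] l_neg\<close>)
  qed
  show "Group.comm_monoid (loc p R)"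
  proof (rule comm_monoidI)
    fix u v assume u: "u \<in> carrier (loc p R)" and v: "v \<in> carrier (loc p R)"
    show "u \<otimes>\<^bsub>loc p R\<^esub> v \<in> carrier (loc p R)" by (rule loc_common3[OF u v v]) simp
    show "u \<otimes>\<^bsub>loc p R\<^esub> v = v \<otimes>\<^bsub>loc p R\<^esub> u" by (rule loc_common3[OF u v v]) (simp add: m_comm)
    fix w assume w: "w \<in> carrier (loc p R)"
    show "u \<otimes>\<^bsub>loc p R\<^esub> v \<otimes>\<^bsub>loc p R\<^esub> w = u \<otimes>\<^bsub>loc p R\<^esub> (v \<otimes>\<^bsub>loc p R\<^esub> w)"
      by (rule loc_common3[OF u v w]) (simp add: m_assoc add.assoc)
  next
    fix u assume "u \<in> carrier (loc p R)"
    then obtain a n where a: "a \<in> carrier R" "u = loc_cls p R a n" by (auto simp: carrier_loc)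
    then show "\<one>\<^bsub>loc p R\<^esub> \<otimes>\<^bsub>loc p R\<^esub> u = u" by (simp add: loc_one)
  qed (simp add: loc_one)
  fix u v w assume u: "u \<in> carrier (loc p R)" and v: "v \<in> carrier (loc p R)" and w: "w \<in> carrier (loc p R)"
  show "(u \<oplus>\<^bsub>loc p R\<^esub> v) \<otimes>\<^bsub>loc p R\<^esub> w = u \<otimes>\<^bsub>loc p R\<^esub> w \<oplus>\<^bsub>loc p R\<^esub> v \<otimes>\<^bsub>loc p R\<^esub> w"
    by (rule loc_common3[OF u v w]) (simp add: l_distr)
qed

lemma loc_cls_hom: "(\<lambda>a. loc_cls p R a 0) \<in> ring_hom R (loc p R)"
  by (rule ring_hom_memI) (simp_all add: loc_one)

end

end

lemma loc_map_cls:
  assumes A: "cring A" and B: "cring B" and f: "f \<in> add_hom A B" and a: "a \<in> carrier A"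
  shows "loc_map p B f (loc_cls p A a n) = loc_cls p B (f a) n"
proof -
  interpret A: cring A by fact
  interpret B: cring B by fact
  note sm = add_hom_smult[OF A.abelian_group_axioms B.abelian_group_axioms f]
  have "loc_cls p B (f b) m = loc_cls p B (f a) n" if b: "(b, m) \<in> loc_cls p A a n" for b m
  proof -
    obtain k where k: "b \<in> carrier A" "[(p ^ (m + k))] \<cdot>\<^bsub>A\<^esub> a = [(p ^ (n + k))] \<cdot>\<^bsub>A\<^esub> b"
      using A.loc_cls_memD[OF b] by blast
    have "[(p ^ (n + k))] \<cdot>\<^bsub>B\<^esub> f b = [(p ^ (m + k))] \<cdot>\<^bsub>B\<^esub> f a"
      using arg_cong[OF k(2), of f] unfolding sm[OF a] sm[OF k(1)] by (rule sym)
    then show ?thesis by (rule B.loc_cls_eqI[rotated 2]) (use add_hom_closed[OF f] a k(1) in auto)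
  qed
  note eq = this
  show ?thesis unfolding loc_map_def
  proof (rule SUP_eq_const)
    show "loc_cls p A a n \<noteq> {}" using A.loc_cls_self[OF a] by blast
    fix x assume x: "x \<in> loc_cls p A a n"
    have "loc_cls p B (f (fst x)) (snd x) = loc_cls p B (f a) n" by (rule eq) (use x in simp)
    then show "(case x of (a, n) \<Rightarrow> loc_cls p B (f a) n) = loc_cls p B (f a) n" by (simp only: case_prod_beta)
  qed
qed

lemma loc_map_hom:
  assumes A: "cring A" and B: "cring B" and f: "f \<in> ring_hom A B"
  shows "loc_map p B f \<in> ring_hom (loc p A) (loc p B)"
proof -
  interpret A: cring A by fact
  interpret B: cring B by fact
  note lc = loc_map_cls[OF A B ring_hom_add_hom[OF f]]
  have fc: "a \<in> carrier A \<Longrightarrow> f a \<in> carrier B" for a by (rule ring_hom_closed[OF f])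
  show ?thesis
  proof (rule ring_hom_memI)
    fix u v assume u: "u \<in> carrier (loc p A)" and v: "v \<in> carrier (loc p A)"
    show "loc_map p B f u \<in> carrier (loc p B)" by (rule A.loc_common3[OF u v v]) (simp add: lc fc)
    show "loc_map p B f (u \<otimes>\<^bsub>loc p A\<^esub> v) = loc_map p B f u \<otimes>\<^bsub>loc p B\<^esub> loc_map p B f v"
      by (rule A.loc_common3[OF u v v]) (simp add: lc fc ring_hom_mult[OF f])
    show "loc_map p B f (u \<oplus>\<^bsub>loc p A\<^esub> v) = loc_map p B f u \<oplus>\<^bsub>loc p B\<^esub> loc_map p B f v"
      by (rule A.loc_common3[OF u v v]) (simp add: lc fc ring_hom_add[OF f])
  qed (simp add: A.loc_one B.loc_one lc ring_hom_one[OF f])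
qed

section \<open>Adic spectra and continuous homomorphisms\<close>

context
  fixes S :: "('a, 'm) huber_pair_scheme" and T :: "('b, 'n) huber_pair_scheme" and h :: "'b \<Rightarrow> 'a"
  assumes S: "cring S" and T: "cring T" and h: "h \<in> ring_hom T S"
    and cont: "continuous_map (ring_topology T) (ring_topology S) h"
    and top: "topspace (ring_topology T) = carrier T"
    and plus: "h ` plus_part T \<subseteq> plus_part S" "plus_part T \<subseteq> carrier T"
begin

interpretation S: cring S by (rule S)
interpretation T: cring T by (rule T)

lemma pull_iff: "(f, g) \<in> pull_valuation T h v \<longleftrightarrow> f \<in> carrier T \<and> g \<in> carrier T \<and> (h f, h g) \<in> v"
  by (simp add: pull_valuation_def)

lemma pull_h: "h \<zero>\<^bsub>T\<^esub> = \<zero>\<^bsub>S\<^esub>" "h \<one>\<^bsub>T\<^esub> = \<one>\<^bsub>S\<^esub>" "f \<in> carrier T \<Longrightarrow> h f \<in> carrier S"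
    "f \<in> carrier T \<Longrightarrow> g \<in> carrier T \<Longrightarrow> h (f \<oplus>\<^bsub>T\<^esub> g) = h f \<oplus>\<^bsub>S\<^esub> h g"
    "f \<in> carrier T \<Longrightarrow> g \<in> carrier T \<Longrightarrow> h (f \<otimes>\<^bsub>T\<^esub> g) = h f \<otimes>\<^bsub>S\<^esub> h g"
  using add_hom_zero[OF T.abelian_group_axioms S.abelian_group_axioms ring_hom_add_hom[OF h]]
    ring_hom_one[OF h] ring_hom_closed[OF h] ring_hom_add[OF h] ring_hom_mult[OF h] by auto

text \<open>The valuation axioms are inherited because \<open>h\<close> is a homomorphism.
  Continuity is inherited because the set to be shown open is the preimage under \<open>h\<close> of
  one that is open for \<open>v\<close>.\<close>

lemma pull_spa:
  assumes v: "v \<in> spa S"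
  shows "pull_valuation T h v \<in> spa T"
proof -
  let ?w = "pull_valuation T h v"
  have val: "valuation_rel S v"
    and vc: "\<And>f g. f \<in> carrier S \<Longrightarrow> g \<in> carrier S \<Longrightarrow> (f, \<zero>\<^bsub>S\<^esub>) \<notin> v \<Longrightarrow> (g, \<zero>\<^bsub>S\<^esub>) \<notin> v \<Longrightarrow>
        openin (ring_topology S) {a \<in> carrier S. (g, a \<otimes>\<^bsub>S\<^esub> f) \<notin> v}"
    and vp: "\<And>a. a \<in> plus_part S \<Longrightarrow> (a, \<one>\<^bsub>S\<^esub>) \<in> v"
    using v by (auto simp: spa_def)
  have tot: "total_on (carrier S) v" and refl: "refl_on (carrier S) v" and tr: "trans v" and n1: "(\<one>\<^bsub>S\<^esub>, \<zero>\<^bsub>S\<^esub>) \<notin> v"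
    and va: "\<And>f g k. f \<in> carrier S \<Longrightarrow> g \<in> carrier S \<Longrightarrow> k \<in> carrier S \<Longrightarrow> (f, k) \<in> v \<Longrightarrow> (g, k) \<in> v \<Longrightarrow> (f \<oplus>\<^bsub>S\<^esub> g, k) \<in> v"
    and vm: "\<And>f g k. f \<in> carrier S \<Longrightarrow> g \<in> carrier S \<Longrightarrow> k \<in> carrier S \<Longrightarrow> (f, g) \<in> v \<Longrightarrow> (f \<otimes>\<^bsub>S\<^esub> k, g \<otimes>\<^bsub>S\<^esub> k) \<in> v"
    and vd: "\<And>f g k. f \<in> carrier S \<Longrightarrow> g \<in> carrier S \<Longrightarrow> k \<in> carrier S \<Longrightarrow> (f \<otimes>\<^bsub>S\<^esub> k, g \<otimes>\<^bsub>S\<^esub> k) \<in> v \<Longrightarrow> (k, \<zero>\<^bsub>S\<^esub>) \<notin> v \<Longrightarrow> (f, g) \<in> v"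
    using val unfolding valuation_rel_def by blast+
  have "valuation_rel T ?w" unfolding valuation_rel_def
  proof (intro conjI ballI impI; (elim conjE)?)
    show "?w \<subseteq> carrier T \<times> carrier T" by (auto simp: pull_iff)
    have "(f, g) \<in> v \<or> (g, f) \<in> v" if "f \<in> carrier S" "g \<in> carrier S" for f g
      using tot refl that unfolding total_on_def refl_on_def by metis
    then show "total_on (carrier T) ?w" by (auto simp: total_on_def pull_iff pull_h(3))
    show "refl_on (carrier T) ?w" using refl by (auto simp: refl_on_def pull_iff pull_h(3))
    show "trans ?w" by (rule transI) (use tr in \<open>auto simp: pull_iff dest: transD\<close>)
    show "(\<one>\<^bsub>T\<^esub>, \<zero>\<^bsub>T\<^esub>) \<notin> ?w" using n1 by (simp add: pull_iff pull_h)
    fix f g k assume c: "f \<in> carrier T" "g \<in> carrier T" "k \<in> carrier T"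
    note hc = pull_h(3)[OF c(1)] pull_h(3)[OF c(2)] pull_h(3)[OF c(3)]
    show "(f \<oplus>\<^bsub>T\<^esub> g, k) \<in> ?w" if "(f, k) \<in> ?w" "(g, k) \<in> ?w"
      using va[OF hc] that c by (simp add: pull_iff pull_h)
    show "(f \<otimes>\<^bsub>T\<^esub> k, g \<otimes>\<^bsub>T\<^esub> k) \<in> ?w" if "(f, g) \<in> ?w"
      using vm[OF hc] that c by (simp add: pull_iff pull_h)
    show "(f, g) \<in> ?w" if "(f \<otimes>\<^bsub>T\<^esub> k, g \<otimes>\<^bsub>T\<^esub> k) \<in> ?w" "(k, \<zero>\<^bsub>T\<^esub>) \<notin> ?w"
      using vd[OF hc] that c by (simp add: pull_iff pull_h)
  qed
  moreover have "openin (ring_topology T) {a \<in> carrier T. (g, a \<otimes>\<^bsub>T\<^esub> f) \<notin> ?w}"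
    if c: "f \<in> carrier T" "g \<in> carrier T" and nz: "(f, \<zero>\<^bsub>T\<^esub>) \<notin> ?w" "(g, \<zero>\<^bsub>T\<^esub>) \<notin> ?w" for f g
  proof -
    have "openin (ring_topology S) {a \<in> carrier S. (h g, a \<otimes>\<^bsub>S\<^esub> h f) \<notin> v}"
      by (rule vc) (use c nz in \<open>simp_all add: pull_iff pull_h\<close>)
    then have "openin (ring_topology T) {x \<in> topspace (ring_topology T). h x \<in> {a \<in> carrier S. (h g, a \<otimes>\<^bsub>S\<^esub> h f) \<notin> v}}"
      using cont unfolding continuous_map_def by blast
    moreover have "{x \<in> topspace (ring_topology T). h x \<in> {a \<in> carrier S. (h g, a \<otimes>\<^bsub>S\<^esub> h f) \<notin> v}} = {a \<in> carrier T. (g, a \<otimes>\<^bsub>T\<^esub> f) \<notin> ?w}"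
      using c by (auto simp: top pull_iff pull_h)
    ultimately show ?thesis by simp
  qed
  moreover have "(a, \<one>\<^bsub>T\<^esub>) \<in> ?w" if "a \<in> plus_part T" for a
    using vp[of "h a"] that plus by (auto simp: pull_iff pull_h)
  ultimately show ?thesis unfolding spa_def by blast
qed

text \<open>Shows that the whole spectrum is one of the generating open sets, the one with f = 0 and
  g = 1, and thus equals the underlying space of \<open>spa_topology\<close>.\<close>

lemma spa_zero_one:
  assumes "v \<in> spa S"
  shows "(\<zero>\<^bsub>S\<^esub>, \<one>\<^bsub>S\<^esub>) \<in> v \<and> (\<one>\<^bsub>S\<^esub>, \<zero>\<^bsub>S\<^esub>) \<notin> v"
proof -
  have val: "valuation_rel S v" using assms unfolding spa_def by blast
  then have tot: "total_on (carrier S) v" and refl: "refl_on (carrier S) v" and n1: "(\<one>\<^bsub>S\<^esub>, \<zero>\<^bsub>S\<^esub>) \<notin> v"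
    unfolding valuation_rel_def by blast+
  have "(\<zero>\<^bsub>S\<^esub>, \<zero>\<^bsub>S\<^esub>) \<in> v" using refl unfolding refl_on_def by blast
  then have "\<zero>\<^bsub>S\<^esub> \<noteq> \<one>\<^bsub>S\<^esub>" using n1 by auto
  then have "(\<zero>\<^bsub>S\<^esub>, \<one>\<^bsub>S\<^esub>) \<in> v \<or> (\<one>\<^bsub>S\<^esub>, \<zero>\<^bsub>S\<^esub>) \<in> v"
    using tot unfolding total_on_def by blast
  with n1 show ?thesis by blast
qed

text \<open>The preimage of the basic open set of (f, g) is the basic open set of (h f, h
  g).\<close>

lemma adic_induced_hom: "adic_induced S T h \<in> adic_hom S T"
proof -
  let ?f = "restrict (pull_valuation T h) (spa S)" and ?h = "restrict h (carrier T)"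
  have ph: "pull_valuation T ?h v = pull_valuation T h v" for v
    by (auto simp: pull_valuation_def)
  have "?h \<in> ring_hom T S" by (rule ring_hom_memI) (simp_all add: pull_h)
  moreover have "continuous_map (ring_topology T) (ring_topology S) ?h"
    by (rule continuous_map_eq[OF cont]) (simp add: top)
  moreover have "?h ` plus_part T \<subseteq> plus_part S" using plus by auto
  moreover have "continuous_map (spa_topology S) (spa_topology T) ?f"
    unfolding spa_topology_def[of T]
  proof (rule continuous_on_generated_topo)
    have ts: "topspace (spa_topology S) \<subseteq> spa S" unfolding spa_topology_def by auto
    have st: "spa S \<subseteq> topspace (spa_topology S)"
    proof
      fix v assume "v \<in> spa S"
      then have "v \<in> {v \<in> spa S. (\<zero>\<^bsub>S\<^esub>, \<one>\<^bsub>S\<^esub>) \<in> v \<and> (\<one>\<^bsub>S\<^esub>, \<zero>\<^bsub>S\<^esub>) \<notin> v}" using spa_zero_one by blast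
      then show "v \<in> topspace (spa_topology S)" unfolding spa_topology_def topology_generated_by_topspace by blast
    qed
    show "openin (spa_topology S) (?f -` U \<inter> topspace (spa_topology S))"
      if "U \<in> {{v \<in> spa T. (f, g) \<in> v \<and> (g, \<zero>\<^bsub>T\<^esub>) \<notin> v} | f g. f \<in> carrier T \<and> g \<in> carrier T}" for U
    proof -
      from that obtain f g where U: "U = {v \<in> spa T. (f, g) \<in> v \<and> (g, \<zero>\<^bsub>T\<^esub>) \<notin> v}" and c: "f \<in> carrier T" "g \<in> carrier T" by blast
      have "?f -` U \<inter> topspace (spa_topology S) = {v \<in> spa S. (h f, h g) \<in> v \<and> (h g, \<zero>\<^bsub>S\<^esub>) \<notin> v}"
        using ts st pull_spa c by (auto simp: U pull_iff pull_h)
      moreover have "{v \<in> spa S. (h f, h g) \<in> v \<and> (h g, \<zero>\<^bsub>S\<^esub>) \<notin> v}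
          \<in> {{v \<in> spa S. (f, g) \<in> v \<and> (g, \<zero>\<^bsub>S\<^esub>) \<notin> v} | f g. f \<in> carrier S \<and> g \<in> carrier S}"
        unfolding mem_Collect_eq by (rule exI[of _ "h f"], rule exI[of _ "h g"]) (simp add: c pull_h(3))
      ultimately show ?thesis unfolding spa_topology_def[of S] by (simp only: topology_generated_by_Basis)
    qed
    have "pull_valuation T h v \<in> \<Union>{{v \<in> spa T. (f, g) \<in> v \<and> (g, \<zero>\<^bsub>T\<^esub>) \<notin> v} | f g. f \<in> carrier T \<and> g \<in> carrier T}"
      if v: "v \<in> spa S" for v
    proof -
      have "pull_valuation T h v \<in> {v \<in> spa T. (\<zero>\<^bsub>T\<^esub>, \<one>\<^bsub>T\<^esub>) \<in> v \<and> (\<one>\<^bsub>T\<^esub>, \<zero>\<^bsub>T\<^esub>) \<notin> v}"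
        using pull_spa[OF v] spa_zero_one[OF v] by (simp add: pull_iff pull_h)
      then show ?thesis by blast
    qed
    then show "?f ` topspace (spa_topology S) \<subseteq> \<Union>{{v \<in> spa T. (f, g) \<in> v \<and> (g, \<zero>\<^bsub>T\<^esub>) \<notin> v} | f g. f \<in> carrier T \<and> g \<in> carrier T}"
      using ts by auto
  qed
  ultimately show ?thesis by (simp add: adic_induced_def adic_hom_def ph)
qed

end

section \<open>The pair (P, P_circ) and its topology\<close>

lemma P_pair_simps [simp]:
  "carrier (P_pair p \<phi> A) = carrier (loc p (P_circ p \<phi> A))"
  "monoid.mult (P_pair p \<phi> A) = monoid.mult (loc p (P_circ p \<phi> A))"
  "monoid.one (P_pair p \<phi> A) = monoid.one (loc p (P_circ p \<phi> A))"
  "ring.zero (P_pair p \<phi> A) = ring.zero (loc p (P_circ p \<phi> A))"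
  "ring.add (P_pair p \<phi> A) = ring.add (loc p (P_circ p \<phi> A))"
  "cring (P_pair p \<phi> A) = cring (loc p (P_circ p \<phi> A))"
  "ring_hom (P_pair p \<phi> A) W = ring_hom (loc p (P_circ p \<phi> A)) W"
  "ring_hom V (P_pair p \<phi> A) = ring_hom V (loc p (P_circ p \<phi> A))"
  "plus_part (P_pair p \<phi> A) = {loc_cls p (P_circ p \<phi> A) a 0 | a. a \<in> carrier (P_circ p \<phi> A)}"
  "ring_topology (P_pair p \<phi> A) = topology (\<lambda>U. U \<subseteq> carrier (loc p (P_circ p \<phi> A)) \<and>
     (\<forall>x\<in>U. \<exists>n. \<forall>y\<in>{loc_cls p (P_circ p \<phi> A) a 0 | a. a \<in> carrier (P_circ p \<phi> A)}.
        x \<oplus>\<^bsub>loc p (P_circ p \<phi> A)\<^esub> [(p ^ n)] \<cdot>\<^bsub>loc p (P_circ p \<phi> A)\<^esub> y \<in> U))"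
proof -
  show "plus_part (P_pair p \<phi> A) = {loc_cls p (P_circ p \<phi> A) a 0 | a. a \<in> carrier (P_circ p \<phi> A)}"
    by (simp add: P_pair_def Let_def ring.defs huber_pair.defs)
  show "ring_topology (P_pair p \<phi> A) = topology (\<lambda>U. U \<subseteq> carrier (loc p (P_circ p \<phi> A)) \<and>
     (\<forall>x\<in>U. \<exists>n. \<forall>y\<in>{loc_cls p (P_circ p \<phi> A) a 0 | a. a \<in> carrier (P_circ p \<phi> A)}.
        x \<oplus>\<^bsub>loc p (P_circ p \<phi> A)\<^esub> [(p ^ n)] \<cdot>\<^bsub>loc p (P_circ p \<phi> A)\<^esub> y \<in> U))"
    by (simp add: P_pair_def Let_def ring.defs huber_pair.defs)
qed (simp_all add: P_pair_def Let_def)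

lemma smult_loc_cls:
  assumes A: "cring A" and a: "a \<in> carrier A"
  shows "[(k::nat)] \<cdot>\<^bsub>loc p A\<^esub> loc_cls p A a 0 = loc_cls p A ([k] \<cdot>\<^bsub>A\<^esub> a) 0"
proof -
  interpret A: cring A by fact
  interpret L: cring "loc p A" by (rule A.loc_cring)
  show ?thesis
    using add_hom_smult[OF A.abelian_group_axioms L.abelian_group_axioms ring_hom_add_hom[OF A.loc_cls_hom] a] by simp
qed

text \<open>The constant \<open>topology\<close> reveals its open sets only after the predicate has
  been shown to be a topology; the neighbourhoods p^n P_circ are rewritten as fractions with
  denominator 1 on the way.\<close>

lemma openin_P_pair:
  assumes A: "cring (P_circ p \<phi> A)"
  shows "openin (ring_topology (P_pair p \<phi> A)) U \<longleftrightarrow> U \<subseteq> carrier (loc p (P_circ p \<phi> A)) \<and>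
     (\<forall>x\<in>U. \<exists>n. \<forall>a\<in>carrier (P_circ p \<phi> A). x \<oplus>\<^bsub>loc p (P_circ p \<phi> A)\<^esub> loc_cls p (P_circ p \<phi> A) ([(p ^ n)] \<cdot>\<^bsub>P_circ p \<phi> A\<^esub> a) 0 \<in> U)"
    and "topspace (ring_topology (P_pair p \<phi> A)) = carrier (loc p (P_circ p \<phi> A))"
proof -
  let ?A = "P_circ p \<phi> A"
  let ?P = "loc p ?A"
  interpret A: cring ?A by fact
  interpret P: cring ?P by (rule A.loc_cring)
  let ?L = "\<lambda>U. U \<subseteq> carrier ?P \<and> (\<forall>x\<in>U. \<exists>n. \<forall>a\<in>carrier ?A. x \<oplus>\<^bsub>?P\<^esub> loc_cls p ?A ([(p ^ n)] \<cdot>\<^bsub>?A\<^esub> a) 0 \<in> U)"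
  have L: "ring_topology (P_pair p \<phi> A) = topology ?L"
  proof -
    have "(\<forall>y\<in>{loc_cls p ?A a 0 | a. a \<in> carrier ?A}. Q ([(p ^ n)] \<cdot>\<^bsub>?P\<^esub> y)) \<longleftrightarrow> (\<forall>a\<in>carrier ?A. Q (loc_cls p ?A ([(p ^ n)] \<cdot>\<^bsub>?A\<^esub> a) 0))" for Q n
    proof -
      have sm: "[(p ^ n)] \<cdot>\<^bsub>?P\<^esub> loc_cls p ?A a 0 = loc_cls p ?A ([(p ^ n)] \<cdot>\<^bsub>?A\<^esub> a) 0" if "a \<in> carrier ?A" for a
        by (rule smult_loc_cls[OF A.is_cring that])
      have "(\<forall>y\<in>{loc_cls p ?A a 0 | a. a \<in> carrier ?A}. Q ([(p ^ n)] \<cdot>\<^bsub>?P\<^esub> y))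
          \<longleftrightarrow> (\<forall>a\<in>carrier ?A. Q ([(p ^ n)] \<cdot>\<^bsub>?P\<^esub> loc_cls p ?A a 0))" by blast
      then show ?thesis using sm by simp
    qed
    note Q = this
    have "(\<forall>y\<in>{loc_cls p ?A a 0 | a. a \<in> carrier ?A}. x \<oplus>\<^bsub>?P\<^esub> [(p ^ n)] \<cdot>\<^bsub>?P\<^esub> y \<in> U)
        \<longleftrightarrow> (\<forall>a\<in>carrier ?A. x \<oplus>\<^bsub>?P\<^esub> loc_cls p ?A ([(p ^ n)] \<cdot>\<^bsub>?A\<^esub> a) 0 \<in> U)" for x U n
      by (rule Q)
    then show ?thesis unfolding P_pair_simps by (simp only:)
  qed
  have "istopology ?L" unfolding istopology_def
  proof (intro conjI allI impI)
    fix U V assume U: "?L U" and V: "?L V"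
    show "U \<inter> V \<subseteq> carrier ?P" using U by blast
    show "\<forall>x\<in>U \<inter> V. \<exists>n. \<forall>a\<in>carrier ?A. x \<oplus>\<^bsub>?P\<^esub> loc_cls p ?A ([(p ^ n)] \<cdot>\<^bsub>?A\<^esub> a) 0 \<in> U \<inter> V"
    proof
      fix x assume "x \<in> U \<inter> V"
      then obtain n m where n: "\<And>a. a \<in> carrier ?A \<Longrightarrow> x \<oplus>\<^bsub>?P\<^esub> loc_cls p ?A ([(p ^ n)] \<cdot>\<^bsub>?A\<^esub> a) 0 \<in> U"
        and m: "\<And>a. a \<in> carrier ?A \<Longrightarrow> x \<oplus>\<^bsub>?P\<^esub> loc_cls p ?A ([(p ^ m)] \<cdot>\<^bsub>?A\<^esub> a) 0 \<in> V" using U V by blast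
      \<comment> \<open>A multiple of p^(n+m) is a multiple of both p^n and p^m, so this exponent
        serves both open sets.\<close>
      have "x \<oplus>\<^bsub>?P\<^esub> loc_cls p ?A ([(p ^ (n + m))] \<cdot>\<^bsub>?A\<^esub> a) 0 \<in> U \<inter> V" if a: "a \<in> carrier ?A" for a
      proof
        show "x \<oplus>\<^bsub>?P\<^esub> loc_cls p ?A ([(p ^ (n + m))] \<cdot>\<^bsub>?A\<^esub> a) 0 \<in> U"
          using n[of "[(p ^ m)] \<cdot>\<^bsub>?A\<^esub> a"] a by (simp add: A.smult_smult power_add)
        show "x \<oplus>\<^bsub>?P\<^esub> loc_cls p ?A ([(p ^ (n + m))] \<cdot>\<^bsub>?A\<^esub> a) 0 \<in> V"
          using m[of "[(p ^ n)] \<cdot>\<^bsub>?A\<^esub> a"] a by (simp add: A.smult_smult power_add mult.commute)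
      qed
      then show "\<exists>n. \<forall>a\<in>carrier ?A. x \<oplus>\<^bsub>?P\<^esub> loc_cls p ?A ([(p ^ n)] \<cdot>\<^bsub>?A\<^esub> a) 0 \<in> U \<inter> V" by blast
    qed
  next
    fix \<U> assume U: "\<forall>U\<in>\<U>. ?L U"
    show "\<Union>\<U> \<subseteq> carrier ?P" using U by blast
    show "\<forall>x\<in>\<Union>\<U>. \<exists>n. \<forall>a\<in>carrier ?A. x \<oplus>\<^bsub>?P\<^esub> loc_cls p ?A ([(p ^ n)] \<cdot>\<^bsub>?A\<^esub> a) 0 \<in> \<Union>\<U>"
    proof
      fix x assume "x \<in> \<Union>\<U>"
      then obtain U where "U \<in> \<U>" "x \<in> U" by blast
      then obtain n where "\<forall>a\<in>carrier ?A. x \<oplus>\<^bsub>?P\<^esub> loc_cls p ?A ([(p ^ n)] \<cdot>\<^bsub>?A\<^esub> a) 0 \<in> U" using U by blast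
      then show "\<exists>n. \<forall>a\<in>carrier ?A. x \<oplus>\<^bsub>?P\<^esub> loc_cls p ?A ([(p ^ n)] \<cdot>\<^bsub>?A\<^esub> a) 0 \<in> \<Union>\<U>" using \<open>U \<in> \<U>\<close> by blast
    qed
  qed
  then show o: "openin (ring_topology (P_pair p \<phi> A)) U \<longleftrightarrow> ?L U" for U
    unfolding L by (simp only: topology_inverse')
  have "?L (carrier ?P)" by simp
  then have "openin (ring_topology (P_pair p \<phi> A)) (carrier ?P)" unfolding o .
  then have "carrier ?P \<subseteq> topspace (ring_topology (P_pair p \<phi> A))" by (rule openin_subset)
  moreover have "topspace (ring_topology (P_pair p \<phi> A)) \<subseteq> carrier ?P"
    using openin_topspace[of "ring_topology (P_pair p \<phi> A)"] unfolding o by (rule conjunct1)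
  ultimately show "topspace (ring_topology (P_pair p \<phi> A)) = carrier ?P" by blast
qed

text \<open>A homomorphism on P_circ maps p^n P_circ into p^n P_circ, which gives continuity of its
  extension to fractions and the inclusion of plus parts. Both the character and the cocharacters
  are instances.\<close>

lemma P_pair_hom:
  assumes A: "cring (P_circ p \<phi> A)" and B: "cring (P_circ p \<phi> B)" and f: "f \<in> ring_hom (P_circ p \<phi> A) (P_circ p \<phi> B)"
  defines "h \<equiv> loc_map p (P_circ p \<phi> B) f"
  shows "adic_induced (P_pair p \<phi> B) (P_pair p \<phi> A) h \<in> adic_hom (P_pair p \<phi> B) (P_pair p \<phi> A)"
    and "v \<in> spa (P_pair p \<phi> B) \<Longrightarrow> pull_valuation (P_pair p \<phi> A) h v \<in> spa (P_pair p \<phi> A)"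
    and "h \<in> ring_hom (loc p (P_circ p \<phi> A)) (loc p (P_circ p \<phi> B))"
    and "\<And>a n. a \<in> carrier (P_circ p \<phi> A) \<Longrightarrow> h (loc_cls p (P_circ p \<phi> A) a n) = loc_cls p (P_circ p \<phi> B) (f a) n"
proof -
  let ?A = "P_circ p \<phi> A" and ?B = "P_circ p \<phi> B"
  interpret A: cring ?A by fact
  interpret B: cring ?B by fact
  interpret LA: cring "loc p ?A" by (rule A.loc_cring)
  interpret LB: cring "loc p ?B" by (rule B.loc_cring)
  note fa = ring_hom_add_hom[OF f]
  show hh: "h \<in> ring_hom (loc p ?A) (loc p ?B)" unfolding h_def by (rule loc_map_hom[OF A B f])
  show hc: "h (loc_cls p ?A a n) = loc_cls p ?B (f a) n" if "a \<in> carrier ?A" for a n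
    unfolding h_def by (rule loc_map_cls[OF A B fa that])
  have cont: "continuous_map (ring_topology (P_pair p \<phi> A)) (ring_topology (P_pair p \<phi> B)) h"
    unfolding continuous_map_def openin_P_pair(2)[OF A] openin_P_pair(2)[OF B]
  proof (intro conjI allI impI)
    show "h \<in> carrier (loc p ?A) \<rightarrow> carrier (loc p ?B)" using ring_hom_closed[OF hh] by blast
    fix U assume "openin (ring_topology (P_pair p \<phi> B)) U"
    then have U: "\<And>x. x \<in> U \<Longrightarrow> \<exists>n. \<forall>a\<in>carrier ?B. x \<oplus>\<^bsub>loc p ?B\<^esub> loc_cls p ?B ([(p ^ n)] \<cdot>\<^bsub>?B\<^esub> a) 0 \<in> U"
      unfolding openin_P_pair(1)[OF B] by blast
    show "openin (ring_topology (P_pair p \<phi> A)) {x \<in> carrier (loc p ?A). h x \<in> U}"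
      unfolding openin_P_pair(1)[OF A]
    proof (intro conjI ballI)
      fix x assume x: "x \<in> {x \<in> carrier (loc p ?A). h x \<in> U}"
      then obtain n where n: "\<And>a. a \<in> carrier ?B \<Longrightarrow> h x \<oplus>\<^bsub>loc p ?B\<^esub> loc_cls p ?B ([(p ^ n)] \<cdot>\<^bsub>?B\<^esub> a) 0 \<in> U"
        using U[of "h x"] by blast
      have "x \<oplus>\<^bsub>loc p ?A\<^esub> loc_cls p ?A ([(p ^ n)] \<cdot>\<^bsub>?A\<^esub> a) 0 \<in> {x \<in> carrier (loc p ?A). h x \<in> U}" if a: "a \<in> carrier ?A" for a
      proof -
        have xc: "x \<in> carrier (loc p ?A)" using x by blast
        have yc: "loc_cls p ?A ([(p ^ n)] \<cdot>\<^bsub>?A\<^esub> a) 0 \<in> carrier (loc p ?A)" using a by simp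
        have "h (x \<oplus>\<^bsub>loc p ?A\<^esub> loc_cls p ?A ([(p ^ n)] \<cdot>\<^bsub>?A\<^esub> a) 0) = h x \<oplus>\<^bsub>loc p ?B\<^esub> loc_cls p ?B ([(p ^ n)] \<cdot>\<^bsub>?B\<^esub> f a) 0"
          unfolding ring_hom_add[OF hh xc yc] using a
          by (simp add: hc add_hom_smult[OF A.abelian_group_axioms B.abelian_group_axioms fa])
        then show ?thesis using n[OF ring_hom_closed[OF f a]] LA.a_closed[OF xc yc] by simp
      qed
      then show "\<exists>n. \<forall>a\<in>carrier ?A. x \<oplus>\<^bsub>loc p ?A\<^esub> loc_cls p ?A ([(p ^ n)] \<cdot>\<^bsub>?A\<^esub> a) 0 \<in> {x \<in> carrier (loc p ?A). h x \<in> U}"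
        by blast
    qed blast
  qed
  have S: "cring (P_pair p \<phi> B)" "cring (P_pair p \<phi> A)" "h \<in> ring_hom (P_pair p \<phi> A) (P_pair p \<phi> B)"
    using LA.is_cring LB.is_cring hh by (simp_all only: P_pair_simps)
  have top: "topspace (ring_topology (P_pair p \<phi> A)) = carrier (P_pair p \<phi> A)"
    by (simp only: openin_P_pair(2)[OF A] P_pair_simps(1))
  have plus: "h ` plus_part (P_pair p \<phi> A) \<subseteq> plus_part (P_pair p \<phi> B)" "plus_part (P_pair p \<phi> A) \<subseteq> carrier (P_pair p \<phi> A)"
    unfolding P_pair_simps using hc ring_hom_closed[OF f] by auto
  show "adic_induced (P_pair p \<phi> B) (P_pair p \<phi> A) h \<in> adic_hom (P_pair p \<phi> B) (P_pair p \<phi> A)"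
    by (rule adic_induced_hom[OF S cont top plus])
  show "v \<in> spa (P_pair p \<phi> B) \<Longrightarrow> pull_valuation (P_pair p \<phi> A) h v \<in> spa (P_pair p \<phi> A)"
    by (rule pull_spa[OF S cont top plus])
qed

section \<open>The right inverse\<close>

lemma algebraically_closed_infinite:
  assumes "algebraically_closed K"
  shows "infinite (carrier K)"
proof
  assume fin: "finite (carrier K)"
  interpret K: algebraically_closed K by fact
  have UK: "finite (Units K)" by (rule finite_subset[OF _ fin]) auto
  define N where "N = card (Units K)"
  have "\<one>\<^bsub>K\<^esub> \<in> Units K" by simp
  then have N: "N > 0" using UK by (auto simp: N_def card_gt_0_iff)
  \<comment> \<open>\<open>P\<close> is \<open>X^(N+1) - X + 1\<close>, which takes the value 1 on all of \<open>K\<close>.\<close>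
  define P where "P = (K.monom \<one>\<^bsub>K\<^esub> (N - 1) @ [\<ominus>\<^bsub>K\<^esub> \<one>\<^bsub>K\<^esub>]) @ [\<one>\<^bsub>K\<^esub>]"
  have ms: "set (K.monom \<one>\<^bsub>K\<^esub> (N - 1)) \<subseteq> carrier K" by (auto simp: K.monom_def)
  have ms2: "set (K.monom \<one>\<^bsub>K\<^esub> (N - 1) @ [\<ominus>\<^bsub>K\<^esub> \<one>\<^bsub>K\<^esub>]) \<subseteq> carrier K" using ms by simp
  have "polynomial\<^bsub>K\<^esub> (carrier K) P"
    using ms by (auto simp: polynomial_def P_def K.monom_def)
  then have Pc: "P \<in> carrier (poly_ring K)" by (simp add: univ_poly_carrier)
  have "size (K.roots P) = length P - 1" using K.roots_over_carrier[OF Pc] by (simp add: K.splitted_def)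
  moreover have "length P - 1 > 0" by (simp add: P_def K.monom_def)
  ultimately obtain x where "x \<in># K.roots P" by (metis neq0_conv nonempty_has_size multiset_nonemptyE less_irrefl)
  then have x: "x \<in> carrier K" "K.eval P x = \<zero>\<^bsub>K\<^esub>"
    using K.roots_mem_iff_is_root[OF Pc] by (auto simp: K.is_root_def)
  \<comment> \<open>Coefficient lists begin with the leading coefficient, so appending an entry
    multiplies by X and adds it; the evaluation unfolds by Horner's scheme.\<close>
  have "K.eval P x = (((\<one>\<^bsub>K\<^esub> \<otimes>\<^bsub>K\<^esub> x [^]\<^bsub>K\<^esub> (N - 1)) \<otimes>\<^bsub>K\<^esub> x \<oplus>\<^bsub>K\<^esub> \<ominus>\<^bsub>K\<^esub> \<one>\<^bsub>K\<^esub>) \<otimes>\<^bsub>K\<^esub> x) \<oplus>\<^bsub>K\<^esub> \<one>\<^bsub>K\<^esub>"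
    unfolding P_def K.eval_append_aux[OF ms2 K.one_closed x(1)]
      K.eval_append_aux[OF ms K.a_inv_closed[OF K.one_closed] x(1)] K.eval_monom[OF K.one_closed x(1)] ..
  also have "\<dots> = \<one>\<^bsub>K\<^esub>"
  proof (cases "x = \<zero>\<^bsub>K\<^esub>")
    case True
    then show ?thesis by simp
  next
    case False
    then have "x \<in> Units K" using x(1) K.field_Units by simp
    then have "x [^]\<^bsub>K\<^esub> N = \<one>\<^bsub>K\<^esub>" unfolding N_def by (rule K.units_power_order_eq_one[OF UK])
    then have "x [^]\<^bsub>K\<^esub> (N - 1) \<otimes>\<^bsub>K\<^esub> x = \<one>\<^bsub>K\<^esub>" using N by (metis K.nat_pow_Suc Suc_diff_1)
    then show ?thesis using x(1) by (simp add: K.r_neg)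
  qed
  finally show False using x(2) by simp
qed

lemma type_algebra_pideal: "(x::'r::comm_ring_1) \<in> pideal p ring_of_type_algebra n \<longleftrightarrow> of_nat p ^ n dvd x"
proof -
  interpret R: cring "ring_of_type_algebra :: 'r ring" by (rule cring_from_type_algebra)
  show ?thesis by (simp add: R.pideal_iff)
qed

lemma delta_domainI:
  fixes p :: nat and \<phi> :: "'r::idom \<Rightarrow> 'r"
  assumes p: "Factorial_Ring.prime p" "odd p"
    and dvr: "discrete_valuation_ring (ring_of_type_algebra :: 'r ring)"
      "maximalideal (pideal p ring_of_type_algebra 1) (ring_of_type_algebra :: 'r ring)"
    and complete: "p_complete p (ring_of_type_algebra :: 'r ring)"
    and residue_field: "algebraically_closed (ring_of_type_algebra Quot pideal p (ring_of_type_algebra :: 'r ring) 1)"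
    and frobenius: "frobenius_lift p ring_of_type_algebra \<phi>" "bij \<phi>"
  shows "delta_domain p \<phi>"
proof -
  let ?R = "ring_of_type_algebra :: 'r ring"
  let ?I = "pideal p ?R 1"
  interpret R: cring ?R by (rule cring_from_type_algebra)
  interpret I: maximalideal ?I ?R by (rule dvr(2))
  interpret I': primeideal ?I ?R by (rule R.maximalideal_prime[OF dvr(2)])
  \<comment> \<open>If p were 0, the zero ideal would be maximal and R a field, which a discrete
    valuation ring is not.\<close>
  have p0: "(of_nat p :: 'r) \<noteq> 0"
  proof
    assume "(of_nat p :: 'r) = 0"
    then have "?I = {\<zero>\<^bsub>?R\<^esub>}" by (auto simp: type_algebra_pideal)
    then have "field ?R" using R.zeromaximalideal_fieldI dvr(2) by simp
    then show False using dvr(1) by (simp add: discrete_valuation_ring_def)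
  qed
  show ?thesis
  proof unfold_locales
    show "\<phi> \<in> ring_hom ?R ?R" using frobenius(1) by (simp add: frobenius_lift_def)
    show "frob_lift p ?R \<phi>" unfolding frob_lift_def
    proof
      fix a assume "a \<in> carrier ?R"
      then have "\<phi> a \<ominus>\<^bsub>?R\<^esub> a [^]\<^bsub>?R\<^esub> p \<in> ?I" using frobenius(1) unfolding frobenius_lift_def by blast
      then show "pcong p ?R 1 (\<phi> a) (a [^]\<^bsub>?R\<^esub> p)" by (subst (asm) R.minus_in_pideal) simp_all
    qed
    show "\<And>r::'r. of_nat p * r = 0 \<Longrightarrow> r = 0" using p0 by simp
    show "of_nat p dvd x \<or> of_nat p dvd y" if "of_nat p dvd x * y" for x y :: 'r
      using I'.I_prime[of x y] that by (simp add: type_algebra_pideal)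
    fix m
    have "infinite (carrier (?R Quot ?I))" by (rule algebraically_closed_infinite[OF residue_field])
    then obtain U where U: "finite U" "card U = m" "U \<subseteq> carrier (?R Quot ?I)"
      using infinite_arbitrarily_large by metis
    \<comment> \<open>Representatives of distinct residue classes are incongruent modulo p.\<close>
    define f where "f c = (SOME x. ?I +>\<^bsub>?R\<^esub> x = c)" for c
    have f: "?I +>\<^bsub>?R\<^esub> f c = c" if "c \<in> U" for c
    proof -
      have "\<exists>x. ?I +>\<^bsub>?R\<^esub> x = c" using that U(3) by (auto simp: FactRing_def A_RCOSETS_def')
      then show ?thesis unfolding f_def by (rule someI_ex)
    qed
    have inj: "inj_on f U" by (rule inj_on_inverseI[where g = "\<lambda>x. ?I +>\<^bsub>?R\<^esub> x"]) (rule f)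
    have "\<not> of_nat p dvd f c - f c'" if c: "c \<in> U" "c' \<in> U" "f c \<noteq> f c'" for c c'
    proof
      assume "of_nat p dvd f c - f c'"
      then have "pcong p ?R 1 (f c) (f c')" by simp
      then have "?I +>\<^bsub>?R\<^esub> f c = ?I +>\<^bsub>?R\<^esub> f c'" by (subst R.pcoset_eq) simp_all
      then show False using f c by metis
    qed
    then show "\<exists>S::'r set. finite S \<and> card S = m \<and> (\<forall>s\<in>S. \<forall>t\<in>S. s \<noteq> t \<longrightarrow> \<not> of_nat p dvd s - t)"
      using U(1,2) card_image[OF inj] by (intro exI[of _ "f ` U"]) auto
  qed (use p complete frobenius(2) p0 in auto)
qed

context delta_base begin

lemmas psi_mor = P_pair_hom[OF PGa_cring PGm_cring Ppsi_hom]
lemmas cochar_mor = P_pair_hom[OF PGm_cring PGa_cring cochar_P_circ_hom]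

lemma P_inf_psi_hom: "P_inf_psi p \<phi> \<in> adic_hom (P_inf p \<phi> Gm_exps) (P_inf p \<phi> Ga_exps)"
  unfolding P_inf_psi_def P_inf_def by (rule psi_mor(1))

lemma cochar_hom: "admissible p a \<Longrightarrow> cochar p \<phi> a \<in> adic_hom (P_inf p \<phi> Ga_exps) (P_inf p \<phi> Gm_exps)"
  unfolding cochar_def P_inf_def by (rule cochar_mor(1))

abbreviation (input) "hpsi \<equiv> loc_map p PGm Ppsi"

text \<open>Composition of morphisms reverses the order on global sections, so the statement about
  sections is that the cocharacter undoes \<open>hpsi\<close>. The statement about points follows,
  since points are pulled back along the homomorphisms of sections.\<close>

lemma cochar_seq_comp:
  "adic_comp (P_inf p \<phi> Ga_exps) (P_inf p \<phi> Ga_exps) (P_inf_psi p \<phi>) (cochar p \<phi> (cochar_seq p)) = adic_id (P_inf p \<phi> Ga_exps)"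
proof -
  let ?S = "P_pair p \<phi> (jet_alg p \<phi> Ga_exps)" and ?T = "P_pair p \<phi> (jet_alg p \<phi> Gm_exps)"
  let ?k = "loc_map p PGa (cochar_P_circ p \<phi> (cochar_seq p))"
  note co = cochar_mor[OF cochar_seq_admissible]
  interpret PGa: cring PGa by (rule PGa_cring)
  have kh: "?k (hpsi u) = u" if u: "u \<in> carrier (loc p PGa)" for u
  proof -
    obtain a n where a: "a \<in> carrier PGa" "u = loc_cls p PGa a n" using u by (auto simp: PGa.carrier_loc)
    show ?thesis unfolding a(2) psi_mor(4)[OF a(1)] co(4)[OF ring_hom_closed[OF Ppsi_hom a(1)]] cochar_P_circ_seq[OF a(1)] ..
  qed
  have hc: "hpsi u \<in> carrier (loc p PGm)" if "u \<in> carrier (loc p PGa)" for u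
    by (rule ring_hom_closed[OF psi_mor(3) that])
  have "pull_valuation ?S hpsi (pull_valuation ?T ?k v) = v" if v: "v \<in> spa ?S" for v
  proof -
    have vs: "v \<subseteq> carrier (loc p PGa) \<times> carrier (loc p PGa)" using v by (auto simp: spa_def valuation_rel_def)
    have "(f, g) \<in> pull_valuation ?S hpsi (pull_valuation ?T ?k v) \<longleftrightarrow> f \<in> carrier (loc p PGa) \<and> g \<in> carrier (loc p PGa) \<and> (f, g) \<in> v" for f g
      unfolding pull_valuation_def P_pair_simps(1) mem_Collect_eq case_prod_conv using kh hc by auto
    then show ?thesis using vs by (auto simp del: P_pair_simps)
  qed
  then have "compose (spa ?S) (fst (P_inf_psi p \<phi>)) (fst (cochar p \<phi> (cochar_seq p))) = restrict id (spa ?S)"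
    unfolding P_inf_psi_def cochar_def adic_induced_def P_inf_def fst_conv
    using co(2) by (auto simp: compose_def restrict_def fun_eq_iff simp del: P_pair_simps)
  moreover have "compose (carrier ?S) (snd (cochar p \<phi> (cochar_seq p))) (snd (P_inf_psi p \<phi>)) = restrict id (carrier ?S)"
    unfolding P_inf_psi_def cochar_def adic_induced_def P_inf_def snd_conv P_pair_simps(1)
    using kh hc by (auto simp: compose_def restrict_def fun_eq_iff)
  ultimately show ?thesis unfolding adic_comp_def adic_id_def P_inf_def by (rule arg_cong2[where f = Pair])
qed

end

text \<open>The hypothesis is used through its value on the single section z/1. Equality of
  fractions yields the power p^k that \<open>cochar_P_circ_ztil\<close> accepts.\<close>

lemma (in delta_domain) cochar_comp_unique:
  assumes a: "admissible p a"
    and eq: "adic_comp (P_inf p \<phi> Ga_exps) (P_inf p \<phi> Ga_exps) (P_inf_psi p \<phi>) (cochar p \<phi> a) = adic_id (P_inf p \<phi> Ga_exps)"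
  shows "a = cochar_seq p"
proof -
  let ?S = "P_pair p \<phi> (jet_alg p \<phi> Ga_exps)"
  let ?z = "loc_cls p PGa ztil 0" and ?k = "loc_map p PGa (cochar_P_circ p \<phi> a)"
  note co = cochar_mor[OF a]
  interpret PGa: cring PGa by (rule PGa_cring)
  have zc: "?z \<in> carrier (loc p PGa)" using ztil_closed by simp
  have hz: "hpsi ?z = loc_cls p PGm (Ppsi ztil) 0" by (rule psi_mor(4)[OF ztil_closed])
  have pc: "Ppsi ztil \<in> carrier PGm" by (rule ring_hom_closed[OF Ppsi_hom ztil_closed])
  have sc: "cochar_P_circ p \<phi> a (Ppsi ztil) \<in> carrier PGa" by (rule ring_hom_closed[OF cochar_P_circ_hom[OF a] pc])
  have hzc: "hpsi ?z \<in> carrier (loc p PGm)" by (rule ring_hom_closed[OF psi_mor(3) zc])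
  have "snd (adic_comp ?S ?S (P_inf_psi p \<phi>) (cochar p \<phi> a)) ?z = snd (adic_id ?S) ?z"
    using eq unfolding P_inf_def by simp
  then have "?k (hpsi ?z) = ?z"
    unfolding adic_comp_def adic_id_def P_inf_psi_def cochar_def adic_induced_def P_inf_def snd_conv P_pair_simps(1)
    using zc hzc by (simp add: compose_def)
  then have "loc_cls p PGa (cochar_P_circ p \<phi> a (Ppsi ztil)) 0 = ?z" unfolding hz co(4)[OF pc] .
  then obtain k where k: "[(p ^ k)] \<cdot>\<^bsub>PGa\<^esub> cochar_P_circ p \<phi> a (Ppsi ztil) = [(p ^ k)] \<cdot>\<^bsub>PGa\<^esub> ztil"
    unfolding PGa.loc_cls_eq[OF sc ztil_closed] by auto
  show ?thesis by (rule coefficients_unique[OF a cochar_P_circ_ztil[OF a k]])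
qed

theorem theorem4p3:
  fixes p :: nat and \<phi> :: "'r::idom \<Rightarrow> 'r" and R :: "'r ring"
  assumes R: "R = ring_of_type_algebra"
    and p: "Factorial_Ring.prime p" "odd p"
    and dvr: "discrete_valuation_ring R" "maximalideal (pideal p R 1) R"
    and complete: "p_complete p R"
    and residue_field: "algebraically_closed (R Quot pideal p R 1)"
    and frobenius: "frobenius_lift p R \<phi>" "bij \<phi>"
  shows "P_inf_psi p \<phi> \<in> adic_hom (P_inf p \<phi> Gm_exps) (P_inf p \<phi> Ga_exps) \<and>
    cocharacters p \<phi> \<subseteq> adic_hom (P_inf p \<phi> Ga_exps) (P_inf p \<phi> Gm_exps) \<and>
    (\<exists>!\<sigma>. \<sigma> \<in> cocharacters p \<phi> \<and>
      adic_comp (P_inf p \<phi> Ga_exps) (P_inf p \<phi> Ga_exps) (P_inf_psi p \<phi>) \<sigma>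
        = adic_id (P_inf p \<phi> Ga_exps)) \<and>
    (let a = (\<lambda>n. if 1 \<le> n then of_nat p ^ nat n else 0) in
      admissible p a \<and>
      adic_comp (P_inf p \<phi> Ga_exps) (P_inf p \<phi> Ga_exps) (P_inf_psi p \<phi>) (cochar p \<phi> a)
        = adic_id (P_inf p \<phi> Ga_exps))"
proof -
  interpret delta_domain p \<phi>
    by (rule delta_domainI[OF p dvr[unfolded R] complete[unfolded R] residue_field[unfolded R] frobenius[unfolded R]])
  have "cocharacters p \<phi> \<subseteq> adic_hom (P_inf p \<phi> Ga_exps) (P_inf p \<phi> Gm_exps)"
    using cochar_hom unfolding cocharacters_def by blast
  moreover have "\<exists>!\<sigma>. \<sigma> \<in> cocharacters p \<phi> \<and>
      adic_comp (P_inf p \<phi> Ga_exps) (P_inf p \<phi> Ga_exps) (P_inf_psi p \<phi>) \<sigma> = adic_id (P_inf p \<phi> Ga_exps)"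
  proof (rule ex1I[of _ "cochar p \<phi> (cochar_seq p)"])
    show "cochar p \<phi> (cochar_seq p) \<in> cocharacters p \<phi> \<and>
      adic_comp (P_inf p \<phi> Ga_exps) (P_inf p \<phi> Ga_exps) (P_inf_psi p \<phi>) (cochar p \<phi> (cochar_seq p)) = adic_id (P_inf p \<phi> Ga_exps)"
      using cochar_seq_admissible cochar_seq_comp unfolding cocharacters_def by blast
    fix \<sigma> assume \<sigma>: "\<sigma> \<in> cocharacters p \<phi> \<and>
      adic_comp (P_inf p \<phi> Ga_exps) (P_inf p \<phi> Ga_exps) (P_inf_psi p \<phi>) \<sigma> = adic_id (P_inf p \<phi> Ga_exps)"
    then obtain a where a: "\<sigma> = cochar p \<phi> a" "admissible p a" by (auto simp: cocharacters_def)
    \<comment> \<open>Uniqueness is obtained for the sequence itself, and so for the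
      cocharacter.\<close>
    have "a = cochar_seq p" by (rule cochar_comp_unique[OF a(2)]) (use \<sigma> a(1) in blast)
    then show "\<sigma> = cochar p \<phi> (cochar_seq p)" using a(1) by simp
  qed
  ultimately show ?thesis
    using P_inf_psi_hom cochar_seq_admissible cochar_seq_comp by (simp only: Let_def cochar_seq_def[symmetric] simp_thms)
qed

end
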